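(* Let $i\ge 1$, let $W=(E,B)$ be the exact solution of the Maxwell system, and let $W^{h,i}\in\tilde V_h$ be the solution of the $i$-th step discrete problem $\tilde{\mathcal B}(W^{h,i},g)=\tilde{\mathcal L}(b^{h,i-1};g)$ for all $g\in\tilde V_h$. Assume that $W\in H^{k+1}([0,T]\times\Omega_x)$ and that on each $K\in\tilde{\mathcal C}_h$ the parameter $\delta_K$ satisfies $\delta_K=C_1\frac{h_K}{p_K}$ for some constant $C_1>0$, with $p_Kh_K\le C_2<1$ for some constant $C_2>0$. Let $0\le s_K\le\min(p_K,k)$. Then there exists a constant $C>0$ independent of $p_K$, $h_K$ and $s_K$ such that $$|\!|\!|W-W^{h,i}|\!|\!|_{\mathrm M}^2\le C\sum_{K\in\tilde{\mathcal C}_h}h_K^{2s_K+1}p_K^{-1}\Phi_{\mathrm M}(p_K,s_K)\|W\|^2_{s_K+1,K}+C\|f-f^{h,i-1}\|^2_{Q_T},$$ where $\Phi_{\mathrm M}=\max(\Phi_1,\Phi_2)$, with $\Phi_1,\Phi_2$ taken for the space-time dimension $\mathcal N=\dim\Omega_x+1$.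
   Context: **Continuous problem.** $\Omega_x,\Omega_v\subset\mathbb R^3$ are the space and velocity domains, $Q_T=[0,T]\times\Omega_x\times\Omega_v$. The functions $f(t,x,v)\ge 0$, $E(t,x)$, $B(t,x)\in\mathbb R^3$ solve the relativistic Vlasov-Maxwell system $\partial_t f+\hat v\cdot\nabla_xf+(E+\hat v\times B)\cdot\nabla_vf=0$, $\partial_tE=\nabla_x\times B-j$, $\partial_tB=-\nabla_x\times E$, with $\hat v=(1+|v|^2)^{-1/2}v$, $j(t,x)=\int f\hat v\,dv$, and initial data $f^0,E^0,B^0$. It is assumed that $f,E,B$ have compact support in $\Omega_x$ and that $f$ has compact support in $\Omega_v$. Put $W=(E_1,E_2,E_3,B_1,B_2,B_3)^T$, $W^0=W(0,\cdot)$, $b=(-j_1,-j_2,-j_3,0,0,0)^T$. Let $M_1,M_2,M_3$ be the constant symmetric $6\times6$ matrices determined by $\sum_{l=1}^3M_l\partial_lW=(-\nabla_x\times B,\ \nabla_x\times E)^T$ ($\partial_l=\partial/\partial x_l$); Maxwell's equations read $\partial_tW+\sum_lM_l\partial_lW=b$, $W(0)=W^0$. **Mesh.** $0=t_0<\dots<t_M=T$, $I_m=(t_m,t_{m+1}]$; $T_h^x=\{\tau_x\}$ is a finite element subdivision of $\Omega_x$, and $\tilde{\mathcal C}_h$ is the set of elements $K=I_m\times\tau_x$, with $h_K=\operatorname{diam}K$ and polynomial degree $p_K$. $(\cdot,\cdot)_K$, $\|\cdot\|_K$ are the $L_2$ inner product and norm on $K$; $\|\cdot\|_{s,K}$ is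 the $H^s(K)$ norm; $\langle\cdot,\cdot\rangle_m$ and $|\cdot|_m$ are the $L_2(\Omega_x)$ inner product and norm at time $t_m$. $g_\pm(t,x)=\lim_{s\to0^\pm}g(t+s,x)$, $[g]=g_+-g_-$. **Discrete space.** $\tilde{\mathcal H}_0=\prod_{m=0}^{M-1}\{w\in H^1(I_m\times\Omega_x):w=0\text{ on }\partial\Omega_x\}$ and $\tilde V_h$ is the space of $g\in[\tilde{\mathcal H}_0]^6$ whose components restricted to each $K=I_m\times\tau_x$ are polynomials of degree at most $p_K$ in $t$ and at most $p_K$ in $x$ (continuous in $x$, possibly discontinuous at the time levels $t_m$). **Discrete Maxwell problem.** $\delta_K\ge0$ is a constant on each $K$ and $$\tilde{\mathcal B}(W,g)=\sum_{K\in\tilde{\mathcal C}_h}\Big(\partial_tW+\sum_lM_l\partial_lW,\ g+\delta_K(\partial_tg+\sum_lM_l\partial_lg)\Big)_K+\sum_{m=1}^{M-1}\langle[W],g_+\rangle_m+\langle W_+,g_+\rangle_0,$$ $$\tilde{\mathcal L}(b;g)=\sum_{K\in\tilde{\mathcal C}_h}\Big(b,\ g+\delta_K(\partial_tg+\sum_lM_l\partial_lg)\Big)_K+\langle W^0,g_+\rangle_0.$$ $f^{h,i-1}$ is the approximation of $f$ from the previous iteration step, $j^{h,i-1}=\int f^{h,i-1}\hat v\,dv$ and $b^{h,i-1}=(-j^{h,i-1},0,0,0)^T$. **Norm.** $$|\!|\!|g|\!|\!|_{\mathrm M}^2=\tfrac12\Big(|g_+|_0^2+|g_-|_M^2+\sum_{m=1}^{M-1}|[g]|_m^2+2\sum_{K\in\tilde{\mathcal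 C}_h}\delta_K\|\partial_tg+\sum_lM_l\partial_lg\|_K^2\Big).$$ **Functions $\Phi_1,\Phi_2$.** These are the functions (depending on the space-time dimension $\mathcal N$) in the $hp$-interpolation estimates: for $w\in H^{k+1}$ there is an interpolant $\tilde w$ in the finite element space such that, with $\eta=w-\tilde w$ and $0\le s_K\le\min(p_K,k)$, $$\|\eta\|_K^2\le C\Big(\frac{h_K}2\Big)^{2s_K+2}p_K^{-2}\Phi_1(p_K,s_K)\|w\|_{s_K+1,K}^2,\qquad\|\mathcal D\eta\|_K^2\le C\Big(\frac{h_K}2\Big)^{2s_K}\Phi_2(p_K,s_K)\|w\|_{s_K+1,K}^2,$$ where $\mathcal D$ is the full space-time gradient and $C$ is independent of $h_K,p_K,s_K$; for $W$ the interpolation is componentwise. *)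

theory Defs
  imports "HOL-Analysis.Analysis" "HOL-Library.Multiset"
begin

section \<open>Sobolev spaces\<close>

text \<open>
  All integrals are with respect to \<^term>\<open>lborel\<close>, so every element of an \<open>L\<^sub>2\<close> or Sobolev
  space is given by a Borel representative.
\<close>

definition L2_on :: "'a::euclidean_space set \<Rightarrow> ('a \<Rightarrow> 'b::euclidean_space) \<Rightarrow> bool" where
  "L2_on A u \<longleftrightarrow> set_borel_measurable lborel A u \<and> set_integrable lborel A (\<lambda>z. (norm (u z))\<^sup>2)"

definition L2_inner ::
  "'a::euclidean_space set \<Rightarrow> ('a \<Rightarrow> 'b::euclidean_space) \<Rightarrow> ('a \<Rightarrow> 'b) \<Rightarrow> real" where
  "L2_inner A u w = (LINT z:A|lborel. u z \<bullet> w z)"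

definition L2_norm :: "'a::euclidean_space set \<Rightarrow> ('a \<Rightarrow> 'b::euclidean_space) \<Rightarrow> real" where
  "L2_norm A u = sqrt (L2_inner A u u)"

primrec iter_deriv :: "'a::euclidean_space list \<Rightarrow> ('a \<Rightarrow> real) \<Rightarrow> 'a \<Rightarrow> real" where
  "iter_deriv [] \<phi> = \<phi>"
| "iter_deriv (b # bs) \<phi> = (\<lambda>z. frechet_derivative (iter_deriv bs \<phi>) (at z) b)"

text \<open>
  If all iterated partial derivatives are differentiable, then they are all continuous, so this is
  \<open>C\<^sup>\<infinity>\<close>.
\<close>

definition smooth :: "('a::euclidean_space \<Rightarrow> real) \<Rightarrow> bool" where
  "smooth \<phi> \<longleftrightarrow> (\<forall>bs. set bs \<subseteq> Basis \<longrightarrow> iter_deriv bs \<phi> differentiable_on UNIV)"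

definition test_function :: "'a::euclidean_space set \<Rightarrow> ('a \<Rightarrow> real) \<Rightarrow> bool" where
  "test_function U \<phi> \<longleftrightarrow> smooth \<phi> \<and> (\<exists>C. compact C \<and> C \<subseteq> U \<and> (\<forall>z. z \<notin> C \<longrightarrow> \<phi> z = 0))"

definition locally_integrable :: "'a::euclidean_space set \<Rightarrow> ('a \<Rightarrow> real) \<Rightarrow> bool" where
  "locally_integrable U u \<longleftrightarrow> (\<forall>C. compact C \<longrightarrow> C \<subseteq> U \<longrightarrow> set_integrable lborel C u)"

text \<open>
  A multi-index of order \<open>s\<close> is a multiset of \<open>s\<close> coordinate directions: the multiplicity of a
  basis vector is the number of derivatives taken in that direction.
\<close>

definition multi_indices :: "nat \<Rightarrow> 'a::euclidean_space multiset set" where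
  "multi_indices s = {\<alpha>. set_mset \<alpha> \<subseteq> Basis \<and> size \<alpha> \<le> s}"

definition weak_deriv ::
  "'a::euclidean_space set \<Rightarrow> 'a multiset \<Rightarrow> ('a \<Rightarrow> real) \<Rightarrow> ('a \<Rightarrow> real) \<Rightarrow> bool" where
  "weak_deriv U \<alpha> u g \<longleftrightarrow> locally_integrable U u \<and> locally_integrable U g \<and>
     (\<forall>\<phi> bs. test_function U \<phi> \<longrightarrow> mset bs = \<alpha> \<longrightarrow>
        (LINT z:U|lborel. u z * iter_deriv bs \<phi> z) = (-1) ^ size \<alpha> * (LINT z:U|lborel. g z * \<phi> z))"

text \<open>On an open set the weak derivative is unique almost everywhere, if it exists.\<close>

definition wderiv :: "'a::euclidean_space set \<Rightarrow> 'a multiset \<Rightarrow> ('a \<Rightarrow> real) \<Rightarrow> 'a \<Rightarrow> real" where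
  "wderiv U \<alpha> u = (SOME g. weak_deriv U \<alpha> u g)"

definition sobolev :: "nat \<Rightarrow> 'a::euclidean_space set \<Rightarrow> ('a \<Rightarrow> real) \<Rightarrow> bool" where
  "sobolev s U u \<longleftrightarrow> L2_on U u \<and> (\<forall>\<alpha>\<in>multi_indices s. \<exists>g. weak_deriv U \<alpha> u g \<and> L2_on U g)"

definition sobolev_norm :: "nat \<Rightarrow> 'a::euclidean_space set \<Rightarrow> ('a \<Rightarrow> real) \<Rightarrow> real" where
  "sobolev_norm s U u = sqrt (\<Sum>\<alpha>\<in>multi_indices s. (L2_norm U (wderiv U \<alpha> u))\<^sup>2)"

definition sobolev_vec :: "nat \<Rightarrow> 'a::euclidean_space set \<Rightarrow> ('a \<Rightarrow> real^'n) \<Rightarrow> bool" where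
  "sobolev_vec s U u \<longleftrightarrow> (\<forall>c. sobolev s U (\<lambda>z. u z $ c))"

definition sobolev_norm_vec :: "nat \<Rightarrow> 'a::euclidean_space set \<Rightarrow> ('a \<Rightarrow> real^'n) \<Rightarrow> real" where
  "sobolev_norm_vec s U u = sqrt (\<Sum>c\<in>UNIV. (sobolev_norm s U (\<lambda>z. u z $ c))\<^sup>2)"

section \<open>The relativistic Vlasov-Maxwell system\<close>

type_synonym spacetime = "real \<times> (real^3)"
type_synonym phase_spacetime = "real \<times> (real^3) \<times> (real^3)"
type_synonym em = "real^(3+3)"

definition dt :: "spacetime set \<Rightarrow> (spacetime \<Rightarrow> real^'n) \<Rightarrow> spacetime \<Rightarrow> real^'n" where
  "dt U u z = (\<chi> c. wderiv U {#(1, 0)#} (\<lambda>y. u y $ c) z)"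

definition dx :: "spacetime set \<Rightarrow> 3 \<Rightarrow> (spacetime \<Rightarrow> real^'n) \<Rightarrow> spacetime \<Rightarrow> real^'n" where
  "dx U l u z = (\<chi> c. wderiv U {#(0, axis l 1)#} (\<lambda>y. u y $ c) z)"

definition curl :: "spacetime set \<Rightarrow> (spacetime \<Rightarrow> real^3) \<Rightarrow> spacetime \<Rightarrow> real^3" where
  "curl U u z = vector
     [dx U 2 u z $ 3 - dx U 3 u z $ 2,
      dx U 3 u z $ 1 - dx U 1 u z $ 3,
      dx U 1 u z $ 2 - dx U 2 u z $ 1]"

definition em_vec :: "real^3 \<Rightarrow> real^3 \<Rightarrow> em" where
  "em_vec e b = (\<chi> c. case c of Inl i \<Rightarrow> e $ i | Inr i \<Rightarrow> b $ i)"

definition el_part :: "em \<Rightarrow> real^3" where "el_part w = (\<chi> i. w $ Inl i)"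
definition mag_part :: "em \<Rightarrow> real^3" where "mag_part w = (\<chi> i. w $ Inr i)"

definition em_field :: "('a \<Rightarrow> real^3) \<Rightarrow> ('a \<Rightarrow> real^3) \<Rightarrow> 'a \<Rightarrow> em" where
  "em_field E B z = em_vec (E z) (B z)"

text \<open>The symbol of the curl in direction \<open>l\<close> is the cross product with the unit vector \<open>e\<^sub>l\<close>.\<close>

definition maxwell_matrix :: "3 \<Rightarrow> real^(3+3)^(3+3)" where
  "maxwell_matrix l =
     matrix (\<lambda>w. em_vec (- cross3 (axis l 1) (mag_part w)) (cross3 (axis l 1) (el_part w)))"

lemma em_vec_nth: "em_vec e b $ Inl i = e $ i" "em_vec e b $ Inr i = b $ i"
  by (simp_all add: em_vec_def)

lemma part_nth: "el_part w $ i = w $ Inl i" "mag_part w $ i = w $ Inr i"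
  by (simp_all add: el_part_def mag_part_def)

lemma part_em_vec: "el_part (em_vec e b) = e" "mag_part (em_vec e b) = b"
  by (simp_all add: vec_eq_iff em_vec_nth part_nth)

lemma em_vec_part: "em_vec (el_part w) (mag_part w) = w"
  by (simp add: vec_eq_iff em_vec_def el_part_def mag_part_def split: sum.split)

lemma em_eqI:
  assumes "el_part w = el_part w'" and "mag_part w = mag_part w'"
  shows "w = w'"
  by (metis assms em_vec_part)

lemma part_linear: "linear el_part" "linear mag_part"
  by (simp_all add: linear_iff vec_eq_iff part_nth)

lemma em_inner: "w \<bullet> w' = el_part w \<bullet> el_part w' + mag_part w \<bullet> mag_part w'"
proof -
  have "(\<Sum>c\<in>(UNIV :: (3 + 3) set). w $ c * w' $ c)
      = (\<Sum>i\<in>UNIV. w $ Inl i * w' $ Inl i) + (\<Sum>i\<in>UNIV. w $ Inr i * w' $ Inr i)"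
    using sum.Plus[of "UNIV :: 3 set" "UNIV :: 3 set" "\<lambda>c. w $ c * w' $ c"] by (simp add: comp_def)
  then show ?thesis
    by (simp add: inner_vec_def part_nth)
qed

lemma maxwell_matrix_mult:
  "maxwell_matrix l *v w =
     em_vec (- cross3 (axis l 1) (mag_part w)) (cross3 (axis l 1) (el_part w))"
proof -
  have "linear (\<lambda>w. em_vec (- cross3 (axis l 1) (mag_part w)) (cross3 (axis l 1) (el_part w)))"
    by (rule linearI; rule em_eqI)
       (simp_all add: part_em_vec part_linear[THEN linear_add] part_linear[THEN linear_scale]
         cross_add_right cross_mult_right)
  then show ?thesis
    unfolding maxwell_matrix_def by (rule matrix_vector_mul(2)[THEN fun_cong])
qed

lemma maxwell_matrix_symmetric: "transpose (maxwell_matrix l) = maxwell_matrix l"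
proof -
  have "(maxwell_matrix l *v w) \<bullet> w' = w \<bullet> (maxwell_matrix l *v w')" for w w'
  proof -
    have "cross3 a b \<bullet> c = - (b \<bullet> cross3 a c)" for a b c :: "real^3"
      by (metis cross_triple cross_skew inner_commute inner_minus_left)
    then show ?thesis
      by (simp add: em_inner maxwell_matrix_mult part_em_vec)
  qed
  then have "transpose (maxwell_matrix l) *v w = maxwell_matrix l *v w" for w
    by (metis dot_lmul_matrix transpose_matrix_vector vector_eq_rdot)
  then show ?thesis
    by (simp add: matrix_eq)
qed

lemma maxwell_matrix_curl:
  "(\<Sum>l\<in>UNIV. maxwell_matrix l *v dx U l u z) =
     em_vec (- curl U (\<lambda>y. mag_part (u y)) z) (curl U (\<lambda>y. el_part (u y)) z)"
proof -
  have d: "el_part (dx U l u z) = dx U l (\<lambda>y. el_part (u y)) z"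
    "mag_part (dx U l u z) = dx U l (\<lambda>y. mag_part (u y)) z" for l
    by (simp_all add: dx_def vec_eq_iff part_nth)
  have c: "curl U v z = (\<Sum>l\<in>UNIV. cross3 (axis l 1) (dx U l v z))" for v
    by (simp add: curl_def vec_eq_iff forall_3 sum_3 cross_components axis_def)
  show ?thesis
    by (rule em_eqI)
       (simp_all add: maxwell_matrix_mult part_linear[THEN linear_sum] part_em_vec d c sum_negf)
qed

definition maxwell_op :: "spacetime set \<Rightarrow> (spacetime \<Rightarrow> em) \<Rightarrow> spacetime \<Rightarrow> em" where
  "maxwell_op U u z = dt U u z + (\<Sum>l\<in>UNIV. maxwell_matrix l *v dx U l u z)"

definition vhat :: "real^3 \<Rightarrow> real^3" where
  "vhat v = (1 / sqrt (1 + (norm v)\<^sup>2)) *\<^sub>R v"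

definition current :: "(real^3) set \<Rightarrow> (phase_spacetime \<Rightarrow> real) \<Rightarrow> spacetime \<Rightarrow> real^3" where
  "current \<Omega>v f = (\<lambda>(t, x). LINT v:\<Omega>v|lborel. f (t, x, v) *\<^sub>R vhat v)"

definition maxwell_source :: "(real^3) set \<Rightarrow> (phase_spacetime \<Rightarrow> real) \<Rightarrow> spacetime \<Rightarrow> em" where
  "maxwell_source \<Omega>v f z = em_vec (- current \<Omega>v f z) 0"

text \<open>
  The Vlasov equation together with its initial condition, in the sense of distributions; the
  velocity field \<open>(vhat v, E + vhat v \<times> B)\<close> is divergence free in \<open>(x, v)\<close>.
\<close>

definition vlasov_solution ::
  "real \<Rightarrow> (real^3) set \<Rightarrow> (real^3) set \<Rightarrow> (phase_spacetime \<Rightarrow> real) \<Rightarrow> (spacetime \<Rightarrow> real^3) \<Rightarrow>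
   (spacetime \<Rightarrow> real^3) \<Rightarrow> ((real^3) \<times> (real^3) \<Rightarrow> real) \<Rightarrow> bool" where
  "vlasov_solution T \<Omega>x \<Omega>v f E B f0 \<longleftrightarrow>
     (\<forall>\<phi>. test_function ({..<T} \<times> \<Omega>x \<times> \<Omega>v) \<phi> \<longrightarrow>
        (LINT (t, x, v):{0<..<T} \<times> \<Omega>x \<times> \<Omega>v|lborel.
           f (t, x, v) *
             (iter_deriv [(1, 0, 0)] \<phi> (t, x, v)
              + (\<Sum>l\<in>UNIV. vhat v $ l * iter_deriv [(0, axis l 1, 0)] \<phi> (t, x, v))
              + (\<Sum>l\<in>UNIV. (E (t, x) + cross3 (vhat v) (B (t, x))) $ l
                   * iter_deriv [(0, 0, axis l 1)] \<phi> (t, x, v))))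
        + (LINT (x, v):\<Omega>x \<times> \<Omega>v|lborel. f0 (x, v) * \<phi> (0, x, v)) = 0)"

text \<open>
  Maxwell's equations hold almost everywhere with weak derivatives. Every \<open>H\<^sup>1\<close> function has a
  representative that is continuous in time for each fixed \<open>x\<close>; \<open>E\<close> and \<open>B\<close> are taken to be such
  representatives, which gives their values at a fixed time a meaning.
\<close>

definition vlasov_maxwell_solution ::
  "real \<Rightarrow> (real^3) set \<Rightarrow> (real^3) set \<Rightarrow> (phase_spacetime \<Rightarrow> real) \<Rightarrow> (spacetime \<Rightarrow> real^3) \<Rightarrow>
   (spacetime \<Rightarrow> real^3) \<Rightarrow> ((real^3) \<times> (real^3) \<Rightarrow> real) \<Rightarrow> (real^3 \<Rightarrow> real^3) \<Rightarrow> (real^3 \<Rightarrow> real^3) \<Rightarrow>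
   bool" where
  "vlasov_maxwell_solution T \<Omega>x \<Omega>v f E B f0 E0 B0 \<longleftrightarrow>
     L2_on ({0..T} \<times> \<Omega>x \<times> \<Omega>v) f \<and>
     (\<forall>z\<in>{0..T} \<times> \<Omega>x \<times> \<Omega>v. 0 \<le> f z) \<and>
     set_integrable lborel (\<Omega>x \<times> \<Omega>v) f0 \<and>
     vlasov_solution T \<Omega>x \<Omega>v f E B f0 \<and>
     sobolev_vec 1 ({0<..<T} \<times> \<Omega>x) E \<and>
     sobolev_vec 1 ({0<..<T} \<times> \<Omega>x) B \<and>
     (\<forall>x\<in>\<Omega>x. continuous_on {0..T} (\<lambda>t. E (t, x)) \<and> continuous_on {0..T} (\<lambda>t. B (t, x))) \<and>
     (AE z in lborel. z \<in> {0<..<T} \<times> \<Omega>x \<longrightarrow>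
        dt ({0<..<T} \<times> \<Omega>x) E z = curl ({0<..<T} \<times> \<Omega>x) B z - current \<Omega>v f z \<and>
        dt ({0<..<T} \<times> \<Omega>x) B z = - curl ({0<..<T} \<times> \<Omega>x) E z) \<and>
     (\<forall>x\<in>\<Omega>x. E (0, x) = E0 x \<and> B (0, x) = B0 x) \<and>
     (\<exists>C. compact C \<and> C \<subseteq> \<Omega>x \<and>
        (\<forall>t\<in>{0..T}. \<forall>x\<in>\<Omega>x - C. E (t, x) = 0 \<and> B (t, x) = 0 \<and> (\<forall>v\<in>\<Omega>v. f (t, x, v) = 0))) \<and>
     (\<exists>D. compact D \<and> D \<subseteq> \<Omega>v \<and>
        (\<forall>t\<in>{0..T}. \<forall>x\<in>\<Omega>x. \<forall>v\<in>\<Omega>v - D. f (t, x, v) = 0))"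

section \<open>Mesh and discrete space\<close>

definition mesh :: "real \<Rightarrow> (real^3) set \<Rightarrow> nat \<Rightarrow> (nat \<Rightarrow> real) \<Rightarrow> (real^3) set set \<Rightarrow> bool" where
  "mesh T \<Omega>x M tn \<T> \<longleftrightarrow>
     tn 0 = 0 \<and> tn M = T \<and> (\<forall>m<M. tn m < tn (Suc m)) \<and>
     finite \<T> \<and> \<Union>\<T> = closure \<Omega>x \<and>
     (\<forall>\<tau>\<in>\<T>. compact \<tau> \<and> interior \<tau> \<noteq> {} \<and> interior \<tau> \<subseteq> \<Omega>x \<and> negligible (frontier \<tau>)) \<and>
     (\<forall>\<tau>\<in>\<T>. \<forall>\<tau>'\<in>\<T>. \<tau> \<noteq> \<tau>' \<longrightarrow> interior \<tau> \<inter> interior \<tau>' = {})"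

definition elements :: "nat \<Rightarrow> (nat \<Rightarrow> real) \<Rightarrow> (real^3) set set \<Rightarrow> spacetime set set" where
  "elements M tn \<T> = {{tn m<..tn (Suc m)} \<times> \<tau> | m \<tau>. m < M \<and> \<tau> \<in> \<T>}"

text \<open>
  Every mesh is shape regular for some \<open>\<sigma> > 0\<close>; constants that are independent of the element sizes
  may depend on \<open>\<sigma>\<close>.
\<close>

definition shape_regular :: "real \<Rightarrow> nat \<Rightarrow> (nat \<Rightarrow> real) \<Rightarrow> (real^3) set set \<Rightarrow> bool" where
  "shape_regular \<sigma> M tn \<T> \<longleftrightarrow> (\<forall>K\<in>elements M tn \<T>. \<exists>z. ball z (\<sigma> * diameter K) \<subseteq> K)"

text \<open>
  Vanishing on the lateral boundary of \<open>{a<..<b} \<times> \<Omega>\<close> in the sense of traces: approximability in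
  \<open>H\<^sup>1\<close> by smooth functions that vanish near the lateral boundary.
\<close>

definition zero_lateral_trace :: "real \<Rightarrow> real \<Rightarrow> (real^3) set \<Rightarrow> (spacetime \<Rightarrow> real) \<Rightarrow> bool" where
  "zero_lateral_trace a b \<Omega> w \<longleftrightarrow>
     (\<exists>\<phi> :: nat \<Rightarrow> spacetime \<Rightarrow> real.
        (\<forall>n. smooth (\<phi> n) \<and> (\<exists>C. compact C \<and> C \<subseteq> \<Omega> \<and> (\<forall>t x. x \<notin> C \<longrightarrow> \<phi> n (t, x) = 0))) \<and>
        (\<lambda>n. sobolev_norm 1 ({a<..<b} \<times> \<Omega>) (\<lambda>z. w z - \<phi> n z)) \<longlonglongrightarrow> 0)"

definition H0_tilde :: "(real^3) set \<Rightarrow> nat \<Rightarrow> (nat \<Rightarrow> real) \<Rightarrow> (spacetime \<Rightarrow> real) set" where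
  "H0_tilde \<Omega>x M tn =
     {w. \<forall>m<M. sobolev 1 ({tn m<..<tn (Suc m)} \<times> \<Omega>x) w \<and>
                zero_lateral_trace (tn m) (tn (Suc m)) \<Omega>x w}"

definition poly_on :: "nat \<Rightarrow> spacetime set \<Rightarrow> (spacetime \<Rightarrow> real) \<Rightarrow> bool" where
  "poly_on p K g \<longleftrightarrow>
     (\<exists>c. \<forall>(t, x)\<in>K. g (t, x) =
        (\<Sum>a\<le>p. \<Sum>\<beta> | (\<Sum>i\<in>UNIV. \<beta> i) \<le> p. c a \<beta> * t ^ a * (\<Prod>i\<in>(UNIV::3 set). x $ i ^ \<beta> i)))"

text \<open>
  The spatial elements are closed and \<open>g\<close> is single-valued, so prescribing a polynomial on each
  \<open>I\<^sub>m \<times> \<tau>\<close> includes continuity in \<open>x\<close>; nothing links the two sides of a time level.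
\<close>

definition fe_space ::
  "(real^3) set \<Rightarrow> nat \<Rightarrow> (nat \<Rightarrow> real) \<Rightarrow> (real^3) set set \<Rightarrow> (spacetime set \<Rightarrow> nat) \<Rightarrow>
   (spacetime \<Rightarrow> real) set" where
  "fe_space \<Omega>x M tn \<T> p = {g\<in>H0_tilde \<Omega>x M tn. \<forall>K\<in>elements M tn \<T>. poly_on (p K) K g}"

definition em_fe_space ::
  "(real^3) set \<Rightarrow> nat \<Rightarrow> (nat \<Rightarrow> real) \<Rightarrow> (real^3) set set \<Rightarrow> (spacetime set \<Rightarrow> nat) \<Rightarrow>
   (spacetime \<Rightarrow> em) set" where
  "em_fe_space \<Omega>x M tn \<T> p = {g. \<forall>c. (\<lambda>z. g z $ c) \<in> fe_space \<Omega>x M tn \<T> p}"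

section \<open>Discrete Maxwell problem\<close>

definition trace_plus :: "(spacetime \<Rightarrow> em) \<Rightarrow> real \<Rightarrow> real^3 \<Rightarrow> em" where
  "trace_plus g t x = Lim (at_right 0) (\<lambda>s. g (t + s, x))"

definition trace_minus :: "(spacetime \<Rightarrow> em) \<Rightarrow> real \<Rightarrow> real^3 \<Rightarrow> em" where
  "trace_minus g t x = Lim (at_left 0) (\<lambda>s. g (t + s, x))"

definition jump :: "(spacetime \<Rightarrow> em) \<Rightarrow> real \<Rightarrow> real^3 \<Rightarrow> em" where
  "jump g t x = trace_plus g t x - trace_minus g t x"

text \<open>
  Integrals and derivatives over an element are taken over its interior, which differs from it by
  a null set.
\<close>

definition maxwell_form ::
  "(real^3) set \<Rightarrow> nat \<Rightarrow> (nat \<Rightarrow> real) \<Rightarrow> (real^3) set set \<Rightarrow> (spacetime set \<Rightarrow> real) \<Rightarrow>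
   (spacetime \<Rightarrow> em) \<Rightarrow> (spacetime \<Rightarrow> em) \<Rightarrow> real" where
  "maxwell_form \<Omega>x M tn \<T> \<delta> W g =
     (\<Sum>K\<in>elements M tn \<T>. L2_inner (interior K) (maxwell_op (interior K) W)
        (\<lambda>z. g z + \<delta> K *\<^sub>R maxwell_op (interior K) g z))
     + (\<Sum>m=1..<M. L2_inner \<Omega>x (jump W (tn m)) (trace_plus g (tn m)))
     + L2_inner \<Omega>x (trace_plus W (tn 0)) (trace_plus g (tn 0))"

definition maxwell_rhs ::
  "(real^3) set \<Rightarrow> nat \<Rightarrow> (nat \<Rightarrow> real) \<Rightarrow> (real^3) set set \<Rightarrow> (spacetime set \<Rightarrow> real) \<Rightarrow>
   (real^3 \<Rightarrow> em) \<Rightarrow> (spacetime \<Rightarrow> em) \<Rightarrow> (spacetime \<Rightarrow> em) \<Rightarrow> real" where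
  "maxwell_rhs \<Omega>x M tn \<T> \<delta> W0 b g =
     (\<Sum>K\<in>elements M tn \<T>. L2_inner (interior K) b
        (\<lambda>z. g z + \<delta> K *\<^sub>R maxwell_op (interior K) g z))
     + L2_inner \<Omega>x W0 (trace_plus g (tn 0))"

definition discrete_maxwell_solution ::
  "(real^3) set \<Rightarrow> nat \<Rightarrow> (nat \<Rightarrow> real) \<Rightarrow> (real^3) set set \<Rightarrow> (spacetime set \<Rightarrow> nat) \<Rightarrow>
   (spacetime set \<Rightarrow> real) \<Rightarrow> (real^3 \<Rightarrow> em) \<Rightarrow> (spacetime \<Rightarrow> em) \<Rightarrow> (spacetime \<Rightarrow> em) \<Rightarrow> bool" where
  "discrete_maxwell_solution \<Omega>x M tn \<T> p \<delta> W0 b Wh \<longleftrightarrow>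
     Wh \<in> em_fe_space \<Omega>x M tn \<T> p \<and>
     (\<forall>g\<in>em_fe_space \<Omega>x M tn \<T> p.
        maxwell_form \<Omega>x M tn \<T> \<delta> Wh g = maxwell_rhs \<Omega>x M tn \<T> \<delta> W0 b g)"

definition maxwell_norm ::
  "(real^3) set \<Rightarrow> nat \<Rightarrow> (nat \<Rightarrow> real) \<Rightarrow> (real^3) set set \<Rightarrow> (spacetime set \<Rightarrow> real) \<Rightarrow>
   (spacetime \<Rightarrow> em) \<Rightarrow> real" where
  "maxwell_norm \<Omega>x M tn \<T> \<delta> g = sqrt (1 / 2 *
     ((L2_norm \<Omega>x (trace_plus g (tn 0)))\<^sup>2
      + (L2_norm \<Omega>x (trace_minus g (tn M)))\<^sup>2
      + (\<Sum>m=1..<M. (L2_norm \<Omega>x (jump g (tn m)))\<^sup>2)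
      + 2 * (\<Sum>K\<in>elements M tn \<T>.
               \<delta> K * (L2_norm (interior K) (maxwell_op (interior K) g))\<^sup>2)))"

section \<open>Interpolation estimates\<close>

text \<open>
  \<open>\<Phi>\<^sub>1 N p s\<close> and \<open>\<Phi>\<^sub>2 N p s\<close> depend on the space-time dimension \<open>N\<close>, which is \<open>4\<close> here. The
  finite element space contains only functions that vanish on the lateral boundary, so only
  functions with compact support in \<open>\<Omega>x\<close> are interpolated. The estimates are required only for the
  given orders \<open>s\<close>, so the interpolant may depend on them.
\<close>

definition hp_interpolation ::
  "real \<Rightarrow> (nat \<Rightarrow> nat \<Rightarrow> nat \<Rightarrow> real) \<Rightarrow> (nat \<Rightarrow> nat \<Rightarrow> nat \<Rightarrow> real) \<Rightarrow> real \<Rightarrow> (real^3) set \<Rightarrow> nat \<Rightarrow>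
   (nat \<Rightarrow> real) \<Rightarrow> (real^3) set set \<Rightarrow> (spacetime set \<Rightarrow> nat) \<Rightarrow> nat \<Rightarrow> (spacetime set \<Rightarrow> nat) \<Rightarrow>
   bool" where
  "hp_interpolation C \<Phi>\<^sub>1 \<Phi>\<^sub>2 T \<Omega>x M tn \<T> p k s \<longleftrightarrow>
     (\<forall>w. sobolev (k + 1) ({0<..<T} \<times> \<Omega>x) w \<longrightarrow>
          (\<exists>S. compact S \<and> S \<subseteq> \<Omega>x \<and> (\<forall>t\<in>{0..T}. \<forall>x\<in>\<Omega>x - S. w (t, x) = 0)) \<longrightarrow>
        (\<exists>w'\<in>fe_space \<Omega>x M tn \<T> p. \<forall>K\<in>elements M tn \<T>.
           (L2_norm (interior K) (\<lambda>z. w z - w' z))\<^sup>2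
             \<le> C * (diameter K / 2) ^ (2 * s K + 2) * inverse ((real (p K))\<^sup>2)
                 * \<Phi>\<^sub>1 (DIM(real^3) + 1) (p K) (s K) * (sobolev_norm (s K + 1) (interior K) w)\<^sup>2 \<and>
           (\<Sum>b\<in>Basis. (L2_norm (interior K) (wderiv (interior K) {#b#} (\<lambda>z. w z - w' z)))\<^sup>2)
             \<le> C * (diameter K / 2) ^ (2 * s K)
                 * \<Phi>\<^sub>2 (DIM(real^3) + 1) (p K) (s K) * (sobolev_norm (s K + 1) (interior K) w)\<^sup>2))"

definition Phi_M ::
  "(nat \<Rightarrow> nat \<Rightarrow> nat \<Rightarrow> real) \<Rightarrow> (nat \<Rightarrow> nat \<Rightarrow> nat \<Rightarrow> real) \<Rightarrow> nat \<Rightarrow> nat \<Rightarrow> real" where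
  "Phi_M \<Phi>\<^sub>1 \<Phi>\<^sub>2 p s = max (\<Phi>\<^sub>1 (DIM(real^3) + 1) p s) (\<Phi>\<^sub>2 (DIM(real^3) + 1) p s)"

end

theory Submission imports Defs
begin

text \<open>
  Let \<open>\<eta>\<close> be the interpolation error and \<open>\<xi>\<close> the difference of the discrete solution and the
  interpolant, so that \<open>W - W\<^sup>h = \<eta> - \<xi>\<close>. Discrete functions may jump at the time levels, hence \<open>\<xi>\<close>
  cut off after any level \<open>t\<^sub>N\<close> is an admissible test function. Testing with it and integrating by parts
  (the matrices \<open>M\<^sub>l\<close> are symmetric and \<open>\<xi>\<close> vanishes on the lateral boundary) turns the left-hand side into
  the energy of \<open>\<xi>\<close> up to \<open>t\<^sub>N\<close>, and leaves on the right the traces of \<open>\<eta>\<close>, terms that pair \<open>\<eta>\<close> with the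
  Maxwell operator applied to \<open>\<xi>\<close>, and the error of the current.
  The only term that the energy does not absorb by Young's inequality is the pairing of the current error
  with \<open>\<xi>\<close>. On a slab of length \<open>\<Delta>\<close> the \<open>L\<^sub>2\<close> norm of \<open>\<xi>\<close> is bounded by \<open>\<Delta>\<close> times its upper trace
  and \<open>\<Delta>\<^sup>2\<close> times its Maxwell operator; the slab lengths sum up to \<open>T\<close> and \<open>\<Delta>\<^sup>2\<close> is at most a multiple of
  \<open>\<delta>\<^sub>K\<close>, so that this is again the energy. The traces of \<open>\<eta>\<close> are bounded elementwise by a scaled trace
  inequality.

  The weak formulation of Maxwell's equations supplies only weak derivatives. For almost every \<open>x\<close> they
  are derivatives of absolutely continuous functions of time, which justifies the integrations by parts.
\<close>

section \<open>Smooth functions and bumps\<close>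

text \<open>The Green formulas in time and in space carry an affine weight
  \<open>\<alpha> + \<beta> * fst z\<close>. The constant weight yields the energy identity and its
  adjoint; a weight that vanishes at one end of a time interval isolates the trace at the other end
  and yields the square integrability of traces, the trace inequalities and the bound of the L2 norm
  on a slab. Integration by parts for the form takes place on whole slabs, where discrete functions
  are in H^1; on single cells it would leave integrals over spatial faces. Everything weighted with
  \<delta> is split into cells afterwards. As \<open>wderiv\<close> chooses a representative for
  each set separately, operators on a cell and on its slab agree only almost everywhere, which
  accounts for the many transfers along null sets. The functions \<open>\<Phi>\<^sub>1\<close> and
  \<open>\<Phi>\<^sub>2\<close> are arbitrary and may take negative values; that the right-hand
  sides are nonnegative is deduced from the interpolation estimates themselves.\<close>

definition partial_deriv :: "'a::euclidean_space \<Rightarrow> ('a \<Rightarrow> real) \<Rightarrow> 'a \<Rightarrow> real" where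
  "partial_deriv b f z = frechet_derivative f (at z) b"

lemma iter_deriv_Cons: "iter_deriv (b # bs) f = partial_deriv b (iter_deriv bs f)"
  by (simp add: partial_deriv_def fun_eq_iff)

lemma iter_deriv_snoc: "iter_deriv (bs @ [b]) f = iter_deriv bs (partial_deriv b f)"
  by (induction bs) (simp_all add: iter_deriv_Cons del: iter_deriv.simps(2))

lemma partial_derivI: "(f has_derivative f') (at z) \<Longrightarrow> partial_deriv b f z = f' b"
  by (metis frechet_derivative_at partial_deriv_def)

text \<open>By induction on the list of directions, no iterated derivative of \<open>f\<close>
  leaves \<open>S\<close>. Smoothness of a constructed function is thereby reduced to naming a set
  of differentiable functions that taking derivatives never leaves.\<close>

lemma smooth_coinduct:
  assumes "f \<in> S"
    and "\<And>g z. g \<in> S \<Longrightarrow> g differentiable at z"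
    and "\<And>g b. g \<in> S \<Longrightarrow> b \<in> Basis \<Longrightarrow> partial_deriv b g \<in> S"
  shows "smooth f"
proof -
  have "set bs \<subseteq> Basis \<Longrightarrow> iter_deriv bs f \<in> S" for bs
    using assms(1,3) by (induction bs) (auto simp del: iter_deriv.simps(2) simp: iter_deriv_Cons)
  then show ?thesis
    by (auto simp: smooth_def differentiable_on_def assms(2))
qed

lemma smooth_differentiable: "smooth f \<Longrightarrow> f differentiable at z"
  unfolding smooth_def differentiable_on_def by (drule spec[of _ "[]"]) simp

lemma smooth_partial_deriv: "smooth f \<Longrightarrow> b \<in> Basis \<Longrightarrow> smooth (partial_deriv b f)"
  unfolding smooth_def by (auto simp flip: iter_deriv_snoc)

lemma smooth_continuous_on: "smooth f \<Longrightarrow> continuous_on A f"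
  by (meson continuous_at_imp_continuous_on differentiable_imp_continuous_within smooth_differentiable)

lemma smooth_borel [measurable_dest]: "smooth f \<Longrightarrow> f \<in> borel_measurable borel"
  by (intro borel_measurable_continuous_onI smooth_continuous_on)

lemma smooth_has_derivative:
  "smooth f \<Longrightarrow> (f has_derivative (\<lambda>h. \<Sum>b\<in>Basis. (h \<bullet> b) * partial_deriv b f z)) (at z)"
proof -
  assume "smooth f"
  then have d: "(f has_derivative frechet_derivative f (at z)) (at z)"
    using frechet_derivative_works smooth_differentiable by blast
  have "frechet_derivative f (at z) h = (\<Sum>b\<in>Basis. (h \<bullet> b) * partial_deriv b f z)" for h
  proof -
    have "linear (frechet_derivative f (at z))"
      using d has_derivative_linear by blast
    then have "frechet_derivative f (at z) (\<Sum>b\<in>Basis. (h \<bullet> b) *\<^sub>R b)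
        = (\<Sum>b\<in>Basis. (h \<bullet> b) * partial_deriv b f z)"
      by (simp add: linear_sum linear_scale partial_deriv_def)
    then show ?thesis by (simp add: euclidean_representation)
  qed
  then show ?thesis using d by (metis (no_types, lifting) ext)
qed

lemma smooth_const: "smooth (\<lambda>_. c)"
proof (rule smooth_coinduct[where S="range (\<lambda>c _. c)"])
  fix g :: "'a \<Rightarrow> real" and b :: 'a assume "g \<in> range (\<lambda>c _. c)"
  then obtain c where g: "g = (\<lambda>_. c)" by auto
  have "partial_deriv b g = (\<lambda>_. 0)"
    by (auto simp: g fun_eq_iff intro!: partial_derivI derivative_eq_intros)
  then show "partial_deriv b g \<in> range (\<lambda>c _. c)" by auto
qed auto

text \<open>The Leibniz rule leads out of the set of products of two functions, but not out of the
  algebra they generate. This algebra is the invariant set for \<open>smooth_coinduct\<close>, both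
  for sums and products of smooth functions and for the family \<open>flat\<close>.\<close>

inductive_set generated_algebra :: "('a \<Rightarrow> real) set \<Rightarrow> ('a \<Rightarrow> real) set" for G where
  gen: "f \<in> G \<Longrightarrow> f \<in> generated_algebra G"
| const: "(\<lambda>_. c) \<in> generated_algebra G"
| add: "f \<in> generated_algebra G \<Longrightarrow> g \<in> generated_algebra G \<Longrightarrow>
    (\<lambda>z. f z + g z) \<in> generated_algebra G"
| mult: "f \<in> generated_algebra G \<Longrightarrow> g \<in> generated_algebra G \<Longrightarrow>
    (\<lambda>z. f z * g z) \<in> generated_algebra G"

lemma generated_algebra_smooth:
  fixes G :: "('a::euclidean_space \<Rightarrow> real) set"
  assumes G: "\<And>g z. g \<in> G \<Longrightarrow> g differentiable at z"
    and G': "\<And>g b. g \<in> G \<Longrightarrow> b \<in> Basis \<Longrightarrow> partial_deriv b g \<in> generated_algebra G"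
    and f: "f \<in> generated_algebra G"
  shows "smooth f"
proof (rule smooth_coinduct[OF f])
  have *: "(\<forall>z. g differentiable at z) \<and> (\<forall>b\<in>Basis. partial_deriv b g \<in> generated_algebra G)"
    if "g \<in> generated_algebra G" for g
    using that
  proof induction
    case (gen f)
    then show ?case using G G' by blast
  next
    case (const c)
    have "partial_deriv b (\<lambda>_. c) = (\<lambda>_. 0)" for b :: 'a
      by (auto simp: fun_eq_iff intro!: partial_derivI derivative_eq_intros)
    then show ?case using generated_algebra.const[of 0 G] by simp
  next
    case (add f g)
    have "partial_deriv b (\<lambda>z. f z + g z) = (\<lambda>z. partial_deriv b f z + partial_deriv b g z)" for b
    proof
      fix z
      have "(f has_derivative frechet_derivative f (at z)) (at z)"
        "(g has_derivative frechet_derivative g (at z)) (at z)"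
        using add frechet_derivative_works by blast+
      then show "partial_deriv b (\<lambda>z. f z + g z) z = partial_deriv b f z + partial_deriv b g z"
        by (intro trans[OF partial_derivI[OF has_derivative_add]]) (auto simp: partial_deriv_def)
    qed
    then show ?case using add by (auto intro: generated_algebra.add)
  next
    case (mult f g)
    have "partial_deriv b (\<lambda>z. f z * g z) = (\<lambda>z. f z * partial_deriv b g z + partial_deriv b f z * g z)"
      for b
    proof
      fix z
      have "(f has_derivative frechet_derivative f (at z)) (at z)"
        "(g has_derivative frechet_derivative g (at z)) (at z)"
        using mult frechet_derivative_works by blast+
      then show "partial_deriv b (\<lambda>z. f z * g z) z = f z * partial_deriv b g z + partial_deriv b f z * g z"
        by (intro trans[OF partial_derivI[OF has_derivative_mult]]) (auto simp: partial_deriv_def)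
    qed
    then show ?case using mult by (auto intro!: generated_algebra.add generated_algebra.mult)
  qed
  show "g differentiable at z" if "g \<in> generated_algebra G" for g z using * that by blast
  show "partial_deriv b g \<in> generated_algebra G" if "g \<in> generated_algebra G" "b \<in> Basis" for g b
    using * that by blast
qed

lemma smooth_algebra: "f \<in> generated_algebra (Collect smooth) \<Longrightarrow> smooth f"
  by (rule generated_algebra_smooth)
     (auto intro: generated_algebra.gen smooth_partial_deriv smooth_differentiable)

lemma smooth_add: "smooth f \<Longrightarrow> smooth g \<Longrightarrow> smooth (\<lambda>z. f z + g z)"
  by (rule smooth_algebra) (auto intro: generated_algebra.intros)

lemma smooth_mult: "smooth f \<Longrightarrow> smooth g \<Longrightarrow> smooth (\<lambda>z. f z * g z)"
  by (rule smooth_algebra) (auto intro: generated_algebra.intros)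

lemma smooth_diff: "smooth f \<Longrightarrow> smooth g \<Longrightarrow> smooth (\<lambda>z. f z - g z)"
  using smooth_add[of f "\<lambda>z. (-1) * g z"] smooth_mult[OF smooth_const[of "-1"], of g] by simp

lemma smooth_sum: "(\<And>i. i \<in> I \<Longrightarrow> smooth (f i)) \<Longrightarrow> smooth (\<lambda>z. \<Sum>i\<in>I. f i z)"
  by (induction I rule: infinite_finite_induct) (auto intro: smooth_const smooth_add)

lemma smooth_prod: "(\<And>i. i \<in> I \<Longrightarrow> smooth (f i)) \<Longrightarrow> smooth (\<lambda>z. \<Prod>i\<in>I. f i z)"
  by (induction I rule: infinite_finite_induct) (auto intro: smooth_const smooth_mult)

lemma partial_deriv_mult:
  assumes "smooth f" "smooth g"
  shows "partial_deriv b (\<lambda>z. f z * g z) z = f z * partial_deriv b g z + partial_deriv b f z * g z"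
proof -
  have "(f has_derivative frechet_derivative f (at z)) (at z)"
    "(g has_derivative frechet_derivative g (at z)) (at z)"
    using assms smooth_differentiable frechet_derivative_works by blast+
  then show ?thesis
    by (intro trans[OF partial_derivI[OF has_derivative_mult]]) (auto simp: partial_deriv_def)
qed

lemma partial_deriv_comp_affine:
  fixes L :: "'a::euclidean_space \<Rightarrow> 'b::euclidean_space"
  assumes "smooth g" "linear L"
  shows "partial_deriv e (\<lambda>z. g (L z + c)) z = (\<Sum>b\<in>Basis. (L e \<bullet> b) * partial_deriv b g (L z + c))"
proof -
  have "((\<lambda>z. L z + c) has_derivative L) (at z)"
    using assms(2) by (auto intro!: derivative_eq_intros linear_imp_has_derivative)
  from has_derivative_compose[OF this smooth_has_derivative[OF assms(1)]]
  show ?thesis by (rule partial_derivI)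
qed

text \<open>The chain rule replaces \<open>g\<close> by a fixed linear combination of its partial
  derivatives and keeps the affine map, so the set of all compositions with this map is closed under
  differentiation.\<close>

lemma smooth_comp_affine:
  fixes L :: "'a::euclidean_space \<Rightarrow> 'b::euclidean_space"
  assumes "smooth g" "linear L"
  shows "smooth (\<lambda>z. g (L z + c))"
proof (rule smooth_coinduct[where S="{\<lambda>z. g (L z + c) | g. smooth g}"])
  show "(\<lambda>z. g (L z + c)) \<in> {\<lambda>z. g (L z + c) | g. smooth g}" using assms by auto
next
  fix f :: "'a \<Rightarrow> real" and z assume "f \<in> {\<lambda>z. g (L z + c) | g. smooth g}"
  then obtain g where g: "smooth g" "f = (\<lambda>z. g (L z + c))" by auto
  have "((\<lambda>z. L z + c) has_derivative L) (at z)"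
    using assms(2) by (auto intro!: derivative_eq_intros linear_imp_has_derivative)
  from has_derivative_compose[OF this smooth_has_derivative[OF g(1)]]
  show "f differentiable at z" unfolding g(2) differentiable_def by blast
next
  fix f :: "'a \<Rightarrow> real" and e :: 'a assume "f \<in> {\<lambda>z. g (L z + c) | g. smooth g}"
  then obtain g where g: "smooth g" "f = (\<lambda>z. g (L z + c))" by auto
  have "smooth (\<lambda>y. \<Sum>b\<in>Basis. (L e \<bullet> b) * partial_deriv b g y)"
    using g(1) by (intro smooth_sum smooth_mult smooth_const smooth_partial_deriv)
  moreover have "partial_deriv e f = (\<lambda>z. \<Sum>b\<in>Basis. (L e \<bullet> b) * partial_deriv b g (L z + c))"
    using partial_deriv_comp_affine[OF g(1) assms(2)] by (auto simp: g(2))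
  ultimately show "partial_deriv e f \<in> {\<lambda>z. g (L z + c) | g. smooth g}"
    by (intro CollectI exI[of _ "\<lambda>y. \<Sum>b\<in>Basis. (L e \<bullet> b) * partial_deriv b g y"]) auto
qed

lemma smooth_antiderivative:
  assumes "\<And>x. (f has_real_derivative f' x) (at x)" and "smooth f'"
  shows "smooth f" "partial_deriv 1 f = f'"
proof -
  show d: "partial_deriv 1 f = f'"
  proof
    show "partial_deriv 1 f x = f' x" for x
      using partial_derivI[OF assms(1)[unfolded has_field_derivative_def], of 1 x] by simp
  qed
  show "smooth f"
  proof (rule smooth_coinduct[where S="insert f (Collect smooth)"])
    fix g z assume "g \<in> insert f (Collect smooth)"
    then show "g differentiable at z"
      using differentiableI[OF has_field_derivative_imp_has_derivative[OF assms(1)]]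
      by (auto simp: smooth_differentiable)
  qed (use assms(2) d in \<open>auto simp: smooth_partial_deriv\<close>)
qed

text \<open>\<open>flat 0\<close> is the standard function exp(-1/x), continued by 0. The powers of
  1/x are included because the derivative of one member of the family is then a linear combination
  of two others.\<close>

definition flat :: "nat \<Rightarrow> real \<Rightarrow> real" where
  "flat n x = (if x > 0 then inverse x ^ n * exp (- inverse x) else 0)"

lemma flat_tendsto_0: "(flat n \<longlongrightarrow> 0) (at 0)"
proof -
  have "((\<lambda>x. inverse x ^ n / exp (inverse x)) \<longlongrightarrow> (0::real)) (at_right 0)"
    by (rule filterlim_compose[OF tendsto_power_div_exp_0 filterlim_inverse_at_top_right])
  then have "(flat n \<longlongrightarrow> 0) (at_right 0)"
    by (rule Lim_transform_eventually)
       (auto simp: flat_def eventually_at_filter exp_minus field_simps)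
  moreover have "(flat n \<longlongrightarrow> 0) (at_left 0)"
    by (rule tendsto_eventually) (auto simp: flat_def eventually_at_filter)
  ultimately show ?thesis
    using filterlim_at_split by blast
qed

lemma flat_deriv: "(flat n has_real_derivative flat (n + 2) x - n * flat (n + 1) x) (at x)"
proof -
  consider "x > 0" | "x < 0" | "x = 0" by linarith
  then show ?thesis
  proof cases
    case 1
    have "((\<lambda>x. inverse x ^ n * exp (- inverse x)) has_real_derivative
        inverse x ^ n * (exp (- inverse x) * (inverse x)\<^sup>2)
        - real n * (inverse x ^ (n - 1) * (inverse x)\<^sup>2) * exp (- inverse x)) (at x)"
      using 1 by (auto intro!: derivative_eq_intros simp: power2_eq_square)
    moreover have "real n * (inverse x ^ (n - 1) * (inverse x)\<^sup>2) = real n * inverse x ^ (n + 1)"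
      by (cases n) (simp_all add: power2_eq_square)
    moreover have "inverse x ^ n * (exp (- inverse x) * (inverse x)\<^sup>2) - real n * inverse x ^ (n + 1) * exp (- inverse x)
       = flat (n + 2) x - n * flat (n + 1) x"
      using 1 by (simp add: flat_def power_add power2_eq_square algebra_simps)
    ultimately have "((\<lambda>x. inverse x ^ n * exp (- inverse x)) has_real_derivative
        flat (n + 2) x - n * flat (n + 1) x) (at x)"
      by (simp only:)
    then show ?thesis
      by (rule has_field_derivative_transform_within[where d=x]) (use 1 in \<open>auto simp: flat_def dist_real_def\<close>)
  next
    case 2
    have "((\<lambda>x. 0) has_real_derivative flat (n + 2) x - n * flat (n + 1) x) (at x)"
      using 2 by (auto simp: flat_def)
    then show ?thesis
      by (rule has_field_derivative_transform_within[where d="-x"]) (use 2 in \<open>auto simp: flat_def dist_real_def\<close>)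
  next
    case 3
    \<comment> \<open>Away from 0 the difference quotient at 0 is \<open>flat (Suc n)\<close>, which
      tends to 0.\<close>
    have "((\<lambda>y. (flat n (0 + y) - flat n 0) / y) \<longlongrightarrow> 0) (at 0)"
      by (rule Lim_transform_eventually[OF flat_tendsto_0[of "Suc n"]])
         (auto simp: flat_def eventually_at_filter field_simps)
    then show ?thesis
      using 3 by (simp add: DERIV_def) (simp add: flat_def)
  qed
qed

lemma smooth_flat: "smooth (flat n)"
proof (rule generated_algebra_smooth[where G="range flat"])
  show "g differentiable at z" if "g \<in> range flat" for g z
    using that flat_deriv real_differentiable_def by fastforce
  fix g :: "real \<Rightarrow> real" and b :: real assume "g \<in> range flat" "b \<in> Basis"
  then obtain n where g: "g = flat n" and "b = 1" by auto
  then have "partial_deriv b g = (\<lambda>x. flat (n + 2) x + (- real n) * flat (n + 1) x)"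
    using partial_derivI[OF flat_deriv[of n, unfolded has_field_derivative_def], of 1]
    unfolding g by (auto simp: fun_eq_iff)
  then show "partial_deriv b g \<in> generated_algebra (range flat)"
    using generated_algebra.add[OF generated_algebra.gen[of "flat (n + 2)" "range flat"]
      generated_algebra.mult[OF generated_algebra.const[of "- real n"]
        generated_algebra.gen[of "flat (n + 1)" "range flat"]]] by simp
qed (auto intro: generated_algebra.intros)

lemma flat0: "0 \<le> flat 0 x" "flat 0 x \<le> 1" "x \<le> 0 \<Longrightarrow> flat 0 x = 0" "x > 0 \<Longrightarrow> flat 0 x > 0"
  by (auto simp: flat_def)

lemma flat0_tendsto: "(flat 0 \<longlongrightarrow> 1) at_top"
proof -
  have "((\<lambda>x. exp (- inverse x)) \<longlongrightarrow> exp (- 0 :: real)) at_top"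
    by (intro tendsto_intros tendsto_inverse_0_at_top filterlim_ident)
  then have "((\<lambda>x. exp (- inverse x)) \<longlongrightarrow> (1 :: real)) at_top" by simp
  then show ?thesis
    by (rule Lim_transform_eventually)
       (use eventually_gt_at_top[of 0] in \<open>auto simp: flat_def elim!: eventually_mono\<close>)
qed

lemma flat0_scaled_tendsto:
  "(\<lambda>n. flat 0 (real n * x - 1)) \<longlonglongrightarrow> (if x > 0 then 1 else 0)"
proof (cases "x > 0")
  case True
  have "filterlim (\<lambda>n. - 1 + x * real n) at_top sequentially"
    using True by (intro filterlim_tendsto_add_at_top[OF tendsto_const]
        filterlim_tendsto_pos_mult_at_top[OF tendsto_const] filterlim_real_sequentially)
  then have "filterlim (\<lambda>n. real n * x - 1) at_top sequentially"
    by (simp add: mult.commute)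
  from filterlim_compose[OF flat0_tendsto this] show ?thesis using True by simp
next
  case False
  then have "real n * x \<le> 0" for n by (simp add: mult_nonneg_nonpos)
  then have "flat 0 (real n * x - 1) = 0" for n
    by (intro flat0) (smt (verit) \<open>\<And>n. real n * x \<le> 0\<close>)
  then show ?thesis using False by simp
qed

text \<open>The shift by 1 makes the support a compact subset of the open box.\<close>

definition bump :: "nat \<Rightarrow> 'a::euclidean_space \<Rightarrow> 'a \<Rightarrow> 'a \<Rightarrow> real" where
  "bump n l u z =
     (\<Prod>b\<in>Basis. flat 0 (real n * (z \<bullet> b - l \<bullet> b) - 1) * flat 0 (real n * (u \<bullet> b - z \<bullet> b) - 1))"

lemma smooth_bump: "smooth (bump n l u)"
proof -
  have lin: "linear (\<lambda>z::'a. real n * (z \<bullet> b))" "linear (\<lambda>z::'a. - real n * (z \<bullet> b))" for b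
    by (auto simp: linear_iff algebra_simps)
  have "smooth (\<lambda>z::'a. flat 0 (real n * (z \<bullet> b - l \<bullet> b) - 1))"
    "smooth (\<lambda>z::'a. flat 0 (real n * (u \<bullet> b - z \<bullet> b) - 1))" for b
    using smooth_comp_affine[OF smooth_flat lin(1), of 0 b "- real n * (l \<bullet> b) - 1"]
      smooth_comp_affine[OF smooth_flat lin(2), of 0 b "real n * (u \<bullet> b) - 1"]
    by (simp_all add: algebra_simps)
  then show ?thesis unfolding bump_def by (intro smooth_prod smooth_mult)
qed

lemma bump_bounds: "0 \<le> bump n l u z" "bump n l u z \<le> 1"
  unfolding bump_def
  by (auto intro!: prod_nonneg prod_le_1 mult_nonneg_nonneg mult_le_one flat0)

lemma bump_support: "bump n l u z \<noteq> 0 \<Longrightarrow> n > 0 \<and> z \<in> cbox (l + (1 / n) *\<^sub>R One) (u - (1 / n) *\<^sub>R One)"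
proof -
  assume "bump n l u z \<noteq> 0"
  then have nz: "flat 0 (real n * (z \<bullet> b - l \<bullet> b) - 1) \<noteq> 0 \<and> flat 0 (real n * (u \<bullet> b - z \<bullet> b) - 1) \<noteq> 0"
    if "b \<in> Basis" for b
    using that unfolding bump_def by (auto simp: prod_zero_iff)
  then have gt: "real n * (z \<bullet> b - l \<bullet> b) - 1 > 0 \<and> real n * (u \<bullet> b - z \<bullet> b) - 1 > 0"
    if "b \<in> Basis" for b
    using that flat0(3) by (metis not_less)
  obtain b :: 'a where "b \<in> Basis" using nonempty_Basis by blast
  with gt have n: "n > 0" by (cases n) force+
  then show ?thesis using gt
    by (force simp: mem_box inner_add_left inner_diff_left field_simps)
qed

lemma bump_cbox_subset:
  "n > 0 \<Longrightarrow> cbox (l + (1 / real n) *\<^sub>R One) (u - (1 / real n) *\<^sub>R One) \<subseteq> box l u"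
proof
  fix z assume n: "n > 0" and z: "z \<in> cbox (l + (1 / real n) *\<^sub>R One) (u - (1 / real n) *\<^sub>R One)"
  define e where "e = 1 / real n"
  have e: "e > 0" using n by (simp add: e_def)
  show "z \<in> box l u"
    unfolding mem_box
  proof
    fix i :: 'a assume "i \<in> Basis"
    then have "l \<bullet> i + e \<le> z \<bullet> i \<and> z \<bullet> i \<le> u \<bullet> i - e"
      using z unfolding e_def[symmetric] by (simp add: mem_box inner_add_left inner_diff_left)
    then show "l \<bullet> i < z \<bullet> i \<and> z \<bullet> i < u \<bullet> i" using e by linarith
  qed
qed

lemma bump_eq_0: "z \<notin> box l u \<Longrightarrow> bump n l u z = 0"
  using bump_support bump_cbox_subset by blast

lemma bump_tendsto:
  fixes z :: "'a::euclidean_space"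
  shows "(\<lambda>n. bump n l u z) \<longlonglongrightarrow> indicat_real (box l u) z"
proof -
  have "(\<Prod>b\<in>Basis. (if z \<bullet> b - l \<bullet> b > 0 then 1 else 0) * (if u \<bullet> b - z \<bullet> b > 0 then 1 else 0)) = indicat_real (box l u) z"
    by (auto simp: indicator_def mem_box prod_zero_iff intro!: prod.neutral)
  moreover have "(\<lambda>n. bump n l u z) \<longlonglongrightarrow>
    (\<Prod>b\<in>Basis. (if z \<bullet> b - l \<bullet> b > 0 then 1 else 0) * (if u \<bullet> b - z \<bullet> b > 0 then 1 else 0))"
    unfolding bump_def by (intro tendsto_intros flat0_scaled_tendsto)
  ultimately show ?thesis by simp
qed

lemma test_function_bump:
  fixes l u :: "'a::euclidean_space"
  assumes "box l u \<subseteq> U"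
  shows "test_function U (bump n l u)"
proof -
  let ?C = "if n > 0 then cbox (l + (1 / n) *\<^sub>R One) (u - (1 / n) *\<^sub>R One) else ({} :: 'a set)"
  have "compact ?C" "?C \<subseteq> U" using assms bump_cbox_subset[of n l u] by auto
  moreover have "bump n l u z = 0" if "z \<notin> ?C" for z
    using bump_support[of n l u z] that by (cases "bump n l u z = 0") (auto split: if_splits)
  ultimately show ?thesis unfolding test_function_def using smooth_bump by blast
qed

section \<open>Weak derivatives\<close>

lemma bump_integral_tendsto:
  assumes "set_integrable lborel (cbox l u) (g :: 'a::euclidean_space \<Rightarrow> real)"
  shows "(\<lambda>n. LINT z|lborel. g z * bump n l u z) \<longlonglongrightarrow> (LINT z:box l u|lborel. g z)"
proof -
  define G where "G z = indicator (cbox l u) z * g z" for z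
  have G: "integrable lborel G"
    using assms by (simp add: G_def[abs_def] set_integrable_def)
  have [measurable]: "bump n l u \<in> borel_measurable borel" for n
    by (rule smooth_borel[OF smooth_bump])
  have [measurable]: "G \<in> borel_measurable borel"
    using borel_measurable_integrable[OF G] by simp
  have "(\<lambda>n. LINT z|lborel. G z * bump n l u z) \<longlonglongrightarrow> (LINT z|lborel. G z * indicator (box l u) z)"
  proof (rule integral_dominated_convergence[where w="\<lambda>z. \<bar>G z\<bar>"])
    show "AE x in lborel. (\<lambda>n. G x * bump n l u x) \<longlonglongrightarrow> G x * indicat_real (box l u) x"
      by (intro AE_I2 tendsto_intros bump_tendsto)
    show "AE x in lborel. norm (G x * bump n l u x) \<le> \<bar>G x\<bar>" for n
      by (intro AE_I2) (auto simp: abs_mult bump_bounds intro!: mult_left_le)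
  qed (use G in auto)
  moreover have "G z * bump n l u z = g z * bump n l u z" for n z
    using box_subset_cbox[of l u] bump_eq_0[of z l u n] by (cases "z \<in> box l u") (auto simp: G_def)
  moreover have "(LINT z|lborel. G z * indicator (box l u) z) = (LINT z:box l u|lborel. g z)"
    unfolding set_lebesgue_integral_def using box_subset_cbox[of l u]
    by (intro Bochner_Integration.integral_cong) (auto simp: G_def indicator_def)
  ultimately show ?thesis by simp
qed

text \<open>Lebesgue differentiation: outside a negligible set, \<open>G\<close> is the limit of its
  averages over the cubes with lower corner \<open>z\<close> and edge \<open>h\<close>. These
  averages vanish as soon as the cube lies in the open box, and the boundary of the box is
  negligible.\<close>

lemma zero_box_integrals_AE:
  fixes g :: "'a::euclidean_space \<Rightarrow> real"
  assumes g: "set_integrable lborel (cbox a b) g"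
    and zero: "\<And>l u. cbox l u \<subseteq> box a b \<Longrightarrow> (LINT z:box l u|lborel. g z) = 0"
  shows "AE z in lborel. z \<in> cbox a b \<longrightarrow> g z = 0"
proof -
  define G where "G z = indicator (cbox a b) z * g z" for z
  have G: "integrable lborel G"
    using g by (simp add: G_def[abs_def] set_integrable_def)
  have Gset: "set_integrable lborel A G" if "A \<in> sets borel" for A
    unfolding set_integrable_def using integrable_mult_indicator[OF _ G] that by simp
  have "G integrable_on cbox l u" for l u
    using set_borel_integral_eq_integral(1)[OF Gset[of "cbox l u"]] by simp
  from integrable_ccontinuous_explicit[OF this] obtain N where N: "negligible N" and
    lim: "\<And>x e. \<lbrakk>x \<notin> N; 0 < e\<rbrakk> \<Longrightarrow> \<exists>d>0. \<forall>h. 0 < h \<and> h < d \<longrightarrow>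
       norm (integral (cbox x (x + h *\<^sub>R One)) G /\<^sub>R h ^ DIM('a) - G x) < e"
    by metis
  have "g z = 0" if z: "z \<in> box a b" "z \<notin> N" for z
  proof (rule ccontr)
    assume "g z \<noteq> 0"
    then have Gz: "G z \<noteq> 0" using z box_subset_cbox[of a b] by (auto simp: G_def)
    then obtain d where d: "d > 0" "\<And>h. 0 < h \<and> h < d \<Longrightarrow>
       norm (integral (cbox z (z + h *\<^sub>R One)) G /\<^sub>R h ^ DIM('a) - G z) < \<bar>G z\<bar>"
      using lim[of z "\<bar>G z\<bar>"] z by auto
    have "\<forall>\<^sub>F h in at_right 0. \<forall>i\<in>Basis. z \<bullet> i + h < b \<bullet> i"
    proof (subst eventually_ball_finite_distrib, simp, rule ballI)
      fix i :: 'a assume i: "i \<in> Basis"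
      have "((\<lambda>h. z \<bullet> i + h) \<longlongrightarrow> z \<bullet> i + 0) (at_right 0)" by (intro tendsto_intros)
      then show "\<forall>\<^sub>F h in at_right 0. z \<bullet> i + h < b \<bullet> i"
        using z i by (intro order_tendstoD) (auto simp: mem_box)
    qed
    moreover have "\<forall>\<^sub>F h in at_right 0. 0 < h \<and> h < d"
      using d(1) eventually_at_right_less[of 0] eventually_at_right[of 0 d "\<lambda>h. h < d"]
      by (auto simp: eventually_conj_iff)
    ultimately have "\<forall>\<^sub>F h in at_right 0. (\<forall>i\<in>Basis. z \<bullet> i + h < b \<bullet> i) \<and> 0 < h \<and> h < d"
      by eventually_elim auto
    then obtain h where h: "\<forall>i\<in>Basis. z \<bullet> i + h < b \<bullet> i" "0 < h" "h < d"
      by (metis (no_types, lifting) eventually_happens' trivial_limit_at_right_real)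
    let ?u = "z + h *\<^sub>R One"
    have sub: "cbox z ?u \<subseteq> box a b"
      using h z by (force simp: mem_box inner_add_left)
    have "integral (cbox z ?u) G = integral (box z ?u) G"
      by (rule integral_open_interval[symmetric])
    also have "\<dots> = (LINT y:box z ?u|lborel. G y)"
      using set_borel_integral_eq_integral(2)[OF Gset[of "box z ?u"]] by simp
    also have "\<dots> = (LINT y:box z ?u|lborel. g y)"
      using sub box_subset_cbox[of a b] box_subset_cbox[of z ?u]
      by (intro set_lebesgue_integral_cong) (auto simp: G_def indicator_def)
    also have "\<dots> = 0" by (rule zero[OF sub])
    finally show False using d(2)[of h] h by simp
  qed
  moreover have "AE z in lborel. z \<notin> N"
    using N AE_completion_iff[of "\<lambda>z. z \<notin> N" lborel] AE_not_in[of N lebesgue]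
    by (simp add: negligible_iff_null_sets)
  moreover have "AE z in lborel. z \<notin> cbox a b - box a b"
    using negligible_frontier_interval[of a b] AE_completion_iff[of "\<lambda>z. z \<notin> cbox a b - box a b" lborel]
      AE_not_in[of "cbox a b - box a b" lebesgue]
    by (simp add: negligible_iff_null_sets)
  ultimately show ?thesis by (auto elim!: eventually_elim2)
qed

lemma integral_times_supported:
  fixes g \<phi> :: "'a \<Rightarrow> real"
  assumes "\<And>z. z \<notin> U \<Longrightarrow> \<phi> z = 0"
  shows "(LINT z:U|M. g z * \<phi> z) = (LINT z|M. g z * \<phi> z)"
  unfolding set_lebesgue_integral_def using assms
  by (intro Bochner_Integration.integral_cong) (auto simp: indicator_def)

text \<open>Bumps supported in a box converge boundedly to its indicator, so the integrals of
  \<open>g\<close> over small boxes vanish. Countably many closed boxes cover \<open>U\<close>,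
  hence the exceptional sets unite to a single null set.\<close>

theorem fundamental_lemma:
  fixes g :: "'a::euclidean_space \<Rightarrow> real"
  assumes U: "open U" and g: "locally_integrable U g"
    and zero: "\<And>\<phi>. test_function U \<phi> \<Longrightarrow> (LINT z:U|lborel. g z * \<phi> z) = 0"
  shows "AE z in lborel. z \<in> U \<longrightarrow> g z = 0"
proof -
  obtain D where D: "countable D" "D \<subseteq> Pow U" "\<And>X. X \<in> D \<Longrightarrow> \<exists>a b::'a. X = cbox a b" "\<Union>D = U"
    using open_countable_Union_open_cbox[OF U] by metis
  have "AE z in lborel. z \<in> X \<longrightarrow> g z = 0" if X: "X \<in> D" for X
  proof -
    obtain a b where ab: "X = cbox a b" using D X by metis
    have int: "set_integrable lborel (cbox l u) g" if "cbox l u \<subseteq> U" for l u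
      using g that by (simp add: locally_integrable_def)
    show ?thesis unfolding ab
    proof (rule zero_box_integrals_AE)
      show "set_integrable lborel (cbox a b) g" using int D X ab by blast
      fix l u assume "cbox l u \<subseteq> box a b"
      then have sub: "cbox l u \<subseteq> U" using D X ab box_subset_cbox[of a b] by blast
      have "(LINT z|lborel. g z * bump n l u z) = 0" for n
      proof -
        have "box l u \<subseteq> U" using sub box_subset_cbox[of l u] by blast
        then have "(LINT z:U|lborel. g z * bump n l u z) = 0" "z \<notin> U \<Longrightarrow> bump n l u z = 0" for z
          using zero test_function_bump bump_eq_0[of z l u n] by blast+
        then show ?thesis by (simp add: integral_times_supported)
      qed
      then show "(LINT z:box l u|lborel. g z) = 0"
        using bump_integral_tendsto[OF int[OF sub]] by (simp add: LIMSEQ_const_iff)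
    qed
  qed
  then have "AE z in lborel. \<forall>X\<in>D. z \<in> X \<longrightarrow> g z = 0"
    by (intro AE_ball_countable[OF D(1), THEN iffD2] ballI)
  then show ?thesis using D(4) by (auto elim!: eventually_mono)
qed

text \<open>Local integrability speaks of compact subsets only; measurability on the whole of
  \<open>U\<close> is recovered as a limit along a compact exhaustion.\<close>

lemma locally_integrable_measurable:
  assumes "open U" "locally_integrable U (g :: 'a::euclidean_space \<Rightarrow> real)"
  shows "set_borel_measurable lborel U g"
proof -
  obtain C :: "nat \<Rightarrow> 'a set" where C: "\<And>n. compact (C n)" "\<And>n. C n \<subseteq> U"
    "\<And>K. \<lbrakk>compact K; K \<subseteq> U\<rbrakk> \<Longrightarrow> \<exists>N. \<forall>n\<ge>N. K \<subseteq> C n"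
    using open_Union_compact_subsets[OF assms(1)] by metis
  show ?thesis
    unfolding set_borel_measurable_def
  proof (rule borel_measurable_LIMSEQ_metric)
    show "(\<lambda>x. indicator (C n) x *\<^sub>R g x) \<in> borel_measurable lborel" for n
      using assms(2) C by (intro borel_measurable_integrable) (auto simp: locally_integrable_def set_integrable_def)
    show "(\<lambda>n. indicator (C n) x *\<^sub>R g x) \<longlonglongrightarrow> indicator U x *\<^sub>R g x" for x
    proof (cases "x \<in> U")
      case True
      then obtain N where "\<forall>n\<ge>N. {x} \<subseteq> C n" using C(3)[of "{x}"] by auto
      then show ?thesis
        using True by (intro tendsto_eventually) (auto simp: eventually_sequentially intro!: exI[of _ N])
    next
      case False
      then have "x \<notin> C n" for n using C(2) by auto
      then show ?thesis using False by simp
    qed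
  qed
qed

lemma locally_integrable_subset:
  "locally_integrable U g \<Longrightarrow> V \<subseteq> U \<Longrightarrow> locally_integrable V g"
  by (auto simp: locally_integrable_def)

lemma locally_integrable_cmult:
  "locally_integrable U g \<Longrightarrow> locally_integrable U (\<lambda>z. c * g z)"
  by (auto simp: locally_integrable_def)

lemma locally_integrable_add:
  "locally_integrable U g \<Longrightarrow> locally_integrable U h \<Longrightarrow> locally_integrable U (\<lambda>z. g z + h z)"
  by (auto simp: locally_integrable_def)

lemma locally_integrable_times_test:
  assumes "locally_integrable U g" "continuous_on UNIV \<phi>" "compact C" "C \<subseteq> U" "\<And>z. z \<notin> C \<Longrightarrow> \<phi> z = 0"
  shows "set_integrable lborel U (\<lambda>z. g z * \<phi> z)"
proof -
  have gC: "integrable lborel (\<lambda>z. indicator C z *\<^sub>R g z)"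
    using assms by (auto simp: locally_integrable_def set_integrable_def)
  have "compact (\<phi> ` C)"
    using assms(2,3) compact_continuous_image continuous_on_subset by blast
  then obtain B where B: "\<And>z. z \<in> C \<Longrightarrow> \<bar>\<phi> z\<bar> \<le> B"
    by (meson bounded_real compact_imp_bounded imageI)
  have [measurable]: "\<phi> \<in> borel_measurable borel"
    using assms(2) by (rule borel_measurable_continuous_onI)
  have "integrable lborel (\<lambda>z. (indicator C z *\<^sub>R g z) * \<phi> z)"
  proof (rule Bochner_Integration.integrable_bound[of _ "\<lambda>z. B * (indicator C z *\<^sub>R g z)"])
    show "AE x in lborel. norm (indicator C x *\<^sub>R g x * \<phi> x) \<le> norm (B * indicator C x *\<^sub>R g x)"
    proof (rule AE_I2)
      fix x
      show "norm (indicator C x *\<^sub>R g x * \<phi> x) \<le> norm (B * indicator C x *\<^sub>R g x)"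
      proof (cases "x \<in> C")
        case True
        have "\<bar>\<phi> x\<bar> \<le> \<bar>B\<bar>" using B[OF True] by linarith
        then have "\<bar>g x\<bar> * \<bar>\<phi> x\<bar> \<le> \<bar>g x\<bar> * \<bar>B\<bar>" by (rule mult_left_mono) simp
        then show ?thesis using True by (simp add: abs_mult mult.commute)
      qed simp
    qed
  qed (use gC borel_measurable_integrable[OF gC] in auto)
  moreover have "(\<lambda>z. (indicator C z *\<^sub>R g z) * \<phi> z) = (\<lambda>z. indicator U z *\<^sub>R (g z * \<phi> z))"
    using assms(4,5) by (auto simp: indicator_def fun_eq_iff)
  ultimately show ?thesis by (simp add: set_integrable_def)
qed

lemma test_function_integrable:
  assumes "locally_integrable U g" "test_function U \<phi>"
  shows "set_integrable lborel U (\<lambda>z. g z * \<phi> z)"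
proof -
  obtain C where "smooth \<phi>" "compact C" "C \<subseteq> U" "\<And>z. z \<notin> C \<Longrightarrow> \<phi> z = 0"
    using assms(2) by (auto simp: test_function_def)
  then show ?thesis
    by (intro locally_integrable_times_test[OF assms(1), of _ C] smooth_continuous_on)
qed

lemma partial_deriv_support:
  fixes \<phi> :: "'a::euclidean_space \<Rightarrow> real"
  assumes "closed C" "\<And>z. z \<notin> C \<Longrightarrow> \<phi> z = 0" "z \<notin> C"
  shows "partial_deriv b \<phi> z = 0"
proof -
  have "open (- C)" using assms(1) by (simp add: open_Compl)
  moreover have "((\<lambda>_. 0) has_derivative (\<lambda>_. 0)) (at z)" by simp
  ultimately have "(\<phi> has_derivative (\<lambda>_. 0)) (at z)"
    using assms by (auto intro: has_derivative_transform_within_open[of "\<lambda>_. 0" _ z UNIV "- C"])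
  then show ?thesis by (simp add: partial_derivI)
qed

lemma test_function_partial_deriv:
  assumes "test_function U \<phi>" "b \<in> Basis"
  shows "test_function U (partial_deriv b \<phi>)"
  using assms unfolding test_function_def by (metis compact_imp_closed partial_deriv_support smooth_partial_deriv)

lemma test_function_iter_deriv:
  assumes "test_function U \<phi>" "set bs \<subseteq> Basis"
  shows "test_function U (iter_deriv bs \<phi>)"
  using assms(2)
  by (induction bs) (auto simp: iter_deriv_Cons assms(1) simp del: iter_deriv.simps(2)
      intro: test_function_partial_deriv)

lemma test_function_0: "test_function U \<phi> \<Longrightarrow> z \<notin> U \<Longrightarrow> \<phi> z = 0"
  by (auto simp: test_function_def)

lemma test_function_mono: "test_function U \<phi> \<Longrightarrow> U \<subseteq> V \<Longrightarrow> test_function V \<phi>"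
  by (auto simp: test_function_def)

section \<open>Calculus of weak derivatives\<close>

lemma weak_derivD:
  assumes "weak_deriv U \<alpha> u g" "test_function U \<phi>" "mset bs = \<alpha>"
  shows "(LINT z:U|lborel. u z * iter_deriv bs \<phi> z) = (-1) ^ size \<alpha> * (LINT z:U|lborel. g z * \<phi> z)"
  using assms by (simp add: weak_deriv_def)

lemma weak_deriv_unique:
  assumes U: "open U" and g: "weak_deriv U \<alpha> u g" and h: "weak_deriv U \<alpha> u h"
  shows "AE z in lborel. z \<in> U \<longrightarrow> g z = h z"
proof -
  have loc: "locally_integrable U g" "locally_integrable U h" using g h by (auto simp: weak_deriv_def)
  have "AE z in lborel. z \<in> U \<longrightarrow> g z + (-1) * h z = 0"
  proof (rule fundamental_lemma[OF U])
    show "locally_integrable U (\<lambda>z. g z + (-1) * h z)"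
      using loc by (intro locally_integrable_add locally_integrable_cmult)
    fix \<phi> assume \<phi>: "test_function U \<phi>"
    obtain bs where bs: "mset bs = \<alpha>" using ex_mset by blast
    have "(-1) ^ size \<alpha> * (LINT z:U|lborel. g z * \<phi> z) = (-1) ^ size \<alpha> * (LINT z:U|lborel. h z * \<phi> z)"
      using weak_derivD[OF g \<phi> bs] weak_derivD[OF h \<phi> bs] by simp
    then have "(LINT z:U|lborel. g z * \<phi> z) = (LINT z:U|lborel. h z * \<phi> z)" by simp
    then show "(LINT z:U|lborel. (g z + (-1) * h z) * \<phi> z) = 0"
      using test_function_integrable[OF loc(1) \<phi>] test_function_integrable[OF loc(2) \<phi>]
      by (simp add: left_diff_distrib set_integral_diff)
  qed
  then show ?thesis by (auto elim!: eventually_mono)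
qed

lemma set_integral_cong_on:
  assumes "\<And>z. z \<in> A \<Longrightarrow> f z = g z"
  shows "(LINT z:A|M. f z) = (LINT z:A|M. g z)"
  unfolding set_lebesgue_integral_def using assms
  by (intro Bochner_Integration.integral_cong) (auto simp: indicator_def)

lemma set_integrable_cong_on:
  assumes "\<And>z. z \<in> A \<Longrightarrow> f z = g z"
  shows "set_integrable M A f \<longleftrightarrow> set_integrable M A g"
  unfolding set_integrable_def using assms
  by (intro Bochner_Integration.integrable_cong) (auto simp: indicator_def)

lemma weak_deriv_cong:
  assumes "\<And>z. z \<in> U \<Longrightarrow> u z = u' z" "\<And>z. z \<in> U \<Longrightarrow> g z = g' z"
  shows "weak_deriv U \<alpha> u g \<longleftrightarrow> weak_deriv U \<alpha> u' g'"
proof -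
  have loc: "locally_integrable U h \<longleftrightarrow> locally_integrable U h'" if "\<And>z. z \<in> U \<Longrightarrow> h z = h' z" for h h'
  proof -
    have "set_integrable lborel C h \<longleftrightarrow> set_integrable lborel C h'" if "C \<subseteq> U" for C
      by (rule set_integrable_cong_on) (use that \<open>\<And>z. z \<in> U \<Longrightarrow> h z = h' z\<close> in blast)
    then show ?thesis by (auto simp: locally_integrable_def)
  qed
  have "(LINT z:U|lborel. u z * \<phi> z) = (LINT z:U|lborel. u' z * \<phi> z)"
    "(LINT z:U|lborel. g z * \<phi> z) = (LINT z:U|lborel. g' z * \<phi> z)" for \<phi>
    using assms by (auto intro!: set_integral_cong_on)
  then show ?thesis using loc[OF assms(1)] loc[OF assms(2)] by (simp add: weak_deriv_def)
qed

text \<open>The choice operator sees nothing but the predicate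
  \<open>weak_deriv U \<alpha> u\<close>, which depends on the values in \<open>U\<close> alone. The
  chosen derivatives are therefore equal everywhere and not just almost everywhere.\<close>

lemma wderiv_cong:
  assumes "\<And>z. z \<in> U \<Longrightarrow> u z = u' z"
  shows "wderiv U \<alpha> u = wderiv U \<alpha> u'"
proof -
  have "weak_deriv U \<alpha> u g = weak_deriv U \<alpha> u' g" for g
    by (rule weak_deriv_cong) (use assms in auto)
  then have "weak_deriv U \<alpha> u = weak_deriv U \<alpha> u'" by blast
  then show ?thesis by (simp only: wderiv_def)
qed

lemma weak_deriv_wderiv: "weak_deriv U \<alpha> u g \<Longrightarrow> weak_deriv U \<alpha> u (wderiv U \<alpha> u)"
  unfolding wderiv_def by (metis someI)

lemma wderiv_AE_eq:
  "open U \<Longrightarrow> weak_deriv U \<alpha> u g \<Longrightarrow> AE z in lborel. z \<in> U \<longrightarrow> wderiv U \<alpha> u z = g z"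
  by (rule weak_deriv_unique[OF _ weak_deriv_wderiv])

lemma weak_deriv_restrict:
  assumes "weak_deriv U \<alpha> u g" "V \<subseteq> U" "set_mset \<alpha> \<subseteq> Basis"
  shows "weak_deriv V \<alpha> u g"
  unfolding weak_deriv_def
proof (intro conjI allI impI)
  show "locally_integrable V u" "locally_integrable V g"
    using assms by (auto simp: weak_deriv_def intro: locally_integrable_subset)
  fix \<phi> bs assume \<phi>: "test_function V \<phi>" and bs: "mset bs = \<alpha>"
  have t: "test_function V (iter_deriv bs \<phi>)"
    using \<phi> assms(3) bs by (auto intro!: test_function_iter_deriv)
  have "(LINT z:U|lborel. u z * iter_deriv bs \<phi> z) = (-1) ^ size \<alpha> * (LINT z:U|lborel. g z * \<phi> z)"
    by (rule weak_derivD[OF assms(1) test_function_mono[OF \<phi> assms(2)] bs])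
  moreover have "(LINT z:X|lborel. u z * iter_deriv bs \<phi> z) = (LINT z|lborel. u z * iter_deriv bs \<phi> z)"
    "(LINT z:X|lborel. g z * \<phi> z) = (LINT z|lborel. g z * \<phi> z)" if "V \<subseteq> X" for X
    using that test_function_0[OF \<phi>] test_function_0[OF t]
    by (auto intro!: integral_times_supported)
  ultimately show "(LINT z:V|lborel. u z * iter_deriv bs \<phi> z) = (-1) ^ size \<alpha> * (LINT z:V|lborel. g z * \<phi> z)"
    using assms(2) by simp
qed

lemma weak_deriv_cmult:
  assumes "weak_deriv U \<alpha> u g"
  shows "weak_deriv U \<alpha> (\<lambda>z. c * u z) (\<lambda>z. c * g z)"
  using assms unfolding weak_deriv_def
  by (auto intro: locally_integrable_cmult simp: mult.assoc)

lemma weak_deriv_add: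
  assumes "weak_deriv U \<alpha> u g" "weak_deriv U \<alpha> u' g'" "set_mset \<alpha> \<subseteq> Basis"
  shows "weak_deriv U \<alpha> (\<lambda>z. u z + u' z) (\<lambda>z. g z + g' z)"
  unfolding weak_deriv_def
proof (intro conjI allI impI)
  show "locally_integrable U (\<lambda>z. u z + u' z)" "locally_integrable U (\<lambda>z. g z + g' z)"
    using assms by (auto simp: weak_deriv_def intro: locally_integrable_add)
  fix \<phi> bs assume \<phi>: "test_function U \<phi>" and bs: "mset bs = \<alpha>"
  have t: "test_function U (iter_deriv bs \<phi>)"
    using \<phi> assms(3) bs by (auto intro!: test_function_iter_deriv)
  have l: "locally_integrable U u" "locally_integrable U u'" "locally_integrable U g" "locally_integrable U g'"
    using assms by (auto simp: weak_deriv_def)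
  have "(LINT z:U|lborel. u z * iter_deriv bs \<phi> z) = (-1) ^ size \<alpha> * (LINT z:U|lborel. g z * \<phi> z)"
    "(LINT z:U|lborel. u' z * iter_deriv bs \<phi> z) = (-1) ^ size \<alpha> * (LINT z:U|lborel. g' z * \<phi> z)"
    by (rule weak_derivD[OF assms(1) \<phi> bs] weak_derivD[OF assms(2) \<phi> bs])+
  then show "(LINT z:U|lborel. (u z + u' z) * iter_deriv bs \<phi> z)
      = (-1) ^ size \<alpha> * (LINT z:U|lborel. (g z + g' z) * \<phi> z)"
    using l[THEN test_function_integrable, OF t] l[THEN test_function_integrable, OF \<phi>]
    by (simp add: distrib_right distrib_left set_integral_add)
qed

lemma weak_deriv_diff:
  assumes "weak_deriv U \<alpha> u g" "weak_deriv U \<alpha> u' g'" "set_mset \<alpha> \<subseteq> Basis"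
  shows "weak_deriv U \<alpha> (\<lambda>z. u z - u' z) (\<lambda>z. g z - g' z)"
  using weak_deriv_add[OF assms(1) weak_deriv_cmult[OF assms(2), of "-1"] assms(3)] by simp

lemma weak_deriv_single:
  "weak_deriv U {#b#} u g \<longleftrightarrow> locally_integrable U u \<and> locally_integrable U g \<and>
     (\<forall>\<phi>. test_function U \<phi> \<longrightarrow>
        (LINT z:U|lborel. u z * partial_deriv b \<phi> z) = - (LINT z:U|lborel. g z * \<phi> z))"
proof -
  have "mset bs = {#b#} \<longleftrightarrow> bs = [b]" for bs by (cases bs) auto
  then show ?thesis by (simp add: weak_deriv_def partial_deriv_def[abs_def])
qed

lemma weak_deriv_empty: "locally_integrable U u \<Longrightarrow> weak_deriv U {#} u u"
  by (simp add: weak_deriv_def)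

section \<open>Square-integrable functions\<close>

lemma set_borel_measurable_inner:
  assumes "set_borel_measurable lborel A u" "set_borel_measurable lborel A w"
  shows "set_borel_measurable lborel A (\<lambda>z. u z \<bullet> (w z :: 'b::euclidean_space))"
proof -
  have "(\<lambda>z. (indicator A z *\<^sub>R u z) \<bullet> (indicator A z *\<^sub>R w z)) \<in> borel_measurable lborel"
    using assms unfolding set_borel_measurable_def by (intro borel_measurable_inner)
  moreover have "(\<lambda>z. (indicator A z *\<^sub>R u z) \<bullet> (indicator A z *\<^sub>R w z)) = (\<lambda>z. indicator A z *\<^sub>R (u z \<bullet> w z))"
    by (simp add: indicator_def fun_eq_iff)
  ultimately show ?thesis by (simp only: set_borel_measurable_def)
qed

lemma L2_inner_integrable:
  assumes "L2_on A u" "L2_on A w"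
  shows "set_integrable lborel A (\<lambda>z. u z \<bullet> w z)"
  unfolding set_integrable_def
proof (rule Bochner_Integration.integrable_bound)
  show "integrable lborel (\<lambda>z. indicator A z *\<^sub>R ((norm (u z))\<^sup>2 + (norm (w z))\<^sup>2))"
    using assms unfolding L2_on_def set_integrable_def[symmetric] by (intro set_integral_add(1)) auto
  show "(\<lambda>x. indicator A x *\<^sub>R (u x \<bullet> w x)) \<in> borel_measurable lborel"
    using set_borel_measurable_inner assms by (auto simp: L2_on_def set_borel_measurable_def)
  have "\<bar>u z \<bullet> w z\<bar> \<le> (norm (u z))\<^sup>2 + (norm (w z))\<^sup>2" for z
  proof -
    have "\<bar>u z \<bullet> w z\<bar> \<le> norm (u z) * norm (w z)" by (rule Cauchy_Schwarz_ineq2)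
    moreover have "2 * (norm (u z) * norm (w z)) \<le> (norm (u z))\<^sup>2 + (norm (w z))\<^sup>2"
      using sum_squares_bound[of "norm (u z)" "norm (w z)"] by (simp only: mult.assoc)
    moreover have "0 \<le> norm (u z) * norm (w z)" by simp
    ultimately show ?thesis by linarith
  qed
  then show "AE x in lborel. norm (indicator A x *\<^sub>R (u x \<bullet> w x))
      \<le> norm (indicator A x *\<^sub>R ((norm (u x))\<^sup>2 + (norm (w x))\<^sup>2))"
    by (intro AE_I2) (auto simp: indicator_def abs_of_nonneg[OF add_nonneg_nonneg])
qed

lemma L2_mult_integrable:
  "L2_on A u \<Longrightarrow> L2_on A w \<Longrightarrow> set_integrable lborel A (\<lambda>z. u z * (w z :: real))"
  using L2_inner_integrable[of A u w] by (simp add: inner_real_def)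

lemma L2_onI_bound:
  assumes "set_borel_measurable lborel A w" "set_integrable lborel A g"
    and "\<And>z. z \<in> A \<Longrightarrow> (norm (w z))\<^sup>2 \<le> g z"
  shows "L2_on A w"
  unfolding L2_on_def
proof
  have "set_borel_measurable lborel A (\<lambda>z. w z \<bullet> w z)"
    using assms(1) by (intro set_borel_measurable_inner)
  then have m: "set_borel_measurable lborel A (\<lambda>z. (norm (w z))\<^sup>2)"
    by (simp add: power2_norm_eq_inner)
  show "set_integrable lborel A (\<lambda>z. (norm (w z))\<^sup>2)"
    unfolding set_integrable_def
  proof (rule Bochner_Integration.integrable_bound)
    show "integrable lborel (\<lambda>x. indicator A x *\<^sub>R g x)"
      using assms(2) by (simp add: set_integrable_def)
    show "(\<lambda>x. indicator A x *\<^sub>R (norm (w x))\<^sup>2) \<in> borel_measurable lborel"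
      using m by (simp add: set_borel_measurable_def)
    show "AE x in lborel. norm (indicator A x *\<^sub>R (norm (w x))\<^sup>2) \<le> norm (indicator A x *\<^sub>R g x)"
      using assms(3) by (intro AE_I2) (force simp: indicator_def)
  qed
qed (fact assms(1))

lemma L2_on_cmult:
  assumes "L2_on A u"
  shows "L2_on A (\<lambda>z. c *\<^sub>R u z)"
proof (rule L2_onI_bound)
  have "(\<lambda>x. c *\<^sub>R (indicator A x *\<^sub>R u x)) \<in> borel_measurable lborel"
    using assms unfolding L2_on_def set_borel_measurable_def
    by (intro borel_measurable_scaleR[OF borel_measurable_const]) blast
  then show "set_borel_measurable lborel A (\<lambda>z. c *\<^sub>R u z)"
    by (simp add: set_borel_measurable_def mult.commute)
  show "set_integrable lborel A (\<lambda>z. c\<^sup>2 * (norm (u z))\<^sup>2)"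
    using assms by (intro set_integrable_mult_right) (auto simp: L2_on_def)
qed (simp add: power_mult_distrib)

lemma L2_on_add:
  assumes "L2_on A u" "L2_on A w"
  shows "L2_on A (\<lambda>z. u z + w z)"
proof (rule L2_onI_bound)
  have "(\<lambda>x. indicator A x *\<^sub>R u x + indicator A x *\<^sub>R w x) \<in> borel_measurable lborel"
    using assms unfolding L2_on_def set_borel_measurable_def by (intro borel_measurable_add) auto
  then show "set_borel_measurable lborel A (\<lambda>z. u z + w z)"
    by (simp add: set_borel_measurable_def scaleR_add_right)
  show "set_integrable lborel A (\<lambda>z. 2 * (norm (u z))\<^sup>2 + 2 * (norm (w z))\<^sup>2)"
    using assms by (intro set_integral_add(1) set_integrable_mult_right) (auto simp: L2_on_def)
  fix z
  have "(norm (u z + w z))\<^sup>2 \<le> (norm (u z) + norm (w z))\<^sup>2"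
    by (intro power_mono norm_triangle_ineq) simp
  also have "\<dots> \<le> 2 * (norm (u z))\<^sup>2 + 2 * (norm (w z))\<^sup>2"
    using sum_squares_bound[of "norm (u z)" "norm (w z)"] by (simp add: power2_sum)
  finally show "(norm (u z + w z))\<^sup>2 \<le> 2 * (norm (u z))\<^sup>2 + 2 * (norm (w z))\<^sup>2" .
qed

lemma L2_on_diff: "L2_on A u \<Longrightarrow> L2_on A w \<Longrightarrow> L2_on A (\<lambda>z. u z - w z)"
  using L2_on_add[of A u "\<lambda>z. (-1) *\<^sub>R w z"] L2_on_cmult[of A w "-1"] by simp

lemma L2_on_zero: "L2_on A (\<lambda>z. 0)"
  by (simp add: L2_on_def set_borel_measurable_def set_integrable_def)

lemma L2_on_sum: "(\<And>i. i \<in> I \<Longrightarrow> L2_on A (f i)) \<Longrightarrow> L2_on A (\<lambda>z. \<Sum>i\<in>I. f i z)"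
  by (induction I rule: infinite_finite_induct) (auto intro: L2_on_zero L2_on_add)

lemma L2_on_cong: "(\<And>z. z \<in> A \<Longrightarrow> u z = w z) \<Longrightarrow> L2_on A u \<longleftrightarrow> L2_on A w"
proof -
  assume "\<And>z. z \<in> A \<Longrightarrow> u z = w z"
  then have "(\<lambda>z. indicator A z *\<^sub>R u z) = (\<lambda>z. indicator A z *\<^sub>R w z)"
    "(\<lambda>z. indicator A z *\<^sub>R (norm (u z))\<^sup>2) = (\<lambda>z. indicator A z *\<^sub>R (norm (w z))\<^sup>2)"
    by (auto simp: fun_eq_iff indicator_def)
  then show ?thesis by (simp add: L2_on_def set_borel_measurable_def set_integrable_def)
qed

lemma L2_on_subset:
  assumes "L2_on A u" "B \<subseteq> A" "B \<in> sets borel"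
  shows "L2_on B u"
proof -
  have "(\<lambda>x. indicator B x *\<^sub>R (indicator A x *\<^sub>R u x)) \<in> borel_measurable lborel"
    by (rule borel_measurable_scaleR[OF borel_measurable_indicator])
      (use assms in \<open>auto simp: L2_on_def set_borel_measurable_def\<close>)
  moreover have "(\<lambda>x. indicator B x *\<^sub>R (indicator A x *\<^sub>R u x)) = (\<lambda>x. indicator B x *\<^sub>R u x)"
    using assms(2) by (auto simp: indicator_def fun_eq_iff)
  ultimately show ?thesis
    using assms set_integrable_subset[of lborel A "\<lambda>z. (norm (u z))\<^sup>2" B] by (simp add: L2_on_def set_borel_measurable_def)
qed

lemma L2_on_AE_cong:
  assumes u: "L2_on A u" and w: "set_borel_measurable lborel A w"
    and eq: "AE z in lborel. z \<in> A \<longrightarrow> u z = w z"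
  shows "L2_on A w"
  unfolding L2_on_def
proof
  have "set_borel_measurable lborel A (\<lambda>z. w z \<bullet> w z)"
    using w by (intro set_borel_measurable_inner)
  then have m: "(\<lambda>z. indicator A z *\<^sub>R (norm (w z))\<^sup>2) \<in> borel_measurable lborel"
    by (simp add: power2_norm_eq_inner set_borel_measurable_def)
  have "integrable lborel (\<lambda>z. indicator A z *\<^sub>R (norm (u z))\<^sup>2)"
    using u by (simp add: L2_on_def set_integrable_def)
  then show "set_integrable lborel A (\<lambda>z. (norm (w z))\<^sup>2)"
    unfolding set_integrable_def
    using eq by (subst integrable_cong_AE[OF m borel_measurable_integrable, of "\<lambda>z. indicator A z *\<^sub>R (norm (u z))\<^sup>2"])
      (auto elim!: eventually_mono simp: indicator_def)
qed (fact w)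

lemma L2_inner_AE_cong:
  assumes "set_borel_measurable lborel A u" "set_borel_measurable lborel A w"
    "set_borel_measurable lborel A u'" "set_borel_measurable lborel A w'"
    "AE z in lborel. z \<in> A \<longrightarrow> u z = u' z" "AE z in lborel. z \<in> A \<longrightarrow> w z = w' z"
  shows "L2_inner A u w = L2_inner A u' w'"
  unfolding L2_inner_def set_lebesgue_integral_def
proof (rule integral_cong_AE)
  show "AE x in lborel. indicat_real A x *\<^sub>R (u x \<bullet> w x) = indicat_real A x *\<^sub>R (u' x \<bullet> w' x)"
    using assms(5,6) by eventually_elim (auto simp: indicator_def)
qed (use set_borel_measurable_inner assms in \<open>auto simp: set_borel_measurable_def\<close>)

lemma L2_norm_sq: "(L2_norm A u)\<^sup>2 = (LINT z:A|lborel. (norm (u z))\<^sup>2)"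
proof -
  have "0 \<le> L2_inner A u u"
    unfolding L2_inner_def set_lebesgue_integral_def by (intro integral_nonneg_AE) auto
  then show ?thesis by (simp add: L2_norm_def L2_inner_def power2_norm_eq_inner)
qed

lemma L2_norm_nonneg: "0 \<le> L2_norm A u"
proof -
  have "0 \<le> L2_inner A u u"
    unfolding L2_inner_def set_lebesgue_integral_def by (intro integral_nonneg_AE) auto
  then show ?thesis by (simp add: L2_norm_def)
qed

lemma L2_norm_AE_cong:
  assumes "set_borel_measurable lborel A u" "set_borel_measurable lborel A w"
    "AE z in lborel. z \<in> A \<longrightarrow> u z = w z"
  shows "L2_norm A u = L2_norm A w"
  using L2_inner_AE_cong[OF assms(1,1,2,2,3,3)] by (simp add: L2_norm_def)

lemma set_integrable_const_bounded:
  assumes "bounded A" "A \<in> sets borel"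
  shows "set_integrable lborel A (\<lambda>_. c::real)"
proof -
  have "emeasure lborel A < \<infinity>" using assms(1) emeasure_bounded_finite by blast
  then show ?thesis unfolding set_integrable_def using assms(2)
    by (simp add: mult.commute)
qed

lemma L2_on_integrable:
  fixes u :: "'a::euclidean_space \<Rightarrow> real"
  assumes "L2_on A u" "bounded A" "A \<in> sets borel"
  shows "set_integrable lborel A u"
  unfolding set_integrable_def
proof (rule Bochner_Integration.integrable_bound)
  show "integrable lborel (\<lambda>z. indicator A z *\<^sub>R (1 + (norm (u z))\<^sup>2))"
    using set_integral_add(1)[OF set_integrable_const_bounded[OF assms(2,3), of 1], of "\<lambda>z. (norm (u z))\<^sup>2"] assms(1)
    by (simp add: L2_on_def set_integrable_def)
  show "(\<lambda>x. indicator A x *\<^sub>R u x) \<in> borel_measurable lborel"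
    using assms by (simp add: L2_on_def set_borel_measurable_def)
  have "\<bar>x\<bar> \<le> 1 + x\<^sup>2" for x :: real
    using sum_squares_bound[of "\<bar>x\<bar>" 1] by simp
  then show "AE x in lborel. norm (indicator A x *\<^sub>R u x) \<le> norm (indicator A x *\<^sub>R (1 + (norm (u x))\<^sup>2))"
    by (intro AE_I2) (auto simp: indicator_def abs_of_nonneg[OF add_nonneg_nonneg])
qed

lemma L2_on_locally_integrable:
  fixes u :: "'a::euclidean_space \<Rightarrow> real"
  shows "L2_on U u \<Longrightarrow> locally_integrable U u"
  unfolding locally_integrable_def
  by (auto intro!: L2_on_integrable intro: L2_on_subset compact_imp_bounded borel_compact)

section \<open>Sobolev functions\<close>

lemma multi_indices_1: "multi_indices (Suc 0) = insert {#} ((\<lambda>b. {#b#}) ` Basis)"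
proof (rule set_eqI)
  fix \<alpha> :: "'a multiset"
  show "\<alpha> \<in> multi_indices (Suc 0) \<longleftrightarrow> \<alpha> \<in> insert {#} ((\<lambda>b. {#b#}) ` Basis)"
    by (cases \<alpha>) (auto simp: multi_indices_def)
qed

lemma sobolev_L2: "sobolev s U u \<Longrightarrow> L2_on U u"
  by (simp add: sobolev_def)

text \<open>The definition provides some square-integrable derivative. The one chosen by
  \<open>wderiv\<close> is locally integrable, hence measurable, and agrees with it almost
  everywhere, so it is square integrable as well.\<close>

lemma sobolev_wderiv:
  assumes "sobolev s U u" "\<alpha> \<in> multi_indices s" "open U"
  shows "weak_deriv U \<alpha> u (wderiv U \<alpha> u)" "L2_on U (wderiv U \<alpha> u)"
proof -
  obtain g where g: "weak_deriv U \<alpha> u g" "L2_on U g" using assms by (auto simp: sobolev_def)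
  show w: "weak_deriv U \<alpha> u (wderiv U \<alpha> u)" using g weak_deriv_wderiv by blast
  have "set_borel_measurable lborel U (wderiv U \<alpha> u)"
    using w assms(3) by (auto simp: weak_deriv_def intro: locally_integrable_measurable)
  moreover have "AE z in lborel. z \<in> U \<longrightarrow> g z = wderiv U \<alpha> u z"
    using weak_deriv_unique[OF assms(3) g(1) w] .
  ultimately show "L2_on U (wderiv U \<alpha> u)" using g(2) L2_on_AE_cong by blast
qed

lemma sobolev1_wderiv:
  assumes "sobolev 1 U u" "b \<in> Basis" "open U"
  shows "weak_deriv U {#b#} u (wderiv U {#b#} u)" "L2_on U (wderiv U {#b#} u)"
  using sobolev_wderiv[OF assms(1) _ assms(3), of "{#b#}"] assms(2) by (auto simp: multi_indices_1)

lemma sobolev1I: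
  assumes "L2_on U u" "\<And>b. b \<in> Basis \<Longrightarrow> weak_deriv U {#b#} u (d b)"
    "\<And>b. b \<in> Basis \<Longrightarrow> L2_on U (d b)"
  shows "sobolev 1 U u"
  using assms weak_deriv_empty[OF L2_on_locally_integrable[OF assms(1)]]
  unfolding sobolev_def multi_indices_1 One_nat_def by blast

lemma sobolev_restrict:
  assumes u: "sobolev s U u" and "open U" "open V" "V \<subseteq> U"
  shows "sobolev s V u"
    and "\<alpha> \<in> multi_indices s \<Longrightarrow> AE z in lborel. z \<in> V \<longrightarrow> wderiv V \<alpha> u z = wderiv U \<alpha> u z"
proof -
  have w: "weak_deriv V \<alpha> u (wderiv U \<alpha> u)" if "\<alpha> \<in> multi_indices s" for \<alpha>
    using weak_deriv_restrict[OF sobolev_wderiv(1)[OF u that \<open>open U\<close>] \<open>V \<subseteq> U\<close>] that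
    by (simp add: multi_indices_def)
  moreover have "L2_on V (wderiv U \<alpha> u)" if "\<alpha> \<in> multi_indices s" for \<alpha>
    using L2_on_subset[OF sobolev_wderiv(2)[OF u that \<open>open U\<close>] \<open>V \<subseteq> U\<close>] \<open>open V\<close> by simp
  moreover have "L2_on V u"
    using L2_on_subset[OF sobolev_L2[OF u] \<open>V \<subseteq> U\<close>] \<open>open V\<close> by simp
  ultimately show "sobolev s V u" unfolding sobolev_def by blast
  show "AE z in lborel. z \<in> V \<longrightarrow> wderiv V \<alpha> u z = wderiv U \<alpha> u z" if "\<alpha> \<in> multi_indices s"
    using wderiv_AE_eq[OF \<open>open V\<close> w[OF that]] .
qed

lemma sobolev_diff:
  assumes u: "sobolev s U u" and w: "sobolev s U w" and "open U"
  shows "sobolev s U (\<lambda>z. u z - w z)"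
    and "\<alpha> \<in> multi_indices s \<Longrightarrow>
      AE z in lborel. z \<in> U \<longrightarrow> wderiv U \<alpha> (\<lambda>z. u z - w z) z = wderiv U \<alpha> u z - wderiv U \<alpha> w z"
proof -
  have d: "weak_deriv U \<alpha> (\<lambda>z. u z - w z) (\<lambda>z. wderiv U \<alpha> u z - wderiv U \<alpha> w z)"
    if "\<alpha> \<in> multi_indices s" for \<alpha>
    using weak_deriv_diff[OF sobolev_wderiv(1)[OF u that \<open>open U\<close>] sobolev_wderiv(1)[OF w that \<open>open U\<close>]] that
    by (simp add: multi_indices_def)
  moreover have "L2_on U (\<lambda>z. wderiv U \<alpha> u z - wderiv U \<alpha> w z)" if "\<alpha> \<in> multi_indices s" for \<alpha>
    using sobolev_wderiv(2) that u w \<open>open U\<close> by (intro L2_on_diff)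
  ultimately show "sobolev s U (\<lambda>z. u z - w z)"
    using L2_on_diff[OF sobolev_L2[OF u] sobolev_L2[OF w]] unfolding sobolev_def by blast
  show "AE z in lborel. z \<in> U \<longrightarrow> wderiv U \<alpha> (\<lambda>z. u z - w z) z = wderiv U \<alpha> u z - wderiv U \<alpha> w z"
    if "\<alpha> \<in> multi_indices s"
    using wderiv_AE_eq[OF \<open>open U\<close> d[OF that]] .
qed

lemma sobolev_cong:
  assumes "\<And>z. z \<in> U \<Longrightarrow> u z = w z"
  shows "sobolev s U u \<longleftrightarrow> sobolev s U w"
proof -
  have "weak_deriv U \<alpha> u g \<longleftrightarrow> weak_deriv U \<alpha> w g" for \<alpha> g
    by (rule weak_deriv_cong) (use assms in auto)
  moreover have "L2_on U u \<longleftrightarrow> L2_on U w" by (rule L2_on_cong) (use assms in auto)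
  ultimately show ?thesis by (simp add: sobolev_def)
qed

lemma sobolev_zero: "sobolev s U (\<lambda>_. 0)" "open U \<Longrightarrow> AE z in lborel. z \<in> U \<longrightarrow> wderiv U \<alpha> (\<lambda>_. 0) z = 0"
proof -
  have w: "weak_deriv U \<alpha> (\<lambda>_. 0) (\<lambda>_. 0)" for \<alpha>
    by (simp add: weak_deriv_def locally_integrable_def set_integrable_def)
  then show "sobolev s U (\<lambda>_. 0)" using L2_on_zero unfolding sobolev_def by blast
  show "open U \<Longrightarrow> AE z in lborel. z \<in> U \<longrightarrow> wderiv U \<alpha> (\<lambda>_. 0) z = 0"
    using wderiv_AE_eq[OF _ w] .
qed

lemma finite_multi_indices: "finite (multi_indices 1 :: 'a::euclidean_space multiset set)"
  by (simp add: multi_indices_1)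

lemma sobolev_norm_sq:
  "(sobolev_norm s U u)\<^sup>2 = (\<Sum>\<alpha>\<in>multi_indices s. (L2_norm U (wderiv U \<alpha> u))\<^sup>2)"
  unfolding sobolev_norm_def by (intro real_sqrt_pow2 sum_nonneg) simp

lemma L2_norm_le_sobolev_norm:
  assumes "\<alpha> \<in> multi_indices 1"
  shows "L2_norm U (wderiv U \<alpha> u) \<le> sobolev_norm 1 U u"
  unfolding sobolev_norm_def
  by (intro real_le_rsqrt member_le_sum[OF assms]) (auto simp: finite_multi_indices[unfolded One_nat_def])

section \<open>Classical derivatives as weak derivatives\<close>

lemma integral_translation:
  fixes f :: "'a::euclidean_space \<Rightarrow> real"
  assumes "f \<in> borel_measurable borel"
  shows "(LINT z|lborel. f (z + c)) = (LINT z|lborel. f z)"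
proof -
  have "(LINT z|lborel. f z) = (LINT z|distr lborel borel ((+) c). f z)"
    by (simp add: lborel_distr_plus)
  also have "\<dots> = (LINT z|lborel. f (c + z))"
    using assms by (subst integral_distr) auto
  finally show ?thesis by (simp add: add.commute)
qed

lemma compact_support_integrable:
  fixes f :: "'a::euclidean_space \<Rightarrow> real"
  assumes "continuous_on UNIV f" "compact C" "\<And>z. z \<notin> C \<Longrightarrow> f z = 0"
  shows "integrable lborel f"
proof -
  have "integrable lborel (\<lambda>z. indicator C z *\<^sub>R f z)"
    using assms by (intro borel_integrable_compact) (auto intro: continuous_on_subset)
  moreover have "(\<lambda>z. indicator C z *\<^sub>R f z) = f"
    using assms(3) by (auto simp: indicator_def fun_eq_iff)
  ultimately show ?thesis by simp
qed

text \<open>Difference quotients have vanishing integral by translation invariance.\<close>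

lemma integral_partial_deriv_zero:
  fixes f :: "'a::euclidean_space \<Rightarrow> real"
  assumes f: "smooth f" and C: "compact C" "\<And>z. z \<notin> C \<Longrightarrow> f z = 0" and b: "b \<in> Basis"
  shows "(LINT z|lborel. partial_deriv b f z) = 0"
proof -
  have intf: "integrable lborel f"
    by (rule compact_support_integrable[OF smooth_continuous_on[OF f] C])
  have [measurable]: "f \<in> borel_measurable borel" "partial_deriv b f \<in> borel_measurable borel"
    using smooth_borel[OF f] smooth_borel[OF smooth_partial_deriv[OF f b]] by auto
  have DERIV: "((\<lambda>s. f (z + s *\<^sub>R b)) has_real_derivative partial_deriv b f (z + s *\<^sub>R b)) (at s)" for z s
  proof -
    have "((\<lambda>s. z + s *\<^sub>R b) has_derivative (\<lambda>h. h *\<^sub>R b)) (at s)"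
      by (auto intro!: derivative_eq_intros)
    from has_derivative_compose[OF this smooth_has_derivative[OF f]]
    have "((\<lambda>s. f (z + s *\<^sub>R b)) has_derivative (\<lambda>h. \<Sum>i\<in>Basis. (h *\<^sub>R b \<bullet> i) * partial_deriv i f (z + s *\<^sub>R b))) (at s)" .
    moreover have "(\<Sum>i\<in>Basis. (h *\<^sub>R b \<bullet> i) * partial_deriv i f (z + s *\<^sub>R b)) = partial_deriv b f (z + s *\<^sub>R b) * h" for h
      using b by (simp add: inner_Basis if_distrib if_distribR sum.delta mult.commute cong: if_cong)
    ultimately show ?thesis by (simp add: has_field_derivative_def)
  qed
  obtain R where R: "\<And>z. z \<in> C \<Longrightarrow> norm z \<le> R" using compact_imp_bounded[OF C(1)] bounded_iff by blast
  have "compact (partial_deriv b f ` C)"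
    using compact_continuous_image[OF smooth_continuous_on[OF smooth_partial_deriv[OF f b]] C(1)] .
  then obtain B where B: "\<And>z. z \<in> C \<Longrightarrow> \<bar>partial_deriv b f z\<bar> \<le> B"
    by (meson bounded_real compact_imp_bounded imageI)
  have B': "\<bar>partial_deriv b f z\<bar> \<le> \<bar>B\<bar>" for z
    using B[of z] partial_deriv_support[OF compact_imp_closed[OF C(1)] C(2), where z=z and b=b] by (cases "z \<in> C") auto
  define h where "h n = 1 / (real n + 1)" for n
  have h: "0 < h n" "h n \<le> 1" for n by (auto simp: h_def)
  define q where "q n z = (f (z + h n *\<^sub>R b) - f z) / h n" for n z
  have qm[measurable]: "q n \<in> borel_measurable borel" for n unfolding q_def[abs_def] by measurable
  \<comment> \<open>A uniform majorant: the mean value theorem turns the quotient into a value of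
    the derivative, and since \<open>h n\<close> is at most 1 both points lie outside
    \<open>C\<close> when \<open>z\<close> has norm above \<open>R + 1\<close>.\<close>
  have q_bound: "\<bar>q n z\<bar> \<le> indicator (cball 0 (R + 1)) z * \<bar>B\<bar>" for n z
  proof (cases "z \<in> cball 0 (R + 1)")
    case True
    obtain s where "f (z + h n *\<^sub>R b) - f (z + 0 *\<^sub>R b) = (h n - 0) * partial_deriv b f (z + s *\<^sub>R b)"
      using MVT2[OF h(1)[of n], of "\<lambda>s. f (z + s *\<^sub>R b)" "\<lambda>s. partial_deriv b f (z + s *\<^sub>R b)"] DERIV by blast
    then have "q n z = partial_deriv b f (z + s *\<^sub>R b)" using h(1)[of n] by (simp add: q_def)
    then show ?thesis using True B' by simp
  next
    case False
    then have n: "norm z > R + 1" by simp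
    moreover have "norm z \<le> norm (z + h n *\<^sub>R b) + norm (h n *\<^sub>R b)"
      using norm_triangle_ineq4[of "z + h n *\<^sub>R b" "h n *\<^sub>R b"] by simp
    moreover have "norm (h n *\<^sub>R b) \<le> 1" using h[of n] b by simp
    ultimately have "z \<notin> C" "z + h n *\<^sub>R b \<notin> C" using R[of z] R[of "z + h n *\<^sub>R b"] by force+
    then show ?thesis using C(2) by (simp add: q_def)
  qed
  have "(\<lambda>n. LINT z|lborel. q n z) \<longlonglongrightarrow> (LINT z|lborel. partial_deriv b f z)"
  proof (rule integral_dominated_convergence[where w="\<lambda>z. indicator (cball 0 (R + 1)) z * \<bar>B\<bar>"])
    show "integrable lborel (\<lambda>z::'a. indicator (cball 0 (R + 1)) z * \<bar>B\<bar>)"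
      using set_integrable_const_bounded[of "cball 0 (R + 1) :: 'a set" "\<bar>B\<bar>"] by (simp add: set_integrable_def)
    show "AE z in lborel. (\<lambda>n. q n z) \<longlonglongrightarrow> partial_deriv b f z"
    proof (rule AE_I2)
      fix z
      have "((\<lambda>y. (f (z + (0 + y) *\<^sub>R b) - f (z + 0 *\<^sub>R b)) / y) \<longlongrightarrow> partial_deriv b f (z + 0 *\<^sub>R b)) (at 0)"
        using DERIV[of z 0] unfolding DERIV_def .
      moreover have "filterlim h (at 0) sequentially"
        unfolding filterlim_at using h(1)
        by (auto simp: h_def[abs_def] add.commute less_imp_neq[THEN not_sym] intro!: LIMSEQ_inverse_real_of_nat[unfolded inverse_eq_divide, simplified add.commute of_nat_Suc])
      ultimately have "(\<lambda>n. (f (z + (0 + h n) *\<^sub>R b) - f (z + 0 *\<^sub>R b)) / h n) \<longlonglongrightarrow> partial_deriv b f (z + 0 *\<^sub>R b)"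
        by (rule filterlim_compose)
      then show "(\<lambda>n. q n z) \<longlonglongrightarrow> partial_deriv b f z" by (simp add: q_def)
    qed
  qed (use q_bound in auto)
  moreover have "(LINT z|lborel. q n z) = 0" for n
  proof -
    have "integrable lborel (\<lambda>z. f (z + h n *\<^sub>R b))"
      using intf lborel_distr_plus[of "h n *\<^sub>R b"] integrable_distr_eq[of "(+) (h n *\<^sub>R b)" lborel borel f]
      by (simp add: add.commute)
    then show ?thesis
      using intf integral_translation[of f "h n *\<^sub>R b"] by (simp add: q_def diff_divide_distrib)
  qed
  ultimately show ?thesis by (simp add: LIMSEQ_const_iff)
qed

text \<open>The product of \<open>f\<close> with a test function has compact support, so the
  integral of its derivative vanishes; the Leibniz rule splits it into the two sides.\<close>

lemma smooth_weak_deriv: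
  assumes f: "smooth f" and b: "b \<in> Basis"
  shows "weak_deriv U {#b#} f (partial_deriv b f)"
  unfolding weak_deriv_single
proof (intro conjI allI impI)
  have loc: "locally_integrable U g" if "smooth g" for g :: "'a \<Rightarrow> real"
    unfolding locally_integrable_def set_integrable_def
    using borel_integrable_compact smooth_continuous_on[OF that] by blast
  show l: "locally_integrable U f" "locally_integrable U (partial_deriv b f)"
    using loc f b smooth_partial_deriv by blast+
  fix \<phi> assume \<phi>: "test_function U \<phi>"
  then obtain C where C: "smooth \<phi>" "compact C" "C \<subseteq> U" "\<And>z. z \<notin> C \<Longrightarrow> \<phi> z = 0"
    by (auto simp: test_function_def)
  have \<phi>': "test_function U (partial_deriv b \<phi>)" using test_function_partial_deriv[OF \<phi> b] .
  have "0 = (LINT z|lborel. partial_deriv b (\<lambda>z. f z * \<phi> z) z)"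
    by (rule integral_partial_deriv_zero[OF smooth_mult[OF f C(1)] C(2) _ b, symmetric]) (simp add: C(4))
  also have "\<dots> = (LINT z|lborel. f z * partial_deriv b \<phi> z + partial_deriv b f z * \<phi> z)"
    by (simp add: partial_deriv_mult[OF f C(1)])
  also have "\<dots> = (LINT z:U|lborel. f z * partial_deriv b \<phi> z + partial_deriv b f z * \<phi> z)"
    unfolding set_lebesgue_integral_def
    using test_function_0[OF \<phi>] test_function_0[OF \<phi>']
    by (intro Bochner_Integration.integral_cong) (auto simp: indicator_def)
  also have "\<dots> = (LINT z:U|lborel. f z * partial_deriv b \<phi> z) + (LINT z:U|lborel. partial_deriv b f z * \<phi> z)"
    using test_function_integrable[OF l(1) \<phi>'] test_function_integrable[OF l(2) \<phi>] by (rule set_integral_add(2))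
  finally show "(LINT z:U|lborel. f z * partial_deriv b \<phi> z) = - (LINT z:U|lborel. partial_deriv b f z * \<phi> z)" by simp
qed

section \<open>Absolute continuity from a countable family of test functions\<close>

lemma smooth_translate:
  fixes f :: "'a::euclidean_space \<Rightarrow> real"
  shows "smooth f \<Longrightarrow> smooth (\<lambda>z. f (z - c))"
  using smooth_comp_affine[of f "\<lambda>x. x" "- c"] by (simp add: linear_id[unfolded id_def])

lemma compact_support_bounded:
  fixes f :: "'a::euclidean_space \<Rightarrow> real"
  assumes "continuous_on UNIV f" "compact C" "\<And>z. z \<notin> C \<Longrightarrow> f z = 0"
  obtains B where "\<And>z. \<bar>f z\<bar> \<le> B"
proof -
  have "compact (f ` C)" using assms(1,2) compact_continuous_image continuous_on_subset by blast
  then obtain B where B: "\<And>z. z \<in> C \<Longrightarrow> \<bar>f z\<bar> \<le> B"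
    by (meson bounded_real compact_imp_bounded imageI)
  have "\<bar>f z\<bar> \<le> \<bar>B\<bar>" for z using B[of z] assms(3)[of z] by (cases "z \<in> C") auto
  then show ?thesis by (rule that)
qed

text \<open>The kernels sit just to the right of \<open>c\<close> and \<open>m k\<close> is their
  mass. Continuity at \<open>c\<close> controls the average once the support has shrunk into a
  neighbourhood of \<open>c\<close> inside the interval.\<close>

lemma bump_average_tendsto:
  fixes v :: "real \<Rightarrow> real"
  assumes v: "continuous_on {a<..<b} v" and c: "c \<in> {a<..<b}"
    and \<epsilon>: "\<epsilon> \<longlonglongrightarrow> 0" "\<And>k. 0 < \<epsilon> k"
    and \<rho>: "\<And>k. continuous_on UNIV (\<rho> k)" "\<And>k r. 0 \<le> \<rho> k r" "\<And>k r. r \<notin> {c..c + \<epsilon> k} \<Longrightarrow> \<rho> k r = 0"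
    and m: "\<And>k. m k = (LINT r|lborel. \<rho> k r)" "\<And>k. 0 < m k"
  shows "(\<lambda>k. (LINT r:{a<..<b}|lborel. v r * \<rho> k r) / m k) \<longlonglongrightarrow> v c"
proof (rule LIMSEQ_I)
  fix e :: real assume e: "e > 0"
  have "isCont v c" using v c by (simp add: continuous_on_eq_continuous_at)
  then obtain d where d: "d > 0" "\<And>r. \<bar>r - c\<bar> < d \<Longrightarrow> \<bar>v r - v c\<bar> < e / 2"
    using e unfolding continuous_at_eps_delta dist_real_def by (metis half_gt_zero)
  have "\<forall>\<^sub>F k in sequentially. \<epsilon> k < min d (b - c)"
    using \<epsilon>(1) c d(1) by (intro order_tendstoD) auto
  then obtain N where N: "\<And>k. k \<ge> N \<Longrightarrow> \<epsilon> k < min d (b - c)" by (auto simp: eventually_sequentially)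
  show "\<exists>N. \<forall>k\<ge>N. norm ((LINT r:{a<..<b}|lborel. v r * \<rho> k r) / m k - v c) < e"
  proof (intro exI[of _ N] allI impI)
    fix k assume k: "k \<ge> N"
    let ?I = "{c..c + \<epsilon> k}"
    have I: "?I \<subseteq> {a<..<b}" "\<And>r. r \<in> ?I \<Longrightarrow> \<bar>r - c\<bar> < d" using N[OF k] c \<epsilon>(2)[of k] by auto
    have int\<rho>: "integrable lborel (\<rho> k)"
      by (rule compact_support_integrable[OF \<rho>(1), of ?I]) (use \<rho>(3) in auto)
    have contI: "continuous_on ?I (\<lambda>r. v r * \<rho> k r)"
      using v \<rho>(1) I(1) by (intro continuous_intros) (auto intro: continuous_on_subset)
    have "integrable lborel (\<lambda>r. indicator ?I r *\<^sub>R (v r * \<rho> k r))"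
      using borel_integrable_compact[OF _ contI] by simp
    moreover have eqI: "(\<lambda>r. indicator ?I r *\<^sub>R (v r * \<rho> k r)) = (\<lambda>r. indicator {a<..<b} r *\<^sub>R (v r * \<rho> k r))"
      using I(1) \<rho>(3) by (auto simp: indicator_def fun_eq_iff)
    ultimately have intv: "integrable lborel (\<lambda>r. indicator {a<..<b} r *\<^sub>R (v r * \<rho> k r))" by simp
    have D: "(LINT r:{a<..<b}|lborel. v r * \<rho> k r) - v c * m k
        = (LINT r|lborel. indicator {a<..<b} r *\<^sub>R (v r * \<rho> k r) - v c * \<rho> k r)"
      using intv int\<rho> by (simp add: set_lebesgue_integral_def m(1))
    have "norm (LINT r|lborel. indicator {a<..<b} r *\<^sub>R (v r * \<rho> k r) - v c * \<rho> k r) \<le> (LINT r|lborel. e / 2 * \<rho> k r)"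
    proof (rule Bochner_Integration.integral_norm_bound_integral)
      fix r :: real
      show "norm (indicator {a<..<b} r *\<^sub>R (v r * \<rho> k r) - v c * \<rho> k r) \<le> e / 2 * \<rho> k r"
      proof (cases "r \<in> ?I")
        case True
        then have "indicator {a<..<b} r *\<^sub>R (v r * \<rho> k r) - v c * \<rho> k r = (v r - v c) * \<rho> k r"
          using I(1) by (auto simp: algebra_simps)
        moreover have "\<bar>v r - v c\<bar> * \<rho> k r \<le> e / 2 * \<rho> k r"
          using d(2)[OF I(2)[OF True]] \<rho>(2) by (intro mult_right_mono) auto
        ultimately show ?thesis using \<rho>(2)[of k r] by (simp add: abs_mult)
      qed (use \<rho>(3) in simp)
    qed (use intv int\<rho> in auto)
    also have "\<dots> = e / 2 * m k" by (simp add: m(1))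
    finally have "\<bar>(LINT r:{a<..<b}|lborel. v r * \<rho> k r) - v c * m k\<bar> \<le> e / 2 * m k" by (simp add: D)
    then have "\<bar>(LINT r:{a<..<b}|lborel. v r * \<rho> k r) / m k - v c\<bar> \<le> e / 2"
      using m(2)[of k] by (simp add: field_simps abs_le_iff)
    then show "norm ((LINT r:{a<..<b}|lborel. v r * \<rho> k r) / m k - v c) < e" using e by simp
  qed
qed

text \<open>
  Primitives of the difference of two translated bumps: smooth functions that approximate a
  multiple of the indicator of \<open>{s<..<t}\<close> and whose derivatives concentrate at \<open>s\<close> and \<open>t\<close>.
\<close>

lemma smooth_plateaus:
  fixes s t :: real
  assumes "s < t"
  obtains \<epsilon> :: "nat \<Rightarrow> real" and m \<rho> \<psi> where
    "\<epsilon> \<longlonglongrightarrow> 0" "\<And>k. 0 < \<epsilon> k" "\<And>k. smooth (\<psi> k)" "\<And>k. smooth (\<rho> k)"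
    "\<And>k r. 0 \<le> \<rho> k r" "\<And>k r. r \<notin> {s..s + \<epsilon> k} \<Longrightarrow> \<rho> k r = 0"
    "\<And>k. m k = (LINT r|lborel. \<rho> k r)" "\<And>k. 0 < (m k :: real)"
    "\<And>k. partial_deriv 1 (\<psi> k) = (\<lambda>r. \<rho> k r - \<rho> k (r - (t - s)))"
    "\<And>k r. r \<notin> {s..t + \<epsilon> k} \<Longrightarrow> \<psi> k r = 0" "\<And>k r. 0 \<le> \<psi> k r" "\<And>k r. \<psi> k r \<le> m k"
    "\<And>k r. s + \<epsilon> k \<le> r \<Longrightarrow> r \<le> t \<Longrightarrow> \<psi> k r = m k"
proof -
  define \<epsilon> where "\<epsilon> k = 1 / (real k + 1)" for k
  \<comment> \<open>The cutoff in \<open>bump n\<close> becomes positive at distance 1 / n from the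
    ends of the interval. With n = 4 (k + 1) this is a quarter of \<open>\<epsilon> k\<close>, so
    the midpoint has a positive value, which later makes the mass \<open>m k\<close>
    positive.\<close>
  define \<rho> where "\<rho> k = bump (4 * (k + 1)) s (s + \<epsilon> k)" for k
  have \<epsilon>0: "0 < \<epsilon> k" for k by (simp add: \<epsilon>_def)
  have \<rho>s: "smooth (\<rho> k)" and \<rho>0: "0 \<le> \<rho> k r" for k r by (auto simp: \<rho>_def smooth_bump bump_bounds)
  have \<rho>z: "\<rho> k r = 0" if "r \<notin> {s..s + \<epsilon> k}" for k r
    using bump_eq_0[of r s "s + \<epsilon> k" "4 * (k + 1)"] that by (auto simp: \<rho>_def box_real)
  have \<rho>pos: "0 < \<rho> k (s + \<epsilon> k / 2)" for k
  proof -
    have "real (4 * (k + 1)) * (\<epsilon> k / 2) = 2" by (simp add: \<epsilon>_def field_simps)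
    then show ?thesis by (simp add: \<rho>_def bump_def flat0 algebra_simps)
  qed
  have "\<exists>F. \<forall>r. (F has_real_derivative \<rho> k r) (at r)" for k
  proof -
    have "isCont (\<rho> k) r" for r
      using smooth_continuous_on[OF \<rho>s, of UNIV k] by (simp add: continuous_on_eq_continuous_at)
    then show ?thesis
      using einterval_antiderivative[of "-\<infinity>" "\<infinity>" "\<rho> k"] by (auto simp: has_real_derivative_iff_has_vector_derivative)
  qed
  then obtain F where F: "\<And>k r. (F k has_real_derivative \<rho> k r) (at r)" by metis
  define m where "m k = F k (s + \<epsilon> k) - F k s" for k
  define \<psi> where "\<psi> k r = F k r - F k (r - (t - s))" for k r
  have Fmono: "F k x \<le> F k y" if "x \<le> y" for k x y
    using DERIV_nonneg_imp_nondecreasing[OF that, of "F k"] F \<rho>0 by blast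
  have Flow: "F k r = F k s" if "r \<le> s" for k r
  proof (cases "r = s")
    case False
    have "\<exists>l z. r < z \<and> z < s \<and> DERIV (F k) z :> l \<and> F k s - F k r = (s - r) * l"
      using that False F by (intro MVT) (auto intro!: DERIV_isCont continuous_at_imp_continuous_on simp: real_differentiable_def)
    then obtain l z where z: "r < z" "z < s" "DERIV (F k) z :> l" "F k s - F k r = (s - r) * l" by auto
    then have "l = 0" using DERIV_unique[OF z(3) F] \<rho>z[of z k] by auto
    then show ?thesis using z(4) by simp
  qed simp
  have Fhigh: "F k r = F k (s + \<epsilon> k)" if "s + \<epsilon> k \<le> r" for k r
  proof (cases "r = s + \<epsilon> k")
    case False
    have "\<exists>l z. s + \<epsilon> k < z \<and> z < r \<and> DERIV (F k) z :> l \<and> F k r - F k (s + \<epsilon> k) = (r - (s + \<epsilon> k)) * l"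
      using that False F by (intro MVT) (auto intro!: DERIV_isCont continuous_at_imp_continuous_on simp: real_differentiable_def)
    then obtain l z where z: "s + \<epsilon> k < z" "z < r" "DERIV (F k) z :> l" "F k r - F k (s + \<epsilon> k) = (r - (s + \<epsilon> k)) * l" by auto
    then have "l = 0" using DERIV_unique[OF z(3) F] \<rho>z[of z k] by auto
    then show ?thesis using z(4) by simp
  qed simp
  have m_int: "m k = (LINT r|lborel. \<rho> k r)" for k
  proof -
    have "(LINT r|lborel. \<rho> k r * indicator {s..s + \<epsilon> k} r) = F k (s + \<epsilon> k) - F k s"
      using \<epsilon>0[of k] F smooth_continuous_on[OF \<rho>s, of UNIV k]
      by (intro integral_FTC_Icc_real) (auto simp: continuous_on_eq_continuous_at)
    moreover have "(\<lambda>r. \<rho> k r * indicator {s..s + \<epsilon> k} r) = \<rho> k"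
      using \<rho>z by (auto simp: indicator_def fun_eq_iff)
    ultimately show ?thesis by (simp add: m_def)
  qed
  have m_pos: "0 < m k" for k
  proof -
    \<comment> \<open>If no mass lay beyond the midpoint, the monotone \<open>F k\<close> would have
      a local maximum there, and its derivative would vanish against
      \<open>\<rho>pos\<close>.\<close>
    have "F k (s + \<epsilon> k / 2) < F k (s + \<epsilon> k)"
    proof (rule ccontr)
      assume "\<not> ?thesis"
      then have c: "F k (s + \<epsilon> k / 2) = F k (s + \<epsilon> k)" using Fmono[of "s + \<epsilon> k / 2" "s + \<epsilon> k" k] \<epsilon>0[of k] by auto
      have "\<forall>y. \<bar>s + \<epsilon> k / 2 - y\<bar> < \<epsilon> k / 2 \<longrightarrow> F k y \<le> F k (s + \<epsilon> k / 2)"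
        unfolding c by (auto intro!: Fmono simp: abs_if split: if_splits)
      then have "\<rho> k (s + \<epsilon> k / 2) = 0"
        using DERIV_local_max[OF F] \<epsilon>0[of k] by (metis half_gt_zero)
      then show False using \<rho>pos[of k] by simp
    qed
    then show ?thesis using Fmono[of s "s + \<epsilon> k / 2" k] \<epsilon>0[of k] by (simp add: m_def)
  qed
  have \<psi>d: "(\<psi> k has_real_derivative \<rho> k r - \<rho> k (r - (t - s))) (at r)" for k r
  proof -
    have "((\<lambda>r. F k (r - (t - s))) has_real_derivative \<rho> k (r - (t - s)) * (1 - 0)) (at r)"
      by (rule DERIV_chain2[OF F]) (auto intro!: derivative_eq_intros)
    then show ?thesis unfolding \<psi>_def[abs_def] using DERIV_diff[OF F] by fastforce
  qed
  have "smooth (\<lambda>r. \<rho> k r - \<rho> k (r - (t - s)))" for k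
    by (intro smooth_diff smooth_translate \<rho>s)
  note \<psi>s = smooth_antiderivative[OF \<psi>d this]
  have e0: "\<epsilon> \<longlonglongrightarrow> 0"
    unfolding \<epsilon>_def[abs_def] using LIMSEQ_inverse_real_of_nat by (simp add: inverse_eq_divide add.commute)
  have p0: "\<psi> k r = 0" if "r \<notin> {s..t + \<epsilon> k}" for k r
    using that Flow[of r k] Flow[of "r - (t - s)" k] Fhigh[of k r] Fhigh[of k "r - (t - s)"] \<open>s < t\<close>
    by (cases "r < s") (auto simp: \<psi>_def)
  have pn: "0 \<le> \<psi> k r" for k r using Fmono[of "r - (t - s)" r k] \<open>s < t\<close> by (simp add: \<psi>_def)
  have pm: "\<psi> k r \<le> m k" for k r
  proof -
    have "F k r \<le> F k (s + \<epsilon> k)" using Fmono[of r "s + \<epsilon> k" k] Fhigh[of k r] by (cases "r \<le> s + \<epsilon> k") auto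
    moreover have "F k s \<le> F k (r - (t - s))"
      using Fmono[of s "r - (t - s)" k] Flow[of "r - (t - s)" k] by (cases "r - (t - s) \<le> s") auto
    ultimately show ?thesis by (simp add: \<psi>_def m_def)
  qed
  have p1: "\<psi> k r = m k" if "s + \<epsilon> k \<le> r" "r \<le> t" for k r
    using that Fhigh[of k r] Flow[of "r - (t - s)" k] by (simp add: \<psi>_def m_def)
  show ?thesis by (rule that[of \<epsilon> \<psi> \<rho> m]) (fact \<epsilon>0 \<psi>s \<rho>s \<rho>0 \<rho>z m_int m_pos e0 p0 pn pm p1)+
qed

lemma set_integrable_times_bounded:
  fixes v \<rho> :: "'a::euclidean_space \<Rightarrow> real"
  assumes v: "set_integrable lborel A v" and [measurable]: "\<rho> \<in> borel_measurable borel"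
    and B: "\<And>r. r \<in> A \<Longrightarrow> \<bar>\<rho> r\<bar> \<le> B"
  shows "set_integrable lborel A (\<lambda>r. v r * \<rho> r)"
proof -
  have iv: "integrable lborel (\<lambda>r. indicator A r *\<^sub>R v r)" using v by (simp add: set_integrable_def)
  note [measurable] = borel_measurable_integrable[OF iv]
  have "integrable lborel (\<lambda>r. (indicator A r *\<^sub>R v r) * \<rho> r)"
  proof (rule Bochner_Integration.integrable_bound)
    show "integrable lborel (\<lambda>r. B * (indicator A r *\<^sub>R v r))" using iv by (rule integrable_mult_right)
    show "AE r in lborel. norm (indicator A r *\<^sub>R v r * \<rho> r) \<le> norm (B * indicator A r *\<^sub>R v r)"
    proof (rule AE_I2)
      fix r
      have "r \<in> A \<Longrightarrow> \<bar>v r\<bar> * \<bar>\<rho> r\<bar> \<le> \<bar>v r\<bar> * \<bar>B\<bar>"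
        using B[of r] by (intro mult_left_mono) auto
      then show "norm (indicator A r *\<^sub>R v r * \<rho> r) \<le> norm (B * indicator A r *\<^sub>R v r)"
        by (cases "r \<in> A") (auto simp: abs_mult mult.commute)
    qed
  qed measurable
  then show ?thesis by (simp add: set_integrable_def mult.assoc)
qed

lemma plateau_integral_tendsto:
  fixes g :: "real \<Rightarrow> real"
  assumes g: "set_integrable lborel {a<..<b} g" and st: "a < s" "s < t" "t < b"
    and e: "\<epsilon> \<longlonglongrightarrow> 0" and m: "\<And>k. 0 < m k"
    and \<psi>s: "\<And>k. \<psi> k \<in> borel_measurable borel"
    and \<psi>: "\<And>k r. r \<notin> {s..t + \<epsilon> k} \<Longrightarrow> \<psi> k r = 0" "\<And>k r. 0 \<le> \<psi> k r" "\<And>k r. \<psi> k r \<le> m k"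
      "\<And>k r. s + \<epsilon> k \<le> r \<Longrightarrow> r \<le> t \<Longrightarrow> \<psi> k r = m k"
  shows "(\<lambda>k. LINT r:{a<..<b}|lborel. g r * (\<psi> k r / m k)) \<longlonglongrightarrow> (LINT r:{s<..<t}|lborel. g r)"
proof -
  have ig': "integrable lborel (\<lambda>r. indicator {a<..<b} r *\<^sub>R g r)" using g by (simp add: set_integrable_def)
  note [measurable] = borel_measurable_integrable[OF ig'] \<psi>s
  have G: "(\<lambda>r. indicator {a<..<b} r *\<^sub>R (g r * (\<psi> k r / m k))) = (\<lambda>r. (indicator {a<..<b} r *\<^sub>R g r) * (\<psi> k r / m k))" for k
    by (simp add: fun_eq_iff)
  have G': "(\<lambda>r. indicator {s<..<t} r *\<^sub>R g r) = (\<lambda>r. (indicator {a<..<b} r *\<^sub>R g r) * indicator {s<..<t} r)"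
    using st by (auto simp: fun_eq_iff indicator_def)
  have le1: "0 \<le> \<psi> k r / m k" "\<psi> k r / m k \<le> 1" for k r
    using \<psi>(2,3)[of k r] m[of k] by auto
  show ?thesis unfolding set_lebesgue_integral_def G G'
  proof (rule integral_dominated_convergence[where w="\<lambda>r. \<bar>indicator {a<..<b} r *\<^sub>R g r\<bar>"])
    show "AE r in lborel. norm ((indicator {a<..<b} r *\<^sub>R g r) * (\<psi> k r / m k)) \<le> \<bar>indicator {a<..<b} r *\<^sub>R g r\<bar>" for k
    proof (rule AE_I2)
      fix r
      show "norm ((indicator {a<..<b} r *\<^sub>R g r) * (\<psi> k r / m k)) \<le> \<bar>indicator {a<..<b} r *\<^sub>R g r\<bar>"
        using mult_left_mono[OF le1(2)[of k r], of "\<bar>indicator {a<..<b} r *\<^sub>R g r\<bar>"] le1(1)[of k r]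
        by (simp only: real_norm_def abs_mult abs_of_nonneg) simp
    qed
    have "AE r in lborel. r \<noteq> s \<and> r \<noteq> t"
      using AE_lborel_singleton[of s] AE_lborel_singleton[of t] by auto
    then show "AE r in lborel. (\<lambda>k. (indicator {a<..<b} r *\<^sub>R g r) * (\<psi> k r / m k)) \<longlonglongrightarrow> (indicator {a<..<b} r *\<^sub>R g r) * indicator {s<..<t} r"
    proof eventually_elim
      case (elim r)
      have "\<forall>\<^sub>F k in sequentially. \<psi> k r / m k = indicator {s<..<t} r"
      proof (cases "r < s")
        case True
        then show ?thesis using \<psi>(1)[of r] by (intro always_eventually) auto
      next
        case False
        have "\<forall>\<^sub>F k in sequentially. \<epsilon> k < \<bar>r - s\<bar>" "\<forall>\<^sub>F k in sequentially. \<epsilon> k < \<bar>r - t\<bar>"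
          using elim by (auto intro!: order_tendstoD[OF e])
        then show ?thesis
        proof eventually_elim
          case e: (elim k)
          show ?case
          proof (cases "r < t")
            case True
            then have "\<psi> k r = m k" using False e by (intro \<psi>(4)) auto
            then show ?thesis using True False m[of k] elim by auto
          next
            case False
            then have "\<psi> k r = 0" using e by (intro \<psi>(1)) auto
            then show ?thesis using False by auto
          qed
        qed
      qed
      then show ?case by (intro tendsto_mult tendsto_const tendsto_eventually)
    qed
  qed (use ig' in \<open>auto simp: indicator_def\<close>)
qed

text \<open>For a function on a slab, the weak identity on the slice at \<open>x\<close> holds off a
  null set of \<open>x\<close> that depends on the test function. The plateaus with rational ends
  form a countable family, so one null set serves all of them, and they already determine the
  increments of \<open>v\<close> between rational times.\<close>

lemma rational_test_functions:
  fixes a b :: real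
  obtains T where "countable T" "\<And>\<phi>. \<phi> \<in> T \<Longrightarrow> test_function {a<..<b} \<phi>"
    "\<And>v g s t. \<lbrakk>continuous_on {a<..<b} v; set_integrable lborel {a<..<b} v; set_integrable lborel {a<..<b} g;
       \<And>\<phi>. \<phi> \<in> T \<Longrightarrow> (LINT r:{a<..<b}|lborel. v r * partial_deriv 1 \<phi> r) = - (LINT r:{a<..<b}|lborel. g r * \<phi> r);
       s \<in> \<rat>; t \<in> \<rat>; a < s; s < t; t < b\<rbrakk> \<Longrightarrow> v t - v s = (LINT r:{s<..<t}|lborel. g r)"
proof -
  define P where "P s t \<epsilon> m \<rho> \<psi> \<longleftrightarrow> \<epsilon> \<longlonglongrightarrow> 0 \<and> (\<forall>k. 0 < \<epsilon> k) \<and> (\<forall>k. smooth (\<psi> k)) \<and> (\<forall>k. smooth (\<rho> k)) \<and>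
    (\<forall>k r. 0 \<le> \<rho> k r) \<and> (\<forall>k r. r \<notin> {s..s + \<epsilon> k} \<longrightarrow> \<rho> k r = 0) \<and>
    (\<forall>k. m k = (LINT r|lborel. \<rho> k r)) \<and> (\<forall>k. 0 < (m k :: real)) \<and>
    (\<forall>k. partial_deriv 1 (\<psi> k) = (\<lambda>r. \<rho> k r - \<rho> k (r - (t - s)))) \<and>
    (\<forall>k r. r \<notin> {s..t + \<epsilon> k} \<longrightarrow> \<psi> k r = 0) \<and> (\<forall>k r. 0 \<le> \<psi> k r) \<and> (\<forall>k r. \<psi> k r \<le> m k) \<and>
    (\<forall>k r. s + \<epsilon> k \<le> r \<longrightarrow> r \<le> t \<longrightarrow> \<psi> k r = m k)"
    for s t :: real and \<epsilon> m :: "nat \<Rightarrow> real" and \<rho> \<psi> :: "nat \<Rightarrow> real \<Rightarrow> real"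
  have "\<exists>\<epsilon> m \<rho> \<psi>. P s t \<epsilon> m \<rho> \<psi>" if "s < t" for s t
    by (rule smooth_plateaus[OF that]) (unfold P_def, blast)
  then obtain \<epsilon> m \<rho> \<psi> where P: "\<And>s t. s < t \<Longrightarrow> P s t (\<epsilon> s t) (m s t) (\<rho> s t) (\<psi> s t)" by metis
  \<comment> \<open>The condition on \<open>t + \<epsilon> s t k\<close> keeps the support inside
    the interval; for fixed \<open>s\<close> and \<open>t\<close> all sufficiently large
    \<open>k\<close> satisfy it.\<close>
  define T where "T = {\<psi> s t k | s t k. s \<in> \<rat> \<and> t \<in> \<rat> \<and> a < s \<and> s < t \<and> t + \<epsilon> s t k < b}"
  have "countable ((\<lambda>(s, t, k). \<psi> s t k) ` (\<rat> \<times> \<rat> \<times> UNIV))"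
    using countable_rat by (intro countable_image countable_SIGMA) auto
  then have "countable T" by (rule countable_subset[rotated]) (force simp: T_def)
  moreover have "test_function {a<..<b} \<phi>" if "\<phi> \<in> T" for \<phi>
  proof -
    obtain s t k where k: "\<phi> = \<psi> s t k" "a < s" "s < t" "t + \<epsilon> s t k < b" using \<open>\<phi> \<in> T\<close> by (auto simp: T_def)
    have "smooth \<phi>" "\<And>r. r \<notin> {s..t + \<epsilon> s t k} \<Longrightarrow> \<phi> r = 0" using P[OF k(3)] by (auto simp: P_def k(1))
    then show ?thesis using k by (auto simp: test_function_def intro!: exI[of _ "{s..t + \<epsilon> s t k}"])
  qed
  moreover have "v t - v s = (LINT r:{s<..<t}|lborel. g r)"
    if v: "continuous_on {a<..<b} v" and iv: "set_integrable lborel {a<..<b} v" and ig: "set_integrable lborel {a<..<b} g"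
      and T: "\<And>\<phi>. \<phi> \<in> T \<Longrightarrow> (LINT r:{a<..<b}|lborel. v r * partial_deriv 1 \<phi> r) = - (LINT r:{a<..<b}|lborel. g r * \<phi> r)"
      and st: "s \<in> \<rat>" "t \<in> \<rat>" "a < s" "s < t" "t < b" for v g s t
  proof -
    note Q = P[OF \<open>s < t\<close>, unfolded P_def]
    have e: "\<epsilon> s t \<longlonglongrightarrow> 0" "\<And>k. 0 < \<epsilon> s t k" and sm: "\<And>k. smooth (\<psi> s t k)" "\<And>k. smooth (\<rho> s t k)"
      and \<rho>0: "\<And>k r. 0 \<le> \<rho> s t k r" "\<And>k r. r \<notin> {s..s + \<epsilon> s t k} \<Longrightarrow> \<rho> s t k r = 0"
      and m: "\<And>k. m s t k = (LINT r|lborel. \<rho> s t k r)" "\<And>k. 0 < m s t k"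
      and pd: "\<And>k. partial_deriv 1 (\<psi> s t k) = (\<lambda>r. \<rho> s t k r - \<rho> s t k (r - (t - s)))"
      and \<psi>0: "\<And>k r. r \<notin> {s..t + \<epsilon> s t k} \<Longrightarrow> \<psi> s t k r = 0" "\<And>k r. 0 \<le> \<psi> s t k r" "\<And>k r. \<psi> s t k r \<le> m s t k"
      and \<psi>1: "\<And>k r. s + \<epsilon> s t k \<le> r \<Longrightarrow> r \<le> t \<Longrightarrow> \<psi> s t k r = m s t k"
      using Q by blast+
    have l1: "(\<lambda>k. (LINT r:{a<..<b}|lborel. v r * \<rho> s t k r) / m s t k) \<longlonglongrightarrow> v s"
      by (rule bump_average_tendsto[where \<epsilon>="\<epsilon> s t"])
         (use v st e sm(2) \<rho>0 m in \<open>auto intro: smooth_continuous_on\<close>)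
    have sh: "smooth (\<lambda>r. \<rho> s t k (r - c))" for k c by (rule smooth_translate[OF sm(2)])
    have l2: "(\<lambda>k. (LINT r:{a<..<b}|lborel. v r * \<rho> s t k (r - (t - s))) / m s t k) \<longlonglongrightarrow> v t"
    proof (rule bump_average_tendsto[where \<epsilon>="\<epsilon> s t"])
      have "(LINT r|lborel. \<rho> s t k (r - c)) = (LINT r|lborel. \<rho> s t k r)" for k c
        using integral_translation[of "\<rho> s t k" "- c"] smooth_borel[OF sm(2)] by simp
      then show "m s t k = (LINT r|lborel. \<rho> s t k (r - (t - s)))" for k
        using m(1) by simp
      show "\<rho> s t k (r - (t - s)) = 0" if "r \<notin> {t..t + \<epsilon> s t k}" for k r
        using that by (intro \<rho>0(2)) auto
    qed (use v st e sh \<rho>0(1) m(2) in \<open>auto intro: smooth_continuous_on\<close>)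
    have iv\<rho>: "set_integrable lborel {a<..<b} (\<lambda>r. v r * \<rho> s t k (r - c))" for k c
    proof -
      obtain B where "\<And>z. \<bar>\<rho> s t k z\<bar> \<le> B"
        by (rule compact_support_bounded[OF smooth_continuous_on[OF sm(2)], of "{s..s + \<epsilon> s t k}" k]) (use \<rho>0(2) in auto)
      then show ?thesis
        by (intro set_integrable_times_bounded[OF iv smooth_borel[OF sh]])
    qed
    have "\<forall>\<^sub>F k in sequentially. \<epsilon> s t k < b - t" using st by (intro order_tendstoD[OF e(1)]) auto
    then have "\<forall>\<^sub>F k in sequentially. (LINT r:{a<..<b}|lborel. v r * \<rho> s t k r) / m s t k
        - (LINT r:{a<..<b}|lborel. v r * \<rho> s t k (r - (t - s))) / m s t k
        = - (LINT r:{a<..<b}|lborel. g r * (\<psi> s t k r / m s t k))"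
    proof eventually_elim
      case (elim k)
      then have "\<psi> s t k \<in> T" unfolding T_def using st by force
      from T[OF this] have "(LINT r:{a<..<b}|lborel. v r * \<rho> s t k r - v r * \<rho> s t k (r - (t - s)))
          = - (LINT r:{a<..<b}|lborel. g r * \<psi> s t k r)"
        by (simp add: pd right_diff_distrib)
      then have "(LINT r:{a<..<b}|lborel. v r * \<rho> s t k r) - (LINT r:{a<..<b}|lborel. v r * \<rho> s t k (r - (t - s)))
          = - (LINT r:{a<..<b}|lborel. g r * \<psi> s t k r)"
        using set_integral_diff(2)[OF iv\<rho>[of k 0] iv\<rho>[of k "t - s"]] by simp
      then show ?case by (simp add: diff_divide_distrib[symmetric])
    qed
    with tendsto_diff[OF l1 l2] have "(\<lambda>k. - (LINT r:{a<..<b}|lborel. g r * (\<psi> s t k r / m s t k))) \<longlonglongrightarrow> v s - v t"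
      by (rule Lim_transform_eventually)
    moreover have "(\<lambda>k. LINT r:{a<..<b}|lborel. g r * (\<psi> s t k r / m s t k)) \<longlonglongrightarrow> (LINT r:{s<..<t}|lborel. g r)"
      by (rule plateau_integral_tendsto[OF ig st(3-5) e(1) m(2) smooth_borel[OF sm(1)] \<psi>0 \<psi>1])
    from tendsto_minus[OF this] have "(\<lambda>k. - (LINT r:{a<..<b}|lborel. g r * (\<psi> s t k r / m s t k))) \<longlonglongrightarrow> - (LINT r:{s<..<t}|lborel. g r)" .
    ultimately have "v s - v t = - (LINT r:{s<..<t}|lborel. g r)" by (rule LIMSEQ_unique)
    then show ?thesis by simp
  qed
  ultimately show ?thesis by (rule that)
qed

text \<open>Rational times tend to \<open>a\<close> and to \<open>t\<close> from inside. Continuity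
  and the one-sided limits take care of the increments, dominated convergence of the integrals. The
  value \<open>vt\<close> treats interior times and the right end of the interval together.\<close>

lemma rational_FTC_extend:
  fixes v g :: "real \<Rightarrow> real"
  assumes v: "continuous_on {a<..<b} v" "(v \<longlongrightarrow> va) (at_right a)" "(v \<longlongrightarrow> vb) (at_left b)"
    and g: "set_integrable lborel {a<..<b} g"
    and FTC: "\<And>s t. s \<in> \<rat> \<Longrightarrow> t \<in> \<rat> \<Longrightarrow> a < s \<Longrightarrow> s < t \<Longrightarrow> t < b \<Longrightarrow> v t - v s = (LINT r:{s<..<t}|lborel. g r)"
    and t: "a < t" "t \<le> b" and vt: "vt = (if t = b then vb else v t)"
  shows "vt = va + (LINT r:{a<..<t}|lborel. g r)"
proof -
  \<comment> \<open>Half the length of the interval, so that \<open>p j\<close> stays left of the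
    midpoint and \<open>q j\<close> right of it.\<close>
  define \<tau> where "\<tau> = (t - a) / 2"
  have \<tau>: "\<tau> > 0" using t by (simp add: \<tau>_def)
  have "\<exists>q\<in>\<rat>. a < q \<and> q < a + \<tau> / (real j + 1)" "\<exists>q\<in>\<rat>. t - \<tau> / (real j + 1) < q \<and> q < t" for j
    using \<tau> by (auto intro!: Rats_dense_in_real)
  then obtain p q where p: "\<And>j. p j \<in> \<rat>" "\<And>j. a < p j" "\<And>j. p j < a + \<tau> / (real j + 1)"
    and q: "\<And>j. q j \<in> \<rat>" "\<And>j. t - \<tau> / (real j + 1) < q j" "\<And>j. q j < t" by metis
  have z: "(\<lambda>j. \<tau> / (real j + 1)) \<longlonglongrightarrow> 0"
    using tendsto_mult_right_zero[OF LIMSEQ_inverse_real_of_nat, of \<tau>] by (simp add: divide_inverse add.commute)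
  have pl: "p \<longlonglongrightarrow> a"
    by (rule tendsto_sandwich[of "\<lambda>_. a" _ _ "\<lambda>j. a + \<tau> / (real j + 1)"])
       (use p tendsto_add[OF tendsto_const z, of a] in \<open>auto intro!: always_eventually less_imp_le\<close>)
  have ql: "q \<longlonglongrightarrow> t"
    by (rule tendsto_sandwich[of "\<lambda>j. t - \<tau> / (real j + 1)" _ _ "\<lambda>_. t"])
       (use q tendsto_diff[OF tendsto_const z, of t] in \<open>auto intro!: always_eventually less_imp_le\<close>)
  have "\<tau> / (real j + 1) \<le> \<tau>" for j using \<tau> by (simp add: field_simps)
  moreover have "a + \<tau> = t - \<tau>" by (simp add: \<tau>_def field_simps)
  ultimately have pq: "p j < q j" for j using p(3)[of j] q(2)[of j] by (smt (verit))
  have "(\<lambda>j. v (p j)) \<longlonglongrightarrow> va"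
    by (rule filterlim_compose[OF v(2)]) (use p pl in \<open>auto simp: filterlim_at intro!: always_eventually\<close>)
  moreover have "(\<lambda>j. v (q j)) \<longlonglongrightarrow> vt"
  proof (cases "t = b")
    case True
    show ?thesis unfolding vt using True
      by (simp, intro filterlim_compose[OF v(3)]) (use q ql in \<open>auto simp: filterlim_at intro!: always_eventually\<close>)
  next
    case False
    then have "isCont v t" using v(1) t by (simp add: continuous_on_eq_continuous_at)
    then show ?thesis unfolding vt using False ql by (simp add: isCont_tendsto_compose)
  qed
  ultimately have lim: "(\<lambda>j. v (q j) - v (p j)) \<longlonglongrightarrow> vt - va" by (intro tendsto_diff)
  have "v (q j) - v (p j) = (LINT r:{p j<..<q j}|lborel. g r)" for j
    using FTC[OF p(1) q(1) p(2) pq] q(3)[of j] t by simp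
  with lim have "(\<lambda>j. LINT r:{p j<..<q j}|lborel. g r) \<longlonglongrightarrow> vt - va" by simp
  moreover have "(\<lambda>j. LINT r:{p j<..<q j}|lborel. g r) \<longlonglongrightarrow> (LINT r:{a<..<t}|lborel. g r)"
  proof -
    have ig': "integrable lborel (\<lambda>r. indicator {a<..<b} r *\<^sub>R g r)" using g by (simp add: set_integrable_def)
    note [measurable] = borel_measurable_integrable[OF ig']
    have G: "(\<lambda>r. indicator {p j<..<q j} r *\<^sub>R g r) = (\<lambda>r. (indicator {a<..<b} r *\<^sub>R g r) * indicator {p j<..<q j} r)" for j
      using p(2)[of j] q(3)[of j] t by (auto simp: fun_eq_iff indicator_def)
    have G': "(\<lambda>r. indicator {a<..<t} r *\<^sub>R g r) = (\<lambda>r. (indicator {a<..<b} r *\<^sub>R g r) * indicator {a<..<t} r)"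
      using t by (auto simp: fun_eq_iff indicator_def)
    show ?thesis unfolding set_lebesgue_integral_def G G'
    proof (rule integral_dominated_convergence[where w="\<lambda>r. \<bar>indicator {a<..<b} r *\<^sub>R g r\<bar>"])
      show "AE r in lborel. (\<lambda>j. (indicator {a<..<b} r *\<^sub>R g r) * indicator {p j<..<q j} r) \<longlonglongrightarrow> (indicator {a<..<b} r *\<^sub>R g r) * indicator {a<..<t} r"
      proof (rule AE_I2)
        fix r
        have "\<forall>\<^sub>F j in sequentially. indicat_real {p j<..<q j} r = indicator {a<..<t} r"
        proof (cases "a < r \<and> r < t")
          case True
          then have "\<forall>\<^sub>F j in sequentially. p j < r" "\<forall>\<^sub>F j in sequentially. r < q j"
            using order_tendstoD(2)[OF pl] order_tendstoD(1)[OF ql] by auto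
          then show ?thesis by eventually_elim (use True in auto)
        next
          case False
          then have "indicat_real {p j<..<q j} r = indicator {a<..<t} r" for j
            using p(2)[of j] q(3)[of j] by (auto simp: indicator_def)
          then show ?thesis by simp
        qed
        then show "(\<lambda>j. (indicator {a<..<b} r *\<^sub>R g r) * indicator {p j<..<q j} r) \<longlonglongrightarrow> (indicator {a<..<b} r *\<^sub>R g r) * indicator {a<..<t} r"
          by (intro tendsto_mult tendsto_const tendsto_eventually)
      qed
    qed (use ig' in \<open>auto simp: indicator_def\<close>)
  qed
  ultimately have "vt - va = (LINT r:{a<..<t}|lborel. g r)" by (rule LIMSEQ_unique)
  then show ?thesis by simp
qed

section \<open>Integration by parts in time\<close>

lemma set_Fubini:
  fixes f :: "'a::euclidean_space \<times> 'b::euclidean_space \<Rightarrow> real"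
  assumes f: "set_integrable lborel (A \<times> U) f"
  shows "AE x in lborel. x \<in> U \<longrightarrow> set_integrable lborel A (\<lambda>r. f (r, x))"
    and "set_integrable lborel U (\<lambda>x. LINT r:A|lborel. f (r, x))"
    and "(LINT z:A \<times> U|lborel. f z) = (LINT x:U|lborel. LINT r:A|lborel. f (r, x))"
proof -
  define F where "F r x = indicator U x *\<^sub>R (indicator A r *\<^sub>R f (r, x))" for r x
  have eq: "case_prod F = (\<lambda>z. indicator (A \<times> U) z *\<^sub>R f z)"
    by (auto simp: F_def fun_eq_iff indicator_def)
  have F: "integrable (lborel \<Otimes>\<^sub>M lborel) (case_prod F)"
    using f by (simp add: eq lborel_prod set_integrable_def)
  show "AE x in lborel. x \<in> U \<longrightarrow> set_integrable lborel A (\<lambda>r. f (r, x))"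
    using lborel_pair.AE_integrable_snd[OF F] by eventually_elim (auto simp: F_def set_integrable_def)
  have inner: "(LINT r|lborel. F r x) = indicator U x *\<^sub>R (LINT r:A|lborel. f (r, x))" for x
    by (simp add: F_def set_lebesgue_integral_def)
  show "set_integrable lborel U (\<lambda>x. LINT r:A|lborel. f (r, x))"
    using lborel_pair.integrable_snd[OF F] by (simp only: inner set_integrable_def)
  show "(LINT z:A \<times> U|lborel. f z) = (LINT x:U|lborel. LINT r:A|lborel. f (r, x))"
    using lborel_pair.integral_snd[OF F]
    by (simp only: inner lborel_prod eq set_lebesgue_integral_def[of lborel U] set_lebesgue_integral_def[of lborel "A \<times> U"])
qed

lemma product_integrable:
  fixes G H :: "real \<Rightarrow> real"
  assumes G: "integrable lborel G" and H: "integrable lborel H"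
  shows "integrable (lborel \<Otimes>\<^sub>M lborel) (\<lambda>(r, q). G r * H q)"
proof (rule lborel_pair.Fubini_integrable)
  have [measurable]: "G \<in> borel_measurable lborel" "H \<in> borel_measurable lborel" using G H by auto
  show "(\<lambda>(r, q). G r * H q) \<in> borel_measurable (lborel \<Otimes>\<^sub>M lborel)" by measurable
  show "integrable lborel (\<lambda>x. \<integral>y. norm (case (x, y) of (r, q) \<Rightarrow> G r * H q) \<partial>lborel)"
    using G H by (simp add: abs_mult)
  show "AE x in lborel. integrable lborel (\<lambda>y. case (x, y) of (r, q) \<Rightarrow> G r * H q)"
    using H by simp
qed

text \<open>
  Integration by parts for absolutely continuous functions, by Fubini's theorem on the two triangles
  of the square.
\<close>

lemma AC_product:
  fixes u w g h :: "real \<Rightarrow> real"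
  assumes g: "set_integrable lborel {a<..<b} g" and h: "set_integrable lborel {a<..<b} h"
    and u: "\<And>t. t \<in> {a<..<b} \<Longrightarrow> u t = ua + (LINT r:{a<..<t}|lborel. g r)" "ub = ua + (LINT r:{a<..<b}|lborel. g r)"
    and w: "\<And>t. t \<in> {a<..<b} \<Longrightarrow> w t = wa + (LINT r:{a<..<t}|lborel. h r)" "wb = wa + (LINT r:{a<..<b}|lborel. h r)"
  shows "set_integrable lborel {a<..<b} (\<lambda>r. g r * w r + u r * h r)"
    and "(LINT r:{a<..<b}|lborel. g r * w r + u r * h r) = ub * wb - ua * wa"
proof -
  define G where "G r = indicator {a<..<b} r *\<^sub>R g r" for r
  define H where "H r = indicator {a<..<b} r *\<^sub>R h r" for r
  have G: "integrable lborel G" and H: "integrable lborel H"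
    using g h by (auto simp: G_def[abs_def] H_def[abs_def] set_integrable_def)
  have [measurable]: "G \<in> borel_measurable borel" "H \<in> borel_measurable borel"
    using borel_measurable_integrable[OF G] borel_measurable_integrable[OF H] by auto
  \<comment> \<open>Both kernels live on the triangle q < r. With the arguments of \<open>K2\<close>
    exchanged, they add up to \<open>G r * H q\<close> except on the diagonal, which is a single
    point for each \<open>r\<close>.\<close>
  define K1 where "K1 r q = G r * H q * indicator {q. q < r} q" for r q
  define K2 where "K2 r q = G q * H r * indicator {q. q < r} q" for r q
  have GH: "integrable (lborel \<Otimes>\<^sub>M lborel) (\<lambda>(r, q). G r * H q)"
    "integrable (lborel \<Otimes>\<^sub>M lborel) (\<lambda>(r, q). H r * G q)"
    using product_integrable G H by blast+
  have K1: "integrable (lborel \<Otimes>\<^sub>M lborel) (case_prod K1)"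
    by (rule Bochner_Integration.integrable_bound[OF GH(1)])
       (auto simp: K1_def[abs_def] abs_mult indicator_def intro!: AE_I2 split: if_splits)
  have K2: "integrable (lborel \<Otimes>\<^sub>M lborel) (case_prod K2)"
    by (rule Bochner_Integration.integrable_bound[OF GH(2)])
       (auto simp: K2_def[abs_def] abs_mult indicator_def intro!: AE_I2 split: if_splits)
  have U: "(LINT q|lborel. G q * indicator {q. q < r} q) = u r - ua" if "r \<in> {a<..<b}" for r
  proof -
    have "(\<lambda>q. G q * indicator {q. q < r} q) = (\<lambda>q. indicator {a<..<r} q *\<^sub>R g q)"
      using that by (auto simp: G_def fun_eq_iff indicator_def)
    then show ?thesis using u(1)[OF that] by (simp add: set_lebesgue_integral_def)
  qed
  have W: "(LINT q|lborel. H q * indicator {q. q < r} q) = w r - wa" if "r \<in> {a<..<b}" for r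
  proof -
    have "(\<lambda>q. H q * indicator {q. q < r} q) = (\<lambda>q. indicator {a<..<r} q *\<^sub>R h q)"
      using that by (auto simp: H_def fun_eq_iff indicator_def)
    then show ?thesis using w(1)[OF that] by (simp add: set_lebesgue_integral_def)
  qed
  have k1: "(LINT q|lborel. K1 r q) = G r * (w r - wa)" for r
    using W[of r] by (cases "r \<in> {a<..<b}") (auto simp: K1_def G_def mult.assoc)
  have k2: "(LINT q|lborel. K2 r q) = H r * (u r - ua)" for r
  proof -
    have "(LINT q|lborel. K2 r q) = (LINT q|lborel. H r * (G q * indicator {q. q < r} q))"
      by (simp add: K2_def mult_ac)
    then show ?thesis using U[of r] by (cases "r \<in> {a<..<b}") (auto simp: H_def)
  qed
  have i1: "integrable lborel (\<lambda>r. G r * (w r - wa))" and i2: "integrable lborel (\<lambda>r. H r * (u r - ua))"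
    using lborel_pair.integrable_fst[OF K1] lborel_pair.integrable_fst[OF K2] by (simp_all only: k1 k2)
  have split: "indicator {a<..<b} r *\<^sub>R (g r * w r + u r * h r) = G r * (w r - wa) + H r * (u r - ua) + wa * G r + ua * H r" for r
    by (simp add: G_def H_def algebra_simps)
  show "set_integrable lborel {a<..<b} (\<lambda>r. g r * w r + u r * h r)"
    unfolding set_integrable_def split using i1 i2 G H by auto
  have "(LINT r|lborel. H r * (u r - ua)) = (LINT r|lborel. LINT q|lborel. K2 r q)" by (simp add: k2)
  also have "\<dots> = (LINT q|lborel. LINT r|lborel. K2 r q)"
    using lborel_pair.Fubini_integral[OF K2] by simp
  finally have s2: "(LINT r|lborel. H r * (u r - ua)) = (LINT r|lborel. LINT q|lborel. K2 q r)" .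
  have K2': "integrable (lborel \<Otimes>\<^sub>M lborel) (case_prod (\<lambda>r q. K2 q r))"
    using K2 lborel_pair.integrable_product_swap_iff[of "\<lambda>(r, q). K2 q r"] by simp
  have "(LINT r|lborel. G r * (w r - wa)) + (LINT r|lborel. H r * (u r - ua))
      = (LINT r|lborel. (LINT q|lborel. K1 r q) + (LINT q|lborel. K2 q r))"
    using lborel_pair.integrable_fst[OF K1] lborel_pair.integrable_fst[OF K2'] by (simp add: s2 k1)
  also have "\<dots> = (LINT r|lborel. G r * (LINT q|lborel. H q))"
  proof (rule integral_cong_AE)
    show "(\<lambda>r. (LINT q|lborel. K1 r q) + (LINT q|lborel. K2 q r)) \<in> borel_measurable lborel"
      using lborel_pair.integrable_fst[OF K1] lborel_pair.integrable_fst[OF K2'] by (intro borel_measurable_add) auto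
    show "(\<lambda>r. G r * (LINT q|lborel. H q)) \<in> borel_measurable lborel" by measurable
    show "AE r in lborel. (LINT q|lborel. K1 r q) + (LINT q|lborel. K2 q r) = G r * (LINT q|lborel. H q)"
      using lborel_pair.AE_integrable_fst[OF K1] lborel_pair.AE_integrable_fst[OF K2']
    proof eventually_elim
      case (elim r)
      then have "(LINT q|lborel. K1 r q) + (LINT q|lborel. K2 q r) = (LINT q|lborel. K1 r q + K2 q r)" by simp
      also have "\<dots> = (LINT q|lborel. G r * H q)"
      proof (rule integral_cong_AE)
        show "AE q in lborel. K1 r q + K2 q r = G r * H q"
          using AE_lborel_singleton[of r] by eventually_elim (auto simp: K1_def K2_def indicator_def)
      qed (use elim in \<open>auto dest!: borel_measurable_integrable\<close>)
      finally show ?case by simp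
    qed
  qed
  finally have main: "(LINT r|lborel. G r * (w r - wa)) + (LINT r|lborel. H r * (u r - ua)) = (ub - ua) * (wb - wa)"
    using u(2) w(2) by (simp add: G_def[abs_def] H_def[abs_def] set_lebesgue_integral_def)
  have "(LINT r:{a<..<b}|lborel. g r * w r + u r * h r)
     = (LINT r|lborel. G r * (w r - wa)) + (LINT r|lborel. H r * (u r - ua)) + wa * (ub - ua) + ua * (wb - wa)"
    unfolding set_lebesgue_integral_def split using i1 i2 G H u(2) w(2)
    by (simp add: G_def[abs_def] H_def[abs_def] set_lebesgue_integral_def)
  also have "\<dots> = ub * wb - ua * wa" unfolding main by (simp add: algebra_simps)
  finally show "(LINT r:{a<..<b}|lborel. g r * w r + u r * h r) = ub * wb - ua * wa" .
qed

text \<open>The product of \<open>u\<close> and \<open>w\<close> is again a primitive, with density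
  \<open>g r * w r + u r * h r\<close>, and the affine weight is the primitive of the constant
  \<beta>. The product rule applied a second time gives the weighted form.\<close>

lemma AC_weighted_product:
  fixes u w g h :: "real \<Rightarrow> real"
  assumes ab: "a < b" and g: "set_integrable lborel {a<..<b} g" and h: "set_integrable lborel {a<..<b} h"
    and u: "\<And>t. t \<in> {a<..<b} \<Longrightarrow> u t = ua + (LINT r:{a<..<t}|lborel. g r)" "ub = ua + (LINT r:{a<..<b}|lborel. g r)"
    and w: "\<And>t. t \<in> {a<..<b} \<Longrightarrow> w t = wa + (LINT r:{a<..<t}|lborel. h r)" "wb = wa + (LINT r:{a<..<b}|lborel. h r)"
  shows "(LINT r:{a<..<b}|lborel. (\<alpha> + \<beta> * r) * (g r * w r + u r * h r) + \<beta> * (u r * w r))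
     = (\<alpha> + \<beta> * b) * (ub * wb) - (\<alpha> + \<beta> * a) * (ua * wa)"
proof -
  have c: "(LINT r:{a<..<t}|lborel. \<beta>) = \<beta> * (t - a)" if "a < t" for t
    using that by (simp add: set_lebesgue_integral_def mult.commute)
  have "(LINT r:{a<..<b}|lborel. \<beta> * (u r * w r) + (\<alpha> + \<beta> * r) * (g r * w r + u r * h r))
     = (\<alpha> + \<beta> * b) * (ub * wb) - (\<alpha> + \<beta> * a) * (ua * wa)"
  proof (rule AC_product(2))
    show "set_integrable lborel {a<..<b} (\<lambda>r. \<beta>)" by (rule set_integrable_const_bounded) auto
    show "set_integrable lborel {a<..<b} (\<lambda>r. g r * w r + u r * h r)" by (rule AC_product(1)[OF g h u w])
    show "u t * w t = ua * wa + (LINT r:{a<..<t}|lborel. g r * w r + u r * h r)" if t: "t \<in> {a<..<b}" for t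
    proof -
      have "(LINT r:{a<..<t}|lborel. g r * w r + u r * h r) = u t * w t - ua * wa"
      proof (rule AC_product(2))
        show "set_integrable lborel {a<..<t} g" by (rule set_integrable_subset[OF g]) (use t in auto)
        show "set_integrable lborel {a<..<t} h" by (rule set_integrable_subset[OF h]) (use t in auto)
      qed (use t u(1) w(1) in auto)
      then show ?thesis by simp
    qed
    show "ub * wb = ua * wa + (LINT r:{a<..<b}|lborel. g r * w r + u r * h r)"
      using AC_product(2)[OF g h u w] by simp
  qed (use ab c in \<open>auto simp: algebra_simps\<close>)
  then show ?thesis by (simp add: add.commute)
qed

section \<open>Weak time derivatives on almost every time line\<close>

lemma smooth_fst: "smooth \<phi> \<Longrightarrow> smooth (\<lambda>z :: real \<times> 'b::euclidean_space. \<phi> (fst z))"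
  using smooth_comp_affine[OF _ linear_fst, of \<phi> 0] by simp

lemma smooth_snd: "smooth \<psi> \<Longrightarrow> smooth (\<lambda>z :: real \<times> 'b::euclidean_space. \<psi> (snd z))"
  using smooth_comp_affine[OF _ linear_snd, of \<psi> 0] by simp

lemmas smooth_fst_borel = smooth_borel[OF smooth_fst]
lemmas smooth_snd_borel = smooth_borel[OF smooth_snd]

lemma weak_deriv_singleD:
  "weak_deriv U {#b#} u g \<Longrightarrow> test_function U \<phi> \<Longrightarrow>
    (LINT z:U|lborel. u z * partial_deriv b \<phi> z) = - (LINT z:U|lborel. g z * \<phi> z)"
  by (simp add: weak_deriv_single)

text \<open>Products of \<open>\<phi>\<close> in time with an arbitrary test function in space are
  test functions on the slab. By Fubini the integral in time then vanishes against every test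
  function in \<open>x\<close>, and the fundamental lemma applies.\<close>

lemma weak_time_deriv_slice:
  fixes u g :: "real \<times> 'b::euclidean_space \<Rightarrow> real"
  assumes U: "open U" and w: "weak_deriv ({a<..<b} \<times> U) {#(1, 0)#} u g"
    and u: "set_integrable lborel ({a<..<b} \<times> U) u" and g: "set_integrable lborel ({a<..<b} \<times> U) g"
    and \<phi>: "test_function {a<..<b} \<phi>"
  shows "AE x in lborel. x \<in> U \<longrightarrow>
    (LINT r:{a<..<b}|lborel. u (r, x) * partial_deriv 1 \<phi> r) = - (LINT r:{a<..<b}|lborel. g (r, x) * \<phi> r)"
proof -
  let ?I = "{a<..<b}"
  obtain C where C: "smooth \<phi>" "compact C" "C \<subseteq> ?I" "\<And>r. r \<notin> C \<Longrightarrow> \<phi> r = 0"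
    using \<phi> by (auto simp: test_function_def)
  have pd: "smooth (partial_deriv 1 \<phi>)" using C(1) by (simp add: smooth_partial_deriv)
  have pd0: "partial_deriv 1 \<phi> r = 0" if "r \<notin> C" for r using partial_deriv_support[OF compact_imp_closed[OF C(2)] C(4) that] .
  obtain B1 where B1: "\<And>r. \<bar>\<phi> r\<bar> \<le> B1"
    using compact_support_bounded[OF smooth_continuous_on[OF C(1)] C(2,4)] by metis
  obtain B2 where B2: "\<And>r. \<bar>partial_deriv 1 \<phi> r\<bar> \<le> B2"
    using compact_support_bounded[OF smooth_continuous_on[OF pd] C(2) pd0] by metis
  note [measurable] = smooth_borel[OF C(1)] smooth_borel[OF pd]
  have iu: "set_integrable lborel (?I \<times> U) (\<lambda>z. u z * partial_deriv 1 \<phi> (fst z))"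
    by (rule set_integrable_times_bounded[OF u smooth_fst_borel[OF pd], of B2]) (rule B2)
  have ig: "set_integrable lborel (?I \<times> U) (\<lambda>z. g z * \<phi> (fst z))"
    by (rule set_integrable_times_bounded[OF g smooth_fst_borel[OF C(1)], of B1]) (rule B1)
  define F where "F x = (LINT r:?I|lborel. u (r, x) * partial_deriv 1 \<phi> r + g (r, x) * \<phi> r)" for x
  have iug: "set_integrable lborel (?I \<times> U) (\<lambda>z. u z * partial_deriv 1 \<phi> (fst z) + g z * \<phi> (fst z))"
    using iu ig by (rule set_integral_add(1))
  have F: "set_integrable lborel U F"
    using set_Fubini(2)[OF iug] by (simp add: F_def[abs_def])
  have "AE x in lborel. x \<in> U \<longrightarrow> F x = 0"
  proof (rule fundamental_lemma[OF U])
    show "locally_integrable U F"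
      unfolding locally_integrable_def using F by (auto intro: set_integrable_subset[OF F] simp: borel_compact)
    fix \<psi> :: "'b \<Rightarrow> real" assume \<psi>: "test_function U \<psi>"
    then obtain D where D: "smooth \<psi>" "compact D" "D \<subseteq> U" "\<And>x. x \<notin> D \<Longrightarrow> \<psi> x = 0"
      by (auto simp: test_function_def)
    obtain B3 where B3: "\<And>x. \<bar>\<psi> x\<bar> \<le> B3"
      using compact_support_bounded[OF smooth_continuous_on[OF D(1)] D(2,4)] by metis
    note [measurable] = smooth_borel[OF D(1)]
    define \<theta> where "\<theta> z = \<phi> (fst z) * \<psi> (snd z)" for z
    have l: "linear (fst :: real \<times> 'b \<Rightarrow> real)" "linear (snd :: real \<times> 'b \<Rightarrow> 'b)"
      by (auto simp: linear_fst linear_snd)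
    have s1: "smooth (\<lambda>z :: real \<times> 'b. \<phi> (fst z))" and s2: "smooth (\<lambda>z :: real \<times> 'b. \<psi> (snd z))"
      using smooth_comp_affine[OF C(1) l(1), of 0] smooth_comp_affine[OF D(1) l(2), of 0] by simp_all
    have t: "test_function (?I \<times> U) \<theta>"
      unfolding test_function_def
    proof (intro conjI exI[of _ "C \<times> D"] allI impI)
      show "smooth \<theta>" unfolding \<theta>_def[abs_def] by (rule smooth_mult[OF s1 s2])
      show "compact (C \<times> D)" using C D by (simp add: compact_Times)
      show "\<theta> z = 0" if "z \<notin> C \<times> D" for z using that C(4) D(4) by (auto simp: \<theta>_def mem_Times_iff)
    qed (use C D in auto)
    have pd\<theta>: "partial_deriv (1, 0) \<theta> z = partial_deriv 1 \<phi> (fst z) * \<psi> (snd z)" for z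
      using partial_deriv_comp_affine[OF C(1) l(1), of "(1, 0)" 0 z] partial_deriv_comp_affine[OF D(1) l(2), of "(1, 0)" 0 z]
      by (simp add: \<theta>_def[abs_def] partial_deriv_mult[OF s1 s2])
    have "(LINT z:?I \<times> U|lborel. u z * (partial_deriv 1 \<phi> (fst z) * \<psi> (snd z)))
        = - (LINT z:?I \<times> U|lborel. g z * (\<phi> (fst z) * \<psi> (snd z)))"
      using weak_deriv_singleD[OF w t] by (simp add: pd\<theta>) (simp add: \<theta>_def)
    moreover have i1: "set_integrable lborel (?I \<times> U) (\<lambda>z. u z * partial_deriv 1 \<phi> (fst z) * \<psi> (snd z))"
      by (rule set_integrable_times_bounded[OF iu smooth_snd_borel[OF D(1)], of B3]) (rule B3)
    moreover have i2: "set_integrable lborel (?I \<times> U) (\<lambda>z. g z * \<phi> (fst z) * \<psi> (snd z))"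
      by (rule set_integrable_times_bounded[OF ig smooth_snd_borel[OF D(1)], of B3]) (rule B3)
    ultimately have "(LINT z:?I \<times> U|lborel. u z * partial_deriv 1 \<phi> (fst z) * \<psi> (snd z) + g z * \<phi> (fst z) * \<psi> (snd z)) = 0"
      using set_integral_add(2)[OF i1 i2] by (simp add: mult.assoc)
    moreover have "(LINT x:U|lborel. F x * \<psi> x)
        = (LINT z:?I \<times> U|lborel. u z * partial_deriv 1 \<phi> (fst z) * \<psi> (snd z) + g z * \<phi> (fst z) * \<psi> (snd z))"
      using set_Fubini(3)[OF set_integral_add(1)[OF i1 i2]]
      by (simp add: F_def distrib_right[symmetric] set_integral_mult_left)
    ultimately show "(LINT x:U|lborel. F x * \<psi> x) = 0" by simp
  qed
  with set_Fubini(1)[OF iu] set_Fubini(1)[OF ig] show ?thesis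
  proof eventually_elim
    case (elim x)
    then show ?case
      using set_integral_add(2)[of lborel ?I "\<lambda>r. u (r, x) * partial_deriv 1 \<phi> r" "\<lambda>r. g (r, x) * \<phi> r"]
      by (auto simp: F_def)
  qed
qed

text \<open>Outside one null set, the slice satisfies the weak identity for the whole countable
  family of plateaus. Continuity in time holds for every \<open>x\<close> by assumption, so the
  identity at rational times extends to all times and to both ends.\<close>

lemma weak_time_deriv_FTC:
  fixes u g :: "real \<times> 'b::euclidean_space \<Rightarrow> real"
  assumes U: "open U" and ab: "a < b" and w: "weak_deriv ({a<..<b} \<times> U) {#(1, 0)#} u g"
    and u: "set_integrable lborel ({a<..<b} \<times> U) u" and g: "set_integrable lborel ({a<..<b} \<times> U) g"
    and cont: "\<And>x. x \<in> U \<Longrightarrow> continuous_on {a<..<b} (\<lambda>t. u (t, x))"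
    and ua: "\<And>x. x \<in> U \<Longrightarrow> ((\<lambda>t. u (t, x)) \<longlongrightarrow> ua x) (at_right a)"
    and ub: "\<And>x. x \<in> U \<Longrightarrow> ((\<lambda>t. u (t, x)) \<longlongrightarrow> ub x) (at_left b)"
  shows "AE x in lborel. x \<in> U \<longrightarrow> set_integrable lborel {a<..<b} (\<lambda>r. g (r, x)) \<and>
    (\<forall>t\<in>{a<..<b}. u (t, x) = ua x + (LINT r:{a<..<t}|lborel. g (r, x))) \<and>
    ub x = ua x + (LINT r:{a<..<b}|lborel. g (r, x))"
proof -
  obtain T where T: "countable T" "\<And>\<phi>. \<phi> \<in> T \<Longrightarrow> test_function {a<..<b} \<phi>"
    "\<And>v g s t. \<lbrakk>continuous_on {a<..<b} v; set_integrable lborel {a<..<b} v; set_integrable lborel {a<..<b} g;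
       \<And>\<phi>. \<phi> \<in> T \<Longrightarrow> (LINT r:{a<..<b}|lborel. v r * partial_deriv 1 \<phi> r) = - (LINT r:{a<..<b}|lborel. g r * \<phi> r);
       s \<in> \<rat>; t \<in> \<rat>; a < s; s < t; t < b\<rbrakk> \<Longrightarrow> v t - v s = (LINT r:{s<..<t}|lborel. g r)"
    by (rule rational_test_functions[of a b]) blast
  have "AE x in lborel. \<forall>\<phi>\<in>T. x \<in> U \<longrightarrow>
    (LINT r:{a<..<b}|lborel. u (r, x) * partial_deriv 1 \<phi> r) = - (LINT r:{a<..<b}|lborel. g (r, x) * \<phi> r)"
    by (intro AE_ball_countable[OF T(1), THEN iffD2] ballI weak_time_deriv_slice[OF U w u g] T(2))
  with set_Fubini(1)[OF u] set_Fubini(1)[OF g] show ?thesis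
  proof eventually_elim
    case (elim x)
    show ?case
    proof (intro impI)
      assume x: "x \<in> U"
      then have gx: "set_integrable lborel {a<..<b} (\<lambda>r. g (r, x))" using elim by simp
      have rat: "u (t, x) - u (s, x) = (LINT r:{s<..<t}|lborel. g (r, x))"
        if "s \<in> \<rat>" "t \<in> \<rat>" "a < s" "s < t" "t < b" for s t
        using T(3)[of "\<lambda>t. u (t, x)" "\<lambda>r. g (r, x)" s t] cont[OF x] elim x that by blast
      note ext = rational_FTC_extend[OF cont[OF x] ua[OF x] ub[OF x] gx rat]
      show "set_integrable lborel {a<..<b} (\<lambda>r. g (r, x)) \<and>
        (\<forall>t\<in>{a<..<b}. u (t, x) = ua x + (LINT r:{a<..<t}|lborel. g (r, x))) \<and>
        ub x = ua x + (LINT r:{a<..<b}|lborel. g (r, x))"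
        using gx ext[of _ "u (_, x)"] ext[of b "ub x"] ab by auto
    qed
  qed
qed

text \<open>Young's inequality with a parameter \<open>t\<close>, which is optimal at
  \<open>?G / ?F\<close>. If one of the norms vanishes, \<open>t\<close> is taken large or small
  instead and the integral is below every positive bound.\<close>

lemma L2_Cauchy_Schwarz:
  assumes u: "L2_on A u" and w: "L2_on A w"
  shows "\<bar>LINT z:A|lborel. u z \<bullet> w z\<bar> \<le> L2_norm A u * L2_norm A w"
proof -
  let ?F = "L2_norm A u" and ?G = "L2_norm A w" and ?I = "\<bar>LINT z:A|lborel. u z \<bullet> w z\<bar>"
  have young: "?I \<le> t * ?F\<^sup>2 / 2 + ?G\<^sup>2 / (2 * t)" if t: "t > 0" for t
  proof -
    have iu: "set_integrable lborel A (\<lambda>z. (norm (u z))\<^sup>2)" and iw: "set_integrable lborel A (\<lambda>z. (norm (w z))\<^sup>2)"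
      using u w by (auto simp: L2_on_def)
    have pt: "\<bar>u z \<bullet> w z\<bar> \<le> t / 2 * (norm (u z))\<^sup>2 + 1 / (2 * t) * (norm (w z))\<^sup>2" for z
    proof -
      have "0 \<le> (t * norm (u z) - norm (w z))\<^sup>2 / (2 * t)" using t by simp
      also have "\<dots> = t / 2 * (norm (u z))\<^sup>2 + 1 / (2 * t) * (norm (w z))\<^sup>2 - norm (u z) * norm (w z)"
        using t by (simp add: field_simps power2_eq_square)
      finally show ?thesis using Cauchy_Schwarz_ineq2[of "u z" "w z"] by linarith
    qed
    have "?I \<le> (LINT z:A|lborel. \<bar>u z \<bullet> w z\<bar>)"
      using integral_norm_bound[of lborel "\<lambda>z. indicator A z *\<^sub>R (u z \<bullet> w z)"]
      by (simp add: set_lebesgue_integral_def abs_mult)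
    also have "\<dots> \<le> (LINT z:A|lborel. t / 2 * (norm (u z))\<^sup>2 + 1 / (2 * t) * (norm (w z))\<^sup>2)"
      by (intro set_integral_mono set_integrable_abs L2_inner_integrable u w set_integral_add(1) set_integrable_mult_right iu iw pt)
    also have "\<dots> = t / 2 * ?F\<^sup>2 + 1 / (2 * t) * ?G\<^sup>2"
      unfolding L2_norm_sq using iu iw by (subst set_integral_add(2)) (auto simp: set_integral_mult_right)
    finally show ?thesis by simp
  qed
  show ?thesis
  proof (cases "?F = 0 \<or> ?G = 0")
    case True
    have "?I \<le> e" if "e > 0" for e
    proof -
      consider "?F = 0" | "?G = 0" using True by blast
      then show ?thesis
      proof cases
        case 1
        define t where "t = (?G\<^sup>2 + 1) / e"
        have t: "t > 0" using that by (auto simp: t_def intro!: divide_pos_pos add_nonneg_pos)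
        have "?G\<^sup>2 / (2 * t) \<le> e"
        proof -
          have "?G\<^sup>2 \<le> e * (2 * t)" using that by (simp add: t_def)
          then show ?thesis using t by (simp add: pos_divide_le_eq)
        qed
        then show ?thesis using young[OF t] 1 by simp
      next
        case 2
        define t where "t = e / (?F\<^sup>2 + 1)"
        have p: "?F\<^sup>2 + 1 > 0" by (auto intro!: add_nonneg_pos)
        then have t: "t > 0" using that by (simp add: t_def)
        have "t * ?F\<^sup>2 / 2 \<le> e"
        proof -
          have "t * ?F\<^sup>2 \<le> t * (?F\<^sup>2 + 1)" using t by (intro mult_left_mono) auto
          also have "\<dots> = e" using p by (simp add: t_def)
          finally show ?thesis using that by simp
        qed
        then show ?thesis using young[OF t] 2 by simp
      qed
    qed
    then have "?I \<le> 0 + e" if "e > 0" for e using that by simp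
    then have "?I \<le> 0" by (rule field_le_epsilon)
    then show ?thesis using mult_nonneg_nonneg[OF L2_norm_nonneg[of A u] L2_norm_nonneg[of A w]] by linarith
  next
    case False
    then have F: "?F > 0" and G: "?G > 0" using L2_norm_nonneg[of A u] L2_norm_nonneg[of A w] by auto
    have "?G / ?F * ?F\<^sup>2 / 2 + ?G\<^sup>2 / (2 * (?G / ?F)) = ?F * ?G"
      using F G by (simp add: field_simps power2_eq_square)
    then show ?thesis using young[of "?G / ?F"] F G by simp
  qed
qed

text \<open>Pointwise one-sided limits, for every \<open>x\<close> in \<open>U\<close>, stand in for
  the traces at the two ends. Both the exact field, through its continuity in time, and discrete
  functions, as polynomials in time, possess them.\<close>

definition slab_H1 ::
  "real \<Rightarrow> real \<Rightarrow> 'b::euclidean_space set \<Rightarrow> (real \<times> 'b \<Rightarrow> real) \<Rightarrow> ('b \<Rightarrow> real) \<Rightarrow> ('b \<Rightarrow> real) \<Rightarrow> bool" where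
  "slab_H1 a b U u ua ub \<longleftrightarrow> sobolev 1 ({a<..<b} \<times> U) u \<and>
     (\<forall>x\<in>U. continuous_on {a<..<b} (\<lambda>t. u (t, x)) \<and>
       ((\<lambda>t. u (t, x)) \<longlongrightarrow> ua x) (at_right a) \<and> ((\<lambda>t. u (t, x)) \<longlongrightarrow> ub x) (at_left b))"

lemma slab_H1_diff:
  assumes "slab_H1 a b U u ua ub" "slab_H1 a b U w wa wb" "open U"
  shows "slab_H1 a b U (\<lambda>z. u z - w z) (\<lambda>x. ua x - wa x) (\<lambda>x. ub x - wb x)"
  using assms unfolding slab_H1_def
  by (auto intro!: sobolev_diff(1) open_Times continuous_intros tendsto_intros)

lemma slab_H1_subset:
  assumes "slab_H1 a b U u ua ub" "V \<subseteq> U" "open V" "open U"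
  shows "slab_H1 a b V u ua ub"
proof -
  have sub: "{a<..<b} \<times> V \<subseteq> {a<..<b} \<times> U" using assms(2) by auto
  have "sobolev 1 ({a<..<b} \<times> V) u"
    by (rule sobolev_restrict(1)[OF _ _ _ sub]) (use assms in \<open>auto simp: slab_H1_def open_Times\<close>)
  then show ?thesis using assms(1,2) unfolding slab_H1_def by blast
qed

lemma trace_measurable:
  assumes u: "set_borel_measurable lborel ({a<..<b} \<times> U) (u :: real \<times> 'b::euclidean_space \<Rightarrow> real)"
    and s: "\<And>n. s n \<in> {a<..<b}" and lim: "\<And>x. x \<in> U \<Longrightarrow> (\<lambda>n. u (s n, x)) \<longlonglongrightarrow> v x"
  shows "set_borel_measurable lborel U v"
  unfolding set_borel_measurable_def
proof (rule borel_measurable_LIMSEQ_metric)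
  have m: "(\<lambda>z. indicator ({a<..<b} \<times> U) z *\<^sub>R u z) \<in> borel_measurable borel"
    using u by (simp add: set_borel_measurable_def)
  show "(\<lambda>x. indicator ({a<..<b} \<times> U) (s n, x) *\<^sub>R u (s n, x)) \<in> borel_measurable lborel" for n
  proof -
    have "(\<lambda>x::'b. (s n, x)) \<in> borel \<rightarrow>\<^sub>M borel"
      by (intro borel_measurable_continuous_onI continuous_intros)
    from measurable_compose[OF this m] show ?thesis by simp
  qed
  show "(\<lambda>n. indicator ({a<..<b} \<times> U) (s n, x) *\<^sub>R u (s n, x)) \<longlonglongrightarrow> indicator U x *\<^sub>R v x" for x
    using s lim[of x] by (cases "x \<in> U") (auto simp: indicator_def)
qed

lemma slab_H1_trace_measurable:
  assumes u: "slab_H1 a b U u ua ub" and ab: "a < b"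
  shows "set_borel_measurable lborel U ua" "set_borel_measurable lborel U ub"
proof -
  have m: "set_borel_measurable lborel ({a<..<b} \<times> U) u"
    using u by (auto simp: slab_H1_def dest!: sobolev_L2 simp: L2_on_def)
  define \<tau> where "\<tau> n = (b - a) / (real n + 2)" for n
  have \<tau>: "0 < \<tau> n" "\<tau> n < b - a" for n
    using ab mult_strict_left_mono[of 1 "real n + 2" "b - a"] by (simp_all add: \<tau>_def pos_divide_less_eq)
  have "(\<lambda>n. (b - a) * inverse (real (n + 2))) \<longlonglongrightarrow> (b - a) * 0"
    by (intro tendsto_intros LIMSEQ_ignore_initial_segment[OF lim_inverse_n])
  then have \<tau>0: "\<tau> \<longlonglongrightarrow> 0" by (simp add: \<tau>_def[abs_def] divide_inverse add.commute)
  have "filterlim (\<lambda>n. a + \<tau> n) (at_right a) sequentially"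
    using tendsto_add[OF tendsto_const \<tau>0, of a] \<tau>(1) by (auto simp: filterlim_at intro!: always_eventually less_imp_neq[THEN not_sym])
  then show "set_borel_measurable lborel U ua"
    using u \<tau> by (intro trace_measurable[OF m, of "\<lambda>n. a + \<tau> n"])
      (auto simp: slab_H1_def less_diff_eq add.commute intro: filterlim_compose)
  have "filterlim (\<lambda>n. b - \<tau> n) (at_left b) sequentially"
    using tendsto_diff[OF tendsto_const \<tau>0, of b] \<tau>(1) by (auto simp: filterlim_at intro!: always_eventually less_imp_neq[THEN not_sym])
  then show "set_borel_measurable lborel U ub"
    using u \<tau> by (intro trace_measurable[OF m, of "\<lambda>n. b - \<tau> n"])
      (auto simp: slab_H1_def less_diff_eq add.commute intro: filterlim_compose)
qed

lemma time_basis: "(1, 0) \<in> (Basis :: (real \<times> 'b::euclidean_space) set)"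
  by (simp add: Basis_prod_def)

lemma space_basis: "e \<in> Basis \<Longrightarrow> (0, e) \<in> (Basis :: (real \<times> 'b::euclidean_space) set)"
  by (simp add: Basis_prod_def)

lemma affine_weight_integrable:
  fixes F :: "real \<times> 'b::euclidean_space \<Rightarrow> real"
  assumes "set_integrable lborel ({a<..<b} \<times> U) F"
  shows "set_integrable lborel ({a<..<b} \<times> U) (\<lambda>z. (\<alpha> + \<beta> * fst z) * F z)"
proof -
  have "set_integrable lborel ({a<..<b} \<times> U) (\<lambda>z. F z * (\<alpha> + \<beta> * fst z))"
  proof (rule set_integrable_times_bounded[OF assms])
    show "(\<lambda>z :: real \<times> 'b. \<alpha> + \<beta> * fst z) \<in> borel_measurable borel"
      by (intro borel_measurable_continuous_onI continuous_intros)
    fix z :: "real \<times> 'b" assume "z \<in> {a<..<b} \<times> U"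
    then have "\<bar>fst z\<bar> \<le> \<bar>a\<bar> + \<bar>b\<bar>" by auto
    then have "\<bar>\<beta>\<bar> * \<bar>fst z\<bar> \<le> \<bar>\<beta>\<bar> * (\<bar>a\<bar> + \<bar>b\<bar>)" by (intro mult_left_mono) auto
    then show "\<bar>\<alpha> + \<beta> * fst z\<bar> \<le> \<bar>\<alpha>\<bar> + \<bar>\<beta>\<bar> * (\<bar>a\<bar> + \<bar>b\<bar>)"
      using abs_triangle_ineq[of \<alpha> "\<beta> * fst z"] by (simp add: abs_mult)
  qed
  then show ?thesis by (simp add: mult.commute)
qed

text \<open>The boundary terms at the two ends are kept under one integral: that each of them is
  integrable by itself is derived from this version in \<open>slab_H1_trace_L2\<close>.\<close>

lemma time_green_pre:
  fixes U :: "'b::euclidean_space set"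
  assumes u: "slab_H1 a b U u ua ub" and w: "slab_H1 a b U w wa wb"
    and ab: "a < b" and U: "open U" "bounded U"
  defines "S \<equiv> {a<..<b} \<times> U"
  defines "D \<equiv> wderiv S {#(1, 0)#}"
  shows "set_integrable lborel U (\<lambda>x. (\<alpha> + \<beta> * b) * (ub x * wb x) - (\<alpha> + \<beta> * a) * (ua x * wa x))" (is ?int)
    and "(LINT z:S|lborel. (\<alpha> + \<beta> * fst z) * (D u z * w z + u z * D w z) + \<beta> * (u z * w z))
      = (LINT x:U|lborel. (\<alpha> + \<beta> * b) * (ub x * wb x) - (\<alpha> + \<beta> * a) * (ua x * wa x))" (is ?eq)
proof -
  have S: "open S" "bounded S" "S \<in> sets borel" using U by (auto simp: S_def open_Times bounded_Times)
  have su: "sobolev 1 S u" and sw: "sobolev 1 S w" using u w by (auto simp: slab_H1_def S_def)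
  have wu: "weak_deriv S {#(1, 0)#} u (D u)" "L2_on S (D u)"
    and ww: "weak_deriv S {#(1, 0)#} w (D w)" "L2_on S (D w)"
    unfolding D_def using sobolev1_wderiv[OF su time_basis S(1)] sobolev1_wderiv[OF sw time_basis S(1)] by auto
  have L: "L2_on S u" "L2_on S w" using su sw sobolev_L2 by auto
  have I: "set_integrable lborel S v" if "L2_on S v" for v :: "real \<times> 'b \<Rightarrow> real"
    by (rule L2_on_integrable[OF that S(2,3)])
  let ?F = "\<lambda>z. (\<alpha> + \<beta> * fst z) * (D u z * w z + u z * D w z) + \<beta> * (u z * w z)"
  have F: "set_integrable lborel S ?F"
    unfolding S_def
    by (intro set_integral_add(1) affine_weight_integrable set_integrable_mult_right L2_mult_integrable)
       (use L wu ww in \<open>auto simp: S_def\<close>)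
  have inner: "AE x in lborel. x \<in> U \<longrightarrow> (LINT r:{a<..<b}|lborel. ?F (r, x))
     = (\<alpha> + \<beta> * b) * (ub x * wb x) - (\<alpha> + \<beta> * a) * (ua x * wa x)"
  proof -
    have "AE x in lborel. x \<in> U \<longrightarrow> set_integrable lborel {a<..<b} (\<lambda>r. D u (r, x)) \<and>
      (\<forall>t\<in>{a<..<b}. u (t, x) = ua x + (LINT r:{a<..<t}|lborel. D u (r, x))) \<and>
      ub x = ua x + (LINT r:{a<..<b}|lborel. D u (r, x))"
      by (rule weak_time_deriv_FTC[OF U(1) ab wu(1)[unfolded S_def] I[OF L(1), unfolded S_def] I[OF wu(2), unfolded S_def]])
         (use u in \<open>auto simp: slab_H1_def\<close>)
    moreover have "AE x in lborel. x \<in> U \<longrightarrow> set_integrable lborel {a<..<b} (\<lambda>r. D w (r, x)) \<and>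
      (\<forall>t\<in>{a<..<b}. w (t, x) = wa x + (LINT r:{a<..<t}|lborel. D w (r, x))) \<and>
      wb x = wa x + (LINT r:{a<..<b}|lborel. D w (r, x))"
      by (rule weak_time_deriv_FTC[OF U(1) ab ww(1)[unfolded S_def] I[OF L(2), unfolded S_def] I[OF ww(2), unfolded S_def]])
         (use w in \<open>auto simp: slab_H1_def\<close>)
    ultimately show ?thesis
    proof eventually_elim
      case (elim x)
      show ?case
      proof
        assume x: "x \<in> U"
        show "(LINT r:{a<..<b}|lborel. ?F (r, x)) = (\<alpha> + \<beta> * b) * (ub x * wb x) - (\<alpha> + \<beta> * a) * (ua x * wa x)"
          using AC_weighted_product[OF ab, of "\<lambda>r. D u (r, x)" "\<lambda>r. D w (r, x)" "\<lambda>r. u (r, x)" "ua x" "ub x" "\<lambda>r. w (r, x)" "wa x" "wb x" \<alpha> \<beta>]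
            elim x by simp
      qed
    qed
  qed
  have m: "set_borel_measurable lborel U (\<lambda>x. (\<alpha> + \<beta> * b) * (ub x * wb x) - (\<alpha> + \<beta> * a) * (ua x * wa x))"
  proof -
    note [measurable] = slab_H1_trace_measurable[OF u ab, unfolded set_borel_measurable_def]
      slab_H1_trace_measurable[OF w ab, unfolded set_borel_measurable_def]
    have "(\<lambda>x. (\<alpha> + \<beta> * b) * ((indicator U x *\<^sub>R ub x) * (indicator U x *\<^sub>R wb x))
       - (\<alpha> + \<beta> * a) * ((indicator U x *\<^sub>R ua x) * (indicator U x *\<^sub>R wa x))) \<in> borel_measurable lborel"
      by measurable
    moreover have "(\<lambda>x. (\<alpha> + \<beta> * b) * ((indicator U x *\<^sub>R ub x) * (indicator U x *\<^sub>R wb x))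
       - (\<alpha> + \<beta> * a) * ((indicator U x *\<^sub>R ua x) * (indicator U x *\<^sub>R wa x)))
       = (\<lambda>x. indicator U x *\<^sub>R ((\<alpha> + \<beta> * b) * (ub x * wb x) - (\<alpha> + \<beta> * a) * (ua x * wa x)))"
      by (auto simp: fun_eq_iff indicator_def)
    ultimately show ?thesis by (simp only: set_borel_measurable_def)
  qed
  have fub: "set_integrable lborel U (\<lambda>x. LINT r:{a<..<b}|lborel. ?F (r, x))"
    "(LINT z:S|lborel. ?F z) = (LINT x:U|lborel. LINT r:{a<..<b}|lborel. ?F (r, x))"
    using set_Fubini(2,3)[OF F[unfolded S_def]] by (simp_all add: S_def)
  have mf: "(\<lambda>x. indicator U x *\<^sub>R (LINT r:{a<..<b}|lborel. ?F (r, x))) \<in> borel_measurable lborel"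
    using fub(1) unfolding set_integrable_def by (rule borel_measurable_integrable)
  have AE': "AE x in lborel. indicator U x *\<^sub>R (LINT r:{a<..<b}|lborel. ?F (r, x))
     = indicator U x *\<^sub>R ((\<alpha> + \<beta> * b) * (ub x * wb x) - (\<alpha> + \<beta> * a) * (ua x * wa x))"
    using inner by eventually_elim (auto simp: indicator_def)
  show ?int
    using fub(1) unfolding set_integrable_def
    by (rule integrable_cong_AE[OF mf m[unfolded set_borel_measurable_def] AE', THEN iffD1])
  show ?eq
    unfolding fub(2) set_lebesgue_integral_def[of lborel U]
    by (rule integral_cong_AE[OF mf m[unfolded set_borel_measurable_def] AE'])
qed

text \<open>With both functions equal to \<open>u\<close>, the weight \<open>b - t\<close> leaves
  only the squared trace at \<open>a\<close>, and the weight \<open>t - a\<close> only the squared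
  trace at \<open>b\<close>, up to the factor \<open>b - a\<close>.\<close>

lemma slab_H1_trace_L2:
  assumes u: "slab_H1 a b U u ua ub" and ab: "a < b" and U: "open U" "bounded U"
  shows "L2_on U ua" "L2_on U ub"
proof -
  have "set_integrable lborel U (\<lambda>x. (b + (-1) * b) * (ub x * ub x) - (b + (-1) * a) * (ua x * ua x))"
    by (rule time_green_pre(1)[OF u u ab U])
  then have "set_integrable lborel U (\<lambda>x. (-1 / (b - a)) * ((b + (-1) * b) * (ub x * ub x) - (b + (-1) * a) * (ua x * ua x)))"
    by (rule set_integrable_mult_right)
  moreover have "(-1 / (b - a)) * ((b + (-1) * b) * (ub x * ub x) - (b + (-1) * a) * (ua x * ua x)) = (norm (ua x))\<^sup>2" for x
    using ab by (simp add: field_simps power2_eq_square)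
  ultimately show "L2_on U ua" using slab_H1_trace_measurable(1)[OF u ab] by (simp add: L2_on_def)
  have "set_integrable lborel U (\<lambda>x. (- a + 1 * b) * (ub x * ub x) - (- a + 1 * a) * (ua x * ua x))"
    by (rule time_green_pre(1)[OF u u ab U])
  then have "set_integrable lborel U (\<lambda>x. (1 / (b - a)) * ((- a + 1 * b) * (ub x * ub x) - (- a + 1 * a) * (ua x * ua x)))"
    by (rule set_integrable_mult_right)
  moreover have "(1 / (b - a)) * ((- a + 1 * b) * (ub x * ub x) - (- a + 1 * a) * (ua x * ua x)) = (norm (ub x))\<^sup>2" for x
    using ab by (simp add: field_simps power2_eq_square)
  ultimately show "L2_on U ub" using slab_H1_trace_measurable(2)[OF u ab] by (simp add: L2_on_def)
qed

theorem time_green: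
  fixes U :: "'b::euclidean_space set"
  assumes u: "slab_H1 a b U u ua ub" and w: "slab_H1 a b U w wa wb"
    and ab: "a < b" and U: "open U" "bounded U"
  defines "S \<equiv> {a<..<b} \<times> U"
  shows "(LINT z:S|lborel. (\<alpha> + \<beta> * fst z) * (wderiv S {#(1, 0)#} u z * w z + u z * wderiv S {#(1, 0)#} w z) + \<beta> * (u z * w z))
      = (\<alpha> + \<beta> * b) * (LINT x:U|lborel. ub x * wb x) - (\<alpha> + \<beta> * a) * (LINT x:U|lborel. ua x * wa x)"
proof -
  have i: "set_integrable lborel U (\<lambda>x. ub x * wb x)" "set_integrable lborel U (\<lambda>x. ua x * wa x)"
    using slab_H1_trace_L2[OF u ab U] slab_H1_trace_L2[OF w ab U] by (auto intro: L2_mult_integrable)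
  show ?thesis
    unfolding S_def time_green_pre(2)[OF u w ab U]
    by (subst set_integral_diff(2)) (use i in auto)
qed

section \<open>Integration by parts in space\<close>

lemma lateral_support_bounded:
  fixes \<phi> :: "real \<times> 'b::euclidean_space \<Rightarrow> real"
  assumes "continuous_on UNIV \<phi>" "compact C" "\<And>t x. x \<notin> C \<Longrightarrow> \<phi> (t, x) = 0"
  obtains B where "\<And>z. z \<in> {a<..<b} \<times> U \<Longrightarrow> \<bar>\<phi> z\<bar> \<le> B"
proof -
  have "compact (\<phi> ` ({a..b} \<times> C))"
    using assms(1,2) by (intro compact_continuous_image compact_Times) (auto intro: continuous_on_subset)
  then obtain B where B: "\<And>z. z \<in> {a..b} \<times> C \<Longrightarrow> \<bar>\<phi> z\<bar> \<le> B"
    by (meson bounded_real compact_imp_bounded imageI)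
  have "\<bar>\<phi> z\<bar> \<le> \<bar>B\<bar>" if "z \<in> {a<..<b} \<times> U" for z
  proof (cases "snd z \<in> C")
    case True
    then have "z \<in> {a..b} \<times> C" using that by (auto simp: mem_Times_iff)
    then show ?thesis using B[of z] by linarith
  next
    case False
    then show ?thesis using assms(3)[of "snd z" "fst z"] by simp
  qed
  then show ?thesis by (rule that)
qed

lemma lateral_partial_deriv_0:
  fixes \<phi> :: "real \<times> 'b::euclidean_space \<Rightarrow> real"
  assumes "compact C" "\<And>t x. x \<notin> C \<Longrightarrow> \<phi> (t, x) = 0" "x \<notin> C"
  shows "partial_deriv e \<phi> (t, x) = 0"
proof (rule partial_deriv_support[of "UNIV \<times> C"])
  show "closed (UNIV \<times> C :: (real \<times> 'b) set)"
    using assms(1) by (intro closed_Times) (auto simp: compact_imp_closed)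
qed (use assms in auto)

lemma smooth_ident: "smooth (\<lambda>r::real. r)"
  by (rule smooth_antiderivative(1)[of _ "\<lambda>_. 1"]) (auto intro: smooth_const derivative_eq_intros)

lemma partial_deriv_fst:
  "smooth \<omega> \<Longrightarrow> partial_deriv (0, e) (\<lambda>z :: real \<times> 'b::euclidean_space. \<omega> (fst z)) z = 0"
  using partial_deriv_comp_affine[of \<omega> "fst :: real \<times> 'b \<Rightarrow> real" "(0, e)" 0 z] by (simp add: linear_fst)

text \<open>\<open>\<phi>\<close> has compact support in space only. Multiplied by a bump in time it
  becomes a test function, and as the derivative is spatial it does not act on the bump. The bumps
  tend to 1 on the interval, and dominated convergence removes them.\<close>

lemma lateral_smooth_green:
  fixes u g \<phi> :: "real \<times> 'b::euclidean_space \<Rightarrow> real"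
  assumes w: "weak_deriv ({a<..<b} \<times> U) {#(0, e)#} u g" and e: "e \<in> Basis"
    and u: "set_integrable lborel ({a<..<b} \<times> U) u" and g: "set_integrable lborel ({a<..<b} \<times> U) g"
    and \<phi>: "smooth \<phi>" and C: "compact C" "C \<subseteq> U" "\<And>t x. x \<notin> C \<Longrightarrow> \<phi> (t, x) = 0"
  shows "(LINT z:{a<..<b} \<times> U|lborel. (\<alpha> + \<beta> * fst z) * (g z * \<phi> z + u z * partial_deriv (0, e) \<phi> z)) = 0"
proof -
  let ?S = "{a<..<b} \<times> U" and ?e = "(0, e) :: real \<times> 'b"
  define F where "F z = g z * \<phi> z + u z * partial_deriv ?e \<phi> z" for z
  have pd: "smooth (partial_deriv ?e \<phi>)" using smooth_partial_deriv[OF \<phi> space_basis[OF e]] .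
  have pd0: "partial_deriv ?e \<phi> (t, x) = 0" if "x \<notin> C" for t x
    by (rule lateral_partial_deriv_0[of C \<phi> x]) (use that C in auto)
  obtain B1 where B1: "\<And>z. z \<in> ?S \<Longrightarrow> \<bar>\<phi> z\<bar> \<le> B1"
    using lateral_support_bounded[OF smooth_continuous_on[OF \<phi>] C(1,3), where a=a and b=b and U=U] by metis
  obtain B2 where B2: "\<And>z. z \<in> ?S \<Longrightarrow> \<bar>partial_deriv ?e \<phi> z\<bar> \<le> B2"
    using lateral_support_bounded[OF smooth_continuous_on[OF pd] C(1) pd0, where a=a and b=b and U=U] by metis
  have i1: "set_integrable lborel ?S (\<lambda>z. g z * \<phi> z)"
    by (rule set_integrable_times_bounded[OF g smooth_borel[OF \<phi>] B1])
  have i2: "set_integrable lborel ?S (\<lambda>z. u z * partial_deriv ?e \<phi> z)"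
    by (rule set_integrable_times_bounded[OF u smooth_borel[OF pd] B2])
  have F: "set_integrable lborel ?S F" unfolding F_def using i1 i2 by (rule set_integral_add(1))
  define \<omega> where "\<omega> n r = bump n a b r * (\<alpha> + \<beta> * r)" for n :: nat and r
  have \<omega>: "smooth (\<omega> n)" for n
    unfolding \<omega>_def[abs_def] by (intro smooth_mult smooth_add smooth_const smooth_bump smooth_ident)
  define M where "M = \<bar>\<alpha>\<bar> + \<bar>\<beta>\<bar> * (\<bar>a\<bar> + \<bar>b\<bar>)"
  have M: "\<bar>\<omega> n (fst z)\<bar> \<le> M" if "z \<in> ?S" for n z
  proof -
    have "\<bar>fst z\<bar> \<le> \<bar>a\<bar> + \<bar>b\<bar>" using that by auto
    then have "\<bar>\<beta>\<bar> * \<bar>fst z\<bar> \<le> \<bar>\<beta>\<bar> * (\<bar>a\<bar> + \<bar>b\<bar>)" by (intro mult_left_mono) auto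
    then have m: "\<bar>\<alpha> + \<beta> * fst z\<bar> \<le> M"
      using abs_triangle_ineq[of \<alpha> "\<beta> * fst z"] by (simp add: abs_mult M_def)
    have "\<bar>\<omega> n (fst z)\<bar> = bump n a b (fst z) * \<bar>\<alpha> + \<beta> * fst z\<bar>"
      using bump_bounds(1)[of n a b "fst z"] by (simp add: \<omega>_def abs_mult)
    also have "\<dots> \<le> 1 * \<bar>\<alpha> + \<beta> * fst z\<bar>"
      using bump_bounds(2)[of n a b "fst z"] by (intro mult_right_mono) auto
    finally show ?thesis using m by simp
  qed
  have zero: "(LINT z:?S|lborel. F z * \<omega> n (fst z)) = 0" for n
  proof -
    define \<Theta> where "\<Theta> z = \<omega> n (fst z) * \<phi> z" for z
    have "test_function {a<..<b} (bump n a b)" by (rule test_function_bump) (simp add: box_real)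
    then obtain D where D: "compact D" "D \<subseteq> {a<..<b}" "\<And>r. r \<notin> D \<Longrightarrow> bump n a b r = 0"
      by (auto simp: test_function_def)
    have t: "test_function ?S \<Theta>"
      unfolding test_function_def
    proof (intro conjI exI[of _ "D \<times> C"] allI impI)
      show "smooth \<Theta>" unfolding \<Theta>_def[abs_def] by (intro smooth_mult smooth_fst \<omega> \<phi>)
      show "compact (D \<times> C)" using C D by (simp add: compact_Times)
      show "\<Theta> z = 0" if "z \<notin> D \<times> C" for z
        using that C(3)[of "snd z" "fst z"] D(3)[of "fst z"] by (auto simp: \<Theta>_def \<omega>_def mem_Times_iff)
    qed (use C D in auto)
    have pd\<Theta>: "partial_deriv ?e \<Theta> z = \<omega> n (fst z) * partial_deriv ?e \<phi> z" for z
      unfolding \<Theta>_def[abs_def] by (simp add: partial_deriv_mult[OF smooth_fst[OF \<omega>] \<phi>] partial_deriv_fst[OF \<omega>])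
    have j1: "set_integrable lborel ?S (\<lambda>z. g z * \<phi> z * \<omega> n (fst z))"
      by (rule set_integrable_times_bounded[OF i1 smooth_fst_borel[OF \<omega>] M])
    have j2: "set_integrable lborel ?S (\<lambda>z. u z * partial_deriv ?e \<phi> z * \<omega> n (fst z))"
      by (rule set_integrable_times_bounded[OF i2 smooth_fst_borel[OF \<omega>] M])
    have "(LINT z:?S|lborel. u z * partial_deriv ?e \<phi> z * \<omega> n (fst z)) = - (LINT z:?S|lborel. g z * \<phi> z * \<omega> n (fst z))"
      using weak_deriv_singleD[OF w t] by (simp add: pd\<Theta>) (simp add: \<Theta>_def mult_ac)
    then show ?thesis
      using set_integral_add(2)[OF j1 j2] by (simp add: F_def distrib_right)
  qed
  have F': "integrable lborel (\<lambda>z. indicator ?S z *\<^sub>R F z)" using F by (simp add: set_integrable_def)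
  note [measurable] = borel_measurable_integrable[OF F']
  have [measurable]: "(\<lambda>z :: real \<times> 'b. \<omega> n (fst z)) \<in> borel_measurable lborel" for n
    using smooth_fst_borel[OF \<omega>] by simp
  have [measurable]: "(\<lambda>z :: real \<times> 'b. \<alpha> + \<beta> * fst z) \<in> borel_measurable lborel"
    using smooth_fst_borel[OF smooth_add[OF smooth_const[of \<alpha>] smooth_mult[OF smooth_const[of \<beta>] smooth_ident]]] by simp
  have "(\<lambda>n. LINT z|lborel. (indicator ?S z *\<^sub>R F z) * \<omega> n (fst z)) \<longlonglongrightarrow> (LINT z|lborel. (indicator ?S z *\<^sub>R F z) * (\<alpha> + \<beta> * fst z))"
  proof (rule integral_dominated_convergence[where w="\<lambda>z. M * \<bar>indicator ?S z *\<^sub>R F z\<bar>"])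
    show "integrable lborel (\<lambda>z. M * \<bar>indicator ?S z *\<^sub>R F z\<bar>)" using F' by (intro integrable_mult_right integrable_abs)
    show "AE z in lborel. (\<lambda>n. (indicator ?S z *\<^sub>R F z) * \<omega> n (fst z)) \<longlonglongrightarrow> (indicator ?S z *\<^sub>R F z) * (\<alpha> + \<beta> * fst z)"
    proof (rule AE_I2)
      fix z :: "real \<times> 'b"
      show "(\<lambda>n. (indicator ?S z *\<^sub>R F z) * \<omega> n (fst z)) \<longlonglongrightarrow> (indicator ?S z *\<^sub>R F z) * (\<alpha> + \<beta> * fst z)"
      proof (cases "z \<in> ?S")
        case True
        then have "indicat_real (box a b) (fst z) = 1" by (auto simp: box_real)
        then have "(\<lambda>n. bump n a b (fst z)) \<longlonglongrightarrow> 1" using bump_tendsto[of a b "fst z"] by simp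
        then have "(\<lambda>n. \<omega> n (fst z)) \<longlonglongrightarrow> 1 * (\<alpha> + \<beta> * fst z)" unfolding \<omega>_def by (intro tendsto_intros)
        then show ?thesis by (intro tendsto_mult tendsto_const) simp
      qed simp
    qed
    show "AE z in lborel. norm ((indicator ?S z *\<^sub>R F z) * \<omega> n (fst z)) \<le> M * \<bar>indicator ?S z *\<^sub>R F z\<bar>" for n
    proof (rule AE_I2)
      fix z :: "real \<times> 'b"
      show "norm ((indicator ?S z *\<^sub>R F z) * \<omega> n (fst z)) \<le> M * \<bar>indicator ?S z *\<^sub>R F z\<bar>"
      proof (cases "z \<in> ?S")
        case True
        have "\<bar>F z\<bar> * \<bar>\<omega> n (fst z)\<bar> \<le> \<bar>F z\<bar> * M" using M[OF True] by (intro mult_left_mono) auto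
        then show ?thesis using True by (simp add: abs_mult mult.commute)
      qed simp
    qed
  qed measurable
  moreover have "(LINT z|lborel. (indicator ?S z *\<^sub>R F z) * \<omega> n (fst z)) = 0" for n
    using zero[of n] by (simp add: set_lebesgue_integral_def mult.assoc)
  ultimately have "(LINT z|lborel. (indicator ?S z *\<^sub>R F z) * (\<alpha> + \<beta> * fst z)) = 0"
    by (simp add: LIMSEQ_const_iff)
  then show ?thesis by (simp add: set_lebesgue_integral_def F_def mult_ac)
qed

lemma bounded_smooth_L2:
  fixes \<phi> :: "'a::euclidean_space \<Rightarrow> real"
  assumes "\<phi> \<in> borel_measurable borel" "\<And>z. z \<in> S \<Longrightarrow> \<bar>\<phi> z\<bar> \<le> B" "bounded S" "S \<in> sets borel"
  shows "L2_on S \<phi>"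
proof (rule L2_onI_bound)
  show "set_borel_measurable lborel S \<phi>"
    using assms(1,4) by (simp add: set_borel_measurable_def)
  show "set_integrable lborel S (\<lambda>_. B\<^sup>2)" by (rule set_integrable_const_bounded[OF assms(3,4)])
  show "(norm (\<phi> z))\<^sup>2 \<le> B\<^sup>2" if "z \<in> S" for z
    using assms(2)[OF that] by (intro power_mono) auto
qed

lemma lateral_smooth_sobolev:
  fixes \<phi> :: "real \<times> 'b::euclidean_space \<Rightarrow> real"
  assumes U: "open U" "bounded U" and \<phi>: "smooth \<phi>"
    and C: "compact C" "\<And>t x. x \<notin> C \<Longrightarrow> \<phi> (t, x) = 0"
  shows "sobolev 1 ({a<..<b} \<times> U) \<phi>"
proof (rule sobolev1I)
  have S: "bounded ({a<..<b} \<times> U)" "{a<..<b} \<times> U \<in> sets borel" using U by (auto simp: open_Times bounded_Times)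
  obtain B where "\<And>z. z \<in> {a<..<b} \<times> U \<Longrightarrow> \<bar>\<phi> z\<bar> \<le> B"
    using lateral_support_bounded[OF smooth_continuous_on[OF \<phi>] C, where a=a and b=b and U=U] by metis
  then show "L2_on ({a<..<b} \<times> U) \<phi>" by (rule bounded_smooth_L2[OF smooth_borel[OF \<phi>] _ S])
  fix i :: "real \<times> 'b" assume i: "i \<in> Basis"
  show "weak_deriv ({a<..<b} \<times> U) {#i#} \<phi> (partial_deriv i \<phi>)" by (rule smooth_weak_deriv[OF \<phi> i])
  have sm: "smooth (partial_deriv i \<phi>)" by (rule smooth_partial_deriv[OF \<phi> i])
  have pd0: "partial_deriv i \<phi> (t, x) = 0" if "x \<notin> C" for t x
    by (rule lateral_partial_deriv_0[of C \<phi> x]) (use that C in auto)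
  obtain B where "\<And>z. z \<in> {a<..<b} \<times> U \<Longrightarrow> \<bar>partial_deriv i \<phi> z\<bar> \<le> B"
    using lateral_support_bounded[OF smooth_continuous_on[OF sm] C(1) pd0, where a=a and b=b and U=U] by metis
  then show "L2_on ({a<..<b} \<times> U) (partial_deriv i \<phi>)" by (rule bounded_smooth_L2[OF smooth_borel[OF sm] _ S])
qed

lemma L2_affine_weight:
  fixes u :: "real \<times> 'b::euclidean_space \<Rightarrow> real"
  assumes "L2_on ({a<..<b} \<times> U) u"
  shows "L2_on ({a<..<b} \<times> U) (\<lambda>z. (\<alpha> + \<beta> * fst z) * u z)"
proof (rule L2_onI_bound)
  let ?S = "{a<..<b} \<times> U"
  have m: "(\<lambda>z. indicator ?S z *\<^sub>R u z) \<in> borel_measurable borel"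
    using assms by (simp add: L2_on_def set_borel_measurable_def)
  have "(\<lambda>z :: real \<times> 'b. \<alpha> + \<beta> * fst z) \<in> borel_measurable borel"
    by (intro borel_measurable_continuous_onI continuous_intros)
  then have "(\<lambda>z. (\<alpha> + \<beta> * fst z) * (indicator ?S z *\<^sub>R u z)) \<in> borel_measurable borel"
    using m by (rule borel_measurable_times)
  then show "set_borel_measurable lborel ?S (\<lambda>z. (\<alpha> + \<beta> * fst z) * u z)"
    by (simp add: set_borel_measurable_def mult_ac)
  show "set_integrable lborel ?S (\<lambda>z. (\<bar>\<alpha>\<bar> + \<bar>\<beta>\<bar> * (\<bar>a\<bar> + \<bar>b\<bar>))\<^sup>2 * (norm (u z))\<^sup>2)"
    using assms by (intro set_integrable_mult_right) (simp add: L2_on_def)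
  fix z assume "z \<in> ?S"
  then have "\<bar>fst z\<bar> \<le> \<bar>a\<bar> + \<bar>b\<bar>" by auto
  then have "\<bar>\<beta>\<bar> * \<bar>fst z\<bar> \<le> \<bar>\<beta>\<bar> * (\<bar>a\<bar> + \<bar>b\<bar>)" by (intro mult_left_mono) auto
  then have "\<bar>\<alpha> + \<beta> * fst z\<bar> \<le> \<bar>\<alpha>\<bar> + \<bar>\<beta>\<bar> * (\<bar>a\<bar> + \<bar>b\<bar>)"
    using abs_triangle_ineq[of \<alpha> "\<beta> * fst z"] by (simp add: abs_mult)
  then have "\<bar>\<alpha> + \<beta> * fst z\<bar>\<^sup>2 \<le> (\<bar>\<alpha>\<bar> + \<bar>\<beta>\<bar> * (\<bar>a\<bar> + \<bar>b\<bar>))\<^sup>2" by (rule power_mono) simp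
  then show "(norm ((\<alpha> + \<beta> * fst z) * u z))\<^sup>2 \<le> (\<bar>\<alpha>\<bar> + \<bar>\<beta>\<bar> * (\<bar>a\<bar> + \<bar>b\<bar>))\<^sup>2 * (norm (u z))\<^sup>2"
    by (simp add: power_mult_distrib mult_right_mono)
qed

text \<open>Only \<open>w\<close> vanishes on the lateral boundary, in the sense of approximation.
  For the smooth approximants the formula is exact; the rest is at most their H^1 distance from
  \<open>w\<close> times a constant that depends on \<open>u\<close> and the weight.\<close>

theorem lateral_green:
  fixes u w :: "spacetime \<Rightarrow> real"
  assumes U: "open U" "bounded U"
    and u: "sobolev 1 ({a<..<b} \<times> U) u" and w: "sobolev 1 ({a<..<b} \<times> U) w"
    and tr: "zero_lateral_trace a b U w" and e: "e \<in> Basis"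
  defines "S \<equiv> {a<..<b} \<times> U"
  defines "D \<equiv> wderiv S {#(0, e)#}"
  shows "(LINT z:S|lborel. (\<alpha> + \<beta> * fst z) * (D u z * w z + u z * D w z)) = 0"
proof -
  have S: "open S" "bounded S" "S \<in> sets borel" using U by (auto simp: S_def open_Times bounded_Times)
  have I: "set_integrable lborel S v" if "L2_on S v" for v :: "spacetime \<Rightarrow> real"
    by (rule L2_on_integrable[OF that S(2,3)])
  have su: "sobolev 1 S u" and sw: "sobolev 1 S w" using u w by (auto simp: S_def)
  have wu: "weak_deriv S {#(0, e)#} u (D u)" "L2_on S (D u)" "L2_on S u"
    and ww: "weak_deriv S {#(0, e)#} w (D w)" "L2_on S (D w)" "L2_on S w"
    unfolding D_def using sobolev1_wderiv[OF su space_basis[OF e] S(1)] sobolev1_wderiv[OF sw space_basis[OF e] S(1)]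
      sobolev_L2[OF su] sobolev_L2[OF sw] by auto
  obtain \<phi> where \<phi>: "\<And>n. smooth (\<phi> n)" "\<And>n. \<exists>C. compact C \<and> C \<subseteq> U \<and> (\<forall>t x. x \<notin> C \<longrightarrow> \<phi> n (t, x) = 0)"
    and lim: "(\<lambda>n. sobolev_norm 1 S (\<lambda>z. w z - \<phi> n z)) \<longlonglongrightarrow> 0"
    using tr unfolding zero_lateral_trace_def S_def by blast
  let ?I = "LINT z:S|lborel. (\<alpha> + \<beta> * fst z) * (D u z * w z + u z * D w z)"
  define N1 where "N1 = L2_norm S (\<lambda>z. (\<alpha> + \<beta> * fst z) * D u z)"
  define N2 where "N2 = L2_norm S (\<lambda>z. (\<alpha> + \<beta> * fst z) * u z)"
  have bound: "\<bar>?I\<bar> \<le> (N1 + N2) * sobolev_norm 1 S (\<lambda>z. w z - \<phi> n z)" for n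
  proof -
    obtain C where C: "compact C" "C \<subseteq> U" "\<And>t x. x \<notin> C \<Longrightarrow> \<phi> n (t, x) = 0" using \<phi>(2)[of n] by blast
    have pd0: "partial_deriv i (\<phi> n) (t, x) = 0" if "x \<notin> C" for i t x
      by (rule lateral_partial_deriv_0[of C "\<phi> n" x]) (use that C in auto)
    have s\<phi>: "sobolev 1 S (\<phi> n)"
      unfolding S_def by (rule lateral_smooth_sobolev[OF U \<phi>(1) C(1,3)])
    define \<eta> where "\<eta> z = w z - \<phi> n z" for z
    have s\<eta>: "sobolev 1 S \<eta>" unfolding \<eta>_def[abs_def] by (rule sobolev_diff(1)[OF sw s\<phi> S(1)])
    have L\<eta>: "L2_on S \<eta>" "L2_on S (D \<eta>)"
      using sobolev_L2[OF s\<eta>] sobolev1_wderiv(2)[OF s\<eta> space_basis[OF e] S(1)] by (auto simp: D_def)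
    have mi: "{#(0, e)#} \<in> (multi_indices 1 :: spacetime multiset set)" "{#} \<in> (multi_indices 1 :: spacetime multiset set)"
      using space_basis[OF e] by (auto simp: multi_indices_def)
    have L\<phi>: "L2_on S (\<phi> n)" "L2_on S (D (\<phi> n))"
      using sobolev_L2[OF s\<phi>] sobolev_wderiv(2)[OF s\<phi> mi(1) S(1)] by (auto simp: D_def)
    have AE1: "AE z in lborel. z \<in> S \<longrightarrow> D \<eta> z = D w z - D (\<phi> n) z"
      using sobolev_diff(2)[OF sw s\<phi> S(1) mi(1)] by (simp add: D_def \<eta>_def[abs_def])
    have AE2: "AE z in lborel. z \<in> S \<longrightarrow> D (\<phi> n) z = partial_deriv (0, e) (\<phi> n) z"
      unfolding D_def by (rule wderiv_AE_eq[OF S(1) smooth_weak_deriv[OF \<phi>(1) space_basis[OF e]]])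
    let ?\<theta> = "\<lambda>z :: spacetime. \<alpha> + \<beta> * fst z"
    have L1: "L2_on S (\<lambda>z. ?\<theta> z * D u z)" "L2_on S (\<lambda>z. ?\<theta> z * u z)"
      using wu L2_affine_weight unfolding S_def by blast+
    have i1: "set_integrable lborel S (\<lambda>z. (?\<theta> z * D u z) * \<eta> z)" and i2: "set_integrable lborel S (\<lambda>z. (?\<theta> z * u z) * D \<eta> z)"
      using L1 L\<eta> by (auto intro: L2_mult_integrable)
    have sm: "smooth (partial_deriv (0, e) (\<phi> n))" by (rule smooth_partial_deriv[OF \<phi>(1) space_basis[OF e]])
    obtain B1 where B1: "\<And>z. z \<in> S \<Longrightarrow> \<bar>partial_deriv (0, e) (\<phi> n) z\<bar> \<le> B1"
      using lateral_support_bounded[OF smooth_continuous_on[OF sm] C(1) pd0, where a=a and b=b and U=U] unfolding S_def by metis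
    have i3: "set_integrable lborel S (\<lambda>z. ?\<theta> z * (D u z * \<phi> n z + u z * partial_deriv (0, e) (\<phi> n) z))"
      unfolding S_def
    proof (intro affine_weight_integrable set_integral_add(1))
      show "set_integrable lborel ({a<..<b} \<times> U) (\<lambda>z. D u z * \<phi> n z)"
        using L2_mult_integrable[OF wu(2) L\<phi>(1)] by (simp add: S_def)
      show "set_integrable lborel ({a<..<b} \<times> U) (\<lambda>z. u z * partial_deriv (0, e) (\<phi> n) z)"
        using set_integrable_times_bounded[OF I[OF wu(3)] smooth_borel[OF sm] B1] by (simp add: S_def)
    qed
    have i4: "set_integrable lborel S (\<lambda>z. ?\<theta> z * (D u z * w z + u z * D w z))"
      using L2_mult_integrable[OF wu(2) ww(3)] L2_mult_integrable[OF wu(3) ww(2)] unfolding S_def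
      by (intro affine_weight_integrable set_integral_add(1))
    have z: "(LINT z:S|lborel. ?\<theta> z * (D u z * \<phi> n z + u z * partial_deriv (0, e) (\<phi> n) z)) = 0"
      unfolding S_def
      by (rule lateral_smooth_green[OF wu(1)[unfolded S_def] e I[OF wu(3), unfolded S_def] I[OF wu(2), unfolded S_def] \<phi>(1) C])
    have "?I = (LINT z:S|lborel. (?\<theta> z * D u z) * \<eta> z + (?\<theta> z * u z) * D \<eta> z
       + ?\<theta> z * (D u z * \<phi> n z + u z * partial_deriv (0, e) (\<phi> n) z))"
      unfolding set_lebesgue_integral_def
    proof (rule integral_cong_AE)
      show "(\<lambda>z. indicator S z *\<^sub>R (?\<theta> z * (D u z * w z + u z * D w z))) \<in> borel_measurable lborel"
        using i4 unfolding set_integrable_def by (rule borel_measurable_integrable)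
      show "(\<lambda>z. indicator S z *\<^sub>R ((?\<theta> z * D u z) * \<eta> z + (?\<theta> z * u z) * D \<eta> z
       + ?\<theta> z * (D u z * \<phi> n z + u z * partial_deriv (0, e) (\<phi> n) z))) \<in> borel_measurable lborel"
        using set_integral_add(1)[OF set_integral_add(1)[OF i1 i2] i3] unfolding set_integrable_def by (rule borel_measurable_integrable)
      show "AE z in lborel. indicator S z *\<^sub>R (?\<theta> z * (D u z * w z + u z * D w z))
        = indicator S z *\<^sub>R ((?\<theta> z * D u z) * \<eta> z + (?\<theta> z * u z) * D \<eta> z
         + ?\<theta> z * (D u z * \<phi> n z + u z * partial_deriv (0, e) (\<phi> n) z))"
        using AE1 AE2
      proof eventually_elim
        case (elim z)
        show ?case
        proof (cases "z \<in> S")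
          case True
          then have e: "D w z = D \<eta> z + partial_deriv (0, e) (\<phi> n) z" using elim by simp
          have w: "w z = \<eta> z + \<phi> n z" by (simp add: \<eta>_def)
          show ?thesis unfolding e w by (simp add: algebra_simps)
        qed simp
      qed
    qed
    also have "\<dots> = (LINT z:S|lborel. (?\<theta> z * D u z) * \<eta> z) + (LINT z:S|lborel. (?\<theta> z * u z) * D \<eta> z)"
      using z by (simp add: set_integral_add(2)[OF set_integral_add(1)[OF i1 i2] i3] set_integral_add(2)[OF i1 i2])
    finally have "\<bar>?I\<bar> \<le> \<bar>LINT z:S|lborel. (?\<theta> z * D u z) * \<eta> z\<bar> + \<bar>LINT z:S|lborel. (?\<theta> z * u z) * D \<eta> z\<bar>"
      using abs_triangle_ineq by simp
    also have "\<dots> \<le> N1 * L2_norm S \<eta> + N2 * L2_norm S (D \<eta>)"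
      unfolding N1_def N2_def
      using L2_Cauchy_Schwarz[OF L1(1) L\<eta>(1)] L2_Cauchy_Schwarz[OF L1(2) L\<eta>(2)]
      by (intro add_mono) (simp_all add: inner_real_def)
    also have "\<dots> \<le> N1 * sobolev_norm 1 S \<eta> + N2 * sobolev_norm 1 S \<eta>"
    proof (intro add_mono mult_left_mono)
      have m: "set_borel_measurable lborel S (wderiv S {#} \<eta>)" "set_borel_measurable lborel S \<eta>"
        using sobolev_wderiv(2)[OF s\<eta> mi(2) S(1)] L\<eta>(1) by (auto simp: L2_on_def)
      have "L2_norm S \<eta> = L2_norm S (wderiv S {#} \<eta>)"
        by (rule L2_norm_AE_cong[OF m(1,2), symmetric])
           (rule wderiv_AE_eq[OF S(1) weak_deriv_empty[OF L2_on_locally_integrable[OF L\<eta>(1)]]])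
      then show "L2_norm S \<eta> \<le> sobolev_norm 1 S \<eta>" using L2_norm_le_sobolev_norm[OF mi(2)] by simp
      show "L2_norm S (D \<eta>) \<le> sobolev_norm 1 S \<eta>" unfolding D_def by (rule L2_norm_le_sobolev_norm[OF mi(1)])
      show "0 \<le> N1" "0 \<le> N2" by (simp_all add: N1_def N2_def L2_norm_nonneg)
    qed
    finally show ?thesis by (simp add: distrib_right \<eta>_def[abs_def])
  qed
  have "(\<lambda>n. (N1 + N2) * sobolev_norm 1 S (\<lambda>z. w z - \<phi> n z)) \<longlonglongrightarrow> (N1 + N2) * 0"
    by (intro tendsto_intros lim)
  then have "\<bar>?I\<bar> \<le> (N1 + N2) * 0"
    by (rule tendsto_lowerbound) (use bound in auto)
  then show ?thesis by simp
qed

section \<open>The Maxwell operator\<close>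

lemma set_integral_sum:
  fixes f :: "'i \<Rightarrow> 'a \<Rightarrow> real"
  assumes "\<And>i. i \<in> I \<Longrightarrow> set_integrable M A (f i)"
  shows "set_integrable M A (\<lambda>z. \<Sum>i\<in>I. f i z)"
    and "(LINT z:A|M. \<Sum>i\<in>I. f i z) = (\<Sum>i\<in>I. LINT z:A|M. f i z)"
  using assms unfolding set_integrable_def set_lebesgue_integral_def
  by (simp_all only: scaleR_sum_right Bochner_Integration.integrable_sum Bochner_Integration.integral_sum)

lemma set_borel_measurable_vec_nth:
  fixes u :: "'a::euclidean_space \<Rightarrow> real ^ 'n"
  shows "set_borel_measurable lborel A u \<longleftrightarrow> (\<forall>c. set_borel_measurable lborel A (\<lambda>z. u z $ c))"
proof
  assume u: "set_borel_measurable lborel A u"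
  show "\<forall>c. set_borel_measurable lborel A (\<lambda>z. u z $ c)"
  proof
    fix c
    have "(\<lambda>z. (indicator A z *\<^sub>R u z) \<bullet> axis c 1) \<in> borel_measurable lborel"
      using u unfolding set_borel_measurable_def by (intro borel_measurable_inner borel_measurable_const)
    then show "set_borel_measurable lborel A (\<lambda>z. u z $ c)" by (simp add: set_borel_measurable_def inner_axis)
  qed
next
  assume u: "\<forall>c. set_borel_measurable lborel A (\<lambda>z. u z $ c)"
  have "(\<lambda>z. (indicator A z *\<^sub>R u z) \<bullet> i) \<in> borel_measurable lborel" if "i \<in> Basis" for i
  proof -
    have "i \<in> range (\<lambda>c. axis c (1 :: real))" using that by (auto simp: Basis_vec_def)
    then obtain c where "i = axis c 1" by blast
    then have "(\<lambda>z. (indicator A z *\<^sub>R u z) \<bullet> i) = (\<lambda>z. indicator A z *\<^sub>R (u z $ c))"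
      by (simp add: inner_axis fun_eq_iff)
    then show ?thesis using u unfolding set_borel_measurable_def by metis
  qed
  then show "set_borel_measurable lborel A u"
    unfolding set_borel_measurable_def by (subst borel_measurable_euclidean_space) blast
qed

lemma norm_vec_sq: "(norm (v :: real ^ 'n))\<^sup>2 = (\<Sum>c\<in>UNIV. (v $ c)\<^sup>2)"
  unfolding power2_norm_eq_inner inner_vec_def by (simp add: power2_eq_square)

lemma L2_on_vec_nth:
  fixes u :: "'a::euclidean_space \<Rightarrow> real ^ 'n"
  shows "L2_on A u \<longleftrightarrow> (\<forall>c. L2_on A (\<lambda>z. u z $ c))"
proof
  assume u: "L2_on A u"
  show "\<forall>c. L2_on A (\<lambda>z. u z $ c)"
  proof
    fix c
    show "L2_on A (\<lambda>z. u z $ c)"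
    proof (rule L2_onI_bound)
      show "set_borel_measurable lborel A (\<lambda>z. u z $ c)"
        using u set_borel_measurable_vec_nth by (auto simp: L2_on_def)
      show "set_integrable lborel A (\<lambda>z. (norm (u z))\<^sup>2)" using u by (simp add: L2_on_def)
      show "(norm (u z $ c))\<^sup>2 \<le> (norm (u z))\<^sup>2" for z
        using component_le_norm_cart[of "u z" c] by (intro power_mono) auto
    qed
  qed
next
  assume u: "\<forall>c. L2_on A (\<lambda>z. u z $ c)"
  show "L2_on A u"
  proof (rule L2_onI_bound)
    show "set_borel_measurable lborel A u"
      using u set_borel_measurable_vec_nth by (auto simp: L2_on_def)
    show "set_integrable lborel A (\<lambda>z. \<Sum>c\<in>UNIV. (norm (u z $ c))\<^sup>2)"
      using u by (intro set_integral_sum(1)) (auto simp: L2_on_def)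
    show "(norm (u z))\<^sup>2 \<le> (\<Sum>c\<in>UNIV. (norm (u z $ c))\<^sup>2)" for z
      by (simp add: norm_vec_sq)
  qed
qed

lemma L2_norm_vec_sq:
  fixes u :: "'a::euclidean_space \<Rightarrow> real ^ 'n"
  assumes "L2_on A u"
  shows "(L2_norm A u)\<^sup>2 = (\<Sum>c\<in>UNIV. (L2_norm A (\<lambda>z. u z $ c))\<^sup>2)"
  using assms unfolding L2_norm_sq L2_on_vec_nth norm_vec_sq
  by (subst set_integral_sum(2)) (auto simp: L2_on_def)

lemma maxwell_op_nth:
  "maxwell_op S u z $ c = wderiv S {#(1, 0)#} (\<lambda>y. u y $ c) z +
     (\<Sum>l\<in>UNIV. \<Sum>d\<in>UNIV. maxwell_matrix l $ c $ d * wderiv S {#(0, axis l 1)#} (\<lambda>y. u y $ d) z)"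
  by (simp add: maxwell_op_def dt_def dx_def matrix_vector_mult_def)

lemma space_axis_basis: "(0, axis l 1) \<in> (Basis :: spacetime set)"
  by (intro space_basis) (simp add: axis_in_Basis_iff)

lemma single_multi_index: "b \<in> Basis \<Longrightarrow> {#b#} \<in> multi_indices 1"
  by (simp add: multi_indices_def)

lemma maxwell_op_L2:
  assumes "sobolev_vec 1 S u" "open S"
  shows "L2_on S (maxwell_op S u)"
  unfolding L2_on_vec_nth
proof
  fix c
  have s: "sobolev 1 S (\<lambda>z. u z $ d)" for d using assms(1) by (simp add: sobolev_vec_def)
  have L: "L2_on S (wderiv S {#b#} (\<lambda>z. u z $ d))" if "b \<in> Basis" for b d
    by (rule sobolev1_wderiv(2)[OF s that assms(2)])
  have m: "L2_on S (\<lambda>z. m * wderiv S {#b#} (\<lambda>z. u z $ d) z)" if "b \<in> Basis" for m b d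
    using L2_on_cmult[OF L[OF that], of m] by simp
  show "L2_on S (\<lambda>z. maxwell_op S u z $ c)"
    unfolding maxwell_op_nth by (intro L2_on_add L2_on_sum L m time_basis space_axis_basis)
qed

text \<open>Finitely many weak derivatives enter the operator, so their exceptional sets can be
  united. Restriction, differences and the zero function are all treated through this rule.\<close>

lemma maxwell_op_AE_eqI:
  assumes "\<forall>b\<in>Basis. \<forall>d. AE z in lborel. z \<in> V \<longrightarrow> wderiv V {#b#} (\<lambda>y. u y $ d) z = F b d z"
  shows "AE z in lborel. z \<in> V \<longrightarrow> maxwell_op V u z =
    (\<chi> c. F (1, 0) c z + (\<Sum>l\<in>UNIV. \<Sum>d\<in>UNIV. maxwell_matrix l $ c $ d * F (0, axis l 1) d z))"
proof -
  have "AE z in lborel. \<forall>d. z \<in> V \<longrightarrow> wderiv V {#(1, 0)#} (\<lambda>y. u y $ d) z = F (1, 0) d z"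
    by (subst AE_all_countable) (use assms time_basis in blast)
  moreover have "AE z in lborel. \<forall>d l. z \<in> V \<longrightarrow> wderiv V {#(0, axis l 1)#} (\<lambda>y. u y $ d) z = F (0, axis l 1) d z"
    by (subst AE_all_countable, rule allI, subst AE_all_countable) (use assms space_axis_basis in blast)
  ultimately show ?thesis
    by eventually_elim (auto simp: vec_eq_iff maxwell_op_nth)
qed

text \<open>\<open>wderiv\<close> chooses its representative anew for each set, so the operators on
  \<open>V\<close> and \<open>S\<close> are compared through the uniqueness of weak derivatives, up
  to a null set.\<close>

lemma maxwell_op_restrict:
  assumes "sobolev_vec 1 S u" "open S" "open V" "V \<subseteq> S"
  shows "AE z in lborel. z \<in> V \<longrightarrow> maxwell_op V u z = maxwell_op S u z"
proof -
  have "\<forall>b\<in>Basis. \<forall>d. AE z in lborel. z \<in> V \<longrightarrow> wderiv V {#b#} (\<lambda>y. u y $ d) z = wderiv S {#b#} (\<lambda>y. u y $ d) z"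
    by (intro ballI allI, rule sobolev_restrict(2)[OF _ assms(2-4) single_multi_index]) (use assms(1) in \<open>simp add: sobolev_vec_def\<close>)
  from maxwell_op_AE_eqI[of V u "\<lambda>b d z. wderiv S {#b#} (\<lambda>y. u y $ d) z", OF this]
  show ?thesis by eventually_elim (auto simp: vec_eq_iff maxwell_op_nth)
qed

lemma sobolev_vec_restrict:
  "sobolev_vec s S u \<Longrightarrow> open S \<Longrightarrow> open V \<Longrightarrow> V \<subseteq> S \<Longrightarrow> sobolev_vec s V u"
  unfolding sobolev_vec_def using sobolev_restrict(1) by blast

lemma maxwell_op_diff:
  assumes "sobolev_vec 1 S u" "sobolev_vec 1 S w" "open S"
  shows "AE z in lborel. z \<in> S \<longrightarrow> maxwell_op S (\<lambda>z. u z - w z) z = maxwell_op S u z - maxwell_op S w z"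
proof -
  have "\<forall>b\<in>Basis. \<forall>d. AE z in lborel. z \<in> S \<longrightarrow> wderiv S {#b#} (\<lambda>y. (u y - w y) $ d) z
      = wderiv S {#b#} (\<lambda>y. u y $ d) z - wderiv S {#b#} (\<lambda>y. w y $ d) z"
    unfolding vector_minus_component
    by (intro ballI allI, rule sobolev_diff(2)[OF _ _ assms(3) single_multi_index]) (use assms in \<open>simp_all add: sobolev_vec_def\<close>)
  from maxwell_op_AE_eqI[of S "\<lambda>z. u z - w z" "\<lambda>b d z. wderiv S {#b#} (\<lambda>y. u y $ d) z - wderiv S {#b#} (\<lambda>y. w y $ d) z", OF this]
  show ?thesis
    by eventually_elim (auto simp: vec_eq_iff maxwell_op_nth right_diff_distrib sum_subtractf)
qed

lemma maxwell_op_cong: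
  assumes "\<And>z. z \<in> S \<Longrightarrow> u z = w z"
  shows "maxwell_op S u = maxwell_op S w"
proof -
  have "wderiv S \<alpha> (\<lambda>y. u y $ d) = wderiv S \<alpha> (\<lambda>y. w y $ d)" for \<alpha> d
    by (rule wderiv_cong) (simp add: assms)
  then show ?thesis by (simp add: fun_eq_iff vec_eq_iff maxwell_op_nth)
qed

lemma maxwell_op_zero:
  assumes "open S"
  shows "AE z in lborel. z \<in> S \<longrightarrow> maxwell_op S (\<lambda>_. 0) z = 0"
proof -
  have "\<forall>b\<in>(Basis :: spacetime set). \<forall>d. AE z in lborel. z \<in> S \<longrightarrow> wderiv S {#b#} (\<lambda>y. (0 :: em) $ d) z = 0"
    using sobolev_zero(2)[OF assms] by simp
  from maxwell_op_AE_eqI[of S "\<lambda>_. 0" "\<lambda>b d z. 0", OF this]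
  show ?thesis by eventually_elim (auto simp: vec_eq_iff)
qed

text \<open>By Lagrange's identity, the cross product with the unit vector \<open>axis l 1\<close>
  does not increase the norm, and the matrix acts on the two halves of \<open>w\<close> by such
  cross products.\<close>

lemma norm_maxwell_matrix_mult: "norm (maxwell_matrix l *v w) \<le> norm w"
proof -
  have "(norm (cross3 (axis l 1) v))\<^sup>2 \<le> (norm v)\<^sup>2" for v :: "real^3"
    using norm_cross[of "axis l 1" v] by simp
  then have "(norm (maxwell_matrix l *v w))\<^sup>2 \<le> (norm w)\<^sup>2"
    unfolding maxwell_matrix_mult power2_norm_eq_inner em_inner part_em_vec
    by (simp add: add_mono add.commute)
  then show ?thesis by (simp add: power2_le_iff_abs_le)
qed

lemma sum_Basis_spacetime:
  fixes f :: "spacetime \<Rightarrow> real"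
  shows "(\<Sum>b\<in>Basis. f b) = f (1, 0) + (\<Sum>l\<in>UNIV. f (0, axis l 1))"
proof -
  have B: "(Basis :: (real^3) set) = range (\<lambda>l. axis l 1)" by (auto simp: Basis_vec_def)
  have "inj (\<lambda>l :: 3. (0 :: real, axis l (1 :: real)))" by (auto simp: inj_def axis_eq_axis)
  then have "(\<Sum>b\<in>(\<lambda>v. (0, v)) ` (Basis :: (real^3) set). f b) = (\<Sum>l\<in>UNIV. f (0, axis l 1))"
    unfolding B image_image by (subst sum.reindex) auto
  moreover have B2: "(Basis :: spacetime set) = insert (1, 0) ((\<lambda>v. (0, v)) ` Basis)"
    by (auto simp: Basis_prod_def)
  moreover have "(1, 0) \<notin> (\<lambda>v. (0, v)) ` (Basis :: (real^3) set)" by auto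
  ultimately show ?thesis unfolding B2 by (subst sum.insert) auto
qed

text \<open>The constant 4 counts the directions, one in time and three in space: a sum of four
  terms is squared.\<close>

lemma maxwell_op_norm_bound:
  "(norm (maxwell_op S u z))\<^sup>2 \<le> 4 * (\<Sum>c\<in>UNIV. \<Sum>b\<in>Basis. (wderiv S {#b#} (\<lambda>y. u y $ c) z)\<^sup>2)"
proof -
  let ?t = "norm (dt S u z)" and ?x = "\<lambda>l. norm (dx S l u z)"
  have "norm (maxwell_op S u z) \<le> ?t + (\<Sum>l\<in>UNIV. norm (maxwell_matrix l *v dx S l u z))"
    unfolding maxwell_op_def by (intro norm_triangle_le add_mono norm_sum order_refl)
  also have "\<dots> \<le> ?t + (\<Sum>l\<in>UNIV. ?x l)"
    by (intro add_mono sum_mono norm_maxwell_matrix_mult order_refl)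
  finally have "(norm (maxwell_op S u z))\<^sup>2 \<le> (?t + (?x 1 + ?x 2 + ?x 3))\<^sup>2"
    by (intro power_mono) (simp_all add: sum_3)
  also have "\<dots> \<le> 4 * (?t\<^sup>2 + ((?x 1)\<^sup>2 + (?x 2)\<^sup>2 + (?x 3)\<^sup>2))"
  proof -
    have "0 \<le> (?t - ?x 1)\<^sup>2 + (?t - ?x 2)\<^sup>2 + (?t - ?x 3)\<^sup>2 + (?x 1 - ?x 2)\<^sup>2 + (?x 1 - ?x 3)\<^sup>2 + (?x 2 - ?x 3)\<^sup>2" by simp
    then show ?thesis by (simp add: power2_eq_square algebra_simps)
  qed
  also have "?t\<^sup>2 + ((?x 1)\<^sup>2 + (?x 2)\<^sup>2 + (?x 3)\<^sup>2) = (\<Sum>c\<in>UNIV. \<Sum>b\<in>Basis. (wderiv S {#b#} (\<lambda>y. u y $ c) z)\<^sup>2)"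
    by (simp add: norm_vec_sq dt_def dx_def sum_Basis_spacetime sum_3 sum.distrib)
  finally show ?thesis .
qed

definition em_slab_H1 ::
  "real \<Rightarrow> real \<Rightarrow> (real^3) set \<Rightarrow> (spacetime \<Rightarrow> em) \<Rightarrow> (real^3 \<Rightarrow> em) \<Rightarrow> (real^3 \<Rightarrow> em) \<Rightarrow> bool" where
  "em_slab_H1 a b U u ua ub \<longleftrightarrow> (\<forall>c. slab_H1 a b U (\<lambda>z. u z $ c) (\<lambda>x. ua x $ c) (\<lambda>x. ub x $ c))"

lemma em_slab_H1_sobolev: "em_slab_H1 a b U u ua ub \<Longrightarrow> sobolev_vec 1 ({a<..<b} \<times> U) u"
  by (simp add: em_slab_H1_def slab_H1_def sobolev_vec_def)

lemma em_slab_H1_L2: "em_slab_H1 a b U u ua ub \<Longrightarrow> L2_on ({a<..<b} \<times> U) u"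
  unfolding L2_on_vec_nth by (auto simp: em_slab_H1_def slab_H1_def intro: sobolev_L2)

lemma em_slab_H1_trace_L2:
  assumes "em_slab_H1 a b U u ua ub" "a < b" "open U" "bounded U"
  shows "L2_on U ua" "L2_on U ub"
  unfolding L2_on_vec_nth using slab_H1_trace_L2[OF _ assms(2-4)] assms(1)
  unfolding em_slab_H1_def by blast+

lemma inner_em_sum: "(v :: real^'n) \<bullet> w = (\<Sum>c\<in>UNIV. v $ c * w $ c)"
  by (simp add: inner_vec_def)

text \<open>Symmetry of the matrices lets the two spatial terms be collected into the total
  derivatives \<open>X l c d\<close>, whose integrals vanish because \<open>w\<close> has zero
  lateral trace. The time terms produce the values at both ends.\<close>

theorem maxwell_green:
  assumes U: "open U" "bounded U" and ab: "a < b"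
    and u: "em_slab_H1 a b U u ua ub" and w: "em_slab_H1 a b U w wa wb"
    and tr: "\<And>c. zero_lateral_trace a b U (\<lambda>z. w z $ c)"
  defines "S \<equiv> {a<..<b} \<times> U"
  shows "(LINT z:S|lborel. (\<alpha> + \<beta> * fst z) * (maxwell_op S u z \<bullet> w z + u z \<bullet> maxwell_op S w z) + \<beta> * (u z \<bullet> w z))
     = (\<alpha> + \<beta> * b) * (LINT x:U|lborel. ub x \<bullet> wb x) - (\<alpha> + \<beta> * a) * (LINT x:U|lborel. ua x \<bullet> wa x)"
proof -
  have S: "open S" using U by (auto simp: S_def open_Times)
  have hu: "slab_H1 a b U (\<lambda>z. u z $ c) (\<lambda>x. ua x $ c) (\<lambda>x. ub x $ c)"
    and hw: "slab_H1 a b U (\<lambda>z. w z $ c) (\<lambda>x. wa x $ c) (\<lambda>x. wb x $ c)" for c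
    using u w by (auto simp: em_slab_H1_def)
  have su: "sobolev 1 S (\<lambda>z. u z $ c)" and sw: "sobolev 1 S (\<lambda>z. w z $ c)" for c
    using hu hw by (auto simp: slab_H1_def S_def)
  define D where "D b v = wderiv S {#b#} v" for b v
  have L: "L2_on S (\<lambda>z. u z $ c)" "L2_on S (\<lambda>z. w z $ c)"
    and LD: "b \<in> Basis \<Longrightarrow> L2_on S (D b (\<lambda>z. u z $ c))" "b \<in> Basis \<Longrightarrow> L2_on S (D b (\<lambda>z. w z $ c))" for b c
    unfolding D_def using su sw sobolev_L2 sobolev1_wderiv(2)[OF _ _ S] by blast+
  define \<theta> where "\<theta> z = \<alpha> + \<beta> * fst z" for z :: spacetime
  define T where "T c z = \<theta> z * (D (1, 0) (\<lambda>z. u z $ c) z * w z $ c + u z $ c * D (1, 0) (\<lambda>z. w z $ c) z) + \<beta> * (u z $ c * w z $ c)" for c z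
  define X where "X l c d z = \<theta> z * (D (0, axis l 1) (\<lambda>z. u z $ d) z * w z $ c + u z $ d * D (0, axis l 1) (\<lambda>z. w z $ c) z)" for l c d z
  have iT: "set_integrable lborel S (T c)" for c
    unfolding T_def \<theta>_def S_def
    by (intro set_integral_add(1) affine_weight_integrable set_integrable_mult_right L2_mult_integrable)
       (use L LD time_basis in \<open>auto simp: S_def\<close>)
  have iX: "set_integrable lborel S (X l c d)" for l c d
    unfolding X_def \<theta>_def S_def
    by (intro set_integral_add(1) affine_weight_integrable L2_mult_integrable)
       (use L LD space_axis_basis in \<open>auto simp: S_def\<close>)
  have IT: "(LINT z:S|lborel. T c z) = (\<alpha> + \<beta> * b) * (LINT x:U|lborel. ub x $ c * wb x $ c) - (\<alpha> + \<beta> * a) * (LINT x:U|lborel. ua x $ c * wa x $ c)" for c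
    using time_green[OF hu[of c] hw[of c] ab U, of \<alpha> \<beta>] by (simp add: T_def \<theta>_def D_def S_def)
  have IX: "(LINT z:S|lborel. X l c d z) = 0" for l c d
    using lateral_green[OF U su[of d, unfolded S_def] sw[of c, unfolded S_def] tr[of c], of "axis l 1" \<alpha> \<beta>]
    by (simp add: X_def \<theta>_def D_def S_def axis_in_Basis_iff)
  have sym: "maxwell_matrix l $ c $ d = maxwell_matrix l $ d $ c" for l c d
  proof -
    have "transpose (maxwell_matrix l) $ d $ c = maxwell_matrix l $ c $ d" by (simp add: transpose_def)
    then show ?thesis by (simp add: maxwell_matrix_symmetric)
  qed
  have pt: "(\<alpha> + \<beta> * fst z) * (maxwell_op S u z \<bullet> w z + u z \<bullet> maxwell_op S w z) + \<beta> * (u z \<bullet> w z)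
     = (\<Sum>c\<in>UNIV. T c z) + (\<Sum>l\<in>UNIV. \<Sum>c\<in>UNIV. \<Sum>d\<in>UNIV. maxwell_matrix l $ c $ d * X l c d z)" for z
  proof -
    let ?m = "\<lambda>l c d. maxwell_matrix l $ c $ d"
    let ?du = "\<lambda>b c. D b (\<lambda>z. u z $ c) z" and ?dw = "\<lambda>b c. D b (\<lambda>z. w z $ c) z"
    have a1: "maxwell_op S u z \<bullet> w z = (\<Sum>c\<in>UNIV. ?du (1, 0) c * w z $ c)
       + (\<Sum>l\<in>UNIV. \<Sum>c\<in>UNIV. \<Sum>d\<in>UNIV. ?m l c d * (?du (0, axis l 1) d * w z $ c))"
    proof -
      have "maxwell_op S u z \<bullet> w z = (\<Sum>c\<in>UNIV. ?du (1, 0) c * w z $ c)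
       + (\<Sum>c\<in>UNIV. \<Sum>l\<in>UNIV. \<Sum>d\<in>UNIV. ?m l c d * (?du (0, axis l 1) d * w z $ c))"
        by (simp add: inner_em_sum maxwell_op_nth D_def distrib_right sum.distrib sum_distrib_right mult.assoc)
      then show ?thesis by (subst (asm) sum.swap)
    qed
    have a2: "u z \<bullet> maxwell_op S w z = (\<Sum>c\<in>UNIV. u z $ c * ?dw (1, 0) c)
       + (\<Sum>l\<in>UNIV. \<Sum>c\<in>UNIV. \<Sum>d\<in>UNIV. ?m l c d * (u z $ d * ?dw (0, axis l 1) c))"
    proof -
      have "u z \<bullet> maxwell_op S w z = (\<Sum>c\<in>UNIV. u z $ c * ?dw (1, 0) c)
       + (\<Sum>c\<in>UNIV. \<Sum>l\<in>UNIV. \<Sum>d\<in>UNIV. ?m l c d * (u z $ c * ?dw (0, axis l 1) d))"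
        by (simp add: inner_em_sum maxwell_op_nth D_def distrib_left sum.distrib sum_distrib_left mult_ac)
      also have "(\<Sum>c\<in>UNIV. \<Sum>l\<in>UNIV. \<Sum>d\<in>UNIV. ?m l c d * (u z $ c * ?dw (0, axis l 1) d))
        = (\<Sum>l\<in>UNIV. \<Sum>c\<in>UNIV. \<Sum>d\<in>UNIV. ?m l c d * (u z $ c * ?dw (0, axis l 1) d))"
        by (rule sum.swap)
      also have "\<dots> = (\<Sum>l\<in>UNIV. \<Sum>d\<in>UNIV. \<Sum>c\<in>UNIV. ?m l c d * (u z $ c * ?dw (0, axis l 1) d))"
        by (intro sum.cong refl sum.swap)
      also have "\<dots> = (\<Sum>l\<in>UNIV. \<Sum>c\<in>UNIV. \<Sum>d\<in>UNIV. ?m l c d * (u z $ d * ?dw (0, axis l 1) c))"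
        by (intro sum.cong refl) (simp add: sym)
      finally show ?thesis .
    qed
    have "(\<Sum>l\<in>UNIV. \<Sum>c\<in>UNIV. \<Sum>d\<in>UNIV. ?m l c d * X l c d z) =
      \<theta> z * ((\<Sum>l\<in>UNIV. \<Sum>c\<in>UNIV. \<Sum>d\<in>UNIV. ?m l c d * (?du (0, axis l 1) d * w z $ c))
        + (\<Sum>l\<in>UNIV. \<Sum>c\<in>UNIV. \<Sum>d\<in>UNIV. ?m l c d * (u z $ d * ?dw (0, axis l 1) c)))"
      by (simp add: X_def sum.distrib[symmetric] sum_distrib_left distrib_left mult_ac)
    moreover have "(\<Sum>c\<in>UNIV. T c z) = \<theta> z * ((\<Sum>c\<in>UNIV. ?du (1, 0) c * w z $ c) + (\<Sum>c\<in>UNIV. u z $ c * ?dw (1, 0) c)) + \<beta> * (u z \<bullet> w z)"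
      by (simp add: T_def sum.distrib sum_distrib_left distrib_left inner_em_sum)
    ultimately show ?thesis unfolding a1 a2 by (simp add: \<theta>_def distrib_left)
  qed
  have iU: "set_integrable lborel U (\<lambda>x. ub x $ c * wb x $ c)" "set_integrable lborel U (\<lambda>x. ua x $ c * wa x $ c)" for c
    using slab_H1_trace_L2[OF hu ab U] slab_H1_trace_L2[OF hw ab U] by (auto intro: L2_mult_integrable)
  have "(LINT z:S|lborel. (\<Sum>c\<in>UNIV. T c z) + (\<Sum>l\<in>UNIV. \<Sum>c\<in>UNIV. \<Sum>d\<in>UNIV. maxwell_matrix l $ c $ d * X l c d z))
     = (\<Sum>c\<in>UNIV. LINT z:S|lborel. T c z)
       + (\<Sum>l\<in>UNIV. \<Sum>c\<in>UNIV. \<Sum>d\<in>UNIV. maxwell_matrix l $ c $ d * (LINT z:S|lborel. X l c d z))"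
    using iT iX by (simp add: set_integral_add(2) set_integral_sum)
  also have "\<dots> = (\<alpha> + \<beta> * b) * (\<Sum>c\<in>UNIV. LINT x:U|lborel. ub x $ c * wb x $ c)
     - (\<alpha> + \<beta> * a) * (\<Sum>c\<in>UNIV. LINT x:U|lborel. ua x $ c * wa x $ c)"
    by (simp add: IT IX sum_subtractf sum_distrib_left)
  also have "\<dots> = (\<alpha> + \<beta> * b) * (LINT x:U|lborel. ub x \<bullet> wb x) - (\<alpha> + \<beta> * a) * (LINT x:U|lborel. ua x \<bullet> wa x)"
    using iU by (simp add: inner_em_sum set_integral_sum)
  finally show ?thesis unfolding pt .
qed

section \<open>Mesh functions\<close>

lemma trace_plus_eq:
  assumes "((\<lambda>t. g (t, x)) \<longlongrightarrow> l) (at_right a)"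
  shows "trace_plus g a x = l"
proof -
  have "((\<lambda>s. g (a + s, x)) \<longlongrightarrow> l) (at_right 0)"
    using assms filterlim_at_right_to_0[of "\<lambda>t. g (t, x)" "nhds l" a] by (simp add: add.commute)
  then show ?thesis unfolding trace_plus_def by (rule tendsto_Lim[OF trivial_limit_at_right_real])
qed

lemma trace_minus_eq:
  assumes "((\<lambda>t. g (t, x)) \<longlongrightarrow> l) (at_left a)"
  shows "trace_minus g a x = l"
proof -
  have "((\<lambda>t. g (- t, x)) \<longlongrightarrow> l) (at_right (- a))"
    using assms filterlim_at_left_to_right[of "\<lambda>t. g (t, x)" "nhds l" a] by simp
  then have "((\<lambda>s. g (a - s, x)) \<longlongrightarrow> l) (at_right 0)"
    using filterlim_at_right_to_0[of "\<lambda>t. g (- t, x)" "nhds l" "- a"] by simp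
  then have "((\<lambda>s. g (a + s, x)) \<longlongrightarrow> l) (at_left 0)"
    using filterlim_at_left_to_right[of "\<lambda>s. g (a + s, x)" "nhds l" 0] by simp
  then show ?thesis unfolding trace_minus_def by (rule tendsto_Lim[OF trivial_limit_at_left_real])
qed

lemma em_slab_H1_limits:
  assumes "em_slab_H1 a b U u ua ub" "x \<in> U"
  shows "((\<lambda>t. u (t, x)) \<longlongrightarrow> ua x) (at_right a)" "((\<lambda>t. u (t, x)) \<longlongrightarrow> ub x) (at_left b)"
  using assms by (auto simp: em_slab_H1_def slab_H1_def intro!: vec_tendstoI)

lemma em_slab_H1_traces:
  assumes "em_slab_H1 a b U u ua ub" "x \<in> U"
  shows "trace_plus u a x = ua x" "trace_minus u b x = ub x"
  using em_slab_H1_limits[OF assms] trace_plus_eq trace_minus_eq by blast+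

lemma em_slab_H1_cong:
  assumes "em_slab_H1 a b U u ua ub" "\<And>x. x \<in> U \<Longrightarrow> ua x = va x" "\<And>x. x \<in> U \<Longrightarrow> ub x = vb x"
  shows "em_slab_H1 a b U u va vb"
  using assms by (simp add: em_slab_H1_def slab_H1_def)

lemma em_slab_H1_diff:
  assumes "em_slab_H1 a b U u ua ub" "em_slab_H1 a b U w wa wb" "open U"
  shows "em_slab_H1 a b U (\<lambda>z. u z - w z) (\<lambda>x. ua x - wa x) (\<lambda>x. ub x - wb x)"
  using assms by (simp add: em_slab_H1_def slab_H1_diff)

lemma em_slab_H1_subset:
  assumes "em_slab_H1 a b U u ua ub" "V \<subseteq> U" "open V" "open U"
  shows "em_slab_H1 a b V u ua ub"
  using assms slab_H1_subset unfolding em_slab_H1_def by blast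

lemma em_slab_H1I:
  assumes s: "\<And>c. sobolev 1 ({a<..<b} \<times> U) (\<lambda>z. u z $ c)"
    and c: "\<And>x. x \<in> U \<Longrightarrow> continuous_on {a<..<b} (\<lambda>t. u (t, x))"
    and l: "\<And>x. x \<in> U \<Longrightarrow> ((\<lambda>t. u (t, x)) \<longlongrightarrow> ua x) (at_right a)"
    and r: "\<And>x. x \<in> U \<Longrightarrow> ((\<lambda>t. u (t, x)) \<longlongrightarrow> ub x) (at_left b)"
  shows "em_slab_H1 a b U u ua ub"
  unfolding em_slab_H1_def slab_H1_def
  using s c l r by (auto intro!: tendsto_vec_nth continuous_intros)

lemma set_integral_finite_partition:
  fixes h :: "'a::euclidean_space \<Rightarrow> real"
  assumes h: "set_integrable lborel A h" and fin: "finite J"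
    and B: "\<And>i. i \<in> J \<Longrightarrow> B i \<in> sets borel" "\<And>i. i \<in> J \<Longrightarrow> B i \<subseteq> A"
    and disj: "\<And>i j. i \<in> J \<Longrightarrow> j \<in> J \<Longrightarrow> i \<noteq> j \<Longrightarrow> B i \<inter> B j = {}"
    and cover: "AE z in lborel. z \<in> A \<longrightarrow> z \<in> (\<Union>i\<in>J. B i)"
  shows "(LINT z:A|lborel. h z) = (\<Sum>i\<in>J. LINT z:B i|lborel. h z)"
proof -
  have iB: "set_integrable lborel (B i) h" if "i \<in> J" for i
    by (rule set_integrable_subset[OF h]) (use B that in auto)
  have iU: "set_integrable lborel (\<Union>i\<in>J. B i) h"
    by (rule set_integrable_subset[OF h]) (use B fin in auto)
  have "(LINT z:A|lborel. h z) = (LINT z:(\<Union>i\<in>J. B i)|lborel. h z)"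
    unfolding set_lebesgue_integral_def
  proof (rule integral_cong_AE)
    show "AE z in lborel. indicat_real A z *\<^sub>R h z = indicat_real (\<Union>i\<in>J. B i) z *\<^sub>R h z"
      using cover
    proof eventually_elim
      case (elim z)
      have "z \<in> (\<Union>i\<in>J. B i) \<Longrightarrow> z \<in> A" using B(2) by blast
      then have "z \<in> (\<Union>i\<in>J. B i) \<longleftrightarrow> z \<in> A" using elim by blast
      then show ?case unfolding indicator_def by presburger
    qed
  qed (use h iU in \<open>auto simp: set_integrable_def dest: borel_measurable_integrable\<close>)
  also have "\<dots> = (\<Sum>i\<in>J. LINT z:B i|lborel. h z)"
    by (rule set_integral_finite_Union[OF fin]) (use iB disj B(1) in \<open>auto simp: disjoint_family_on_def\<close>)
  finally show ?thesis .
qed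

section \<open>Geometry of the mesh and functions on it\<close>

locale maxwell_mesh =
  fixes T :: real and \<Omega>x :: "(real^3) set" and M :: nat and tn :: "nat \<Rightarrow> real" and \<T> :: "(real^3) set set"
  assumes open_dom: "open \<Omega>x" and bounded_dom: "bounded \<Omega>x" and T_pos: "0 < T"
    and mesh: "mesh T \<Omega>x M tn \<T>"
begin

abbreviation slab :: "nat \<Rightarrow> spacetime set" where
  "slab m \<equiv> {tn m<..<tn (Suc m)} \<times> \<Omega>x"

definition cell :: "nat \<Rightarrow> (real^3) set \<Rightarrow> spacetime set" where
  "cell m \<tau> = {tn m<..tn (Suc m)} \<times> \<tau>"

lemma tn_less: "m < M \<Longrightarrow> tn m < tn (Suc m)" and tn_0: "tn 0 = 0" and tn_M: "tn M = T"
  and finite_cells: "finite \<T>" and cover_cells: "\<Union>\<T> = closure \<Omega>x"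
  using mesh by (auto simp: mesh_def)

lemma cellD:
  assumes "\<tau> \<in> \<T>"
  shows "compact \<tau>" "interior \<tau> \<noteq> {}" "interior \<tau> \<subseteq> \<Omega>x" "negligible (frontier \<tau>)"
  using mesh assms by (auto simp: mesh_def)

lemma interior_disjoint: "\<tau> \<in> \<T> \<Longrightarrow> \<tau>' \<in> \<T> \<Longrightarrow> \<tau> \<noteq> \<tau>' \<Longrightarrow> interior \<tau> \<inter> interior \<tau>' = {}"
  using mesh by (auto simp: mesh_def)

lemma M_pos: "0 < M"
  using tn_0 tn_M T_pos by (cases M) auto

lemma tn_mono: "m \<le> n \<Longrightarrow> n \<le> M \<Longrightarrow> tn m \<le> tn n"
proof (induction n rule: dec_induct)
  case (step n)
  then show ?case using tn_less[of n] by force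
qed simp

lemma tn_range: "m \<le> M \<Longrightarrow> 0 \<le> tn m" "m \<le> M \<Longrightarrow> tn m \<le> T"
  using tn_mono[of 0 m] tn_mono[of m M] tn_0 tn_M by auto

lemma slab_sub: "m < M \<Longrightarrow> slab m \<subseteq> {0<..<T} \<times> \<Omega>x"
  using tn_range[of m] tn_range[of "Suc m"] by force

lemma open_slab: "open (slab m)"
  by (simp add: open_dom open_Times)

lemma interior_Ioc: "interior {a<..b :: real} = {a<..<b}"
proof (rule interior_unique)
  fix S assume S: "S \<subseteq> {a<..b}" "open S"
  show "S \<subseteq> {a<..<b}"
  proof
    fix x assume x: "x \<in> S"
    then obtain e where e: "e > 0" "ball x e \<subseteq> S" using S(2) openE by blast
    then have "x + e / 2 \<in> S" by (auto simp: dist_real_def subset_iff)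
    then show "x \<in> {a<..<b}" using S(1) x e(1) by force
  qed
qed auto

lemma interior_cell: "interior (cell m \<tau>) = {tn m<..<tn (Suc m)} \<times> interior \<tau>"
  by (simp add: cell_def interior_Times interior_Ioc)

lemma interior_cell_sub: "\<tau> \<in> \<T> \<Longrightarrow> interior (cell m \<tau>) \<subseteq> slab m"
  using cellD(3) by (auto simp: interior_cell)

lemma elements_eq: "elements M tn \<T> = (\<lambda>(m, \<tau>). cell m \<tau>) ` ({..<M} \<times> \<T>)"
  by (auto simp: elements_def cell_def)

lemma cell_in_elements: "m < M \<Longrightarrow> \<tau> \<in> \<T> \<Longrightarrow> cell m \<tau> \<in> elements M tn \<T>"
  by (auto simp: elements_eq)

lemma tn_inj: "m < M \<Longrightarrow> n < M \<Longrightarrow> tn m = tn n \<Longrightarrow> m = n"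
  using tn_mono[of "Suc m" n] tn_mono[of "Suc n" m] tn_less[of m] tn_less[of n]
  by (cases m n rule: linorder_cases) auto

text \<open>The elements are collected in a set, so a double sum is legitimate only because a cell
  determines its slab and its spatial element. Nonempty interiors and strictly increasing time
  levels ensure this.\<close>

lemma sum_elements: "(\<Sum>K\<in>elements M tn \<T>. F K) = (\<Sum>m<M. \<Sum>\<tau>\<in>\<T>. F (cell m \<tau>))"
proof -
  have "inj_on (\<lambda>(m, \<tau>). cell m \<tau>) ({..<M} \<times> \<T>)"
  proof (rule inj_onI, clarify)
    fix m n \<tau> \<tau>' assume mn: "m < M" "n < M" "\<tau> \<in> \<T>" "\<tau>' \<in> \<T>" and eq: "cell m \<tau> = cell n \<tau>'"
    have ne: "\<tau> \<noteq> {}" "\<tau>' \<noteq> {}" using cellD(2)[OF mn(3)] cellD(2)[OF mn(4)] interior_subset by blast+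
    have i: "{tn m<..tn (Suc m)} \<noteq> {}" "{tn n<..tn (Suc n)} \<noteq> {}" using tn_less mn by auto
    have "{tn m<..tn (Suc m)} = {tn n<..tn (Suc n)} \<and> \<tau> = \<tau>'"
      using eq ne i by (auto simp: cell_def times_eq_iff)
    moreover have "tn m = tn n" if "{tn m<..tn (Suc m)} = {tn n<..tn (Suc n)}"
      using that tn_less[OF mn(1)] tn_less[OF mn(2)] by (metis Ioc_inj leD)
    ultimately show "m = n \<and> \<tau> = \<tau>'" using tn_inj mn by blast
  qed
  then show ?thesis
    unfolding elements_eq by (simp add: sum.reindex sum.cartesian_product split_def)
qed

lemma AE_dom_cover: "AE x in lborel. x \<in> \<Omega>x \<longrightarrow> x \<in> (\<Union>\<tau>\<in>\<T>. interior \<tau>)"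
proof -
  have "AE x in lborel. \<forall>\<tau>\<in>\<T>. x \<notin> frontier \<tau>"
  proof (intro AE_ball_countable[THEN iffD2] ballI)
    show "countable \<T>" using finite_cells by (rule countable_finite)
    fix \<tau> assume "\<tau> \<in> \<T>"
    then have "frontier \<tau> \<in> null_sets lebesgue" using cellD(4) by (simp add: negligible_iff_null_sets)
    then show "AE x in lborel. x \<notin> frontier \<tau>"
      using AE_completion_iff[of "\<lambda>x. x \<notin> frontier \<tau>" lborel] AE_not_in by blast
  qed
  then show ?thesis
  proof eventually_elim
    case (elim x)
    show ?case
    proof
      assume "x \<in> \<Omega>x"
      then obtain \<tau> where \<tau>: "\<tau> \<in> \<T>" "x \<in> \<tau>" using cover_cells closure_subset by blast
      then have "x \<in> interior \<tau>" using elim closure_subset by (auto simp: frontier_def)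
      then show "x \<in> (\<Union>\<tau>\<in>\<T>. interior \<tau>)" using \<tau> by blast
    qed
  qed
qed

lemma AE_slab_cover: "AE z in lborel. z \<in> slab m \<longrightarrow> z \<in> (\<Union>\<tau>\<in>\<T>. interior (cell m \<tau>))"
proof -
  obtain N where N: "N \<in> null_sets lborel" "{x. \<not> (x \<in> \<Omega>x \<longrightarrow> x \<in> (\<Union>\<tau>\<in>\<T>. interior \<tau>))} \<subseteq> N"
    using AE_dom_cover unfolding eventually_ae_filter by auto
  have "emeasure (lborel \<Otimes>\<^sub>M lborel) ((UNIV :: real set) \<times> N) = emeasure lborel (UNIV :: real set) * emeasure lborel N"
    using N(1) by (intro lborel.emeasure_pair_measure_Times) auto
  also have "\<dots> = 0" using N(1) by auto
  finally have "(UNIV :: real set) \<times> N \<in> null_sets (lborel :: spacetime measure)"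
    using N(1) by (auto simp: null_sets_def lborel_prod[symmetric])
  from AE_not_in[OF this] show ?thesis
    using N(2) by (auto simp: interior_cell elim!: eventually_mono)
qed

lemma dom_integral:
  assumes "set_integrable lborel \<Omega>x h"
  shows "(LINT x:\<Omega>x|lborel. h x) = (\<Sum>\<tau>\<in>\<T>. LINT x:interior \<tau>|lborel. (h x :: real))"
  by (rule set_integral_finite_partition[OF assms finite_cells])
     (use cellD(3) interior_disjoint AE_dom_cover in auto)

lemma slab_integral:
  assumes "set_integrable lborel (slab m) h"
  shows "(LINT z:slab m|lborel. h z) = (\<Sum>\<tau>\<in>\<T>. LINT z:interior (cell m \<tau>)|lborel. (h z :: real))"
proof (rule set_integral_finite_partition[OF assms finite_cells])
  show "AE z in lborel. z \<in> slab m \<longrightarrow> z \<in> (\<Union>\<tau>\<in>\<T>. interior (cell m \<tau>))" by (rule AE_slab_cover)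
  show "interior (cell m \<tau>) \<inter> interior (cell m \<tau>') = {}" if "\<tau> \<in> \<T>" "\<tau>' \<in> \<T>" "\<tau> \<noteq> \<tau>'" for \<tau> \<tau>'
    using interior_disjoint[OF that] by (simp add: interior_cell Times_Int_Times)
qed (use interior_cell_sub in auto)

text \<open>\<open>trace_plus\<close> and \<open>trace_minus\<close> are values of
  \<open>Lim\<close> and unspecified where no limit exists. The predicate therefore contains the
  claim that they are the actual limits at the two ends of every slab.\<close>

definition mesh_H1 :: "(spacetime \<Rightarrow> em) \<Rightarrow> bool" where
  "mesh_H1 u \<longleftrightarrow> (\<forall>m<M. em_slab_H1 (tn m) (tn (Suc m)) \<Omega>x u (trace_plus u (tn m)) (trace_minus u (tn (Suc m))))"

lemma mesh_H1D:
  "mesh_H1 u \<Longrightarrow> m < M \<Longrightarrow> em_slab_H1 (tn m) (tn (Suc m)) \<Omega>x u (trace_plus u (tn m)) (trace_minus u (tn (Suc m)))"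
  by (simp add: mesh_H1_def)

lemma mesh_H1I:
  assumes "\<And>m. m < M \<Longrightarrow> em_slab_H1 (tn m) (tn (Suc m)) \<Omega>x u (ua m) (ub m)"
  shows "mesh_H1 u"
  unfolding mesh_H1_def
proof (intro allI impI)
  fix m assume m: "m < M"
  show "em_slab_H1 (tn m) (tn (Suc m)) \<Omega>x u (trace_plus u (tn m)) (trace_minus u (tn (Suc m)))"
    by (rule em_slab_H1_cong[OF assms[OF m]]) (simp_all add: em_slab_H1_traces[OF assms[OF m]])
qed

lemma mesh_H1_diff:
  assumes "mesh_H1 u" "mesh_H1 w"
  shows "mesh_H1 (\<lambda>z. u z - w z)"
    and "m < M \<Longrightarrow> x \<in> \<Omega>x \<Longrightarrow> trace_plus (\<lambda>z. u z - w z) (tn m) x = trace_plus u (tn m) x - trace_plus w (tn m) x"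
    and "m < M \<Longrightarrow> x \<in> \<Omega>x \<Longrightarrow> trace_minus (\<lambda>z. u z - w z) (tn (Suc m)) x = trace_minus u (tn (Suc m)) x - trace_minus w (tn (Suc m)) x"
proof -
  note d = em_slab_H1_diff[OF mesh_H1D[OF assms(1)] mesh_H1D[OF assms(2)] open_dom]
  show "mesh_H1 (\<lambda>z. u z - w z)" by (rule mesh_H1I) (rule d)
  show "trace_plus (\<lambda>z. u z - w z) (tn m) x = trace_plus u (tn m) x - trace_plus w (tn m) x"
    "trace_minus (\<lambda>z. u z - w z) (tn (Suc m)) x = trace_minus u (tn (Suc m)) x - trace_minus w (tn (Suc m)) x"
    if "m < M" "x \<in> \<Omega>x"
    using em_slab_H1_traces[OF d[OF that(1) that(1)] that(2)] by simp_all
qed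

text \<open>Every \<open>x\<close> lies in some closed spatial element, possibly on a face, and for
  this fixed \<open>x\<close> the function is a polynomial in time. The polynomial supplies the
  limits at both time levels, for every \<open>x\<close> and not just almost every one.\<close>

lemma fe_polynomial_in_time:
  assumes g: "g \<in> fe_space \<Omega>x M tn \<T> p" and m: "m < M" and x: "x \<in> \<Omega>x"
  obtains q where "continuous_on UNIV q" "\<And>t. t \<in> {tn m<..tn (Suc m)} \<Longrightarrow> g (t, x) = q t"
proof -
  obtain \<tau> where \<tau>: "\<tau> \<in> \<T>" "x \<in> \<tau>" using cover_cells closure_subset x by blast
  have "poly_on (p (cell m \<tau>)) (cell m \<tau>) g"
    using g cell_in_elements[OF m \<tau>(1)] by (simp add: fe_space_def)
  then obtain c where c: "\<And>t y. (t, y) \<in> cell m \<tau> \<Longrightarrow> g (t, y) =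
      (\<Sum>a\<le>p (cell m \<tau>). \<Sum>\<beta> | (\<Sum>i\<in>UNIV. \<beta> i) \<le> p (cell m \<tau>). c a \<beta> * t ^ a * (\<Prod>i\<in>(UNIV::3 set). y $ i ^ \<beta> i))"
    unfolding poly_on_def by blast
  let ?q = "\<lambda>t. \<Sum>a\<le>p (cell m \<tau>). \<Sum>\<beta> | (\<Sum>i\<in>UNIV. \<beta> i) \<le> p (cell m \<tau>). c a \<beta> * t ^ a * (\<Prod>i\<in>(UNIV::3 set). x $ i ^ \<beta> i)"
  have "continuous_on UNIV ?q" by (intro continuous_intros)
  moreover have "g (t, x) = ?q t" if "t \<in> {tn m<..tn (Suc m)}" for t
    by (rule c) (use that \<tau> in \<open>auto simp: cell_def\<close>)
  ultimately show ?thesis by (rule that)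
qed

lemma em_fe_mesh_H1:
  assumes g: "g \<in> em_fe_space \<Omega>x M tn \<T> p"
  shows "mesh_H1 g"
proof -
  have fe: "(\<lambda>z. g z $ c) \<in> fe_space \<Omega>x M tn \<T> p" for c using g by (simp add: em_fe_space_def)
  define Q where "Q m x q \<longleftrightarrow> (\<forall>c. continuous_on UNIV (q c) \<and> (\<forall>t\<in>{tn m<..tn (Suc m)}. g (t, x) $ c = q c t))"
    for m x and q :: "3 + 3 \<Rightarrow> real \<Rightarrow> real"
  have "\<exists>q. Q m x q" if "m < M" "x \<in> \<Omega>x" for m x
  proof -
    have "\<exists>q. continuous_on UNIV q \<and> (\<forall>t\<in>{tn m<..tn (Suc m)}. g (t, x) $ c = q t)" for c
      by (rule fe_polynomial_in_time[OF fe[of c] that]) blast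
    then show ?thesis unfolding Q_def by (intro choice allI)
  qed
  then obtain q where q: "\<And>m x. m < M \<Longrightarrow> x \<in> \<Omega>x \<Longrightarrow> Q m x (q m x)" by metis
  show ?thesis
  proof (rule mesh_H1I)
    fix m assume m: "m < M"
    let ?v = "\<lambda>x t. \<chi> c. q m x c t"
    have cont: "continuous_on UNIV (?v x)" if "x \<in> \<Omega>x" for x
      using q[OF m that] unfolding Q_def by (intro continuous_on_vec_lambda) auto
    have eq: "g (t, x) = ?v x t" if "x \<in> \<Omega>x" "t \<in> {tn m<..tn (Suc m)}" for x t
      using q[OF m that(1)] that(2) by (simp add: Q_def vec_eq_iff)
    have lim: "(?v x \<longlongrightarrow> ?v x s) (at s within A)" if "x \<in> \<Omega>x" for x s A
      using cont[OF that] by (meson UNIV_I continuous_on_def subset_UNIV tendsto_within_subset)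
    show "em_slab_H1 (tn m) (tn (Suc m)) \<Omega>x g (\<lambda>x. ?v x (tn m)) (\<lambda>x. ?v x (tn (Suc m)))"
    proof (rule em_slab_H1I)
      show "sobolev 1 (slab m) (\<lambda>z. g z $ c)" for c
        using fe[of c] m by (simp add: fe_space_def H0_tilde_def)
      fix x assume x: "x \<in> \<Omega>x"
      show "continuous_on {tn m<..<tn (Suc m)} (\<lambda>t. g (t, x))"
        using continuous_on_subset[OF cont[OF x]] eq[OF x]
        by (subst continuous_on_cong[OF refl, of _ _ "?v x"]) auto
      show "((\<lambda>t. g (t, x)) \<longlongrightarrow> ?v x (tn m)) (at_right (tn m))"
      proof (rule Lim_transform_eventually[OF lim[OF x]])
        show "\<forall>\<^sub>F t in at_right (tn m). ?v x t = g (t, x)"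
          using tn_less[OF m] eq[OF x] unfolding eventually_at_right[OF tn_less[OF m]]
          by (intro exI[of _ "tn (Suc m)"]) auto
      qed
      show "((\<lambda>t. g (t, x)) \<longlongrightarrow> ?v x (tn (Suc m))) (at_left (tn (Suc m)))"
      proof (rule Lim_transform_eventually[OF lim[OF x]])
        show "\<forall>\<^sub>F t in at_left (tn (Suc m)). ?v x t = g (t, x)"
          using tn_less[OF m] eq[OF x] unfolding eventually_at_left[OF tn_less[OF m]]
          by (intro exI[of _ "tn m"]) auto
      qed
    qed
  qed
qed

lemma em_fe_lateral_trace:
  "g \<in> em_fe_space \<Omega>x M tn \<T> p \<Longrightarrow> m < M \<Longrightarrow> zero_lateral_trace (tn m) (tn (Suc m)) \<Omega>x (\<lambda>z. g z $ c)"
  by (simp add: em_fe_space_def fe_space_def H0_tilde_def)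

end

section \<open>Galerkin orthogonality\<close>

lemma L2_inner_add_left:
  "L2_on A u \<Longrightarrow> L2_on A v \<Longrightarrow> L2_on A w \<Longrightarrow> L2_inner A (\<lambda>z. u z + v z) w = L2_inner A u w + L2_inner A v w"
  unfolding L2_inner_def inner_add_left by (intro set_integral_add(2) L2_inner_integrable)

lemma L2_inner_diff_left:
  "L2_on A u \<Longrightarrow> L2_on A v \<Longrightarrow> L2_on A w \<Longrightarrow> L2_inner A (\<lambda>z. u z - v z) w = L2_inner A u w - L2_inner A v w"
  unfolding L2_inner_def inner_diff_left by (intro set_integral_diff(2) L2_inner_integrable)

lemma L2_inner_commute: "L2_inner A u w = L2_inner A w u"
  by (simp add: L2_inner_def inner_commute)

lemma L2_inner_add_right:
  "L2_on A u \<Longrightarrow> L2_on A v \<Longrightarrow> L2_on A w \<Longrightarrow> L2_inner A w (\<lambda>z. u z + v z) = L2_inner A w u + L2_inner A w v"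
  using L2_inner_add_left[of A u v w] by (simp add: L2_inner_commute[of A w])

lemma L2_inner_cmult_right: "L2_inner A u (\<lambda>z. c *\<^sub>R w z) = c * L2_inner A u w"
  by (simp add: L2_inner_def)

lemma L2_inner_self: "L2_inner A u u = (L2_norm A u)\<^sup>2"
  by (simp add: L2_norm_sq L2_inner_def power2_norm_eq_inner)

lemma L2_inner_cong:
  assumes "\<And>z. z \<in> A \<Longrightarrow> u z = u' z" "\<And>z. z \<in> A \<Longrightarrow> w z = w' z"
  shows "L2_inner A u w = L2_inner A u' w'"
  unfolding L2_inner_def by (rule set_integral_cong_on) (simp add: assms)

lemma L2_norm_cong: "(\<And>z. z \<in> A \<Longrightarrow> u z = w z) \<Longrightarrow> L2_norm A u = L2_norm A w"
  unfolding L2_norm_def using L2_inner_cong[of A u w u w] by simp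

lemma L2_norm_diff_sq_le:
  assumes "L2_on A u" "L2_on A w"
  shows "(L2_norm A (\<lambda>z. u z - w z))\<^sup>2 \<le> 2 * (L2_norm A u)\<^sup>2 + 2 * (L2_norm A w)\<^sup>2"
proof -
  have i: "set_integrable lborel A (\<lambda>z. (norm (u z))\<^sup>2)" "set_integrable lborel A (\<lambda>z. (norm (w z))\<^sup>2)"
    "set_integrable lborel A (\<lambda>z. (norm (u z - w z))\<^sup>2)"
    using assms L2_on_diff[OF assms] by (auto simp: L2_on_def)
  have "(LINT z:A|lborel. (norm (u z - w z))\<^sup>2) \<le> (LINT z:A|lborel. 2 * (norm (u z))\<^sup>2 + 2 * (norm (w z))\<^sup>2)"
  proof (rule set_integral_mono[OF i(3)])
    show "set_integrable lborel A (\<lambda>z. 2 * (norm (u z))\<^sup>2 + 2 * (norm (w z))\<^sup>2)"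
      using i by (intro set_integral_add(1) set_integrable_mult_right)
    fix z
    have "(norm (u z - w z))\<^sup>2 \<le> (norm (u z) + norm (w z))\<^sup>2"
      by (intro power_mono norm_triangle_ineq4) simp
    also have "\<dots> \<le> 2 * (norm (u z))\<^sup>2 + 2 * (norm (w z))\<^sup>2"
      using sum_squares_bound[of "norm (u z)" "norm (w z)"] by (simp add: power2_sum)
    finally show "(norm (u z - w z))\<^sup>2 \<le> 2 * (norm (u z))\<^sup>2 + 2 * (norm (w z))\<^sup>2" .
  qed
  also have "\<dots> = 2 * (LINT z:A|lborel. (norm (u z))\<^sup>2) + 2 * (LINT z:A|lborel. (norm (w z))\<^sup>2)"
    using i by (subst set_integral_add(2)) auto
  finally show ?thesis by (simp add: L2_norm_sq)
qed

lemma sobolev_norm_diff_sq_le: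
  assumes u: "sobolev 1 S u" and w: "sobolev 1 S w" and S: "open S"
  shows "(sobolev_norm 1 S (\<lambda>z. u z - w z))\<^sup>2 \<le> 2 * (sobolev_norm 1 S u)\<^sup>2 + 2 * (sobolev_norm 1 S w)\<^sup>2"
proof -
  have "(L2_norm S (wderiv S \<alpha> (\<lambda>z. u z - w z)))\<^sup>2 \<le> 2 * (L2_norm S (wderiv S \<alpha> u))\<^sup>2 + 2 * (L2_norm S (wderiv S \<alpha> w))\<^sup>2"
    if \<alpha>: "\<alpha> \<in> multi_indices 1" for \<alpha>
  proof -
    have L: "L2_on S (wderiv S \<alpha> u)" "L2_on S (wderiv S \<alpha> w)" "L2_on S (wderiv S \<alpha> (\<lambda>z. u z - w z))"
      using sobolev_wderiv(2)[OF _ \<alpha> S] u w sobolev_diff(1)[OF u w S] by blast+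
    have "L2_norm S (wderiv S \<alpha> (\<lambda>z. u z - w z)) = L2_norm S (\<lambda>z. wderiv S \<alpha> u z - wderiv S \<alpha> w z)"
      by (rule L2_norm_AE_cong) (use L L2_on_diff[OF L(1,2)] sobolev_diff(2)[OF u w S \<alpha>] in \<open>auto simp: L2_on_def\<close>)
    then show ?thesis using L2_norm_diff_sq_le[OF L(1,2)] by simp
  qed
  then show ?thesis
    unfolding sobolev_norm_sq sum_distrib_left sum.distrib[symmetric] by (rule sum_mono)
qed

lemma zero_lateral_trace_cong:
  assumes "\<And>z. z \<in> {a<..<b} \<times> U \<Longrightarrow> u z = w z"
  shows "zero_lateral_trace a b U u \<longleftrightarrow> zero_lateral_trace a b U w"
proof -
  have "sobolev_norm 1 ({a<..<b} \<times> U) (\<lambda>z. u z - \<phi> z) = sobolev_norm 1 ({a<..<b} \<times> U) (\<lambda>z. w z - \<phi> z)" for \<phi>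
  proof -
    have "wderiv ({a<..<b} \<times> U) \<alpha> (\<lambda>z. u z - \<phi> z) = wderiv ({a<..<b} \<times> U) \<alpha> (\<lambda>z. w z - \<phi> z)" for \<alpha>
      by (rule wderiv_cong) (simp add: assms)
    then show ?thesis by (simp add: sobolev_norm_def)
  qed
  then show ?thesis by (simp add: zero_lateral_trace_def)
qed

lemma sobolev_norm_zero: "open S \<Longrightarrow> sobolev_norm 1 S (\<lambda>_. 0) = 0"
proof -
  assume S: "open S"
  have "L2_norm S (wderiv S \<alpha> (\<lambda>_. 0)) = 0" if \<alpha>: "\<alpha> \<in> multi_indices 1" for \<alpha> :: "'a multiset"
  proof -
    have "L2_norm S (wderiv S \<alpha> (\<lambda>_. 0)) = L2_norm S (\<lambda>_. 0 :: real)"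
      by (rule L2_norm_AE_cong)
         (use sobolev_wderiv(2)[OF sobolev_zero(1) \<alpha> S] L2_on_zero[of S] sobolev_zero(2)[OF S, of \<alpha>] in \<open>auto simp: L2_on_def\<close>)
    then show ?thesis by (simp add: L2_norm_def L2_inner_def)
  qed
  then show ?thesis by (simp add: sobolev_norm_def)
qed

lemma zero_lateral_trace_zero: "open U \<Longrightarrow> zero_lateral_trace a b U (\<lambda>_. 0)"
  unfolding zero_lateral_trace_def
  by (intro exI[of _ "\<lambda>n z. 0"] conjI allI exI[of _ "{}"])
     (simp_all add: smooth_const sobolev_norm_zero[unfolded One_nat_def] open_Times)

text \<open>The approximants are subtracted as well. Squared norms suffice for the convergence,
  since the square of a difference is at most twice the sum of the squares.\<close>

lemma zero_lateral_trace_diff: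
  assumes U: "open U" "bounded U"
    and u: "sobolev 1 ({a<..<b} \<times> U) u" "zero_lateral_trace a b U u"
    and w: "sobolev 1 ({a<..<b} \<times> U) w" "zero_lateral_trace a b U w"
  shows "zero_lateral_trace a b U (\<lambda>z. u z - w z)"
proof -
  let ?S = "{a<..<b} \<times> U" and ?N = "sobolev_norm 1 ({a<..<b} \<times> U)"
  have S: "open ?S" using U by (simp add: open_Times)
  obtain \<phi> where \<phi>: "\<And>n. smooth (\<phi> n)" "\<And>n. \<exists>C. compact C \<and> C \<subseteq> U \<and> (\<forall>t x. x \<notin> C \<longrightarrow> \<phi> n (t, x) = 0)"
    and \<phi>l: "(\<lambda>n. ?N (\<lambda>z. u z - \<phi> n z)) \<longlonglongrightarrow> 0"
    using u(2) unfolding zero_lateral_trace_def by blast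
  obtain \<psi> where \<psi>: "\<And>n. smooth (\<psi> n)" "\<And>n. \<exists>C. compact C \<and> C \<subseteq> U \<and> (\<forall>t x. x \<notin> C \<longrightarrow> \<psi> n (t, x) = 0)"
    and \<psi>l: "(\<lambda>n. ?N (\<lambda>z. w z - \<psi> n z)) \<longlonglongrightarrow> 0"
    using w(2) unfolding zero_lateral_trace_def by blast
  have s: "sobolev 1 ?S (\<lambda>z. u z - \<phi> n z)" "sobolev 1 ?S (\<lambda>z. w z - \<psi> n z)" for n
  proof -
    obtain C where "compact C" "\<And>t x. x \<notin> C \<Longrightarrow> \<phi> n (t, x) = 0" using \<phi>(2)[of n] by blast
    from lateral_smooth_sobolev[OF U \<phi>(1) this] show "sobolev 1 ?S (\<lambda>z. u z - \<phi> n z)"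
      by (rule sobolev_diff(1)[OF u(1) _ S])
    obtain C where "compact C" "\<And>t x. x \<notin> C \<Longrightarrow> \<psi> n (t, x) = 0" using \<psi>(2)[of n] by blast
    from lateral_smooth_sobolev[OF U \<psi>(1) this] show "sobolev 1 ?S (\<lambda>z. w z - \<psi> n z)"
      by (rule sobolev_diff(1)[OF w(1) _ S])
  qed
  have bound: "(?N (\<lambda>z. u z - w z - (\<phi> n z - \<psi> n z)))\<^sup>2 \<le> 2 * (?N (\<lambda>z. u z - \<phi> n z))\<^sup>2 + 2 * (?N (\<lambda>z. w z - \<psi> n z))\<^sup>2" for n
    using sobolev_norm_diff_sq_le[OF s S] by (simp add: algebra_simps)
  have "(\<lambda>n. 2 * (?N (\<lambda>z. u z - \<phi> n z))\<^sup>2 + 2 * (?N (\<lambda>z. w z - \<psi> n z))\<^sup>2) \<longlonglongrightarrow> 2 * 0\<^sup>2 + 2 * 0\<^sup>2"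
    by (intro tendsto_intros \<phi>l \<psi>l)
  then have ub: "(\<lambda>n. 2 * (?N (\<lambda>z. u z - \<phi> n z))\<^sup>2 + 2 * (?N (\<lambda>z. w z - \<psi> n z))\<^sup>2) \<longlonglongrightarrow> 0"
    by simp
  have "(\<lambda>n. (?N (\<lambda>z. u z - w z - (\<phi> n z - \<psi> n z)))\<^sup>2) \<longlonglongrightarrow> 0"
    by (rule tendsto_sandwich[OF _ _ tendsto_const ub]) (use bound in simp_all)
  then have lim: "(\<lambda>n. ?N (\<lambda>z. u z - w z - (\<phi> n z - \<psi> n z))) \<longlonglongrightarrow> 0"
    using tendsto_real_sqrt[of "\<lambda>n. (?N (\<lambda>z. u z - w z - (\<phi> n z - \<psi> n z)))\<^sup>2" 0 sequentially]
    by (simp add: tendsto_rabs_zero_iff)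
  show ?thesis
    unfolding zero_lateral_trace_def
  proof (intro exI[of _ "\<lambda>n z. \<phi> n z - \<psi> n z"] conjI allI lim)
    fix n
    show "smooth (\<lambda>z. \<phi> n z - \<psi> n z)" by (rule smooth_diff[OF \<phi>(1) \<psi>(1)])
    obtain C where C: "compact C" "C \<subseteq> U" "\<And>t x. x \<notin> C \<Longrightarrow> \<phi> n (t, x) = 0" using \<phi>(2)[of n] by blast
    obtain D where D: "compact D" "D \<subseteq> U" "\<And>t x. x \<notin> D \<Longrightarrow> \<psi> n (t, x) = 0" using \<psi>(2)[of n] by blast
    show "\<exists>C. compact C \<and> C \<subseteq> U \<and> (\<forall>t x. x \<notin> C \<longrightarrow> \<phi> n (t, x) - \<psi> n (t, x) = 0)"
      using C D by (intro exI[of _ "C \<union> D"]) auto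
  qed
qed

section \<open>Differences and truncations of discrete functions\<close>

lemma poly_on_zero: "poly_on p K (\<lambda>_. 0)"
  unfolding poly_on_def by (intro exI[of _ "\<lambda>_ _. 0"]) auto

lemma poly_on_diff:
  assumes "poly_on p K u" "poly_on p K w"
  shows "poly_on p K (\<lambda>z. u z - w z)"
proof -
  obtain c where c: "\<And>t x. (t, x) \<in> K \<Longrightarrow> u (t, x) =
      (\<Sum>a\<le>p. \<Sum>\<beta> | (\<Sum>i\<in>UNIV. \<beta> i) \<le> p. c a \<beta> * t ^ a * (\<Prod>i\<in>(UNIV::3 set). x $ i ^ \<beta> i))"
    using assms(1) unfolding poly_on_def by blast
  obtain d where d: "\<And>t x. (t, x) \<in> K \<Longrightarrow> w (t, x) =
      (\<Sum>a\<le>p. \<Sum>\<beta> | (\<Sum>i\<in>UNIV. \<beta> i) \<le> p. d a \<beta> * t ^ a * (\<Prod>i\<in>(UNIV::3 set). x $ i ^ \<beta> i))"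
    using assms(2) unfolding poly_on_def by blast
  show ?thesis
    unfolding poly_on_def
    by (intro exI[of _ "\<lambda>a \<beta>. c a \<beta> - d a \<beta>"]) (auto simp: c d left_diff_distrib sum_subtractf)
qed

lemma poly_on_cong: "(\<And>z. z \<in> K \<Longrightarrow> u z = w z) \<Longrightarrow> poly_on p K u \<longleftrightarrow> poly_on p K w"
  unfolding poly_on_def by (auto simp: split_def)

context maxwell_mesh
begin

lemma fe_space_diff:
  assumes u: "u \<in> fe_space \<Omega>x M tn \<T> p" and w: "w \<in> fe_space \<Omega>x M tn \<T> p"
  shows "(\<lambda>z. u z - w z) \<in> fe_space \<Omega>x M tn \<T> p"
proof -
  have "sobolev 1 (slab m) (\<lambda>z. u z - w z) \<and> zero_lateral_trace (tn m) (tn (Suc m)) \<Omega>x (\<lambda>z. u z - w z)" if "m < M" for m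
    using u w that sobolev_diff(1)[OF _ _ open_slab] zero_lateral_trace_diff[OF open_dom bounded_dom]
    by (auto simp: fe_space_def H0_tilde_def)
  then show ?thesis using u w poly_on_diff by (auto simp: fe_space_def H0_tilde_def)
qed

lemma em_fe_space_diff:
  "u \<in> em_fe_space \<Omega>x M tn \<T> p \<Longrightarrow> w \<in> em_fe_space \<Omega>x M tn \<T> p \<Longrightarrow> (\<lambda>z. u z - w z) \<in> em_fe_space \<Omega>x M tn \<T> p"
  by (simp add: em_fe_space_def fe_space_diff)

text \<open>The comparison is not strict because elements contain their upper time level: level
  \<open>N\<close> still belongs to the last slab that is kept.\<close>

definition truncate :: "nat \<Rightarrow> (spacetime \<Rightarrow> em) \<Rightarrow> spacetime \<Rightarrow> em" where
  "truncate N g z = (if fst z \<le> tn N then g z else 0)"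

lemma truncate_cell:
  assumes "m < M" "N \<le> M" "t \<in> {tn m<..tn (Suc m)}"
  shows "truncate N g (t, x) = (if m < N then g (t, x) else 0)"
proof (cases "m < N")
  case True
  then have "tn (Suc m) \<le> tn N" using assms by (intro tn_mono) auto
  then show ?thesis using assms True by (simp add: truncate_def)
next
  case False
  then have "tn N \<le> tn m" using assms by (intro tn_mono) auto
  then show ?thesis using assms False by (simp add: truncate_def)
qed

text \<open>On each slab the truncation is either \<open>g\<close> or zero, and the discrete space
  imposes no condition across time levels.\<close>

lemma truncate_fe:
  assumes g: "g \<in> em_fe_space \<Omega>x M tn \<T> p" and N: "N \<le> M"
  shows "truncate N g \<in> em_fe_space \<Omega>x M tn \<T> p"
  unfolding em_fe_space_def
proof (intro CollectI allI)
  fix c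
  have fe: "(\<lambda>z. g z $ c) \<in> fe_space \<Omega>x M tn \<T> p" using g by (simp add: em_fe_space_def)
  have eq: "truncate N g z $ c = (if m < N then g z $ c else 0)" if "m < M" "z \<in> {tn m<..tn (Suc m)} \<times> A" for m z A
    using truncate_cell[OF that(1) N, of "fst z" g "snd z"] that(2) by auto
  have eq': "truncate N g z $ c = (if m < N then g z $ c else 0)" if "m < M" "z \<in> slab m" for m z
    by (rule eq[of _ _ UNIV]) (use that in auto)
  have 1: "sobolev 1 (slab m) (\<lambda>z. truncate N g z $ c)" if "m < M" for m
  proof (cases "m < N")
    case True
    then have "sobolev 1 (slab m) (\<lambda>z. truncate N g z $ c) \<longleftrightarrow> sobolev 1 (slab m) (\<lambda>z. g z $ c)"
      using eq'[OF that] by (intro sobolev_cong) simp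
    then show ?thesis using fe that by (simp add: fe_space_def H0_tilde_def)
  next
    case False
    then have "sobolev 1 (slab m) (\<lambda>z. truncate N g z $ c) \<longleftrightarrow> sobolev 1 (slab m) (\<lambda>z. 0)"
      using eq'[OF that] by (intro sobolev_cong) simp
    then show ?thesis using sobolev_zero by blast
  qed
  have 2: "zero_lateral_trace (tn m) (tn (Suc m)) \<Omega>x (\<lambda>z. truncate N g z $ c)" if "m < M" for m
  proof (cases "m < N")
    case True
    then have "zero_lateral_trace (tn m) (tn (Suc m)) \<Omega>x (\<lambda>z. truncate N g z $ c)
        \<longleftrightarrow> zero_lateral_trace (tn m) (tn (Suc m)) \<Omega>x (\<lambda>z. g z $ c)"
      using eq'[OF that] by (intro zero_lateral_trace_cong) simp
    then show ?thesis using fe that by (simp add: fe_space_def H0_tilde_def)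
  next
    case False
    then have "zero_lateral_trace (tn m) (tn (Suc m)) \<Omega>x (\<lambda>z. truncate N g z $ c)
        \<longleftrightarrow> zero_lateral_trace (tn m) (tn (Suc m)) \<Omega>x (\<lambda>z. 0)"
      using eq'[OF that] by (intro zero_lateral_trace_cong) simp
    then show ?thesis using zero_lateral_trace_zero[OF open_dom] by blast
  qed
  have 3: "poly_on (p K) K (\<lambda>z. truncate N g z $ c)" if K: "K \<in> elements M tn \<T>" for K
  proof -
    obtain m \<tau> where m: "m < M" "\<tau> \<in> \<T>" "K = cell m \<tau>" using K by (auto simp: elements_eq)
    have e: "truncate N g z $ c = (if m < N then g z $ c else 0)" if "z \<in> K" for z
      by (rule eq[OF m(1)]) (use that m(3) in \<open>simp add: cell_def\<close>)
    show ?thesis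
    proof (cases "m < N")
      case True
      then have "poly_on (p K) K (\<lambda>z. truncate N g z $ c) \<longleftrightarrow> poly_on (p K) K (\<lambda>z. g z $ c)"
        using e by (intro poly_on_cong) simp
      then show ?thesis using fe K by (simp add: fe_space_def)
    next
      case False
      then have "poly_on (p K) K (\<lambda>z. truncate N g z $ c) \<longleftrightarrow> poly_on (p K) K (\<lambda>z. 0)"
        using e by (intro poly_on_cong) simp
      then show ?thesis using poly_on_zero by blast
    qed
  qed
  show "(\<lambda>z. truncate N g z $ c) \<in> fe_space \<Omega>x M tn \<T> p"
    using 1 2 3 by (simp add: fe_space_def H0_tilde_def)
qed

text \<open>At level \<open>N\<close> itself the trace from above is already 0. The jump term there
  drops out, and the form sees exactly the slabs before \<open>N\<close>.\<close>

lemma truncate_trace_plus: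
  assumes g: "mesh_H1 g" and m: "m < M" and N: "N \<le> M" and x: "x \<in> \<Omega>x"
  shows "trace_plus (truncate N g) (tn m) x = (if m < N then trace_plus g (tn m) x else 0)"
proof (rule trace_plus_eq)
  have "((\<lambda>t. if m < N then g (t, x) else 0) \<longlongrightarrow> (if m < N then trace_plus g (tn m) x else 0)) (at_right (tn m))"
    using em_slab_H1_limits(1)[OF mesh_H1D[OF g m] x] by simp
  moreover have "\<forall>\<^sub>F t in at_right (tn m). (if m < N then g (t, x) else 0) = truncate N g (t, x)"
    unfolding eventually_at_right[OF tn_less[OF m]]
    using tn_less[OF m] truncate_cell[OF m N] by (intro exI[of _ "tn (Suc m)"]) auto
  ultimately show "((\<lambda>t. truncate N g (t, x)) \<longlongrightarrow> (if m < N then trace_plus g (tn m) x else 0)) (at_right (tn m))"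
    by (rule Lim_transform_eventually)
qed

end

lemma L2_inner_zero_right: "L2_inner A u (\<lambda>_. 0) = 0"
  by (simp add: L2_inner_def)

lemma sum_first_shift:
  fixes f :: "nat \<Rightarrow> real"
  assumes "0 < n"
  shows "(\<Sum>m<n. f m) = f 0 + (\<Sum>m=1..<n. f m)"
  using sum.atLeast_Suc_lessThan[OF assms, of f] by (simp add: lessThan_atLeast0)

text \<open>\<open>a\<close> and \<open>b\<close> stand for the squared traces from above and from
  below, \<open>c\<close> for their inner product. Each slab contributes half of its two end terms,
  and what meets at a common level is half a squared jump.\<close>

lemma energy_telescope:
  fixes a b c :: "nat \<Rightarrow> real"
  assumes "0 < n"
  shows "(\<Sum>m<n. b (Suc m) / 2 + a m / 2 - (if m = 0 then 0 else c m))
    = (a 0 + b n + (\<Sum>m=1..<n. a m - 2 * c m + b m)) / 2"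
  using assms
proof (induction n rule: nat_induct_non_zero)
  case (Suc n)
  then show ?case by (simp add: add_divide_distrib diff_divide_distrib)
qed simp

text \<open>The corresponding regrouping for the adjoint form. With \<open>c\<close> equal to zero
  it also serves as a shift of the summation index.\<close>

lemma trace_telescope:
  fixes b c :: "nat \<Rightarrow> real"
  assumes "0 < n"
  shows "(\<Sum>m<n. b (Suc m) - (if m = 0 then 0 else c m)) = b n + (\<Sum>m=1..<n. b m - c m)"
  using assms by (induction n rule: nat_induct_non_zero) simp_all

section \<open>Splitting of the discrete problem into slabs\<close>

context maxwell_mesh
begin

abbreviation cell_int :: "nat \<Rightarrow> (real^3) set \<Rightarrow> spacetime set" where
  "cell_int m \<tau> \<equiv> interior (cell m \<tau>)"

lemma mesh_H1_L2:
  assumes "mesh_H1 u" "m < M"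
  shows "sobolev_vec 1 (slab m) u" "L2_on (slab m) u" "L2_on (slab m) (maxwell_op (slab m) u)"
    "L2_on \<Omega>x (trace_plus u (tn m))" "L2_on \<Omega>x (trace_minus u (tn (Suc m)))"
proof -
  note h = mesh_H1D[OF assms]
  show s: "sobolev_vec 1 (slab m) u" by (rule em_slab_H1_sobolev[OF h])
  show "L2_on (slab m) u" by (rule em_slab_H1_L2[OF h])
  show "L2_on (slab m) (maxwell_op (slab m) u)" by (rule maxwell_op_L2[OF s open_slab])
  show "L2_on \<Omega>x (trace_plus u (tn m))" "L2_on \<Omega>x (trace_minus u (tn (Suc m)))"
    using em_slab_H1_trace_L2[OF h tn_less[OF assms(2)] open_dom bounded_dom] by auto
qed

lemma mesh_H1_left_trace_L2:
  assumes "mesh_H1 u" "m < M"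
  shows "L2_on \<Omega>x (\<lambda>x. if m = 0 then 0 else trace_minus u (tn m) x)"
proof (cases m)
  case 0
  then show ?thesis by (simp add: L2_on_zero)
next
  case (Suc n)
  then show ?thesis using mesh_H1_L2(5)[OF assms(1), of n] assms(2) by simp
qed

lemma L2_cell:
  "\<tau> \<in> \<T> \<Longrightarrow> L2_on (slab m) u \<Longrightarrow> L2_on (cell_int m \<tau>) u"
  by (rule L2_on_subset[OF _ interior_cell_sub]) auto

lemma L2_inner_slab_split:
  "L2_on (slab m) u \<Longrightarrow> L2_on (slab m) w \<Longrightarrow>
    L2_inner (slab m) u w = (\<Sum>\<tau>\<in>\<T>. L2_inner (cell_int m \<tau>) u w)"
  unfolding L2_inner_def by (rule slab_integral[OF L2_inner_integrable])

lemma maxwell_op_cell: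
  assumes "mesh_H1 u" "m < M" "\<tau> \<in> \<T>"
  shows "L2_on (cell_int m \<tau>) (maxwell_op (cell_int m \<tau>) u)"
    and "AE z in lborel. z \<in> cell_int m \<tau> \<longrightarrow> maxwell_op (cell_int m \<tau>) u z = maxwell_op (slab m) u z"
proof -
  note s = mesh_H1_L2(1)[OF assms(1,2)]
  show "AE z in lborel. z \<in> cell_int m \<tau> \<longrightarrow> maxwell_op (cell_int m \<tau>) u z = maxwell_op (slab m) u z"
    by (rule maxwell_op_restrict[OF s open_slab open_interior interior_cell_sub[OF assms(3)]])
  show "L2_on (cell_int m \<tau>) (maxwell_op (cell_int m \<tau>) u)"
    by (rule maxwell_op_L2[OF sobolev_vec_restrict[OF s open_slab open_interior interior_cell_sub[OF assms(3)]] open_interior])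
qed

text \<open>The pairing with \<open>g\<close> is kept over the whole slab, where the Green formula
  applies, and only the part weighted with \<delta> is split into cells. The operator on the slab
  replaces those on the cells, from which it differs on null sets.\<close>

definition src_slab :: "(spacetime set \<Rightarrow> real) \<Rightarrow> (spacetime \<Rightarrow> em) \<Rightarrow> (spacetime \<Rightarrow> em) \<Rightarrow> nat \<Rightarrow> real" where
  "src_slab \<delta> b g m = L2_inner (slab m) b g
     + (\<Sum>\<tau>\<in>\<T>. \<delta> (cell m \<tau>) * L2_inner (cell_int m \<tau>) b (maxwell_op (slab m) g))"

text \<open>Setting the trace from below to 0 at the first level merges the initial term of the form
  with its jump terms.\<close>

definition form_slab :: "(spacetime set \<Rightarrow> real) \<Rightarrow> (spacetime \<Rightarrow> em) \<Rightarrow> (spacetime \<Rightarrow> em) \<Rightarrow> nat \<Rightarrow> real" where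
  "form_slab \<delta> u g m = src_slab \<delta> (maxwell_op (slab m) u) g m
     + L2_inner \<Omega>x (\<lambda>x. trace_plus u (tn m) x - (if m = 0 then 0 else trace_minus u (tn m) x)) (trace_plus g (tn m))"

text \<open>The left factor may vary with the cell because it is also instantiated with
  \<open>maxwell_op (cell_int m \<tau>) u\<close>, whose representative depends on the cell.\<close>

lemma sum_cells_src:
  assumes b0: "L2_on (slab m) b0" and g: "mesh_H1 g" and m: "m < M"
    and b: "\<And>\<tau>. \<tau> \<in> \<T> \<Longrightarrow> L2_on (cell_int m \<tau>) (b \<tau>)"
    and eq: "\<And>\<tau>. \<tau> \<in> \<T> \<Longrightarrow> AE z in lborel. z \<in> cell_int m \<tau> \<longrightarrow> b \<tau> z = b0 z"
  shows "(\<Sum>\<tau>\<in>\<T>. L2_inner (cell_int m \<tau>) (b \<tau>) (\<lambda>z. g z + \<delta> (cell m \<tau>) *\<^sub>R maxwell_op (cell_int m \<tau>) g z))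
     = src_slab \<delta> b0 g m"
proof -
  have "L2_inner (cell_int m \<tau>) (b \<tau>) (\<lambda>z. g z + \<delta> (cell m \<tau>) *\<^sub>R maxwell_op (cell_int m \<tau>) g z)
      = L2_inner (cell_int m \<tau>) b0 g + \<delta> (cell m \<tau>) * L2_inner (cell_int m \<tau>) b0 (maxwell_op (slab m) g)"
    if \<tau>: "\<tau> \<in> \<T>" for \<tau>
  proof -
    note gL = L2_cell[OF \<tau> mesh_H1_L2(2)[OF g m]] and DL = L2_cell[OF \<tau> mesh_H1_L2(3)[OF g m]] and bL = L2_cell[OF \<tau> b0]
    note cL = maxwell_op_cell[OF g m \<tau>]
    have L1: "L2_on (cell_int m \<tau>) (\<lambda>z. g z + \<delta> (cell m \<tau>) *\<^sub>R maxwell_op (cell_int m \<tau>) g z)"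
      and L2: "L2_on (cell_int m \<tau>) (\<lambda>z. g z + \<delta> (cell m \<tau>) *\<^sub>R maxwell_op (slab m) g z)"
      by (intro L2_on_add L2_on_cmult gL cL(1) DL)+
    have "L2_inner (cell_int m \<tau>) (b \<tau>) (\<lambda>z. g z + \<delta> (cell m \<tau>) *\<^sub>R maxwell_op (cell_int m \<tau>) g z)
      = L2_inner (cell_int m \<tau>) b0 (\<lambda>z. g z + \<delta> (cell m \<tau>) *\<^sub>R maxwell_op (slab m) g z)"
    proof (rule L2_inner_AE_cong)
      show "AE z in lborel. z \<in> cell_int m \<tau> \<longrightarrow> g z + \<delta> (cell m \<tau>) *\<^sub>R maxwell_op (cell_int m \<tau>) g z
         = g z + \<delta> (cell m \<tau>) *\<^sub>R maxwell_op (slab m) g z"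
        using cL(2) by eventually_elim simp
    qed (use b[OF \<tau>] bL L1 L2 eq[OF \<tau>] in \<open>auto simp: L2_on_def\<close>)
    also have "\<dots> = L2_inner (cell_int m \<tau>) b0 g + \<delta> (cell m \<tau>) * L2_inner (cell_int m \<tau>) b0 (maxwell_op (slab m) g)"
      by (simp add: L2_inner_add_right[OF gL L2_on_cmult[OF DL] bL] L2_inner_cmult_right)
    finally show ?thesis .
  qed
  then show ?thesis
    using L2_inner_slab_split[OF b0 mesh_H1_L2(2)[OF g m]] by (simp add: src_slab_def sum.distrib)
qed

lemma maxwell_form_eq:
  assumes u: "mesh_H1 u" and g: "mesh_H1 g"
  shows "maxwell_form \<Omega>x M tn \<T> \<delta> u g = (\<Sum>m<M. form_slab \<delta> u g m)"
proof -
  have "(\<Sum>m<M. \<Sum>\<tau>\<in>\<T>. L2_inner (cell_int m \<tau>) (maxwell_op (cell_int m \<tau>) u)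
        (\<lambda>z. g z + \<delta> (cell m \<tau>) *\<^sub>R maxwell_op (cell_int m \<tau>) g z))
     = (\<Sum>m<M. src_slab \<delta> (maxwell_op (slab m) u) g m)"
    by (intro sum.cong refl sum_cells_src) (use u g mesh_H1_L2(3) maxwell_op_cell in auto)
  moreover have "(\<Sum>m<M. L2_inner \<Omega>x (\<lambda>x. trace_plus u (tn m) x - (if m = 0 then 0 else trace_minus u (tn m) x)) (trace_plus g (tn m)))
     = (\<Sum>m=1..<M. L2_inner \<Omega>x (jump u (tn m)) (trace_plus g (tn m))) + L2_inner \<Omega>x (trace_plus u (tn 0)) (trace_plus g (tn 0))"
    unfolding sum_first_shift[OF M_pos] by (simp add: jump_def[abs_def] add.commute)
  ultimately show ?thesis
    by (simp add: maxwell_form_def sum_elements form_slab_def sum.distrib)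
qed

lemma maxwell_rhs_eq:
  assumes b: "\<And>m. m < M \<Longrightarrow> L2_on (slab m) b" and g: "mesh_H1 g"
  shows "maxwell_rhs \<Omega>x M tn \<T> \<delta> W0 b g = (\<Sum>m<M. src_slab \<delta> b g m) + L2_inner \<Omega>x W0 (trace_plus g (tn 0))"
proof -
  have "(\<Sum>m<M. \<Sum>\<tau>\<in>\<T>. L2_inner (cell_int m \<tau>) b
        (\<lambda>z. g z + \<delta> (cell m \<tau>) *\<^sub>R maxwell_op (cell_int m \<tau>) g z))
     = (\<Sum>m<M. src_slab \<delta> b g m)"
    by (intro sum.cong refl sum_cells_src) (use b g L2_cell in auto)
  then show ?thesis by (simp add: maxwell_rhs_def sum_elements)
qed

lemma truncate_slab:
  assumes "m < M" "N \<le> M" "z \<in> slab m"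
  shows "truncate N g z = (if m < N then g z else 0)"
  using truncate_cell[OF assms(1,2), of "fst z" g "snd z"] assms(3) by auto

lemma src_slab_truncate:
  assumes b: "L2_on (slab m) b" and m: "m < M" and N: "N \<le> M"
  shows "src_slab \<delta> b (truncate N g) m = (if m < N then src_slab \<delta> b g m else 0)"
proof (cases "m < N")
  case True
  then have e: "truncate N g z = g z" if "z \<in> slab m" for z using truncate_slab[OF m N that] by simp
  have "L2_inner (slab m) b (truncate N g) = L2_inner (slab m) b g" by (rule L2_inner_cong) (simp_all add: e)
  moreover have "maxwell_op (slab m) (truncate N g) = maxwell_op (slab m) g" by (rule maxwell_op_cong) (rule e)
  ultimately show ?thesis using True by (simp add: src_slab_def)
next
  case False
  then have e: "truncate N g z = 0" if "z \<in> slab m" for z using truncate_slab[OF m N that] by simp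
  have "L2_inner (slab m) b (truncate N g) = L2_inner (slab m) b (\<lambda>_. 0)" by (rule L2_inner_cong) (simp_all add: e)
  then have 1: "L2_inner (slab m) b (truncate N g) = 0" by (simp add: L2_inner_zero_right)
  have "maxwell_op (slab m) (truncate N g) = maxwell_op (slab m) (\<lambda>_. 0)" by (rule maxwell_op_cong) (rule e)
  moreover have "L2_inner (cell_int m \<tau>) b (maxwell_op (slab m) (\<lambda>_. 0)) = 0" if \<tau>: "\<tau> \<in> \<T>" for \<tau>
  proof -
    have z: "sobolev_vec 1 (slab m) (\<lambda>_. 0)" by (simp add: sobolev_vec_def sobolev_zero(1))
    \<comment> \<open>The weak derivative chosen for the zero function is zero only almost
      everywhere.\<close>
    have "L2_inner (cell_int m \<tau>) b (maxwell_op (slab m) (\<lambda>_. 0)) = L2_inner (cell_int m \<tau>) b (\<lambda>_. 0)"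
    proof (rule L2_inner_AE_cong)
      show "AE z in lborel. z \<in> cell_int m \<tau> \<longrightarrow> maxwell_op (slab m) (\<lambda>_. 0) z = 0"
        using maxwell_op_zero[OF open_slab[of m]] interior_cell_sub[OF \<tau>, of m] by (auto elim!: eventually_mono)
    qed (use L2_cell[OF \<tau> b] L2_cell[OF \<tau> maxwell_op_L2[OF z open_slab]] L2_on_zero[of "cell_int m \<tau>"] in \<open>auto simp: L2_on_def\<close>)
    then show ?thesis by (simp add: L2_inner_zero_right)
  qed
  ultimately show ?thesis using False 1 by (simp add: src_slab_def)
qed

lemma form_slab_truncate:
  assumes u: "mesh_H1 u" and g: "mesh_H1 g" and m: "m < M" and N: "N \<le> M"
  shows "form_slab \<delta> u (truncate N g) m = (if m < N then form_slab \<delta> u g m else 0)"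
proof -
  let ?j = "\<lambda>x. trace_plus u (tn m) x - (if m = 0 then 0 else trace_minus u (tn m) x)"
  have "L2_inner \<Omega>x ?j (trace_plus (truncate N g) (tn m)) = L2_inner \<Omega>x ?j (\<lambda>x. if m < N then trace_plus g (tn m) x else 0)"
    by (rule L2_inner_cong) (simp_all add: truncate_trace_plus[OF g m N])
  then show ?thesis
    using src_slab_truncate[OF mesh_H1_L2(3)[OF u m] m N] by (simp add: form_slab_def L2_inner_zero_right)
qed

lemma src_slab_diff:
  assumes "L2_on (slab m) b" "L2_on (slab m) b'" "mesh_H1 g" "m < M"
  shows "src_slab \<delta> (\<lambda>z. b z - b' z) g m = src_slab \<delta> b g m - src_slab \<delta> b' g m"
proof -
  note L = mesh_H1_L2(2,3)[OF assms(3,4)]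
  have "L2_inner (cell_int m \<tau>) (\<lambda>z. b z - b' z) (maxwell_op (slab m) g)
     = L2_inner (cell_int m \<tau>) b (maxwell_op (slab m) g) - L2_inner (cell_int m \<tau>) b' (maxwell_op (slab m) g)"
    if "\<tau> \<in> \<T>" for \<tau>
    using that assms(1,2) L(2) by (intro L2_inner_diff_left L2_cell)
  then show ?thesis
    by (simp add: src_slab_def L2_inner_diff_left[OF assms(1,2) L(1)] right_diff_distrib sum_subtractf)
qed

lemma src_slab_AE_cong:
  assumes "L2_on (slab m) b" "L2_on (slab m) b'" "mesh_H1 g" "m < M"
    and eq: "AE z in lborel. z \<in> slab m \<longrightarrow> b z = b' z"
  shows "src_slab \<delta> b g m = src_slab \<delta> b' g m"
proof -
  note L = mesh_H1_L2(2,3)[OF assms(3,4)]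
  have "L2_inner (slab m) b g = L2_inner (slab m) b' g"
    by (rule L2_inner_AE_cong) (use assms L in \<open>auto simp: L2_on_def\<close>)
  moreover have "L2_inner (cell_int m \<tau>) b (maxwell_op (slab m) g) = L2_inner (cell_int m \<tau>) b' (maxwell_op (slab m) g)"
    if \<tau>: "\<tau> \<in> \<T>" for \<tau>
  proof (rule L2_inner_AE_cong)
    show "AE z in lborel. z \<in> cell_int m \<tau> \<longrightarrow> b z = b' z"
      using eq interior_cell_sub[OF \<tau>] by (auto elim!: eventually_mono)
  qed (use assms(1,2) L(2) L2_cell[OF \<tau>] in \<open>auto simp: L2_on_def\<close>)
  ultimately show ?thesis by (simp add: src_slab_def)
qed

lemma form_slab_diff:
  assumes u: "mesh_H1 u" and w: "mesh_H1 w" and g: "mesh_H1 g" and m: "m < M"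
  shows "form_slab \<delta> (\<lambda>z. u z - w z) g m = form_slab \<delta> u g m - form_slab \<delta> w g m"
proof -
  note d = mesh_H1_diff[OF u w]
  note Lu = mesh_H1_L2[OF u m] and Lw = mesh_H1_L2[OF w m] and Lg = mesh_H1_L2[OF g m]
  have "src_slab \<delta> (maxwell_op (slab m) (\<lambda>z. u z - w z)) g m = src_slab \<delta> (\<lambda>z. maxwell_op (slab m) u z - maxwell_op (slab m) w z) g m"
    by (rule src_slab_AE_cong[OF mesh_H1_L2(3)[OF d(1) m] L2_on_diff[OF Lu(3) Lw(3)] g m maxwell_op_diff[OF Lu(1) Lw(1) open_slab]])
  also have "\<dots> = src_slab \<delta> (maxwell_op (slab m) u) g m - src_slab \<delta> (maxwell_op (slab m) w) g m"
    by (rule src_slab_diff[OF Lu(3) Lw(3) g m])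
  finally have 1: "src_slab \<delta> (maxwell_op (slab m) (\<lambda>z. u z - w z)) g m = src_slab \<delta> (maxwell_op (slab m) u) g m - src_slab \<delta> (maxwell_op (slab m) w) g m" .
  define J where "J v x = trace_plus v (tn m) x - (if m = 0 then 0 else trace_minus v (tn m) x)" for v x
  have LJ: "L2_on \<Omega>x (J v)" if "mesh_H1 v" for v
    unfolding J_def by (rule L2_on_diff[OF mesh_H1_L2(4)[OF that m] mesh_H1_left_trace_L2[OF that m]])
  have "J (\<lambda>z. u z - w z) x = J u x - J w x" if "x \<in> \<Omega>x" for x
    using d(2)[OF m that] d(3)[of "m - 1" x] m that by (cases m) (auto simp: J_def)
  then have "L2_inner \<Omega>x (J (\<lambda>z. u z - w z)) (trace_plus g (tn m)) = L2_inner \<Omega>x (\<lambda>x. J u x - J w x) (trace_plus g (tn m))"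
    by (intro L2_inner_cong) auto
  also have "\<dots> = L2_inner \<Omega>x (J u) (trace_plus g (tn m)) - L2_inner \<Omega>x (J w) (trace_plus g (tn m))"
    by (rule L2_inner_diff_left[OF LJ[OF u] LJ[OF w] Lg(4)])
  finally have "L2_inner \<Omega>x (J (\<lambda>z. u z - w z)) (trace_plus g (tn m))
     = L2_inner \<Omega>x (J u) (trace_plus g (tn m)) - L2_inner \<Omega>x (J w) (trace_plus g (tn m))" .
  then show ?thesis using 1 by (simp add: form_slab_def J_def[abs_def])
qed

text \<open>Consistency of the method: \<open>W\<close> satisfies the equation on the slab and has
  no jump at later levels, and at the first level the convention in \<open>form_slab\<close> leaves
  its trace, which is the initial value.\<close>

lemma form_slab_exact:
  assumes W: "mesh_H1 W" and g: "mesh_H1 g" and m: "m < M" and b: "L2_on (slab m) b"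
    and eq: "AE z in lborel. z \<in> slab m \<longrightarrow> maxwell_op (slab m) W z = b z"
    and cont: "\<And>x. x \<in> \<Omega>x \<Longrightarrow> 0 < m \<Longrightarrow> trace_plus W (tn m) x = trace_minus W (tn m) x"
    and init: "\<And>x. x \<in> \<Omega>x \<Longrightarrow> trace_plus W (tn 0) x = W0 x"
  shows "form_slab \<delta> W g m = src_slab \<delta> b g m + (if m = 0 then L2_inner \<Omega>x W0 (trace_plus g (tn 0)) else 0)"
proof -
  have "L2_inner \<Omega>x (\<lambda>x. trace_plus W (tn m) x - (if m = 0 then 0 else trace_minus W (tn m) x)) (trace_plus g (tn m))
     = L2_inner \<Omega>x (\<lambda>x. if m = 0 then W0 x else 0) (trace_plus g (tn m))"
    using cont init by (intro L2_inner_cong) auto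
  also have "\<dots> = (if m = 0 then L2_inner \<Omega>x W0 (trace_plus g (tn 0)) else 0)"
    by (simp add: L2_inner_def)
  finally show ?thesis
    unfolding form_slab_def src_slab_AE_cong[OF mesh_H1_L2(3)[OF W m] b g m eq] by simp
qed

text \<open>Subtracting the relation for \<open>W\<close> from the discrete equation removes the
  initial value and leaves the difference of the sources, which is present because the method uses
  the current of the previous iterate. Adding and subtracting \<open>W'\<close> brings in \<eta>;
  the truncated test function cuts every sum off at \<open>N\<close>.\<close>

lemma galerkin_identity:
  assumes W: "mesh_H1 W" and b: "\<And>m. m < M \<Longrightarrow> L2_on (slab m) b" and bh: "\<And>m. m < M \<Longrightarrow> L2_on (slab m) bh"
    and eq: "\<And>m. m < M \<Longrightarrow> AE z in lborel. z \<in> slab m \<longrightarrow> maxwell_op (slab m) W z = b z"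
    and cont: "\<And>m x. x \<in> \<Omega>x \<Longrightarrow> 0 < m \<Longrightarrow> m < M \<Longrightarrow> trace_plus W (tn m) x = trace_minus W (tn m) x"
    and init: "\<And>x. x \<in> \<Omega>x \<Longrightarrow> trace_plus W (tn 0) x = W0 x"
    and sol: "discrete_maxwell_solution \<Omega>x M tn \<T> p \<delta> W0 bh Wh"
    and W': "W' \<in> em_fe_space \<Omega>x M tn \<T> p" and N: "N \<le> M"
  defines "\<xi> \<equiv> \<lambda>z. Wh z - W' z" and "\<eta> \<equiv> \<lambda>z. W z - W' z"
  shows "(\<Sum>m<N. form_slab \<delta> \<xi> \<xi> m) = (\<Sum>m<N. form_slab \<delta> \<eta> \<xi> m) + (\<Sum>m<N. src_slab \<delta> (\<lambda>z. bh z - b z) \<xi> m)"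
proof -
  have Wh: "Wh \<in> em_fe_space \<Omega>x M tn \<T> p" using sol by (simp add: discrete_maxwell_solution_def)
  have \<xi>: "\<xi> \<in> em_fe_space \<Omega>x M tn \<T> p" unfolding \<xi>_def by (rule em_fe_space_diff[OF Wh W'])
  define g where "g = truncate N \<xi>"
  have g: "g \<in> em_fe_space \<Omega>x M tn \<T> p" unfolding g_def by (rule truncate_fe[OF \<xi> N])
  note H = em_fe_mesh_H1[OF Wh] em_fe_mesh_H1[OF W'] em_fe_mesh_H1[OF \<xi>] em_fe_mesh_H1[OF g]
  have \<eta>: "mesh_H1 \<eta>" unfolding \<eta>_def by (rule mesh_H1_diff(1)[OF W H(2)])
  let ?w0 = "L2_inner \<Omega>x W0 (trace_plus g (tn 0))"
  have "maxwell_form \<Omega>x M tn \<T> \<delta> Wh g = maxwell_rhs \<Omega>x M tn \<T> \<delta> W0 bh g"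
    using sol g by (simp add: discrete_maxwell_solution_def)
  then have d: "(\<Sum>m<M. form_slab \<delta> Wh g m) = (\<Sum>m<M. src_slab \<delta> bh g m) + ?w0"
    by (simp add: maxwell_form_eq[OF H(1,4)] maxwell_rhs_eq[OF bh H(4)])
  have "(\<Sum>m<M. form_slab \<delta> W g m) = (\<Sum>m<M. src_slab \<delta> b g m + (if m = 0 then ?w0 else 0))"
  proof (intro sum.cong refl)
    fix m assume "m \<in> {..<M}"
    then have m: "m < M" by simp
    show "form_slab \<delta> W g m = src_slab \<delta> b g m + (if m = 0 then ?w0 else 0)"
      by (rule form_slab_exact[OF W H(4) m b[OF m] eq[OF m]]) (use cont m init in auto)
  qed
  also have "\<dots> = (\<Sum>m<M. src_slab \<delta> b g m) + ?w0"
    using M_pos by (simp add: sum.distrib sum.delta)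
  finally have e: "(\<Sum>m<M. form_slab \<delta> W g m) = (\<Sum>m<M. src_slab \<delta> b g m) + ?w0" .
  have "(\<Sum>m<M. form_slab \<delta> \<xi> g m) = (\<Sum>m<M. form_slab \<delta> Wh g m) - (\<Sum>m<M. form_slab \<delta> W' g m)"
    unfolding \<xi>_def by (simp add: form_slab_diff[OF H(1,2,4)] sum_subtractf)
  moreover have "(\<Sum>m<M. form_slab \<delta> \<eta> g m) = (\<Sum>m<M. form_slab \<delta> W g m) - (\<Sum>m<M. form_slab \<delta> W' g m)"
    unfolding \<eta>_def by (simp add: form_slab_diff[OF W H(2,4)] sum_subtractf)
  moreover have "(\<Sum>m<M. src_slab \<delta> (\<lambda>z. bh z - b z) g m) = (\<Sum>m<M. src_slab \<delta> bh g m) - (\<Sum>m<M. src_slab \<delta> b g m)"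
    using bh b by (simp add: src_slab_diff[OF _ _ H(4)] sum_subtractf)
  ultimately have m: "(\<Sum>m<M. form_slab \<delta> \<xi> g m) = (\<Sum>m<M. form_slab \<delta> \<eta> g m) + (\<Sum>m<M. src_slab \<delta> (\<lambda>z. bh z - b z) g m)"
    using d e by simp
  have trunc: "(\<Sum>m<M. F m) = (\<Sum>m<N. G m)" if "\<And>m. m < M \<Longrightarrow> F m = (if m < N then G m else 0)" for F G :: "nat \<Rightarrow> real"
  proof -
    have "(\<Sum>m<M. F m) = (\<Sum>m\<in>{..<M}. if m \<in> {..<N} then G m else 0)" using that by (intro sum.cong) auto
    also have "\<dots> = (\<Sum>m\<in>{..<M} \<inter> {..<N}. G m)" by (simp add: sum.inter_restrict)
    also have "{..<M} \<inter> {..<N} = {..<N}" using N by auto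
    finally show ?thesis .
  qed
  have "(\<Sum>m<M. form_slab \<delta> \<xi> g m) = (\<Sum>m<N. form_slab \<delta> \<xi> \<xi> m)" "(\<Sum>m<M. form_slab \<delta> \<eta> g m) = (\<Sum>m<N. form_slab \<delta> \<eta> \<xi> m)"
    unfolding g_def by (rule trunc, rule form_slab_truncate[OF _ H(3) _ N], rule H(3) \<eta>, assumption)+
  moreover have "(\<Sum>m<M. src_slab \<delta> (\<lambda>z. bh z - b z) g m) = (\<Sum>m<N. src_slab \<delta> (\<lambda>z. bh z - b z) \<xi> m)"
    unfolding g_def by (rule trunc, rule src_slab_truncate[OF L2_on_diff[OF bh b] _ N])
  ultimately show ?thesis using m by simp
qed

lemma slab_green:
  assumes u: "mesh_H1 u" and w: "mesh_H1 w" and m: "m < M"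
    and tr: "\<And>c. zero_lateral_trace (tn m) (tn (Suc m)) \<Omega>x (\<lambda>z. w z $ c)"
  shows "L2_inner (slab m) (maxwell_op (slab m) u) w = - L2_inner (slab m) u (maxwell_op (slab m) w)
     + L2_inner \<Omega>x (trace_minus u (tn (Suc m))) (trace_minus w (tn (Suc m))) - L2_inner \<Omega>x (trace_plus u (tn m)) (trace_plus w (tn m))"
proof -
  note Lu = mesh_H1_L2[OF u m] and Lw = mesh_H1_L2[OF w m]
  have "L2_inner (slab m) (maxwell_op (slab m) u) w + L2_inner (slab m) u (maxwell_op (slab m) w)
      = (LINT z:slab m|lborel. maxwell_op (slab m) u z \<bullet> w z + u z \<bullet> maxwell_op (slab m) w z)"
    unfolding L2_inner_def using L2_inner_integrable[OF Lu(3) Lw(2)] L2_inner_integrable[OF Lu(2) Lw(3)]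
    by (simp add: set_integral_add(2))
  also have "\<dots> = L2_inner \<Omega>x (trace_minus u (tn (Suc m))) (trace_minus w (tn (Suc m))) - L2_inner \<Omega>x (trace_plus u (tn m)) (trace_plus w (tn m))"
    using maxwell_green[OF open_dom bounded_dom tn_less[OF m] mesh_H1D[OF u m] mesh_H1D[OF w m] tr, of 1 0]
    by (simp add: L2_inner_def)
  finally show ?thesis by simp
qed

text \<open>With equal arguments, \<open>slab_green\<close> expresses the pairing with the Maxwell
  operator through traces alone, and \<open>energy_telescope\<close> turns these into squared
  jumps.\<close>

lemma form_sum_energy:
  assumes w: "mesh_H1 w" and N: "0 < N" "N \<le> M"
    and tr: "\<And>m c. m < M \<Longrightarrow> zero_lateral_trace (tn m) (tn (Suc m)) \<Omega>x (\<lambda>z. w z $ c)"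
  shows "(\<Sum>m<N. form_slab \<delta> w w m) =
      ((L2_norm \<Omega>x (trace_plus w (tn 0)))\<^sup>2 + (L2_norm \<Omega>x (trace_minus w (tn N)))\<^sup>2
       + (\<Sum>m=1..<N. (L2_norm \<Omega>x (jump w (tn m)))\<^sup>2)) / 2
      + (\<Sum>m<N. \<Sum>\<tau>\<in>\<T>. \<delta> (cell m \<tau>) * (L2_norm (cell_int m \<tau>) (maxwell_op (slab m) w))\<^sup>2)"
proof -
  define a where "a m = L2_inner \<Omega>x (trace_plus w (tn m)) (trace_plus w (tn m))" for m
  define b where "b m = L2_inner \<Omega>x (trace_minus w (tn m)) (trace_minus w (tn m))" for m
  define c where "c m = L2_inner \<Omega>x (trace_minus w (tn m)) (trace_plus w (tn m))" for m
  define X where "X m = (\<Sum>\<tau>\<in>\<T>. \<delta> (cell m \<tau>) * (L2_norm (cell_int m \<tau>) (maxwell_op (slab m) w))\<^sup>2)" for m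
  have Lm: "L2_on \<Omega>x (trace_minus w (tn m))" if "m < M" "0 < m" for m
    using mesh_H1_L2(5)[OF w, of "m - 1"] that by (cases m) auto
  have "form_slab \<delta> w w m = b (Suc m) / 2 + a m / 2 - (if m = 0 then 0 else c m) + X m" if m: "m < M" for m
  proof -
    have "L2_inner (slab m) (maxwell_op (slab m) w) w = (b (Suc m) - a m) / 2"
      using slab_green[OF w w m tr[OF m]] L2_inner_commute[of "slab m" w] by (simp add: a_def b_def)
    moreover have "L2_inner \<Omega>x (\<lambda>x. trace_plus w (tn m) x - (if m = 0 then 0 else trace_minus w (tn m) x)) (trace_plus w (tn m))
       = a m - (if m = 0 then 0 else c m)"
      using L2_inner_diff_left[OF mesh_H1_L2(4)[OF w m] Lm[OF m] mesh_H1_L2(4)[OF w m]]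
      by (cases "m = 0") (auto simp: a_def c_def)
    ultimately show ?thesis by (simp add: form_slab_def src_slab_def X_def L2_inner_self field_simps)
  qed
  then have "(\<Sum>m<N. form_slab \<delta> w w m) = (\<Sum>m<N. b (Suc m) / 2 + a m / 2 - (if m = 0 then 0 else c m)) + (\<Sum>m<N. X m)"
    using N(2) by (simp add: sum.distrib[symmetric])
  also have "\<dots> = (a 0 + b N + (\<Sum>m=1..<N. a m - 2 * c m + b m)) / 2 + (\<Sum>m<N. X m)"
    by (simp only: energy_telescope[OF N(1)])
  also have "(\<Sum>m=1..<N. a m - 2 * c m + b m) = (\<Sum>m=1..<N. (L2_norm \<Omega>x (jump w (tn m)))\<^sup>2)"
  proof (intro sum.cong refl)
    fix m assume "m \<in> {1..<N}"
    then have m: "m < M" "0 < m" using N by auto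
    note P = mesh_H1_L2(4)[OF w m(1)] and Q = Lm[OF m]
    have "(L2_norm \<Omega>x (jump w (tn m)))\<^sup>2 = L2_inner \<Omega>x (\<lambda>x. trace_plus w (tn m) x - trace_minus w (tn m) x) (jump w (tn m))"
      by (simp add: L2_inner_self[symmetric] jump_def[abs_def])
    also have "\<dots> = L2_inner \<Omega>x (jump w (tn m)) (trace_plus w (tn m)) - L2_inner \<Omega>x (jump w (tn m)) (trace_minus w (tn m))"
      using L2_inner_diff_left[OF P Q L2_on_diff[OF P Q]] by (simp add: jump_def[abs_def] L2_inner_commute)
    also have "L2_inner \<Omega>x (jump w (tn m)) (trace_plus w (tn m)) = a m - c m"
      unfolding jump_def[abs_def] a_def c_def by (rule L2_inner_diff_left[OF P Q P])
    also have "L2_inner \<Omega>x (jump w (tn m)) (trace_minus w (tn m)) = c m - b m"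
      using L2_inner_diff_left[OF P Q Q] by (simp add: jump_def[abs_def] b_def c_def L2_inner_commute)
    finally show "a m - 2 * c m + b m = (L2_norm \<Omega>x (jump w (tn m)))\<^sup>2" by simp
  qed
  finally show ?thesis by (simp add: a_def b_def X_def L2_inner_self)
qed

text \<open>The derivative is moved from \<open>u\<close> to \<open>w\<close>, and the traces of
  \<open>u\<close> from above cancel against the jump terms. What remains of \<open>w\<close> is its
  Maxwell operator, its jumps and its last trace, which are quantities contained in the
  energy.\<close>

lemma form_sum_adjoint:
  assumes u: "mesh_H1 u" and w: "mesh_H1 w" and N: "0 < N" "N \<le> M"
    and tr: "\<And>m c. m < M \<Longrightarrow> zero_lateral_trace (tn m) (tn (Suc m)) \<Omega>x (\<lambda>z. w z $ c)"
  shows "(\<Sum>m<N. form_slab \<delta> u w m) =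
      (\<Sum>m<N. \<Sum>\<tau>\<in>\<T>. \<delta> (cell m \<tau>) * L2_inner (cell_int m \<tau>) (maxwell_op (slab m) u) (maxwell_op (slab m) w)
         - L2_inner (cell_int m \<tau>) u (maxwell_op (slab m) w))
      + L2_inner \<Omega>x (trace_minus u (tn N)) (trace_minus w (tn N))
      - (\<Sum>m=1..<N. L2_inner \<Omega>x (trace_minus u (tn m)) (jump w (tn m)))"
proof -
  define b where "b m = L2_inner \<Omega>x (trace_minus u (tn m)) (trace_minus w (tn m))" for m
  define c where "c m = L2_inner \<Omega>x (trace_minus u (tn m)) (trace_plus w (tn m))" for m
  define X where "X m = (\<Sum>\<tau>\<in>\<T>. \<delta> (cell m \<tau>) * L2_inner (cell_int m \<tau>) (maxwell_op (slab m) u) (maxwell_op (slab m) w)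
         - L2_inner (cell_int m \<tau>) u (maxwell_op (slab m) w))" for m
  have Lm: "L2_on \<Omega>x (trace_minus v (tn m))" if "mesh_H1 v" "m < M" "0 < m" for v m
    using mesh_H1_L2(5)[OF that(1), of "m - 1"] that by (cases m) auto
  have "form_slab \<delta> u w m = b (Suc m) - (if m = 0 then 0 else c m) + X m" if m: "m < M" for m
  proof -
    have "L2_inner \<Omega>x (\<lambda>x. trace_plus u (tn m) x - (if m = 0 then 0 else trace_minus u (tn m) x)) (trace_plus w (tn m))
       = L2_inner \<Omega>x (trace_plus u (tn m)) (trace_plus w (tn m)) - (if m = 0 then 0 else c m)"
      using L2_inner_diff_left[OF mesh_H1_L2(4)[OF u m] Lm[OF u m] mesh_H1_L2(4)[OF w m]]
      by (cases "m = 0") (auto simp: c_def)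
    then show ?thesis
      using slab_green[OF u w m tr[OF m]] L2_inner_slab_split[OF mesh_H1_L2(2)[OF u m] mesh_H1_L2(3)[OF w m]]
      by (simp add: form_slab_def src_slab_def X_def b_def sum_subtractf)
  qed
  then have "(\<Sum>m<N. form_slab \<delta> u w m) = (\<Sum>m<N. b (Suc m) - (if m = 0 then 0 else c m)) + (\<Sum>m<N. X m)"
    using N(2) by (simp add: sum.distrib[symmetric])
  also have "\<dots> = b N + (\<Sum>m=1..<N. b m - c m) + (\<Sum>m<N. X m)"
    by (simp only: trace_telescope[OF N(1)])
  also have "(\<Sum>m=1..<N. b m - c m) = - (\<Sum>m=1..<N. L2_inner \<Omega>x (trace_minus u (tn m)) (jump w (tn m)))"
    unfolding sum_negf[symmetric]
  proof (intro sum.cong refl)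
    fix m assume "m \<in> {1..<N}"
    then have m: "m < M" "0 < m" using N by auto
    show "b m - c m = - L2_inner \<Omega>x (trace_minus u (tn m)) (jump w (tn m))"
      using L2_inner_diff_left[OF mesh_H1_L2(4)[OF w m(1)] Lm[OF w m] Lm[OF u m]]
      by (simp add: jump_def[abs_def] b_def c_def L2_inner_commute[of \<Omega>x "trace_minus u (tn m)"])
  qed
  finally show ?thesis by (simp add: b_def X_def)
qed

end

section \<open>Stability\<close>

lemma young_real:
  fixes x y s :: real
  assumes "0 < s"
  shows "x * y \<le> s * x\<^sup>2 + y\<^sup>2 / (4 * s)"
proof -
  have "0 \<le> (2 * s * x - y)\<^sup>2 / (4 * s)" using assms by simp
  also have "\<dots> = s * x\<^sup>2 + y\<^sup>2 / (4 * s) - x * y"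
    using assms by (simp add: field_simps power2_eq_square)
  finally show ?thesis by simp
qed

lemma L2_inner_young:
  assumes "L2_on A u" "L2_on A w" "0 < s"
  shows "\<bar>L2_inner A u w\<bar> \<le> s * (L2_norm A u)\<^sup>2 + (L2_norm A w)\<^sup>2 / (4 * s)"
  using L2_Cauchy_Schwarz[OF assms(1,2)] young_real[OF assms(3), of "L2_norm A u" "L2_norm A w"]
  by (simp add: L2_inner_def)

lemma abs_mult_unit_le: "0 \<le> \<theta> \<Longrightarrow> \<theta> \<le> 1 \<Longrightarrow> \<bar>\<theta> * p\<bar> \<le> \<bar>p :: real\<bar>"
  by (simp add: abs_mult mult_left_le_one_le)

text \<open>The Green formula in time with the weight that rises from 0 to 1 across the interval
  isolates the trace at \<open>b\<close>, and the reversed weight the trace at \<open>a\<close>; 1 /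
  (b - a) is the slope of the weight. The parameter \<open>r\<close> comes from Young's inequality
  and is later p / h, for which the value and the derivative of the interpolation error contribute
  equally.\<close>

lemma slab_trace_bound:
  fixes V :: "'b::euclidean_space set"
  assumes v: "slab_H1 a b V v va vb" and ab: "a < b" and V: "open V" "bounded V" and r: "0 < r"
  defines "S \<equiv> {a<..<b} \<times> V"
  shows "(L2_norm V vb)\<^sup>2 \<le> (1 / (b - a) + r) * (L2_norm S v)\<^sup>2 + (L2_norm S (wderiv S {#(1, 0)#} v))\<^sup>2 / r"
    and "(L2_norm V va)\<^sup>2 \<le> (1 / (b - a) + r) * (L2_norm S v)\<^sup>2 + (L2_norm S (wderiv S {#(1, 0)#} v))\<^sup>2 / r"
proof -
  let ?d = "wderiv S {#(1, 0)#} v"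
  have S: "open S" using V by (simp add: S_def open_Times)
  have s: "sobolev 1 S v" using v by (simp add: slab_H1_def S_def)
  have L: "L2_on S v" "L2_on S ?d" using sobolev_L2[OF s] sobolev1_wderiv(2)[OF s time_basis S] by auto
  have i: "set_integrable lborel S (\<lambda>z. v z * v z)" "set_integrable lborel S (\<lambda>z. ?d z * v z)" "set_integrable lborel S (\<lambda>z. ?d z * ?d z)"
    using L by (auto intro: L2_mult_integrable)
  have N: "(L2_norm A w)\<^sup>2 = (LINT z:A|lborel. w z * w z)" for A and w :: "'c::euclidean_space \<Rightarrow> real"
    unfolding L2_norm_sq by (simp add: power2_eq_square)
  have rhs: "(LINT z:S|lborel. (1 / (b - a) + r) * (v z * v z) + (1 / r) * (?d z * ?d z))
     = (1 / (b - a) + r) * (L2_norm S v)\<^sup>2 + (L2_norm S ?d)\<^sup>2 / r"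
    unfolding N using i by (subst set_integral_add(2)) auto
  have rint: "set_integrable lborel S (\<lambda>z. (1 / (b - a) + r) * (v z * v z) + (1 / r) * (?d z * ?d z))"
    using i by (intro set_integral_add(1) set_integrable_mult_right)
  have y: "\<bar>2 * (?d z * v z)\<bar> \<le> r * (v z * v z) + (1 / r) * (?d z * ?d z)" for z
  proof -
    have "0 \<le> (r * \<bar>v z\<bar> - \<bar>?d z\<bar>)\<^sup>2 / r" using r by simp
    also have "\<dots> = r * (v z * v z) + (1 / r) * (?d z * ?d z) - \<bar>2 * (?d z * v z)\<bar>"
      using r by (simp add: field_simps power2_eq_square abs_mult)
    finally show ?thesis by simp
  qed
  have "(LINT z:S|lborel. (- a / (b - a) + (1 / (b - a)) * fst z) * (?d z * v z + v z * ?d z) + (1 / (b - a)) * (v z * v z))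
      = (- a / (b - a) + (1 / (b - a)) * b) * (LINT x:V|lborel. vb x * vb x) - (- a / (b - a) + (1 / (b - a)) * a) * (LINT x:V|lborel. va x * va x)"
    unfolding S_def by (rule time_green[OF v v ab V])
  also have "- a / (b - a) + (1 / (b - a)) * b = 1" using ab diff_divide_distrib[of b a "b - a"] by simp
  also have "- a / (b - a) + (1 / (b - a)) * a = 0" by simp
  finally have e1: "(L2_norm V vb)\<^sup>2 = (LINT z:S|lborel. (- a / (b - a) + (1 / (b - a)) * fst z) * (?d z * v z + v z * ?d z) + (1 / (b - a)) * (v z * v z))"
    by (simp add: N)
  show "(L2_norm V vb)\<^sup>2 \<le> (1 / (b - a) + r) * (L2_norm S v)\<^sup>2 + (L2_norm S ?d)\<^sup>2 / r"
    unfolding e1 rhs[symmetric]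
  proof (rule set_integral_mono[OF _ rint])
    show "set_integrable lborel S (\<lambda>z. (- a / (b - a) + (1 / (b - a)) * fst z) * (?d z * v z + v z * ?d z) + (1 / (b - a)) * (v z * v z))"
      unfolding S_def
      by (intro set_integral_add(1) set_integrable_mult_right affine_weight_integrable) (use i in \<open>simp_all add: S_def mult.commute\<close>)
    fix z assume "z \<in> S"
    then have z: "a < fst z" "fst z < b" by (auto simp: S_def)
    define \<theta> where "\<theta> = - a / (b - a) + (1 / (b - a)) * fst z"
    have "\<theta> = (fst z - a) / (b - a)" by (simp add: \<theta>_def diff_divide_distrib)
    then have \<theta>: "0 \<le> \<theta>" "\<theta> \<le> 1" using z by auto
    have "\<theta> * (2 * (?d z * v z)) \<le> \<bar>2 * (?d z * v z)\<bar>"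
      using abs_mult_unit_le[OF \<theta>, of "2 * (?d z * v z)"] by linarith
    moreover have dd: "?d z * v z + v z * ?d z = 2 * (?d z * v z)" by simp
    ultimately show "(- a / (b - a) + (1 / (b - a)) * fst z) * (?d z * v z + v z * ?d z) + (1 / (b - a)) * (v z * v z)
       \<le> (1 / (b - a) + r) * (v z * v z) + (1 / r) * (?d z * ?d z)"
      using y[of z] unfolding \<theta>_def[symmetric] dd distrib_right by linarith
  qed
  have "(LINT z:S|lborel. (b / (b - a) + (- 1 / (b - a)) * fst z) * (?d z * v z + v z * ?d z) + (- 1 / (b - a)) * (v z * v z))
      = (b / (b - a) + (- 1 / (b - a)) * b) * (LINT x:V|lborel. vb x * vb x) - (b / (b - a) + (- 1 / (b - a)) * a) * (LINT x:V|lborel. va x * va x)"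
    unfolding S_def by (rule time_green[OF v v ab V])
  also have "b / (b - a) + (- 1 / (b - a)) * a = 1" using ab diff_divide_distrib[of b a "b - a"] by simp
  also have "b / (b - a) + (- 1 / (b - a)) * b = 0" by simp
  finally have e2: "(L2_norm V va)\<^sup>2 = (LINT z:S|lborel. (-1) * ((b / (b - a) + (- 1 / (b - a)) * fst z) * (?d z * v z + v z * ?d z) + (- 1 / (b - a)) * (v z * v z)))"
    by (simp only: N set_integral_mult_right) simp
  show "(L2_norm V va)\<^sup>2 \<le> (1 / (b - a) + r) * (L2_norm S v)\<^sup>2 + (L2_norm S ?d)\<^sup>2 / r"
    unfolding e2 rhs[symmetric]
  proof (rule set_integral_mono[OF _ rint])
    show "set_integrable lborel S (\<lambda>z. (-1) * ((b / (b - a) + (- 1 / (b - a)) * fst z) * (?d z * v z + v z * ?d z) + (- 1 / (b - a)) * (v z * v z)))"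
      unfolding S_def
      by (intro set_integral_add(1) set_integrable_mult_right affine_weight_integrable) (use i in \<open>simp_all add: S_def mult.commute\<close>)
    fix z assume "z \<in> S"
    then have z: "a < fst z" "fst z < b" by (auto simp: S_def)
    define \<theta> where "\<theta> = b / (b - a) + (- 1 / (b - a)) * fst z"
    have "\<theta> = (b - fst z) / (b - a)" by (simp add: \<theta>_def diff_divide_distrib)
    then have \<theta>: "0 \<le> \<theta>" "\<theta> \<le> 1" using z by auto
    have "- (\<theta> * (2 * (?d z * v z))) \<le> \<bar>2 * (?d z * v z)\<bar>"
      using abs_mult_unit_le[OF \<theta>, of "2 * (?d z * v z)"] by linarith
    moreover have dd: "?d z * v z + v z * ?d z = 2 * (?d z * v z)" by simp
    ultimately show "(-1) * ((b / (b - a) + (- 1 / (b - a)) * fst z) * (?d z * v z + v z * ?d z) + (- 1 / (b - a)) * (v z * v z))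
       \<le> (1 / (b - a) + r) * (v z * v z) + (1 / r) * (?d z * ?d z)"
      using y[of z] minus_divide_left[of 1 "b - a"] mult_minus_left[of "1 / (b - a)" "v z * v z"] unfolding \<theta>_def[symmetric] dd distrib_right mult_minus1 by linarith
  qed
qed

lemma em_slab_trace_bound:
  assumes u: "em_slab_H1 a b V u ua ub" and ab: "a < b" and V: "open V" "bounded V" and r: "0 < r"
  defines "S \<equiv> {a<..<b} \<times> V"
  defines "G \<equiv> (\<Sum>c\<in>UNIV. (L2_norm S (wderiv S {#(1, 0)#} (\<lambda>z. u z $ c)))\<^sup>2)"
  shows "(L2_norm V ub)\<^sup>2 \<le> (1 / (b - a) + r) * (L2_norm S u)\<^sup>2 + G / r"
    and "(L2_norm V ua)\<^sup>2 \<le> (1 / (b - a) + r) * (L2_norm S u)\<^sup>2 + G / r"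
proof -
  have h: "slab_H1 a b V (\<lambda>z. u z $ c) (\<lambda>x. ua x $ c) (\<lambda>x. ub x $ c)" for c using u by (simp add: em_slab_H1_def)
  have e: "(1 / (b - a) + r) * (L2_norm S u)\<^sup>2 + G / r
     = (\<Sum>c\<in>UNIV. (1 / (b - a) + r) * (L2_norm S (\<lambda>z. u z $ c))\<^sup>2 + (L2_norm S (wderiv S {#(1, 0)#} (\<lambda>z. u z $ c)))\<^sup>2 / r)"
    using em_slab_H1_L2[OF u]
    by (simp add: L2_norm_vec_sq S_def G_def sum.distrib sum_distrib_left sum_divide_distrib)
  show "(L2_norm V ub)\<^sup>2 \<le> (1 / (b - a) + r) * (L2_norm S u)\<^sup>2 + G / r"
    unfolding e L2_norm_vec_sq[OF em_slab_H1_trace_L2(2)[OF u ab V]]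
    by (intro sum_mono slab_trace_bound(1)[OF h ab V r, folded S_def])
  show "(L2_norm V ua)\<^sup>2 \<le> (1 / (b - a) + r) * (L2_norm S u)\<^sup>2 + G / r"
    unfolding e L2_norm_vec_sq[OF em_slab_H1_trace_L2(1)[OF u ab V]]
    by (intro sum_mono slab_trace_bound(2)[OF h ab V r, folded S_def])
qed

lemma maxwell_op_L2_norm_bound:
  assumes u: "sobolev_vec 1 S u" and S: "open S"
  shows "(L2_norm S (maxwell_op S u))\<^sup>2 \<le> 4 * (\<Sum>c\<in>UNIV. \<Sum>b\<in>Basis. (L2_norm S (wderiv S {#b#} (\<lambda>y. u y $ c)))\<^sup>2)"
proof -
  have L: "set_integrable lborel S (\<lambda>z. (wderiv S {#b#} (\<lambda>y. u y $ c) z)\<^sup>2)" if "b \<in> Basis" for b c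
    using sobolev1_wderiv(2)[OF _ that S, of "\<lambda>y. u y $ c"] u by (simp add: sobolev_vec_def L2_on_def)
  have i: "set_integrable lborel S (\<lambda>z. \<Sum>c\<in>UNIV. \<Sum>b\<in>Basis. (wderiv S {#b#} (\<lambda>y. u y $ c) z)\<^sup>2)"
    by (intro set_integral_sum(1) L)
  have "(L2_norm S (maxwell_op S u))\<^sup>2 \<le> (LINT z:S|lborel. 4 * (\<Sum>c\<in>UNIV. \<Sum>b\<in>Basis. (wderiv S {#b#} (\<lambda>y. u y $ c) z)\<^sup>2))"
    unfolding L2_norm_sq
  proof (rule set_integral_mono)
    show "set_integrable lborel S (\<lambda>z. (norm (maxwell_op S u z))\<^sup>2)"
      using maxwell_op_L2[OF u S] by (simp add: L2_on_def)
    show "set_integrable lborel S (\<lambda>z. 4 * (\<Sum>c\<in>UNIV. \<Sum>b\<in>Basis. (wderiv S {#b#} (\<lambda>y. u y $ c) z)\<^sup>2))"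
      using i by (intro set_integrable_mult_right)
  qed (rule maxwell_op_norm_bound)
  also have "\<dots> = 4 * (\<Sum>c\<in>UNIV. \<Sum>b\<in>Basis. (L2_norm S (wderiv S {#b#} (\<lambda>y. u y $ c)))\<^sup>2)"
    using L by (simp add: L2_norm_sq set_integral_sum)
  finally show ?thesis .
qed

section \<open>The energy and its bound\<close>

context maxwell_mesh
begin

text \<open>The weight t - t_m vanishes at the lower end, and its derivative 1 puts the squared L2
  norm itself into the Green formula. Young's inequality gives back half of this norm, hence the
  factors 2 and 4.\<close>

lemma slab_poincare:
  assumes w: "mesh_H1 w" and m: "m < M"
    and tr: "\<And>c. zero_lateral_trace (tn m) (tn (Suc m)) \<Omega>x (\<lambda>z. w z $ c)"
  defines "\<Delta> \<equiv> tn (Suc m) - tn m"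
  shows "(L2_norm (slab m) w)\<^sup>2 \<le> 2 * \<Delta> * (L2_norm \<Omega>x (trace_minus w (tn (Suc m))))\<^sup>2
     + 4 * \<Delta>\<^sup>2 * (L2_norm (slab m) (maxwell_op (slab m) w))\<^sup>2"
proof -
  let ?D = "maxwell_op (slab m) w"
  note L = mesh_H1_L2[OF w m]
  have i: "set_integrable lborel (slab m) (\<lambda>z. (norm (w z))\<^sup>2)" "set_integrable lborel (slab m) (\<lambda>z. (norm (?D z))\<^sup>2)"
    using L by (auto simp: L2_on_def)
  have j: "set_integrable lborel (slab m) (\<lambda>z. ?D z \<bullet> w z + w z \<bullet> ?D z)"
    by (intro set_integral_add(1) L2_inner_integrable L)
  have j': "set_integrable lborel (slab m) (\<lambda>z. (- tn m + 1 * fst z) * (?D z \<bullet> w z + w z \<bullet> ?D z))"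
    by (rule affine_weight_integrable[OF j])
  have "(LINT z:slab m|lborel. (- tn m + 1 * fst z) * (?D z \<bullet> w z + w z \<bullet> ?D z) + 1 * (w z \<bullet> w z))
      = (- tn m + 1 * tn (Suc m)) * (LINT x:\<Omega>x|lborel. trace_minus w (tn (Suc m)) x \<bullet> trace_minus w (tn (Suc m)) x)
        - (- tn m + 1 * tn m) * (LINT x:\<Omega>x|lborel. trace_plus w (tn m) x \<bullet> trace_plus w (tn m) x)"
    by (rule maxwell_green[OF open_dom bounded_dom tn_less[OF m] mesh_H1D[OF w m] mesh_H1D[OF w m] tr])
  then have g: "(LINT z:slab m|lborel. (- tn m + 1 * fst z) * (?D z \<bullet> w z + w z \<bullet> ?D z)) + (L2_norm (slab m) w)\<^sup>2
      = \<Delta> * (L2_norm \<Omega>x (trace_minus w (tn (Suc m))))\<^sup>2"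
    using set_integral_add(2)[OF j' i(1)] by (simp add: L2_norm_sq power2_norm_eq_inner \<Delta>_def)
  have "(LINT z:slab m|lborel. - (1 / 2) * (norm (w z))\<^sup>2 - 2 * \<Delta>\<^sup>2 * (norm (?D z))\<^sup>2)
     \<le> (LINT z:slab m|lborel. (- tn m + 1 * fst z) * (?D z \<bullet> w z + w z \<bullet> ?D z))"
  proof (rule set_integral_mono[OF _ j'])
    show "set_integrable lborel (slab m) (\<lambda>z. - (1 / 2) * (norm (w z))\<^sup>2 - 2 * \<Delta>\<^sup>2 * (norm (?D z))\<^sup>2)"
      using i by (intro set_integral_diff(1) set_integrable_mult_right)
    fix z assume "z \<in> slab m"
    then have z: "0 \<le> fst z - tn m" "fst z - tn m \<le> \<Delta>" by (auto simp: \<Delta>_def)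
    have "\<bar>(fst z - tn m) * (2 * (w z \<bullet> ?D z))\<bar> \<le> \<Delta> * (2 * (norm (w z) * norm (?D z)))"
      unfolding abs_mult using z Cauchy_Schwarz_ineq2[of "w z" "?D z"] by (intro mult_mono) auto
    also have "\<dots> = norm (w z) * (2 * \<Delta> * norm (?D z))" by simp
    also have "\<dots> \<le> (1 / 2) * (norm (w z))\<^sup>2 + (2 * \<Delta> * norm (?D z))\<^sup>2 / (4 * (1 / 2))"
      by (rule young_real) simp
    finally show "- (1 / 2) * (norm (w z))\<^sup>2 - 2 * \<Delta>\<^sup>2 * (norm (?D z))\<^sup>2 \<le> (- tn m + 1 * fst z) * (?D z \<bullet> w z + w z \<bullet> ?D z)"
      by (simp add: inner_commute[of "?D z"] power_mult_distrib abs_le_iff)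
  qed
  also have "(LINT z:slab m|lborel. - (1 / 2) * (norm (w z))\<^sup>2 - 2 * \<Delta>\<^sup>2 * (norm (?D z))\<^sup>2)
     = - (1 / 2) * (L2_norm (slab m) w)\<^sup>2 - 2 * \<Delta>\<^sup>2 * (L2_norm (slab m) ?D)\<^sup>2"
    unfolding L2_norm_sq using i by (subst set_integral_diff(2)) (auto simp only: set_integral_mult_right intro!: set_integrable_mult_right)
  finally show ?thesis using g unfolding mult.assoc by linarith
qed

text \<open>For \<open>N = M\<close> and nonnegative \<delta> this is the square of
  \<open>maxwell_norm\<close>; for smaller \<open>N\<close> it is the same quantity for the problem
  stopped at level \<open>N\<close>, and it is what the form yields on the diagonal.\<close>

definition energy :: "(spacetime set \<Rightarrow> real) \<Rightarrow> (spacetime \<Rightarrow> em) \<Rightarrow> nat \<Rightarrow> real" where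
  "energy \<delta> w N =
      ((L2_norm \<Omega>x (trace_plus w (tn 0)))\<^sup>2 + (L2_norm \<Omega>x (trace_minus w (tn N)))\<^sup>2
       + (\<Sum>m=1..<N. (L2_norm \<Omega>x (jump w (tn m)))\<^sup>2)) / 2
      + (\<Sum>m<N. \<Sum>\<tau>\<in>\<T>. \<delta> (cell m \<tau>) * (L2_norm (cell_int m \<tau>) (maxwell_op (slab m) w))\<^sup>2)"

lemma maxwell_norm_energy:
  assumes u: "mesh_H1 u" and \<delta>: "\<And>K. K \<in> elements M tn \<T> \<Longrightarrow> 0 \<le> \<delta> K"
  shows "(maxwell_norm \<Omega>x M tn \<T> \<delta> u)\<^sup>2 = energy \<delta> u M"
proof -
  have "(L2_norm (cell_int m \<tau>) (maxwell_op (cell_int m \<tau>) u)) = (L2_norm (cell_int m \<tau>) (maxwell_op (slab m) u))"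
    if "m < M" "\<tau> \<in> \<T>" for m \<tau>
    by (rule L2_norm_AE_cong)
       (use maxwell_op_cell[OF u that] L2_cell[OF that(2) mesh_H1_L2(3)[OF u that(1)]] in \<open>auto simp: L2_on_def\<close>)
  then have s: "(\<Sum>K\<in>elements M tn \<T>. \<delta> K * (L2_norm (interior K) (maxwell_op (interior K) u))\<^sup>2)
    = (\<Sum>m<M. \<Sum>\<tau>\<in>\<T>. \<delta> (cell m \<tau>) * (L2_norm (cell_int m \<tau>) (maxwell_op (slab m) u))\<^sup>2)"
    by (simp add: sum_elements)
  have nn: "0 \<le> energy \<delta> u M"
    unfolding energy_def using \<delta> cell_in_elements
    by (intro add_nonneg_nonneg divide_nonneg_nonneg sum_nonneg mult_nonneg_nonneg) auto
  have "maxwell_norm \<Omega>x M tn \<T> \<delta> u = sqrt (energy \<delta> u M)"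
    unfolding maxwell_norm_def s energy_def by (simp add: distrib_left)
  then show ?thesis using nn by simp
qed

lemma energy_diff_le:
  assumes u: "mesh_H1 u" and w: "mesh_H1 w" and \<delta>: "\<And>K. K \<in> elements M tn \<T> \<Longrightarrow> 0 \<le> \<delta> K"
  shows "energy \<delta> (\<lambda>z. u z - w z) M \<le> 2 * energy \<delta> u M + 2 * energy \<delta> w M"
proof -
  note d = mesh_H1_diff[OF u w]
  have tp: "(L2_norm \<Omega>x (trace_plus (\<lambda>z. u z - w z) (tn m)))\<^sup>2 \<le> 2 * (L2_norm \<Omega>x (trace_plus u (tn m)))\<^sup>2 + 2 * (L2_norm \<Omega>x (trace_plus w (tn m)))\<^sup>2"
    if m: "m < M" for m
    using L2_norm_diff_sq_le[OF mesh_H1_L2(4)[OF u m] mesh_H1_L2(4)[OF w m]] L2_norm_cong[of \<Omega>x "trace_plus (\<lambda>z. u z - w z) (tn m)", OF d(2)[OF m]] by simp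
  have tm: "(L2_norm \<Omega>x (trace_minus (\<lambda>z. u z - w z) (tn (Suc m))))\<^sup>2 \<le> 2 * (L2_norm \<Omega>x (trace_minus u (tn (Suc m))))\<^sup>2 + 2 * (L2_norm \<Omega>x (trace_minus w (tn (Suc m))))\<^sup>2"
    if m: "m < M" for m
    using L2_norm_diff_sq_le[OF mesh_H1_L2(5)[OF u m] mesh_H1_L2(5)[OF w m]] L2_norm_cong[of \<Omega>x "trace_minus (\<lambda>z. u z - w z) (tn (Suc m))", OF d(3)[OF m]] by simp
  have LJ: "L2_on \<Omega>x (jump v (tn m))" if "mesh_H1 v" "m < M" "1 \<le> m" for v m
    unfolding jump_def[abs_def] using mesh_H1_L2(4)[OF that(1,2)] mesh_H1_L2(5)[OF that(1), of "m - 1"] that by (intro L2_on_diff) auto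
  have j: "(L2_norm \<Omega>x (jump (\<lambda>z. u z - w z) (tn m)))\<^sup>2 \<le> 2 * (L2_norm \<Omega>x (jump u (tn m)))\<^sup>2 + 2 * (L2_norm \<Omega>x (jump w (tn m)))\<^sup>2"
    if m: "m < M" "1 \<le> m" for m
  proof -
    have "L2_norm \<Omega>x (jump (\<lambda>z. u z - w z) (tn m)) = L2_norm \<Omega>x (\<lambda>x. jump u (tn m) x - jump w (tn m) x)"
      using d(2)[OF m(1)] d(3)[of "m - 1"] m by (intro L2_norm_cong) (auto simp: jump_def)
    then show ?thesis using L2_norm_diff_sq_le[OF LJ[OF u m] LJ[OF w m]] by simp
  qed
  have c: "(L2_norm (cell_int m \<tau>) (maxwell_op (slab m) (\<lambda>z. u z - w z)))\<^sup>2
     \<le> 2 * (L2_norm (cell_int m \<tau>) (maxwell_op (slab m) u))\<^sup>2 + 2 * (L2_norm (cell_int m \<tau>) (maxwell_op (slab m) w))\<^sup>2"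
    if m: "m < M" and \<tau>: "\<tau> \<in> \<T>" for m \<tau>
  proof -
    note Lu = L2_cell[OF \<tau> mesh_H1_L2(3)[OF u m]] and Lw = L2_cell[OF \<tau> mesh_H1_L2(3)[OF w m]]
    have "AE z in lborel. z \<in> cell_int m \<tau> \<longrightarrow> maxwell_op (slab m) (\<lambda>z. u z - w z) z = maxwell_op (slab m) u z - maxwell_op (slab m) w z"
      using maxwell_op_diff[OF mesh_H1_L2(1)[OF u m] mesh_H1_L2(1)[OF w m] open_slab] interior_cell_sub[OF \<tau>, of m]
      by (auto elim!: eventually_mono)
    then have "L2_norm (cell_int m \<tau>) (maxwell_op (slab m) (\<lambda>z. u z - w z)) = L2_norm (cell_int m \<tau>) (\<lambda>z. maxwell_op (slab m) u z - maxwell_op (slab m) w z)"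
      using L2_cell[OF \<tau> mesh_H1_L2(3)[OF d(1) m]] L2_on_diff[OF Lu Lw] by (intro L2_norm_AE_cong) (auto simp: L2_on_def)
    then show ?thesis using L2_norm_diff_sq_le[OF Lu Lw] by simp
  qed
  have "(\<Sum>m=1..<M. (L2_norm \<Omega>x (jump (\<lambda>z. u z - w z) (tn m)))\<^sup>2)
     \<le> (\<Sum>m=1..<M. 2 * (L2_norm \<Omega>x (jump u (tn m)))\<^sup>2 + 2 * (L2_norm \<Omega>x (jump w (tn m)))\<^sup>2)"
    by (intro sum_mono j) auto
  then have "(\<Sum>m=1..<M. (L2_norm \<Omega>x (jump (\<lambda>z. u z - w z) (tn m)))\<^sup>2)
     \<le> 2 * (\<Sum>m=1..<M. (L2_norm \<Omega>x (jump u (tn m)))\<^sup>2) + 2 * (\<Sum>m=1..<M. (L2_norm \<Omega>x (jump w (tn m)))\<^sup>2)"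
    by (simp only: sum.distrib sum_distrib_left)
  moreover have "(\<Sum>m<M. \<Sum>\<tau>\<in>\<T>. \<delta> (cell m \<tau>) * (L2_norm (cell_int m \<tau>) (maxwell_op (slab m) (\<lambda>z. u z - w z)))\<^sup>2)
     \<le> (\<Sum>m<M. \<Sum>\<tau>\<in>\<T>. \<delta> (cell m \<tau>) * (2 * (L2_norm (cell_int m \<tau>) (maxwell_op (slab m) u))\<^sup>2 + 2 * (L2_norm (cell_int m \<tau>) (maxwell_op (slab m) w))\<^sup>2))"
    by (intro sum_mono mult_left_mono c \<delta> cell_in_elements) auto
  then have "(\<Sum>m<M. \<Sum>\<tau>\<in>\<T>. \<delta> (cell m \<tau>) * (L2_norm (cell_int m \<tau>) (maxwell_op (slab m) (\<lambda>z. u z - w z)))\<^sup>2)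
     \<le> 2 * (\<Sum>m<M. \<Sum>\<tau>\<in>\<T>. \<delta> (cell m \<tau>) * (L2_norm (cell_int m \<tau>) (maxwell_op (slab m) u))\<^sup>2)
       + 2 * (\<Sum>m<M. \<Sum>\<tau>\<in>\<T>. \<delta> (cell m \<tau>) * (L2_norm (cell_int m \<tau>) (maxwell_op (slab m) w))\<^sup>2)"
    by (simp only: distrib_left sum.distrib sum_distrib_left mult.left_commute[of "\<delta> _" 2])
  moreover have "(L2_norm \<Omega>x (trace_minus (\<lambda>z. u z - w z) (tn M)))\<^sup>2 \<le> 2 * (L2_norm \<Omega>x (trace_minus u (tn M)))\<^sup>2 + 2 * (L2_norm \<Omega>x (trace_minus w (tn M)))\<^sup>2"
    using tm[of "M - 1"] M_pos by simp
  ultimately show ?thesis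
    unfolding energy_def using tp[OF M_pos] by argo
qed

text \<open>A squared jump is at most twice the sum of the two squared traces, and the factor 1 / 2
  in the energy compensates for this.\<close>

lemma energy_le_traces:
  assumes u: "mesh_H1 u"
  shows "energy \<delta> u M \<le> (\<Sum>m<M. (L2_norm \<Omega>x (trace_plus u (tn m)))\<^sup>2 + (L2_norm \<Omega>x (trace_minus u (tn (Suc m))))\<^sup>2)
     + (\<Sum>m<M. \<Sum>\<tau>\<in>\<T>. \<delta> (cell m \<tau>) * (L2_norm (cell_int m \<tau>) (maxwell_op (slab m) u))\<^sup>2)"
proof -
  define p where "p m = (L2_norm \<Omega>x (trace_plus u (tn m)))\<^sup>2" for m
  define q where "q m = (L2_norm \<Omega>x (trace_minus u (tn m)))\<^sup>2" for m
  have pq: "0 \<le> p m" "0 \<le> q m" for m by (auto simp: p_def q_def)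
  have "(L2_norm \<Omega>x (jump u (tn m)))\<^sup>2 \<le> 2 * p m + 2 * q m" if m: "m < M" "1 \<le> m" for m
    unfolding jump_def[abs_def] p_def q_def
    using mesh_H1_L2(4)[OF u m(1)] mesh_H1_L2(5)[OF u, of "m - 1"] m by (intro L2_norm_diff_sq_le) auto
  then have "(\<Sum>m=1..<M. (L2_norm \<Omega>x (jump u (tn m)))\<^sup>2) \<le> (\<Sum>m=1..<M. 2 * p m + 2 * q m)"
    by (intro sum_mono) auto
  also have "\<dots> = 2 * ((\<Sum>m=1..<M. p m) + (\<Sum>m=1..<M. q m))" by (simp add: sum.distrib sum_distrib_left)
  finally have J: "(\<Sum>m=1..<M. (L2_norm \<Omega>x (jump u (tn m)))\<^sup>2) \<le> 2 * ((\<Sum>m=1..<M. p m) + (\<Sum>m=1..<M. q m))" .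
  have "(\<Sum>m<M. p m) = p 0 + (\<Sum>m=1..<M. p m)" by (rule sum_first_shift[OF M_pos])
  moreover have "(\<Sum>m<M. q (Suc m)) = q M + (\<Sum>m=1..<M. q m)"
    using trace_telescope[OF M_pos, of q "\<lambda>_. 0"] by (simp add: if_distrib)
  ultimately show ?thesis
    using J pq(1)[of 0] pq(2)[of M] unfolding energy_def by (simp add: p_def[symmetric] q_def[symmetric] sum.distrib)
qed

text \<open>
  Testing with the error restricted to \<open>t \<le> t\<^sub>N\<close> bounds the energy up to every time level; the maximum
  over the levels takes the place of Gronwall's inequality.
\<close>

theorem energy_stability:
  assumes \<xi>: "mesh_H1 \<xi>" and \<eta>: "mesh_H1 \<eta>" and b: "\<And>m. m < M \<Longrightarrow> L2_on (slab m) b"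
    and tr: "\<And>m c. m < M \<Longrightarrow> zero_lateral_trace (tn m) (tn (Suc m)) \<Omega>x (\<lambda>z. \<xi> z $ c)"
    and id: "\<And>N. N \<le> M \<Longrightarrow> (\<Sum>m<N. form_slab \<delta> \<xi> \<xi> m) = (\<Sum>m<N. form_slab \<delta> \<eta> \<xi> m) + (\<Sum>m<N. src_slab \<delta> b \<xi> m)"
    and \<delta>: "\<And>m \<tau>. m < M \<Longrightarrow> \<tau> \<in> \<T> \<Longrightarrow> 0 < \<delta> (cell m \<tau>)"
    and \<kappa>: "0 < \<kappa>" "\<And>m \<tau>. m < M \<Longrightarrow> \<tau> \<in> \<T> \<Longrightarrow> (tn (Suc m) - tn m)\<^sup>2 \<le> \<kappa> * \<delta> (cell m \<tau>)"
  shows "energy \<delta> \<xi> M \<le> 4 * (\<Sum>m<M. (L2_norm \<Omega>x (trace_minus \<eta> (tn (Suc m))))\<^sup>2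
     + (\<Sum>\<tau>\<in>\<T>. 2 / \<delta> (cell m \<tau>) * (L2_norm (cell_int m \<tau>) \<eta>)\<^sup>2
         + 2 * \<delta> (cell m \<tau>) * (L2_norm (cell_int m \<tau>) (maxwell_op (slab m) \<eta>))\<^sup>2
         + (2 * \<delta> (cell m \<tau>) + 4 * (T + \<kappa>)) * (L2_norm (cell_int m \<tau>) b)\<^sup>2))"
proof -
  define x where "x m \<tau> = (L2_norm (cell_int m \<tau>) (maxwell_op (slab m) \<xi>))\<^sup>2" for m \<tau>
  define r where "r m = (\<Sum>\<tau>\<in>\<T>. 2 / \<delta> (cell m \<tau>) * (L2_norm (cell_int m \<tau>) \<eta>)\<^sup>2
         + 2 * \<delta> (cell m \<tau>) * (L2_norm (cell_int m \<tau>) (maxwell_op (slab m) \<eta>))\<^sup>2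
         + (2 * \<delta> (cell m \<tau>) + 4 * (T + \<kappa>)) * (L2_norm (cell_int m \<tau>) b)\<^sup>2)" for m
  define q where "q m = (L2_norm \<Omega>x (trace_minus \<eta> (tn m)))\<^sup>2" for m
  define R where "R = (\<Sum>m<M. q (Suc m) + r m)"
  define s where "s m = (L2_norm \<Omega>x (trace_minus \<xi> (tn m)))\<^sup>2" for m
  define J where "J m = (L2_norm \<Omega>x (jump \<xi> (tn m)))\<^sup>2" for m
  define A where "A N = energy \<delta> \<xi> N" for N
  have T\<kappa>: "0 < T + \<kappa>" using T_pos \<kappa> by simp
  have r0: "0 \<le> r m" if "m < M" for m
    unfolding r_def using \<delta>[OF that] T_pos \<kappa>(1) by (intro sum_nonneg add_nonneg_nonneg mult_nonneg_nonneg) (auto simp: less_imp_le)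
  have nn: "0 \<le> x m \<tau>" "0 \<le> q m" "0 \<le> s m" "0 \<le> J m" for m \<tau> by (auto simp: x_def q_def s_def J_def)
  have Aeq: "A N = ((L2_norm \<Omega>x (trace_plus \<xi> (tn 0)))\<^sup>2 + s N + (\<Sum>m=1..<N. J m)) / 2 + (\<Sum>m<N. \<Sum>\<tau>\<in>\<T>. \<delta> (cell m \<tau>) * x m \<tau>)" for N
    by (simp add: A_def energy_def s_def J_def x_def)
  have dx: "0 \<le> (\<Sum>m<N. \<Sum>\<tau>\<in>\<T>. \<delta> (cell m \<tau>) * x m \<tau>)" if "N \<le> M" for N
    using \<delta> nn that by (intro sum_nonneg mult_nonneg_nonneg) (auto simp: less_imp_le)
  have Js: "0 \<le> (\<Sum>m=1..<N. J m)" for N by (intro sum_nonneg nn)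
  have sA: "s N \<le> 2 * A N" and xA: "(\<Sum>m<N. \<Sum>\<tau>\<in>\<T>. \<delta> (cell m \<tau>) * x m \<tau>) \<le> A N" if "N \<le> M" for N
    unfolding Aeq using dx[OF that] Js[of N] nn(3)[of N] zero_le_power2[of "L2_norm \<Omega>x (trace_plus \<xi> (tn 0))"] by argo+
  define A1 where "A1 = Max (A ` {1..M})"
  have A1: "A N \<le> A1" if "N \<in> {1..M}" for N unfolding A1_def using that by (intro Max_ge) auto
  have A1_0: "0 \<le> A1" using A1[of M] sA[of M] nn(3)[of M] M_pos by simp
  \<comment> \<open>The traces from below at all levels up to \<open>N\<close> enter here, while
    \<open>A N\<close> contains only the last of them together with jumps. This is what brings in
    the maximum \<open>A1\<close>.\<close>
  have y: "(\<Sum>m<N. (L2_norm (slab m) \<xi>)\<^sup>2) \<le> 4 * (T + \<kappa>) * A1" if N: "N \<in> {1..M}" for N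
  proof -
    have "(L2_norm (slab m) \<xi>)\<^sup>2 \<le> 4 * (tn (Suc m) - tn m) * A1 + 4 * \<kappa> * (\<Sum>\<tau>\<in>\<T>. \<delta> (cell m \<tau>) * x m \<tau>)"
      if m: "m < N" for m
    proof -
      have mM: "m < M" using m N by simp
      define d where "d = tn (Suc m) - tn m"
      note DL = mesh_H1_L2(3)[OF \<xi> mM]
      have "d\<^sup>2 * (L2_norm (slab m) (maxwell_op (slab m) \<xi>))\<^sup>2 = (\<Sum>\<tau>\<in>\<T>. d\<^sup>2 * x m \<tau>)"
        using L2_inner_slab_split[OF DL DL] by (simp add: L2_inner_self x_def sum_distrib_left)
      also have "\<dots> \<le> (\<Sum>\<tau>\<in>\<T>. \<kappa> * \<delta> (cell m \<tau>) * x m \<tau>)"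
        unfolding d_def by (intro sum_mono mult_right_mono \<kappa>(2) mM nn)
      also have "\<dots> = \<kappa> * (\<Sum>\<tau>\<in>\<T>. \<delta> (cell m \<tau>) * x m \<tau>)" by (simp add: sum_distrib_left mult.assoc)
      finally have 1: "d\<^sup>2 * (L2_norm (slab m) (maxwell_op (slab m) \<xi>))\<^sup>2 \<le> \<kappa> * (\<Sum>\<tau>\<in>\<T>. \<delta> (cell m \<tau>) * x m \<tau>)" .
      have "s (Suc m) \<le> 2 * A1" using sA[of "Suc m"] A1[of "Suc m"] mM by simp
      then have "d * s (Suc m) \<le> d * (2 * A1)" using tn_less[OF mM] by (intro mult_left_mono) (auto simp: d_def)
      then show ?thesis
        using slab_poincare[OF \<xi> mM tr[OF mM]] 1 unfolding s_def d_def[symmetric] mult.assoc by linarith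
    qed
    then have "(\<Sum>m<N. (L2_norm (slab m) \<xi>)\<^sup>2) \<le> (\<Sum>m<N. 4 * (tn (Suc m) - tn m) * A1 + 4 * \<kappa> * (\<Sum>\<tau>\<in>\<T>. \<delta> (cell m \<tau>) * x m \<tau>))"
      by (intro sum_mono) auto
    also have "\<dots> = 4 * A1 * (\<Sum>m<N. tn (Suc m) - tn m) + 4 * \<kappa> * (\<Sum>m<N. \<Sum>\<tau>\<in>\<T>. \<delta> (cell m \<tau>) * x m \<tau>)"
      by (simp add: sum.distrib sum_distrib_left mult_ac)
    also have "(\<Sum>m<N. tn (Suc m) - tn m) = tn N" by (simp add: sum_lessThan_telescope tn_0)
    also have "4 * A1 * tn N + 4 * \<kappa> * (\<Sum>m<N. \<Sum>\<tau>\<in>\<T>. \<delta> (cell m \<tau>) * x m \<tau>) \<le> 4 * A1 * T + 4 * \<kappa> * A1"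
      using tn_range(2)[of N] N A1_0 \<kappa>(1) xA[of N] A1[OF N] by (intro add_mono mult_left_mono) auto
    finally show ?thesis by (simp add: algebra_simps)
  qed
  have main: "A N / 2 \<le> R + A1 / 4" if N: "N \<in> {1..M}" for N
  proof -
    have N': "0 < N" "N \<le> M" using N by auto
    have Lm: "L2_on \<Omega>x (trace_minus v (tn m))" if "mesh_H1 v" "m \<in> {1..M}" for v m
      using mesh_H1_L2(5)[OF that(1), of "m - 1"] that by (cases m) auto
    have LJ: "L2_on \<Omega>x (jump \<xi> (tn m))" if "m \<in> {1..<N}" for m
      unfolding jump_def[abs_def] using mesh_H1_L2(4)[OF \<xi>, of m] Lm[OF \<xi>, of m] that N by (intro L2_on_diff) auto
    \<comment> \<open>Three pairings with the Maxwell operator of \<xi>, each of which costs an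
      eighth of the stabilization term. The total of 3 / 8 stays below the half that can be
      absorbed.\<close>
    have cellb: "\<delta> (cell m \<tau>) * L2_inner (cell_int m \<tau>) (maxwell_op (slab m) \<eta>) (maxwell_op (slab m) \<xi>)
         - L2_inner (cell_int m \<tau>) \<eta> (maxwell_op (slab m) \<xi>)
         + \<delta> (cell m \<tau>) * L2_inner (cell_int m \<tau>) b (maxwell_op (slab m) \<xi>)
       \<le> 2 / \<delta> (cell m \<tau>) * (L2_norm (cell_int m \<tau>) \<eta>)\<^sup>2
         + 2 * \<delta> (cell m \<tau>) * (L2_norm (cell_int m \<tau>) (maxwell_op (slab m) \<eta>))\<^sup>2
         + 2 * \<delta> (cell m \<tau>) * (L2_norm (cell_int m \<tau>) b)\<^sup>2 + 3 / 8 * (\<delta> (cell m \<tau>) * x m \<tau>)"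
      if m: "m < N" and \<tau>: "\<tau> \<in> \<T>" for m \<tau>
    proof -
      have mM: "m < M" using m N by simp
      let ?d = "\<delta> (cell m \<tau>)"
      have d: "0 < ?d" using \<delta>[OF mM \<tau>] .
      note L = L2_cell[OF \<tau> mesh_H1_L2(2)[OF \<eta> mM]] L2_cell[OF \<tau> mesh_H1_L2(3)[OF \<eta> mM]]
        L2_cell[OF \<tau> b[OF mM]] L2_cell[OF \<tau> mesh_H1_L2(3)[OF \<xi> mM]]
      have "\<bar>L2_inner (cell_int m \<tau>) (maxwell_op (slab m) \<eta>) (maxwell_op (slab m) \<xi>)\<bar> \<le> 2 * (L2_norm (cell_int m \<tau>) (maxwell_op (slab m) \<eta>))\<^sup>2 + x m \<tau> / (4 * 2)"
        unfolding x_def by (rule L2_inner_young[OF L(2,4)]) simp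
      then have 1: "?d * L2_inner (cell_int m \<tau>) (maxwell_op (slab m) \<eta>) (maxwell_op (slab m) \<xi>) \<le> ?d * (2 * (L2_norm (cell_int m \<tau>) (maxwell_op (slab m) \<eta>))\<^sup>2 + x m \<tau> / (4 * 2))"
        using d by (intro mult_left_mono) auto
      have "\<bar>L2_inner (cell_int m \<tau>) b (maxwell_op (slab m) \<xi>)\<bar> \<le> 2 * (L2_norm (cell_int m \<tau>) b)\<^sup>2 + x m \<tau> / (4 * 2)"
        unfolding x_def by (rule L2_inner_young[OF L(3,4)]) simp
      then have 2: "?d * L2_inner (cell_int m \<tau>) b (maxwell_op (slab m) \<xi>) \<le> ?d * (2 * (L2_norm (cell_int m \<tau>) b)\<^sup>2 + x m \<tau> / (4 * 2))"
        using d by (intro mult_left_mono) auto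
      have "\<bar>L2_inner (cell_int m \<tau>) \<eta> (maxwell_op (slab m) \<xi>)\<bar> \<le> (2 / ?d) * (L2_norm (cell_int m \<tau>) \<eta>)\<^sup>2 + x m \<tau> / (4 * (2 / ?d))"
        unfolding x_def by (rule L2_inner_young[OF L(1,4)]) (use d in simp)
      then have "- L2_inner (cell_int m \<tau>) \<eta> (maxwell_op (slab m) \<xi>) \<le> (2 / ?d) * (L2_norm (cell_int m \<tau>) \<eta>)\<^sup>2 + ?d * x m \<tau> / 8"
        using d by (simp add: abs_le_iff mult.commute)
      then show ?thesis using 1 2 by (simp add: distrib_left)
    qed
    \<comment> \<open>The weight 4 (T + \<kappa>) in Young's inequality is chosen such that, by
      \<open>y\<close>, the L2 norms of \<xi> return at most \<open>A1 / 4\<close>.\<close>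
    have slabb: "L2_inner (slab m) b \<xi> \<le> 4 * (T + \<kappa>) * (\<Sum>\<tau>\<in>\<T>. (L2_norm (cell_int m \<tau>) b)\<^sup>2) + (L2_norm (slab m) \<xi>)\<^sup>2 / (16 * (T + \<kappa>))"
      if m: "m < N" for m
    proof -
      have mM: "m < M" using m N by simp
      have "\<bar>L2_inner (slab m) b \<xi>\<bar> \<le> 4 * (T + \<kappa>) * (L2_norm (slab m) b)\<^sup>2 + (L2_norm (slab m) \<xi>)\<^sup>2 / (4 * (4 * (T + \<kappa>)))"
        by (rule L2_inner_young[OF b[OF mM] mesh_H1_L2(2)[OF \<xi> mM]]) (use T\<kappa> in simp)
      moreover have "(L2_norm (slab m) b)\<^sup>2 = (\<Sum>\<tau>\<in>\<T>. (L2_norm (cell_int m \<tau>) b)\<^sup>2)"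
        using L2_inner_slab_split[OF b[OF mM] b[OF mM]] by (simp add: L2_inner_self)
      ultimately show ?thesis by simp
    qed
    have slab_total: "(\<Sum>\<tau>\<in>\<T>. \<delta> (cell m \<tau>) * L2_inner (cell_int m \<tau>) (maxwell_op (slab m) \<eta>) (maxwell_op (slab m) \<xi>)
         - L2_inner (cell_int m \<tau>) \<eta> (maxwell_op (slab m) \<xi>)) + src_slab \<delta> b \<xi> m
       \<le> r m + 3 / 8 * (\<Sum>\<tau>\<in>\<T>. \<delta> (cell m \<tau>) * x m \<tau>) + (L2_norm (slab m) \<xi>)\<^sup>2 / (16 * (T + \<kappa>))" if m: "m < N" for m
    proof -
      have "(\<Sum>\<tau>\<in>\<T>. \<delta> (cell m \<tau>) * L2_inner (cell_int m \<tau>) (maxwell_op (slab m) \<eta>) (maxwell_op (slab m) \<xi>)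
         - L2_inner (cell_int m \<tau>) \<eta> (maxwell_op (slab m) \<xi>)
         + \<delta> (cell m \<tau>) * L2_inner (cell_int m \<tau>) b (maxwell_op (slab m) \<xi>))
        \<le> (\<Sum>\<tau>\<in>\<T>. 2 / \<delta> (cell m \<tau>) * (L2_norm (cell_int m \<tau>) \<eta>)\<^sup>2
         + 2 * \<delta> (cell m \<tau>) * (L2_norm (cell_int m \<tau>) (maxwell_op (slab m) \<eta>))\<^sup>2
         + 2 * \<delta> (cell m \<tau>) * (L2_norm (cell_int m \<tau>) b)\<^sup>2 + 3 / 8 * (\<delta> (cell m \<tau>) * x m \<tau>))"
        by (intro sum_mono cellb m)
      then show ?thesis
        using slabb[OF m] by (simp add: src_slab_def r_def sum.distrib distrib_right sum_distrib_left sum_subtractf)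
    qed
    have "A N = (\<Sum>m<N. form_slab \<delta> \<xi> \<xi> m)"
      unfolding A_def energy_def by (rule form_sum_energy[OF \<xi> N' tr, symmetric])
    also have "\<dots> = (\<Sum>m<N. (\<Sum>\<tau>\<in>\<T>. \<delta> (cell m \<tau>) * L2_inner (cell_int m \<tau>) (maxwell_op (slab m) \<eta>) (maxwell_op (slab m) \<xi>)
         - L2_inner (cell_int m \<tau>) \<eta> (maxwell_op (slab m) \<xi>)) + src_slab \<delta> b \<xi> m)
      + L2_inner \<Omega>x (trace_minus \<eta> (tn N)) (trace_minus \<xi> (tn N))
      - (\<Sum>m=1..<N. L2_inner \<Omega>x (trace_minus \<eta> (tn m)) (jump \<xi> (tn m)))"
      by (simp add: id[OF N'(2)] form_sum_adjoint[OF \<eta> \<xi> N' tr] sum.distrib)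
    also have "\<dots> \<le> (\<Sum>m<N. r m + 3 / 8 * (\<Sum>\<tau>\<in>\<T>. \<delta> (cell m \<tau>) * x m \<tau>) + (L2_norm (slab m) \<xi>)\<^sup>2 / (16 * (T + \<kappa>)))
      + (q N + s N / 4) + (\<Sum>m=1..<N. q m + J m / 4)"
    proof -
      have "L2_inner \<Omega>x (trace_minus \<eta> (tn N)) (trace_minus \<xi> (tn N)) \<le> q N + s N / 4"
        using L2_inner_young[OF Lm[OF \<eta> N] Lm[OF \<xi> N], of 1] by (simp add: q_def s_def abs_le_iff)
      moreover have "(\<Sum>m=1..<N. - L2_inner \<Omega>x (trace_minus \<eta> (tn m)) (jump \<xi> (tn m))) \<le> (\<Sum>m=1..<N. q m + J m / 4)"
      proof (rule sum_mono)
        fix m assume m: "m \<in> {1..<N}"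
        then have "m \<in> {1..M}" using N by auto
        from L2_inner_young[OF Lm[OF \<eta> this] LJ[OF m], of 1]
        show "- L2_inner \<Omega>x (trace_minus \<eta> (tn m)) (jump \<xi> (tn m)) \<le> q m + J m / 4"
          by (simp add: q_def J_def abs_le_iff)
      qed
      moreover note sum_mono[OF slab_total, of "{..<N}" id]
      ultimately show ?thesis
        unfolding sum_negf by simp
    qed
    also have "\<dots> = (\<Sum>m<N. r m) + 3 / 8 * (\<Sum>m<N. \<Sum>\<tau>\<in>\<T>. \<delta> (cell m \<tau>) * x m \<tau>) + (\<Sum>m<N. (L2_norm (slab m) \<xi>)\<^sup>2) / (16 * (T + \<kappa>))
      + (q N + s N / 4) + ((\<Sum>m=1..<N. q m) + (\<Sum>m=1..<N. J m) / 4)"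
      by (simp add: sum.distrib sum_distrib_left sum_divide_distrib)
    finally have bound: "A N \<le> (\<Sum>m<N. r m) + 3 / 8 * (\<Sum>m<N. \<Sum>\<tau>\<in>\<T>. \<delta> (cell m \<tau>) * x m \<tau>) + (\<Sum>m<N. (L2_norm (slab m) \<xi>)\<^sup>2) / (16 * (T + \<kappa>))
      + (q N + s N / 4) + ((\<Sum>m=1..<N. q m) + (\<Sum>m=1..<N. J m) / 4)" .
    have "(\<Sum>m<N. (L2_norm (slab m) \<xi>)\<^sup>2) / (16 * (T + \<kappa>)) \<le> (4 * (T + \<kappa>) * A1) / (16 * (T + \<kappa>))"
      using y[OF N] T\<kappa> by (intro divide_right_mono) auto
    also have "\<dots> = A1 / 4" using T\<kappa> by (simp add: field_simps)
    finally have Y: "(\<Sum>m<N. (L2_norm (slab m) \<xi>)\<^sup>2) / (16 * (T + \<kappa>)) \<le> A1 / 4" .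
    have "(\<Sum>m<N. q (Suc m)) = q N + (\<Sum>m=1..<N. q m)"
      using trace_telescope[OF N'(1), of q "\<lambda>_. 0"] by (simp add: if_distrib)
    then have "(\<Sum>m<N. r m) + q N + (\<Sum>m=1..<N. q m) = (\<Sum>m<N. q (Suc m) + r m)" by (simp add: sum.distrib)
    also have "\<dots> \<le> R"
      unfolding R_def using N' nn r0 by (intro sum_mono2) auto
    finally have "(\<Sum>m<N. r m) + q N + (\<Sum>m=1..<N. q m) \<le> R" .
    \<comment> \<open>Half of \<open>A N\<close> contains \<open>s N / 4\<close>, a quarter of each
      squared jump and half of the stabilization, which covers everything that Young's inequality
      has left over.\<close>
    then show ?thesis
      using bound Y Aeq[of N] dx[OF N'(2)] zero_le_power2[of "L2_norm \<Omega>x (trace_plus \<xi> (tn 0))"] by argo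
  qed
  \<comment> \<open>At a level where the maximum is attained, \<open>main\<close> reads
    \<open>A1 / 2 \<le> R + A1 / 4\<close>.\<close>
  have "A1 \<in> A ` {1..M}" unfolding A1_def using M_pos by (intro Max_in) auto
  then obtain N where N: "N \<in> {1..M}" "A1 = A N" by auto
  then have "A1 \<le> 4 * R" using main[OF N(1)] by simp
  moreover have "A M \<le> A1" using M_pos by (intro A1) auto
  ultimately show ?thesis by (simp add: A_def R_def q_def r_def)
qed

end

section \<open>The current\<close>

text \<open>Phase space-time is nested as t and (x, v), while the current integrates over
  \<open>v\<close> for a fixed pair (t, x). The rearrangement makes Fubini's theorem for two factors
  applicable; that it preserves Lebesgue measure is verified by Tonelli's theorem on
  indicators.\<close>

lemma distr_lborel_rotate:
  "distr lborel borel (\<lambda>(v, z). (fst z, snd z, v)) = (lborel :: (real \<times> 'a::euclidean_space \<times> 'b::euclidean_space) measure)"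
proof (rule measure_eqI)
  let ?\<psi> = "\<lambda>(v, z). (fst z, snd z, v) :: real \<times> 'a \<times> 'b"
  fix A :: "(real \<times> 'a \<times> 'b) set"
  assume "A \<in> sets (distr lborel borel ?\<psi>)"
  then have A [measurable]: "A \<in> sets borel" by simp
  have \<psi> [measurable]: "?\<psi> \<in> borel_measurable borel"
    unfolding case_prod_beta by (intro borel_measurable_continuous_onI continuous_intros)
  have [measurable]: "(\<lambda>(v, z). indicator A (fst z, snd z, v) :: ennreal) \<in> borel_measurable (lborel \<Otimes>\<^sub>M lborel)"
  proof -
    have "(\<lambda>w. indicator A (?\<psi> w) :: ennreal) \<in> borel_measurable borel" by measurable
    then show ?thesis by (simp add: lborel_prod case_prod_beta)
  qed
  have [measurable]: "(\<lambda>(z, v). indicator A (fst z, snd z, v) :: ennreal) \<in> borel_measurable (lborel \<Otimes>\<^sub>M lborel)"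
  proof -
    have "(\<lambda>w. (fst (fst w), snd (fst w), snd w)) \<in> borel_measurable (borel :: ((real \<times> 'a) \<times> 'b) measure)"
      by (intro borel_measurable_continuous_onI continuous_intros)
    then have "(\<lambda>w. indicator A (fst (fst w), snd (fst w), snd w) :: ennreal) \<in> borel_measurable (borel :: ((real \<times> 'a) \<times> 'b) measure)"
      by measurable
    then show ?thesis by (simp add: lborel_prod case_prod_beta)
  qed
  have i1: "(\<lambda>w. indicator A w :: ennreal) \<in> borel_measurable (lborel \<Otimes>\<^sub>M lborel)"
    by (simp add: lborel_prod)
  have i2: "(\<lambda>y. indicator A (t, y) :: ennreal) \<in> borel_measurable (lborel \<Otimes>\<^sub>M lborel)" for t
  proof -
    have "(\<lambda>y :: 'a \<times> 'b. (t, y)) \<in> borel_measurable borel"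
      by (intro borel_measurable_continuous_onI continuous_intros)
    then have "(\<lambda>y. indicator A (t, y) :: ennreal) \<in> borel_measurable borel" by measurable
    then show ?thesis by (simp add: lborel_prod)
  qed
  have "emeasure (distr lborel borel ?\<psi>) A = (\<integral>\<^sup>+ w. indicator A (?\<psi> w) \<partial>lborel)"
    using nn_integral_distr[of ?\<psi> lborel borel "indicator A"] A \<psi> by simp
  also have "\<dots> = (\<integral>\<^sup>+ w. (case w of (v, z) \<Rightarrow> indicator A (fst z, snd z, v)) \<partial>(lborel \<Otimes>\<^sub>M lborel))"
    by (simp add: lborel_prod case_prod_beta)
  also have "\<dots> = (\<integral>\<^sup>+ z. \<integral>\<^sup>+ v. indicator A (fst z, snd z, v) \<partial>lborel \<partial>lborel)"
    by (subst lborel_pair.nn_integral_snd[symmetric]) (simp_all add: case_prod_beta)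
  also have "\<dots> = (\<integral>\<^sup>+ t. \<integral>\<^sup>+ x. \<integral>\<^sup>+ v. indicator A (t, x, v) \<partial>lborel \<partial>lborel \<partial>lborel)"
    by (subst lborel_prod[symmetric], subst lborel.nn_integral_fst[symmetric]) (simp_all add: lborel_prod case_prod_beta)
  also have "\<dots> = (\<integral>\<^sup>+ t. \<integral>\<^sup>+ y. indicator A (t, y) \<partial>lborel \<partial>lborel)"
    by (intro nn_integral_cong, subst lborel_prod[symmetric], subst lborel.nn_integral_fst[OF i2]) simp
  also have "\<dots> = (\<integral>\<^sup>+ w. indicator A w \<partial>lborel)"
    by (subst lborel.nn_integral_fst[OF i1]) (simp add: lborel_prod)
  also have "\<dots> = emeasure lborel A" by simp
  finally show "emeasure (distr lborel borel ?\<psi>) A = emeasure lborel A" .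
qed simp

lemma phase_Fubini:
  fixes f :: "phase_spacetime \<Rightarrow> real"
  assumes f: "set_integrable lborel (I \<times> X \<times> V) f"
  shows "AE z in lborel. z \<in> I \<times> X \<longrightarrow> set_integrable lborel V (\<lambda>v. f (fst z, snd z, v))"
    and "set_integrable lborel (I \<times> X) (\<lambda>z. LINT v:V|lborel. f (fst z, snd z, v))"
    and "(LINT w:I \<times> X \<times> V|lborel. f w) = (LINT z:I \<times> X|lborel. LINT v:V|lborel. f (fst z, snd z, v))"
proof -
  let ?\<psi> = "\<lambda>(v, z). (fst z, snd z, v) :: phase_spacetime"
  let ?g = "\<lambda>w. indicator (I \<times> X \<times> V) w *\<^sub>R f w"
  let ?F = "\<lambda>(v, z). f (fst z, snd z, v)"
  have \<psi> [measurable]: "?\<psi> \<in> borel_measurable borel"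
    unfolding case_prod_beta by (intro borel_measurable_continuous_onI continuous_intros)
  have g: "integrable (distr lborel borel ?\<psi>) ?g"
    using f unfolding distr_lborel_rotate set_integrable_def .
  then have "integrable lborel (\<lambda>w. ?g (?\<psi> w))" by (rule integrable_distr[rotated]) simp
  moreover have eq: "?g (?\<psi> w) = indicator (V \<times> (I \<times> X)) w *\<^sub>R ?F w" for w
    by (cases w) (auto simp: indicator_def)
  ultimately have F: "set_integrable lborel (V \<times> (I \<times> X)) ?F" by (simp add: set_integrable_def)
  show "AE z in lborel. z \<in> I \<times> X \<longrightarrow> set_integrable lborel V (\<lambda>v. f (fst z, snd z, v))"
    "set_integrable lborel (I \<times> X) (\<lambda>z. LINT v:V|lborel. f (fst z, snd z, v))"
    using set_Fubini(1,2)[OF F] by simp_all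
  have "(LINT w:I \<times> X \<times> V|lborel. f w) = integral\<^sup>L (distr lborel borel ?\<psi>) ?g"
    unfolding distr_lborel_rotate set_lebesgue_integral_def ..
  also have "\<dots> = integral\<^sup>L lborel (\<lambda>w. ?g (?\<psi> w))"
    by (rule integral_distr) (use g in \<open>simp_all add: distr_lborel_rotate borel_measurable_integrable\<close>)
  also have "\<dots> = (LINT w:V \<times> (I \<times> X)|lborel. ?F w)"
    unfolding eq set_lebesgue_integral_def ..
  finally show "(LINT w:I \<times> X \<times> V|lborel. f w) = (LINT z:I \<times> X|lborel. LINT v:V|lborel. f (fst z, snd z, v))"
    using set_Fubini(3)[OF F] by simp
qed

lemma norm_vhat_le: "norm (vhat v) \<le> 1"
proof -
  have "norm v \<le> sqrt (1 + (norm v)\<^sup>2)" by (rule real_le_rsqrt) simp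
  moreover have "0 < sqrt (1 + (norm v)\<^sup>2)" by (simp add: add_pos_nonneg)
  ultimately show ?thesis by (simp add: vhat_def divide_le_eq_1)
qed

lemma vhat_measurable [measurable]: "vhat \<in> borel_measurable borel"
proof -
  have "sqrt (1 + (norm v)\<^sup>2) \<noteq> 0" for v :: "real^3"
    by (metis add_pos_nonneg less_numeral_extra(1,3) real_sqrt_eq_zero_cancel_iff zero_le_power2)
  then show ?thesis
    unfolding vhat_def[abs_def] by (intro borel_measurable_continuous_onI continuous_intros) auto
qed

lemma vhat_weighted_integrable:
  assumes "set_integrable lborel V (h :: real^3 \<Rightarrow> real)"
  shows "set_integrable lborel V (\<lambda>v. h v *\<^sub>R vhat v)"
proof -
  have "integrable lborel (\<lambda>v. indicator V v *\<^sub>R h v *\<^sub>R vhat v)"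
  proof (rule Bochner_Integration.integrable_bound)
    show "integrable lborel (\<lambda>v. indicator V v *\<^sub>R h v)" using assms by (simp add: set_integrable_def)
    then have "(\<lambda>v. indicator V v *\<^sub>R h v) \<in> borel_measurable lborel" by (rule borel_measurable_integrable)
    then have "(\<lambda>v. (indicator V v *\<^sub>R h v) *\<^sub>R vhat v) \<in> borel_measurable lborel" by measurable
    then show "(\<lambda>v. indicator V v *\<^sub>R h v *\<^sub>R vhat v) \<in> borel_measurable lborel" by simp
    show "AE v in lborel. norm (indicator V v *\<^sub>R h v *\<^sub>R vhat v) \<le> norm (indicator V v *\<^sub>R h v)"
      using norm_vhat_le by (auto simp: abs_mult intro!: mult_left_mono mult_left_le)
  qed
  then show ?thesis by (simp add: set_integrable_def)
qed

text \<open>The relativistic velocity has norm at most 1, and Cauchy-Schwarz against the constant 1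
  on the bounded velocity domain yields the factor \<open>measure lborel V\<close>.\<close>

lemma current_sq_le:
  assumes h: "L2_on V (\<lambda>v. f (fst z, snd z, v))" and V: "open V" "bounded V"
  shows "(norm (current V f z))\<^sup>2 \<le> measure lborel V * (LINT v:V|lborel. (f (fst z, snd z, v))\<^sup>2)"
proof -
  let ?h = "\<lambda>v. f (fst z, snd z, v)"
  have one: "L2_on V (\<lambda>_ :: real^3. 1 :: real)"
    using V set_integrable_const_bounded[of V 1] by (simp add: L2_on_def set_borel_measurable_def)
  have n: "L2_on V (\<lambda>v. \<bar>?h v\<bar>)"
  proof -
    have "(\<lambda>v. \<bar>indicator V v *\<^sub>R ?h v\<bar>) \<in> borel_measurable lborel"
      using h by (intro borel_measurable_abs) (simp add: L2_on_def set_borel_measurable_def)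
    also have "(\<lambda>v. \<bar>indicator V v *\<^sub>R ?h v\<bar>) = (\<lambda>v. indicator V v *\<^sub>R \<bar>?h v\<bar>)"
      by (simp add: abs_mult)
    finally show ?thesis using h by (simp add: L2_on_def set_borel_measurable_def)
  qed
  have i: "set_integrable lborel V (\<lambda>v. \<bar>?h v\<bar>)" using n V by (intro L2_on_integrable) auto
  have i': "set_integrable lborel V ?h" using h V by (intro L2_on_integrable) auto
  have "norm (current V f z) \<le> (LINT v:V|lborel. \<bar>?h v\<bar>)"
    unfolding current_def case_prod_beta set_lebesgue_integral_def
  proof (rule Bochner_Integration.integral_norm_bound_integral)
    show "integrable lborel (\<lambda>v. indicator V v *\<^sub>R f (fst z, snd z, v) *\<^sub>R vhat v)"
      using vhat_weighted_integrable[OF i'] by (simp add: set_integrable_def)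
    show "integrable lborel (\<lambda>v. indicator V v *\<^sub>R \<bar>?h v\<bar>)" using i by (simp add: set_integrable_def)
    show "norm (indicator V v *\<^sub>R f (fst z, snd z, v) *\<^sub>R vhat v) \<le> indicator V v *\<^sub>R \<bar>?h v\<bar>" for v
      using norm_vhat_le[of v] by (auto simp: indicator_def intro!: mult_left_le)
  qed
  also have "\<dots> \<le> \<bar>LINT v:V|lborel. \<bar>?h v\<bar> \<bullet> 1\<bar>" by simp
  also have "\<dots> \<le> L2_norm V (\<lambda>v. \<bar>?h v\<bar>) * L2_norm V (\<lambda>_. 1 :: real)" by (rule L2_Cauchy_Schwarz[OF n one])
  finally have "(norm (current V f z))\<^sup>2 \<le> (L2_norm V (\<lambda>v. \<bar>?h v\<bar>) * L2_norm V (\<lambda>_. 1 :: real))\<^sup>2"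
    by (intro power_mono) auto
  also have "\<dots> = (LINT v:V|lborel. 1) * (LINT v:V|lborel. (?h v)\<^sup>2)"
    by (simp add: power_mult_distrib L2_norm_sq)
  also have "(LINT v:V|lborel. 1) = measure lborel V"
    using V by (simp add: set_lebesgue_integral_def)
  finally show ?thesis .
qed

context
  fixes I :: "real set" and X V :: "(real^3) set"
  assumes sets: "I \<in> sets borel" "X \<in> sets borel" and V: "open V" "bounded V"
begin

lemma phase_section_L2:
  assumes f: "L2_on (I \<times> X \<times> V) (f :: phase_spacetime \<Rightarrow> real)"
  shows "AE z in lborel. z \<in> I \<times> X \<longrightarrow> L2_on V (\<lambda>v. f (fst z, snd z, v))"
proof -
  have "set_integrable lborel (I \<times> X \<times> V) (\<lambda>w. (f w)\<^sup>2)" using f by (simp add: L2_on_def)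
  from phase_Fubini(1)[OF this]
  show ?thesis
  proof eventually_elim
    fix z assume s: "z \<in> I \<times> X \<longrightarrow> set_integrable lborel V (\<lambda>v. (f (fst z, snd z, v))\<^sup>2)"
    show "z \<in> I \<times> X \<longrightarrow> L2_on V (\<lambda>v. f (fst z, snd z, v))"
    proof
      assume z: "z \<in> I \<times> X"
      have g: "(\<lambda>w. indicator (I \<times> X \<times> V) w *\<^sub>R f w) \<in> borel_measurable borel"
        using f by (simp add: L2_on_def set_borel_measurable_def)
      have "(\<lambda>v :: real^3. (fst z, snd z, v)) \<in> borel_measurable borel"
        by (intro borel_measurable_continuous_onI continuous_intros)
      from measurable_compose[OF this g]
      have "(\<lambda>v. indicator V v *\<^sub>R f (fst z, snd z, v)) \<in> borel_measurable borel"
        using z by (auto simp: indicator_def mem_Times_iff cong: if_cong)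
      then show "L2_on V (\<lambda>v. f (fst z, snd z, v))"
        using s z by (simp add: L2_on_def set_borel_measurable_def)
    qed
  qed
qed

text \<open>Linearity of the velocity integral rests on integrable sections, which Fubini's theorem
  supplies for almost every \<open>z\<close>.\<close>

lemma current_diff:
  assumes f: "L2_on (I \<times> X \<times> V) f" and g: "L2_on (I \<times> X \<times> V) g"
  shows "AE z in lborel. z \<in> I \<times> X \<longrightarrow> current V (\<lambda>w. f w - g w) z = current V f z - current V g z"
  using phase_section_L2[OF f] phase_section_L2[OF g]
proof eventually_elim
  fix z assume h: "z \<in> I \<times> X \<longrightarrow> L2_on V (\<lambda>v. f (fst z, snd z, v))" "z \<in> I \<times> X \<longrightarrow> L2_on V (\<lambda>v. g (fst z, snd z, v))"
  show "z \<in> I \<times> X \<longrightarrow> current V (\<lambda>w. f w - g w) z = current V f z - current V g z"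
  proof
    assume z: "z \<in> I \<times> X"
    have "set_integrable lborel V (\<lambda>v. f (fst z, snd z, v) *\<^sub>R vhat v)" "set_integrable lborel V (\<lambda>v. g (fst z, snd z, v) *\<^sub>R vhat v)"
      using h z V by (auto intro!: vhat_weighted_integrable L2_on_integrable)
    then show "current V (\<lambda>w. f w - g w) z = current V f z - current V g z"
      by (simp add: current_def case_prod_beta scaleR_diff_left)
  qed
qed

lemma current_measurable:
  assumes f: "L2_on (I \<times> X \<times> V) f"
  shows "set_borel_measurable lborel (I \<times> X) (current V f)"
proof -
  have g: "(\<lambda>w. indicator (I \<times> X \<times> V) w *\<^sub>R f w) \<in> borel_measurable borel"
    using f by (simp add: L2_on_def set_borel_measurable_def)
  have "(\<lambda>w :: spacetime \<times> (real^3). (fst (fst w), snd (fst w), snd w)) \<in> borel_measurable borel"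
    by (intro borel_measurable_continuous_onI continuous_intros)
  note measurable_compose[OF this g]
  moreover have "(\<lambda>w :: spacetime \<times> (real^3). vhat (snd w)) \<in> borel_measurable borel"
    by (rule measurable_compose[OF _ vhat_measurable]) (intro borel_measurable_continuous_onI continuous_intros)
  ultimately have "(\<lambda>w :: spacetime \<times> (real^3). (indicator (I \<times> X \<times> V) (fst (fst w), snd (fst w), snd w) *\<^sub>R f (fst (fst w), snd (fst w), snd w)) *\<^sub>R vhat (snd w)) \<in> borel_measurable borel"
    by (rule borel_measurable_scaleR)
  then have "(\<lambda>(z, v). (indicator (I \<times> X \<times> V) (fst z, snd z, v) *\<^sub>R f (fst z, snd z, v)) *\<^sub>R vhat v) \<in> borel_measurable (lborel \<Otimes>\<^sub>M lborel)"
    by (simp add: lborel_prod case_prod_beta)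
  then have "(\<lambda>z. LINT v|lborel. (indicator (I \<times> X \<times> V) (fst z, snd z, v) *\<^sub>R f (fst z, snd z, v)) *\<^sub>R vhat v) \<in> borel_measurable lborel"
    by (rule lborel.borel_measurable_lebesgue_integral)
  also have "(\<lambda>z. LINT v|lborel. (indicator (I \<times> X \<times> V) (fst z, snd z, v) *\<^sub>R f (fst z, snd z, v)) *\<^sub>R vhat v)
     = (\<lambda>z. indicator (I \<times> X) z *\<^sub>R current V f z)"
    by (auto simp: current_def case_prod_beta set_lebesgue_integral_def indicator_def mem_Times_iff fun_eq_iff intro!: Bochner_Integration.integral_cong)
  finally show ?thesis by (simp add: set_borel_measurable_def)
qed

lemma current_L2:
  assumes f: "L2_on (I \<times> X \<times> V) f"
  shows "L2_on (I \<times> X) (current V f)"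
    and "(L2_norm (I \<times> X) (current V f))\<^sup>2 \<le> measure lborel V * (L2_norm (I \<times> X \<times> V) f)\<^sup>2"
proof -
  let ?G = "\<lambda>z. measure lborel V * (LINT v:V|lborel. (f (fst z, snd z, v))\<^sup>2)"
  have s: "set_integrable lborel (I \<times> X \<times> V) (\<lambda>w. (f w)\<^sup>2)" using f by (simp add: L2_on_def)
  have G: "integrable lborel (\<lambda>z. indicator (I \<times> X) z *\<^sub>R ?G z)"
    using set_integrable_mult_right[OF phase_Fubini(2)[OF s], of "measure lborel V"] by (simp add: set_integrable_def)
  have m: "(\<lambda>z. indicator (I \<times> X) z *\<^sub>R current V f z) \<in> borel_measurable lborel"
    using current_measurable[OF f] by (simp add: set_borel_measurable_def)
  have eq: "(norm (indicator (I \<times> X) z *\<^sub>R current V f z))\<^sup>2 = indicator (I \<times> X) z *\<^sub>R (norm (current V f z))\<^sup>2" for z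
    by (auto simp: indicator_def)
  have le: "AE z in lborel. norm (indicator (I \<times> X) z *\<^sub>R (norm (current V f z))\<^sup>2) \<le> indicator (I \<times> X) z *\<^sub>R ?G z"
    using phase_section_L2[OF f] by eventually_elim (use current_sq_le[OF _ V] in \<open>auto simp: indicator_def\<close>)
  have m2: "(\<lambda>z. indicator (I \<times> X) z *\<^sub>R (norm (current V f z))\<^sup>2) \<in> borel_measurable lborel"
    unfolding eq[symmetric] using m by measurable
  have i: "integrable lborel (\<lambda>z. indicator (I \<times> X) z *\<^sub>R (norm (current V f z))\<^sup>2)"
    by (rule Bochner_Integration.integrable_bound[OF G m2]) (use le in \<open>eventually_elim, auto\<close>)
  then show "L2_on (I \<times> X) (current V f)"
    using current_measurable[OF f] by (simp add: L2_on_def set_integrable_def)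
  have "(L2_norm (I \<times> X) (current V f))\<^sup>2 \<le> (LINT z:I \<times> X|lborel. ?G z)"
    unfolding L2_norm_sq set_lebesgue_integral_def[of _ "I \<times> X"]
    by (rule integral_mono_AE[OF i G]) (use le in \<open>eventually_elim, auto\<close>)
  also have "\<dots> = measure lborel V * (L2_norm (I \<times> X \<times> V) f)\<^sup>2"
    by (simp add: L2_norm_sq phase_Fubini(3)[OF s])
  finally show "(L2_norm (I \<times> X) (current V f))\<^sup>2 \<le> measure lborel V * (L2_norm (I \<times> X \<times> V) f)\<^sup>2" .
qed

end

lemma norm_maxwell_source: "norm (maxwell_source V f z) = norm (current V f z)"
  by (simp add: maxwell_source_def norm_eq_sqrt_inner em_inner part_em_vec)

lemma L2_on_maxwell_source:
  assumes "L2_on A (current V f)"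
  shows "L2_on A (maxwell_source V f)"
proof -
  have "L2_on A (\<lambda>z. maxwell_source V f z $ c)" for c
  proof (cases c)
    case (Inl i)
    have "L2_on A (\<lambda>z. (-1) *\<^sub>R current V f z $ i)"
      using assms L2_on_cmult unfolding L2_on_vec_nth by blast
    then show ?thesis by (simp add: maxwell_source_def Inl em_vec_nth)
  next
    case (Inr i)
    then show ?thesis using L2_on_zero[of A] by (simp add: maxwell_source_def em_vec_nth)
  qed
  then show ?thesis by (simp add: L2_on_vec_nth)
qed

lemma set_integral_mono_set:
  fixes f :: "'a \<Rightarrow> real"
  assumes "set_integrable M A f" "B \<subseteq> A" "B \<in> sets M" "\<And>z. 0 \<le> f z"
  shows "(LINT z:B|M. f z) \<le> (LINT z:A|M. f z)"
  unfolding set_lebesgue_integral_def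
proof (rule integral_mono)
  show "integrable M (\<lambda>z. indicator B z *\<^sub>R f z)" 
    using set_integrable_subset[OF assms(1,3,2)] by (simp add: set_integrable_def)
  show "integrable M (\<lambda>z. indicator A z *\<^sub>R f z)" using assms by (simp add: set_integrable_def)
  show "indicator B z *\<^sub>R f z \<le> indicator A z *\<^sub>R f z" for z
    using assms by (auto simp: indicator_def)
qed

context maxwell_mesh
begin

lemma slabs_L2_norm_le:
  assumes u: "L2_on ({0..T} \<times> \<Omega>x) (u :: spacetime \<Rightarrow> em)"
  shows "(\<Sum>m<M. (L2_norm (slab m) u)\<^sup>2) \<le> (L2_norm ({0..T} \<times> \<Omega>x) u)\<^sup>2"
proof -
  let ?h = "\<lambda>z. (norm (u z))\<^sup>2"
  let ?S = "\<Union>m<M. slab m"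
  have h: "set_integrable lborel ({0..T} \<times> \<Omega>x) ?h" using u by (simp add: L2_on_def)
  have sub: "?S \<subseteq> {0..T} \<times> \<Omega>x" using slab_sub by fastforce
  have op: "?S \<in> sets lborel" using open_slab by auto
  have "(LINT z:?S|lborel. ?h z) = (\<Sum>m<M. LINT z:slab m|lborel. ?h z)"
  proof (rule set_integral_finite_partition)
    show "set_integrable lborel ?S ?h" using set_integrable_subset[OF h op sub] .
    fix i j assume ij: "i \<in> {..<M}" "j \<in> {..<M}" "i \<noteq> j"
    then consider "Suc i \<le> j" | "Suc j \<le> i" by linarith
    then show "slab i \<inter> slab j = {}"
    proof cases
      case 1 then show ?thesis using tn_mono[of "Suc i" j] ij by auto
    next
      case 2 then show ?thesis using tn_mono[of "Suc j" i] ij by auto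
    qed
  qed (use open_slab in auto)
  then have "(\<Sum>m<M. (L2_norm (slab m) u)\<^sup>2) = (LINT z:?S|lborel. ?h z)" by (simp add: L2_norm_sq)
  also have "\<dots> \<le> (LINT z:{0..T} \<times> \<Omega>x|lborel. ?h z)"
    by (rule set_integral_mono_set[OF h sub op]) simp
  finally show ?thesis by (simp add: L2_norm_sq)
qed

lemma source_error:
  assumes V: "open V" "bounded V"
    and f: "L2_on ({0..T} \<times> \<Omega>x \<times> V) f" and g: "L2_on ({0..T} \<times> \<Omega>x \<times> V) g"
  shows "m < M \<Longrightarrow> L2_on (slab m) (maxwell_source V f)"
    and "(\<Sum>m<M. \<Sum>\<tau>\<in>\<T>. (L2_norm (cell_int m \<tau>) (\<lambda>z. maxwell_source V g z - maxwell_source V f z))\<^sup>2)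
      \<le> measure lborel V * (L2_norm ({0..T} \<times> \<Omega>x \<times> V) (\<lambda>w. f w - g w))\<^sup>2"
proof -
  have X: "{0..T} \<in> sets borel" "\<Omega>x \<in> sets borel" using open_dom by auto
  have sub: "slab m \<subseteq> {0..T} \<times> \<Omega>x" if "m < M" for m using slab_sub[OF that] by fastforce
  have sl: "slab m \<in> sets borel" for m using open_slab by auto
  have L: "L2_on ({0..T} \<times> \<Omega>x) (maxwell_source V k)" if "L2_on ({0..T} \<times> \<Omega>x \<times> V) k" for k
    by (rule L2_on_maxwell_source[OF current_L2(1)[OF X V that]])
  have Ls: "L2_on (slab m) (maxwell_source V k)" if "L2_on ({0..T} \<times> \<Omega>x \<times> V) k" "m < M" for k m
    by (rule L2_on_subset[OF L[OF that(1)] sub[OF that(2)] sl])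
  show "m < M \<Longrightarrow> L2_on (slab m) (maxwell_source V f)" by (rule Ls[OF f])
  let ?d = "\<lambda>w. g w - f w"
  have d: "L2_on ({0..T} \<times> \<Omega>x \<times> V) ?d" by (rule L2_on_diff[OF g f])
  have AE: "AE z in lborel. z \<in> slab m \<longrightarrow> maxwell_source V g z - maxwell_source V f z = maxwell_source V ?d z" if m: "m < M" for m
    using current_diff[OF X V g f]
  proof eventually_elim
    fix z assume e: "z \<in> {0..T} \<times> \<Omega>x \<longrightarrow> current V ?d z = current V g z - current V f z"
    show "z \<in> slab m \<longrightarrow> maxwell_source V g z - maxwell_source V f z = maxwell_source V ?d z"
    proof
      assume "z \<in> slab m"
      then have "current V ?d z = current V g z - current V f z" using e sub[OF m] by blast
      then show "maxwell_source V g z - maxwell_source V f z = maxwell_source V ?d z"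
        by (intro em_eqI) (simp_all add: maxwell_source_def part_em_vec part_linear[THEN linear_diff])
    qed
  qed
  have "(\<Sum>\<tau>\<in>\<T>. (L2_norm (cell_int m \<tau>) (\<lambda>z. maxwell_source V g z - maxwell_source V f z))\<^sup>2)
      = (L2_norm (slab m) (maxwell_source V ?d))\<^sup>2" if m: "m < M" for m
  proof -
    have D: "L2_on (slab m) (\<lambda>z. maxwell_source V g z - maxwell_source V f z)"
      by (rule L2_on_diff[OF Ls[OF g m] Ls[OF f m]])
    have "L2_norm (slab m) (maxwell_source V ?d) = L2_norm (slab m) (\<lambda>z. maxwell_source V g z - maxwell_source V f z)"
      by (rule L2_norm_AE_cong[symmetric]) (use D Ls[OF d m] AE[OF m] in \<open>auto simp: L2_on_def\<close>)
    then show ?thesis using L2_inner_slab_split[OF D D] by (simp add: L2_inner_self)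
  qed
  then have "(\<Sum>m<M. \<Sum>\<tau>\<in>\<T>. (L2_norm (cell_int m \<tau>) (\<lambda>z. maxwell_source V g z - maxwell_source V f z))\<^sup>2)
      = (\<Sum>m<M. (L2_norm (slab m) (maxwell_source V ?d))\<^sup>2)" by simp
  also have "\<dots> \<le> (L2_norm ({0..T} \<times> \<Omega>x) (maxwell_source V ?d))\<^sup>2" by (rule slabs_L2_norm_le[OF L[OF d]])
  also have "\<dots> = (L2_norm ({0..T} \<times> \<Omega>x) (current V ?d))\<^sup>2" by (simp add: L2_norm_sq norm_maxwell_source)
  also have "\<dots> \<le> measure lborel V * (L2_norm ({0..T} \<times> \<Omega>x \<times> V) ?d)\<^sup>2" by (rule current_L2(2)[OF X V d])
  also have "(L2_norm ({0..T} \<times> \<Omega>x \<times> V) ?d)\<^sup>2 = (L2_norm ({0..T} \<times> \<Omega>x \<times> V) (\<lambda>w. f w - g w))\<^sup>2"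
    by (simp add: L2_norm_sq power2_commute)
  finally show "(\<Sum>m<M. \<Sum>\<tau>\<in>\<T>. (L2_norm (cell_int m \<tau>) (\<lambda>z. maxwell_source V g z - maxwell_source V f z))\<^sup>2)
      \<le> measure lborel V * (L2_norm ({0..T} \<times> \<Omega>x \<times> V) (\<lambda>w. f w - g w))\<^sup>2" .
qed

end

section \<open>The exact solution and its interpolant\<close>

lemma em_field_nth: "em_field E B z $ Inl i = E z $ i" "em_field E B z $ Inr i = B z $ i"
  by (simp_all add: em_field_def em_vec_nth)

lemma em_field_parts: "el_part (em_field E B z) = E z" "mag_part (em_field E B z) = B z"
  by (simp_all add: em_field_def part_em_vec)

lemma sobolev_vec_em_field:
  assumes "sobolev_vec s S E" "sobolev_vec s S B"
  shows "sobolev_vec s S (em_field E B)"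
  unfolding sobolev_vec_def
proof
  show "sobolev s S (\<lambda>z. em_field E B z $ c)" for c
    using assms by (cases c) (simp_all add: em_field_nth sobolev_vec_def)
qed

lemma continuous_on_em_field:
  assumes "continuous_on A (\<lambda>t. E (t, x))" "continuous_on A (\<lambda>t. B (t, x))"
  shows "continuous_on A (\<lambda>t. em_field E B (t, x))"
  unfolding continuous_on_def
proof
  fix t assume t: "t \<in> A"
  show "((\<lambda>t. em_field E B (t, x)) \<longlongrightarrow> em_field E B (t, x)) (at t within A)"
  proof (rule vec_tendstoI)
    show "((\<lambda>t. em_field E B (t, x) $ c) \<longlongrightarrow> em_field E B (t, x) $ c) (at t within A)" for c
      using assms t by (cases c) (auto simp: em_field_nth continuous_on_def intro!: tendsto_vec_nth)
  qed
qed

lemma maxwell_op_em_field: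
  "maxwell_op U (em_field E B) z = em_vec (dt U E z - curl U B z) (dt U B z + curl U E z)"
proof -
  have "el_part (dt U (em_field E B) z) = dt U E z" "mag_part (dt U (em_field E B) z) = dt U B z"
    by (simp_all add: vec_eq_iff dt_def part_nth em_field_nth)
  then show ?thesis
    unfolding maxwell_op_def maxwell_matrix_curl em_field_parts
    by (intro em_eqI) (simp_all add: part_em_vec part_linear[THEN linear_add])
qed

context maxwell_mesh
begin

text \<open>The equations hold almost everywhere with the weak derivatives on the whole cylinder,
  and \<open>maxwell_op_restrict\<close> carries them over to a slab. Since \<open>E\<close> and
  \<open>B\<close> are continuous in time up to both ends, the traces from either side are the
  pointwise values.\<close>

lemma exact_solution:
  assumes sol: "vlasov_maxwell_solution T \<Omega>x \<Omega>v f E B f0 E0 B0"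
  shows "mesh_H1 (em_field E B)"
    and "m < M \<Longrightarrow> AE z in lborel. z \<in> slab m \<longrightarrow> maxwell_op (slab m) (em_field E B) z = maxwell_source \<Omega>v f z"
    and "x \<in> \<Omega>x \<Longrightarrow> 0 < m \<Longrightarrow> m < M \<Longrightarrow> trace_plus (em_field E B) (tn m) x = trace_minus (em_field E B) (tn m) x"
    and "x \<in> \<Omega>x \<Longrightarrow> trace_plus (em_field E B) (tn 0) x = em_field E0 B0 x"
proof -
  let ?W = "em_field E B" and ?S = "{0<..<T} \<times> \<Omega>x"
  have S: "open ?S" using open_dom by (simp add: open_Times)
  have s: "sobolev_vec 1 ?S ?W"
    using sol by (intro sobolev_vec_em_field) (simp_all add: vlasov_maxwell_solution_def)
  have sm: "sobolev_vec 1 (slab m) ?W" if "m < M" for m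
    by (rule sobolev_vec_restrict[OF s S open_slab slab_sub[OF that]])
  have c: "continuous_on {tn m..tn (Suc m)} (\<lambda>t. ?W (t, x))" if "m < M" "x \<in> \<Omega>x" for m x
  proof (rule continuous_on_subset[OF continuous_on_em_field])
    show "continuous_on {0..T} (\<lambda>t. E (t, x))" "continuous_on {0..T} (\<lambda>t. B (t, x))"
      using sol that by (simp_all add: vlasov_maxwell_solution_def)
    show "{tn m..tn (Suc m)} \<subseteq> {0..T}" using tn_range[of m] tn_range[of "Suc m"] that by auto
  qed
  have l: "((\<lambda>t. ?W (t, x)) \<longlongrightarrow> ?W (tn m, x)) (at_right (tn m))" if "m < M" "x \<in> \<Omega>x" for m x
    by (rule continuous_on_Icc_at_rightD[OF c[OF that] tn_less[OF that(1)]])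
  have r: "((\<lambda>t. ?W (t, x)) \<longlongrightarrow> ?W (tn (Suc m), x)) (at_left (tn (Suc m)))" if "m < M" "x \<in> \<Omega>x" for m x
    by (rule continuous_on_Icc_at_leftD[OF c[OF that] tn_less[OF that(1)]])
  show "mesh_H1 ?W"
  proof (rule mesh_H1I)
    fix m assume m: "m < M"
    show "em_slab_H1 (tn m) (tn (Suc m)) \<Omega>x ?W (\<lambda>x. ?W (tn m, x)) (\<lambda>x. ?W (tn (Suc m), x))"
    proof (rule em_slab_H1I)
      show "sobolev 1 (slab m) (\<lambda>z. ?W z $ c)" for c using sm[OF m] by (simp add: sobolev_vec_def)
      fix x assume x: "x \<in> \<Omega>x"
      show "continuous_on {tn m<..<tn (Suc m)} (\<lambda>t. ?W (t, x))"
        by (rule continuous_on_subset[OF c[OF m x]]) auto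
    qed (use l r m in auto)
  qed
  show "AE z in lborel. z \<in> slab m \<longrightarrow> maxwell_op (slab m) ?W z = maxwell_source \<Omega>v f z" if m: "m < M"
  proof -
    have "AE z in lborel. z \<in> ?S \<longrightarrow> dt ?S E z = curl ?S B z - current \<Omega>v f z \<and> dt ?S B z = - curl ?S E z"
      using sol by (simp add: vlasov_maxwell_solution_def)
    with maxwell_op_restrict[OF s S open_slab slab_sub[OF m]] show ?thesis
    proof eventually_elim
      fix z assume 1: "z \<in> slab m \<longrightarrow> maxwell_op (slab m) ?W z = maxwell_op ?S ?W z"
        and 2: "z \<in> ?S \<longrightarrow> dt ?S E z = curl ?S B z - current \<Omega>v f z \<and> dt ?S B z = - curl ?S E z"
      show "z \<in> slab m \<longrightarrow> maxwell_op (slab m) ?W z = maxwell_source \<Omega>v f z"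
      proof
        assume z: "z \<in> slab m"
        then have "z \<in> ?S" using slab_sub[OF m] by blast
        with 1 2 z show "maxwell_op (slab m) ?W z = maxwell_source \<Omega>v f z"
          by (simp add: maxwell_op_em_field maxwell_source_def)
      qed
    qed
  qed
  have tp: "trace_plus ?W (tn m) x = ?W (tn m, x)" if "m < M" "x \<in> \<Omega>x" for m x
    by (rule trace_plus_eq[OF l[OF that]])
  show "trace_plus ?W (tn m) x = trace_minus ?W (tn m) x" if x: "x \<in> \<Omega>x" "0 < m" "m < M"
    using tp[of m x] trace_minus_eq[OF r[of "m - 1" x]] x by simp
  show "trace_plus ?W (tn 0) x = em_field E0 B0 x" if x: "x \<in> \<Omega>x"
    using tp[OF M_pos x] sol x by (simp add: tn_0 em_field_def vlasov_maxwell_solution_def)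
qed

lemma cell_geometry:
  assumes sh: "shape_regular \<sigma> M tn \<T>" and m: "m < M" "\<tau> \<in> \<T>"
  defines "h \<equiv> diameter (cell m \<tau>)"
  shows "0 < h" "tn (Suc m) - tn m \<le> h" "\<sigma> * h \<le> tn (Suc m) - tn m"
proof -
  have b: "bounded (cell m \<tau>)"
    unfolding cell_def by (intro bounded_Times) (use cellD(1)[OF m(2)] in \<open>auto simp: compact_imp_bounded bounded_Ioc\<close>)
  obtain x where x: "x \<in> \<tau>" using cellD(2)[OF m(2)] interior_subset by blast
  show \<Delta>: "tn (Suc m) - tn m \<le> h"
  proof (rule field_le_epsilon)
    fix e :: real assume e: "0 < e"
    \<comment> \<open>The lower time level does not belong to the cell, so the diameter is compared
      with a point slightly above it.\<close>
    let ?t = "tn m + min e (tn (Suc m) - tn m)"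
    have "(tn (Suc m), x) \<in> cell m \<tau>" "(?t, x) \<in> cell m \<tau>"
      using x tn_less[OF m(1)] e by (auto simp: cell_def)
    from diameter_bounded_bound[OF b this] have "\<bar>tn (Suc m) - ?t\<bar> \<le> h"
      by (simp add: h_def dist_Pair_Pair dist_real_def)
    then show "tn (Suc m) - tn m \<le> h + e" by linarith
  qed
  then show h: "0 < h" using tn_less[OF m(1)] by linarith
  show "\<sigma> * h \<le> tn (Suc m) - tn m"
  proof (rule ccontr)
    assume "\<not> ?thesis"
    then have lt: "tn (Suc m) - tn m < \<sigma> * h" by simp
    obtain z where z: "ball z (\<sigma> * h) \<subseteq> cell m \<tau>"
      using sh cell_in_elements[OF m] by (auto simp: shape_regular_def h_def)
    obtain t y where ty: "z = (t, y)" by (cases z)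
    have "z \<in> ball z (\<sigma> * h)" using lt tn_less[OF m(1)] by simp
    then have "z \<in> cell m \<tau>" using z by blast
    then have t: "tn m < t" "t \<le> tn (Suc m)" by (auto simp: ty cell_def)
    \<comment> \<open>The inscribed ball would be so large that it contained a point at the lower
      time level, which the cell excludes.\<close>
    have "(tn m, y) \<in> ball z (\<sigma> * h)" using t lt by (simp add: ty dist_Pair_Pair dist_real_def)
    then show False using z by (auto simp: cell_def)
  qed
qed

lemma hp_interpolant:
  assumes hp: "hp_interpolation C\<^sub>I \<Phi>\<^sub>1 \<Phi>\<^sub>2 T \<Omega>x M tn \<T> p k s"
    and W: "sobolev_vec (k + 1) ({0<..<T} \<times> \<Omega>x) W"
    and supp: "\<exists>S. compact S \<and> S \<subseteq> \<Omega>x \<and> (\<forall>t\<in>{0..T}. \<forall>x\<in>\<Omega>x - S. W (t, x) = 0)"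
  obtains W' where "W' \<in> em_fe_space \<Omega>x M tn \<T> p"
    and "\<And>K c. K \<in> elements M tn \<T> \<Longrightarrow>
           (L2_norm (interior K) (\<lambda>z. (W z - W' z) $ c))\<^sup>2
             \<le> C\<^sub>I * (diameter K / 2) ^ (2 * s K + 2) * inverse ((real (p K))\<^sup>2)
                 * \<Phi>\<^sub>1 (DIM(real^3) + 1) (p K) (s K) * (sobolev_norm (s K + 1) (interior K) (\<lambda>z. W z $ c))\<^sup>2"
    and "\<And>K c. K \<in> elements M tn \<T> \<Longrightarrow>
           (\<Sum>b\<in>Basis. (L2_norm (interior K) (wderiv (interior K) {#b#} (\<lambda>z. (W z - W' z) $ c)))\<^sup>2)
             \<le> C\<^sub>I * (diameter K / 2) ^ (2 * s K)
                 * \<Phi>\<^sub>2 (DIM(real^3) + 1) (p K) (s K) * (sobolev_norm (s K + 1) (interior K) (\<lambda>z. W z $ c))\<^sup>2"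
proof -
  define P where "P c w' K \<longleftrightarrow>
           (L2_norm (interior K) (\<lambda>z. W z $ c - w' z))\<^sup>2
             \<le> C\<^sub>I * (diameter K / 2) ^ (2 * s K + 2) * inverse ((real (p K))\<^sup>2)
                 * \<Phi>\<^sub>1 (DIM(real^3) + 1) (p K) (s K) * (sobolev_norm (s K + 1) (interior K) (\<lambda>z. W z $ c))\<^sup>2 \<and>
           (\<Sum>b\<in>Basis. (L2_norm (interior K) (wderiv (interior K) {#b#} (\<lambda>z. W z $ c - w' z)))\<^sup>2)
             \<le> C\<^sub>I * (diameter K / 2) ^ (2 * s K)
                 * \<Phi>\<^sub>2 (DIM(real^3) + 1) (p K) (s K) * (sobolev_norm (s K + 1) (interior K) (\<lambda>z. W z $ c))\<^sup>2" for c w' K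
  have "\<exists>w'\<in>fe_space \<Omega>x M tn \<T> p. \<forall>K\<in>elements M tn \<T>. P c w' K" for c
    unfolding P_def
  proof (rule hp[unfolded hp_interpolation_def, rule_format])
    show "sobolev (k + 1) ({0<..<T} \<times> \<Omega>x) (\<lambda>z. W z $ c)" using W by (simp add: sobolev_vec_def)
    obtain S where "compact S" "S \<subseteq> \<Omega>x" "\<forall>t\<in>{0..T}. \<forall>x\<in>\<Omega>x - S. W (t, x) = 0" using supp by blast
    then show "\<exists>S. compact S \<and> S \<subseteq> \<Omega>x \<and> (\<forall>t\<in>{0..T}. \<forall>x\<in>\<Omega>x - S. W (t, x) $ c = 0)"
      by (intro exI[of _ S]) simp
  qed
  then obtain w where w: "\<And>c. w c \<in> fe_space \<Omega>x M tn \<T> p"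
    and P: "\<And>c K. K \<in> elements M tn \<T> \<Longrightarrow> P c (w c) K"
    by metis
  show ?thesis
  proof (rule that[of "\<lambda>z. \<chi> c. w c z"])
    show "(\<lambda>z. \<chi> c. w c z) \<in> em_fe_space \<Omega>x M tn \<T> p" using w by (simp add: em_fe_space_def)
  qed (use P in \<open>simp_all add: P_def\<close>)
qed

lemma trace_cells:
  assumes "L2_on \<Omega>x (w :: real^3 \<Rightarrow> em)"
  shows "(L2_norm \<Omega>x w)\<^sup>2 = (\<Sum>\<tau>\<in>\<T>. (L2_norm (interior \<tau>) w)\<^sup>2)"
  using assms unfolding L2_norm_sq by (intro dom_integral) (simp add: L2_on_def)

text \<open>The Green formula in time has no lateral term, so the trace inequality holds on a single
  cell although functions do not vanish on its spatial boundary.\<close>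

lemma cell_trace_bound:
  assumes u: "mesh_H1 u" and m: "m < M" "\<tau> \<in> \<T>" and r: "0 < r"
  defines "F \<equiv> (\<Sum>c\<in>UNIV. \<Sum>b\<in>Basis. (L2_norm (cell_int m \<tau>) (wderiv (cell_int m \<tau>) {#b#} (\<lambda>z. u z $ c)))\<^sup>2)"
  shows "(L2_norm (interior \<tau>) (trace_minus u (tn (Suc m))))\<^sup>2 \<le> (1 / (tn (Suc m) - tn m) + r) * (L2_norm (cell_int m \<tau>) u)\<^sup>2 + F / r"
    and "(L2_norm (interior \<tau>) (trace_plus u (tn m)))\<^sup>2 \<le> (1 / (tn (Suc m) - tn m) + r) * (L2_norm (cell_int m \<tau>) u)\<^sup>2 + F / r"
proof -
  have e: "em_slab_H1 (tn m) (tn (Suc m)) (interior \<tau>) u (trace_plus u (tn m)) (trace_minus u (tn (Suc m)))"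
    by (rule em_slab_H1_subset[OF mesh_H1D[OF u m(1)] cellD(3)[OF m(2)] open_interior open_dom])
  have b: "bounded (interior \<tau>)"
    using bounded_subset[OF bounded_dom cellD(3)[OF m(2)]] .
  have "(\<Sum>c\<in>UNIV. (L2_norm (cell_int m \<tau>) (wderiv (cell_int m \<tau>) {#(1, 0)#} (\<lambda>z. u z $ c)))\<^sup>2) \<le> F"
    unfolding F_def sum_Basis_spacetime by (intro sum_mono) (simp add: sum_nonneg)
  then have "(\<Sum>c\<in>UNIV. (L2_norm (cell_int m \<tau>) (wderiv (cell_int m \<tau>) {#(1, 0)#} (\<lambda>z. u z $ c)))\<^sup>2) / r \<le> F / r"
    using r by (simp add: divide_right_mono)
  then show "(L2_norm (interior \<tau>) (trace_minus u (tn (Suc m))))\<^sup>2 \<le> (1 / (tn (Suc m) - tn m) + r) * (L2_norm (cell_int m \<tau>) u)\<^sup>2 + F / r"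
    and "(L2_norm (interior \<tau>) (trace_plus u (tn m)))\<^sup>2 \<le> (1 / (tn (Suc m) - tn m) + r) * (L2_norm (cell_int m \<tau>) u)\<^sup>2 + F / r"
    using em_slab_trace_bound[OF e tn_less[OF m(1)] open_interior b r] unfolding interior_cell by linarith+
qed

lemma cell_maxwell_bound:
  assumes u: "mesh_H1 u" and m: "m < M" "\<tau> \<in> \<T>"
  shows "(L2_norm (cell_int m \<tau>) (maxwell_op (slab m) u))\<^sup>2
    \<le> 4 * (\<Sum>c\<in>UNIV. \<Sum>b\<in>Basis. (L2_norm (cell_int m \<tau>) (wderiv (cell_int m \<tau>) {#b#} (\<lambda>z. u z $ c)))\<^sup>2)"
proof -
  have s: "sobolev_vec 1 (cell_int m \<tau>) u"
    by (rule sobolev_vec_restrict[OF mesh_H1_L2(1)[OF u m(1)] open_slab open_interior interior_cell_sub[OF m(2)]])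
  have "L2_norm (cell_int m \<tau>) (maxwell_op (slab m) u) = L2_norm (cell_int m \<tau>) (maxwell_op (cell_int m \<tau>) u)"
    by (rule L2_norm_AE_cong[symmetric])
      (use maxwell_op_cell[OF u m] L2_cell[OF m(2) mesh_H1_L2(3)[OF u m(1)]] in \<open>simp_all add: L2_on_def\<close>)
  then show ?thesis using maxwell_op_L2_norm_bound[OF s open_interior] by simp
qed

end

text \<open>\<phi> may be negative, so it is not immediate that omitting the factor (1 / 2)^n
  enlarges the bound. The nonnegative left-hand side forces the bound to be nonnegative, and then
  the factor and \<phi> can be replaced.\<close>

lemma interpolation_scale:
  fixes L C h a \<phi> \<psi> N :: real
  assumes "L \<le> C * (h / 2) ^ n * a * \<phi> * N" "0 \<le> L" "0 \<le> C" "0 \<le> h" "0 \<le> a" "0 \<le> N" "\<phi> \<le> \<psi>"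
  shows "L \<le> C * h ^ n * a * \<psi> * N"
proof -
  let ?Y = "C * h ^ n * a * \<phi> * N"
  have X: "C * (h / 2) ^ n * a * \<phi> * N = (1 / 2) ^ n * ?Y" by (simp add: power_divide)
  have "0 \<le> (1 / 2) ^ n * ?Y" using assms X by linarith
  moreover have "0 \<le> y" if "0 \<le> (1 / 2) ^ n * y" for y :: real
    using that mult_pos_neg[of "(1 / 2) ^ n" y] by (meson linorder_not_less zero_less_power zero_less_divide_1_iff zero_less_numeral)
  ultimately have "0 \<le> ?Y" by blast
  then have "(1 / 2) ^ n * ?Y \<le> ?Y" by (intro mult_left_le_one_le power_le_one) auto
  also have "\<dots> \<le> C * h ^ n * a * \<psi> * N"
    using assms by (intro mult_right_mono mult_left_mono) auto
  finally show ?thesis using assms X by linarith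
qed

section \<open>The error estimate\<close>

lemma sobolev_norm_vec_sq: "(sobolev_norm_vec s S u)\<^sup>2 = (\<Sum>c\<in>UNIV. (sobolev_norm s S (\<lambda>z. u z $ c))\<^sup>2)"
  by (simp add: sobolev_norm_vec_def sum_nonneg)

text \<open>\<open>Q\<close> is the term of one cell in the final sum, \<open>e\<close> the squared
  L2 norm of the interpolation error and \<open>F\<close> that of its gradient. In units of
  \<open>Q\<close> these have sizes h / p and p / h. A parameter \<delta> proportional to h / p is
  the balance for which \<open>e\<close> divided by \<delta>, \<open>F\<close> times \<delta> and
  the trace terms are all multiples of \<open>Q\<close>.\<close>

lemma cell_constants:
  fixes C\<^sub>1 C\<^sub>2 C \<sigma> h p \<Delta> \<delta> Q e F :: real
  assumes pos: "0 < C\<^sub>1" "0 < C\<^sub>2" "0 < C" "0 < \<sigma>" "0 < h" "1 \<le> p"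
    and \<Delta>: "\<Delta> \<le> h" "\<sigma> * h \<le> \<Delta>" and ph: "p * h \<le> C\<^sub>2" and \<delta>: "\<delta> = C\<^sub>1 * (h / p)"
    and e: "0 \<le> e" "e \<le> C * (h / p) * Q" and F: "0 \<le> F" "F \<le> C * (p / h) * Q"
  shows "0 \<le> Q" "0 < \<delta>" "\<delta> \<le> C\<^sub>1 * C\<^sub>2" "\<Delta>\<^sup>2 \<le> C\<^sub>2 / C\<^sub>1 * \<delta>"
    and "2 / \<delta> * e \<le> 2 * C / C\<^sub>1 * Q" "\<delta> * F \<le> C\<^sub>1 * C * Q"
    and "(1 / \<Delta> + p / h) * e + F / (p / h) \<le> C * (1 / \<sigma> + 2) * Q"
proof -
  have d: "0 < \<Delta>" using \<Delta>(2) pos by (meson less_le_trans mult_pos_pos)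
  have hp: "0 < h / p" using pos by simp
  show \<delta>0: "0 < \<delta>" using hp pos by (simp add: \<delta>)
  \<comment> \<open>The sign of \<open>Q\<close> is not given, since it contains the maximum of two
    arbitrary functions; the bound on \<open>e\<close> forces it.\<close>
  have "0 \<le> C * (h / p) * Q" using e by linarith
  moreover have "0 < C * (h / p)" using pos hp by (intro mult_pos_pos)
  ultimately show Q: "0 \<le> Q" by (simp only: zero_le_mult_iff) linarith
  have "h \<le> p * h" using pos by simp
  then have hC: "h \<le> C\<^sub>2" using ph by linarith
  have "h / p \<le> h" using pos by (simp add: field_simps)
  then have "h / p \<le> C\<^sub>2" using hC by linarith
  then show "\<delta> \<le> C\<^sub>1 * C\<^sub>2" unfolding \<delta> using pos by (intro mult_left_mono) auto
  \<comment> \<open>The square of h is the product of p h and h / p. Here the condition on p h turns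
    a squared length into a multiple of \<delta>.\<close>
  have "\<Delta>\<^sup>2 \<le> h\<^sup>2" using \<Delta> d by (intro power_mono) auto
  also have "\<dots> \<le> C\<^sub>2 * (h / p)"
    using mult_right_mono[OF ph, of "h / p"] pos by (simp add: power2_eq_square)
  also have "\<dots> = C\<^sub>2 / C\<^sub>1 * \<delta>" using pos by (simp add: \<delta>)
  finally show "\<Delta>\<^sup>2 \<le> C\<^sub>2 / C\<^sub>1 * \<delta>" .
  have "2 / \<delta> * e \<le> 2 / \<delta> * (C * (h / p) * Q)" using e \<delta>0 by (intro mult_left_mono) auto
  also have "\<dots> = 2 * C / C\<^sub>1 * Q" using pos by (simp add: \<delta>)
  finally show "2 / \<delta> * e \<le> 2 * C / C\<^sub>1 * Q" .
  have "\<delta> * F \<le> \<delta> * (C * (p / h) * Q)" using F \<delta>0 by (intro mult_left_mono) auto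
  also have "\<dots> = C\<^sub>1 * C * Q" using pos by (simp add: \<delta>)
  finally show "\<delta> * F \<le> C\<^sub>1 * C * Q" .
  have "1 / \<Delta> \<le> 1 / (\<sigma> * h)" using \<Delta> d pos by (intro divide_left_mono) auto
  then have "(1 / \<Delta> + p / h) * e \<le> (1 / (\<sigma> * h) + p / h) * (C * (h / p) * Q)"
    using e d pos by (intro mult_mono) auto
  also have "\<dots> = C * Q * (1 / \<sigma> * (1 / p) + 1)" using pos by (simp add: field_simps)
  also have "\<dots> \<le> C * Q * (1 / \<sigma> + 1)"
  proof -
    have "1 / \<sigma> * (1 / p) \<le> 1 / \<sigma> * 1" using pos by (intro mult_left_mono) auto
    then show ?thesis using pos Q by (intro mult_left_mono) auto
  qed
  finally have 1: "(1 / \<Delta> + p / h) * e \<le> C * Q * (1 / \<sigma> + 1)" .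
  have "F / (p / h) \<le> C * (p / h) * Q / (p / h)" using F pos by (intro divide_right_mono) auto
  also have "\<dots> = C * Q" using pos by simp
  finally show "(1 / \<Delta> + p / h) * e + F / (p / h) \<le> C * (1 / \<sigma> + 2) * Q"
    using 1 by (simp add: algebra_simps)
qed

context maxwell_mesh
begin

text \<open>The powers are regrouped around \<open>Q\<close>: h^(2r+2) / p^2 is h / p times h^(2r+1)
  / p, and h^(2r) is p / h times the same quantity. The maximum in \<open>Phi_M\<close> allows one
  \<open>Q\<close> for both estimates.\<close>

lemma cell_interpolation_error:
  fixes W W' :: "spacetime \<Rightarrow> em"
  assumes u: "mesh_H1 (\<lambda>z. W z - W' z)" and m: "m < M" "\<tau> \<in> \<T>"
    and C: "0 < C" and h: "0 < diameter (cell m \<tau>)" and q: "1 \<le> (q :: nat)"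
    and b1: "\<And>c. (L2_norm (cell_int m \<tau>) (\<lambda>z. (W z - W' z) $ c))\<^sup>2
             \<le> C * (diameter (cell m \<tau>) / 2) ^ (2 * r + 2) * inverse ((real q)\<^sup>2)
                 * \<Phi>\<^sub>1 (DIM(real^3) + 1) q r * (sobolev_norm (r + 1) (cell_int m \<tau>) (\<lambda>z. W z $ c))\<^sup>2"
    and b2: "\<And>c. (\<Sum>b\<in>Basis. (L2_norm (cell_int m \<tau>) (wderiv (cell_int m \<tau>) {#b#} (\<lambda>z. (W z - W' z) $ c)))\<^sup>2)
             \<le> C * (diameter (cell m \<tau>) / 2) ^ (2 * r)
                 * \<Phi>\<^sub>2 (DIM(real^3) + 1) q r * (sobolev_norm (r + 1) (cell_int m \<tau>) (\<lambda>z. W z $ c))\<^sup>2"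
  defines "h \<equiv> diameter (cell m \<tau>)"
  defines "Q \<equiv> h ^ (2 * r + 1) * inverse (real q) * Phi_M \<Phi>\<^sub>1 \<Phi>\<^sub>2 q r * (sobolev_norm_vec (r + 1) (cell_int m \<tau>) W)\<^sup>2"
  shows "(L2_norm (cell_int m \<tau>) (\<lambda>z. W z - W' z))\<^sup>2 \<le> C * (h / q) * Q"
    and "(\<Sum>c\<in>UNIV. \<Sum>b\<in>Basis. (L2_norm (cell_int m \<tau>) (wderiv (cell_int m \<tau>) {#b#} (\<lambda>z. (W z - W' z) $ c)))\<^sup>2) \<le> C * (q / h) * Q"
proof -
  have h0: "0 < h" using h by (simp add: h_def)
  have q0: "0 < real q" using q by simp
  let ?N = "(sobolev_norm_vec (r + 1) (cell_int m \<tau>) W)\<^sup>2"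
  have L: "L2_on (cell_int m \<tau>) (\<lambda>z. W z - W' z)"
    by (rule L2_cell[OF m(2) mesh_H1_L2(2)[OF u m(1)]])
  have "(L2_norm (cell_int m \<tau>) (\<lambda>z. W z - W' z))\<^sup>2
      \<le> C * (h / 2) ^ (2 * r + 2) * inverse ((real q)\<^sup>2) * \<Phi>\<^sub>1 (DIM(real^3) + 1) q r * ?N"
    unfolding L2_norm_vec_sq[OF L] sobolev_norm_vec_sq sum_distrib_left h_def by (intro sum_mono b1)
  then have "(L2_norm (cell_int m \<tau>) (\<lambda>z. W z - W' z))\<^sup>2
      \<le> C * h ^ (2 * r + 2) * inverse ((real q)\<^sup>2) * Phi_M \<Phi>\<^sub>1 \<Phi>\<^sub>2 q r * ?N"
    by (rule interpolation_scale) (use C h0 in \<open>auto simp: Phi_M_def\<close>)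
  also have "\<dots> = C * (h / q) * Q"
    using q0 by (simp add: Q_def power2_eq_square field_simps)
  finally show "(L2_norm (cell_int m \<tau>) (\<lambda>z. W z - W' z))\<^sup>2 \<le> C * (h / q) * Q" .
  let ?F = "\<Sum>c\<in>UNIV. \<Sum>b\<in>Basis. (L2_norm (cell_int m \<tau>) (wderiv (cell_int m \<tau>) {#b#} (\<lambda>z. (W z - W' z) $ c)))\<^sup>2"
  have "?F \<le> C * (h / 2) ^ (2 * r) * 1 * \<Phi>\<^sub>2 (DIM(real^3) + 1) q r * ?N"
    unfolding sobolev_norm_vec_sq sum_distrib_left h_def mult_1_right by (intro sum_mono b2)
  then have "?F \<le> C * h ^ (2 * r) * 1 * Phi_M \<Phi>\<^sub>1 \<Phi>\<^sub>2 q r * ?N"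
    by (rule interpolation_scale) (use C h0 in \<open>auto simp: Phi_M_def intro!: sum_nonneg\<close>)
  also have "\<dots> = C * (q / h) * Q"
    using q0 h0 by (simp add: Q_def field_simps)
  finally show "?F \<le> C * (q / h) * Q" .
qed

text \<open>The interpolation part \<eta> is bounded directly by its traces and its operator, the
  discrete part \<xi> by stability. \<open>Q\<close> and the constants stay abstract: \<alpha>
  belongs to the L2 norm, \<beta> to the Maxwell operator and \<gamma> to the traces of
  \<eta>.\<close>

lemma energy_error:
  fixes Q B :: "nat \<Rightarrow> (real^3) set \<Rightarrow> real"
  assumes \<xi>: "mesh_H1 \<xi>" and \<eta>: "mesh_H1 \<eta>" and b: "\<And>m. m < M \<Longrightarrow> L2_on (slab m) b"
    and tr: "\<And>m c. m < M \<Longrightarrow> zero_lateral_trace (tn m) (tn (Suc m)) \<Omega>x (\<lambda>z. \<xi> z $ c)"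
    and id: "\<And>N. N \<le> M \<Longrightarrow> (\<Sum>m<N. form_slab \<delta> \<xi> \<xi> m) = (\<Sum>m<N. form_slab \<delta> \<eta> \<xi> m) + (\<Sum>m<N. src_slab \<delta> b \<xi> m)"
    and \<delta>: "\<And>m \<tau>. m < M \<Longrightarrow> \<tau> \<in> \<T> \<Longrightarrow> 0 < \<delta> (cell m \<tau>) \<and> \<delta> (cell m \<tau>) \<le> d"
    and \<kappa>: "0 < \<kappa>" "\<And>m \<tau>. m < M \<Longrightarrow> \<tau> \<in> \<T> \<Longrightarrow> (tn (Suc m) - tn m)\<^sup>2 \<le> \<kappa> * \<delta> (cell m \<tau>)"
    and e: "\<And>m \<tau>. m < M \<Longrightarrow> \<tau> \<in> \<T> \<Longrightarrow> 2 / \<delta> (cell m \<tau>) * (L2_norm (cell_int m \<tau>) \<eta>)\<^sup>2 \<le> \<alpha> * Q m \<tau>"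
    and D: "\<And>m \<tau>. m < M \<Longrightarrow> \<tau> \<in> \<T> \<Longrightarrow> \<delta> (cell m \<tau>) * (L2_norm (cell_int m \<tau>) (maxwell_op (slab m) \<eta>))\<^sup>2 \<le> \<beta> * Q m \<tau>"
    and tm: "\<And>m \<tau>. m < M \<Longrightarrow> \<tau> \<in> \<T> \<Longrightarrow> (L2_norm (interior \<tau>) (trace_minus \<eta> (tn (Suc m))))\<^sup>2 \<le> \<gamma> * Q m \<tau>"
    and tp: "\<And>m \<tau>. m < M \<Longrightarrow> \<tau> \<in> \<T> \<Longrightarrow> (L2_norm (interior \<tau>) (trace_plus \<eta> (tn m)))\<^sup>2 \<le> \<gamma> * Q m \<tau>"
  shows "energy \<delta> (\<lambda>z. \<eta> z - \<xi> z) M \<le> (8 * \<alpha> + 18 * \<beta> + 12 * \<gamma>) * (\<Sum>m<M. \<Sum>\<tau>\<in>\<T>. Q m \<tau>)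
     + 8 * (2 * d + 4 * (T + \<kappa>)) * (\<Sum>m<M. \<Sum>\<tau>\<in>\<T>. (L2_norm (cell_int m \<tau>) b)\<^sup>2)"
proof -
  let ?SQ = "\<Sum>m<M. \<Sum>\<tau>\<in>\<T>. Q m \<tau>" and ?SB = "\<Sum>m<M. \<Sum>\<tau>\<in>\<T>. (L2_norm (cell_int m \<tau>) b)\<^sup>2"
  have \<delta>': "0 \<le> \<delta> K" if "K \<in> elements M tn \<T>" for K
    using that \<delta> by (fastforce simp: elements_eq)
  have tms: "(L2_norm \<Omega>x (trace_minus \<eta> (tn (Suc m))))\<^sup>2 \<le> (\<Sum>\<tau>\<in>\<T>. \<gamma> * Q m \<tau>)" if m: "m < M" for m
    unfolding trace_cells[OF mesh_H1_L2(5)[OF \<eta> m]] by (intro sum_mono tm m)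
  have tps: "(L2_norm \<Omega>x (trace_plus \<eta> (tn m)))\<^sup>2 \<le> (\<Sum>\<tau>\<in>\<T>. \<gamma> * Q m \<tau>)" if m: "m < M" for m
    unfolding trace_cells[OF mesh_H1_L2(4)[OF \<eta> m]] by (intro sum_mono tp m)
  have "energy \<delta> \<eta> M \<le> (\<Sum>m<M. (\<Sum>\<tau>\<in>\<T>. \<gamma> * Q m \<tau>) + (\<Sum>\<tau>\<in>\<T>. \<gamma> * Q m \<tau>)) + (\<Sum>m<M. \<Sum>\<tau>\<in>\<T>. \<beta> * Q m \<tau>)"
    by (rule order_trans[OF energy_le_traces[OF \<eta>]]) (intro add_mono sum_mono tps tms D; simp)
  also have "\<dots> = (2 * \<gamma> + \<beta>) * ?SQ"
    by (simp add: sum.distrib sum_distrib_left[symmetric] algebra_simps)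
  finally have E\<eta>: "energy \<delta> \<eta> M \<le> (2 * \<gamma> + \<beta>) * ?SQ" .
  have cellb: "2 / \<delta> (cell m \<tau>) * (L2_norm (cell_int m \<tau>) \<eta>)\<^sup>2
         + 2 * \<delta> (cell m \<tau>) * (L2_norm (cell_int m \<tau>) (maxwell_op (slab m) \<eta>))\<^sup>2
         + (2 * \<delta> (cell m \<tau>) + 4 * (T + \<kappa>)) * (L2_norm (cell_int m \<tau>) b)\<^sup>2
      \<le> \<alpha> * Q m \<tau> + 2 * (\<beta> * Q m \<tau>) + (2 * d + 4 * (T + \<kappa>)) * (L2_norm (cell_int m \<tau>) b)\<^sup>2"
    if m: "m < M" "\<tau> \<in> \<T>" for m \<tau>
  proof -
    have "(2 * \<delta> (cell m \<tau>) + 4 * (T + \<kappa>)) * (L2_norm (cell_int m \<tau>) b)\<^sup>2 \<le> (2 * d + 4 * (T + \<kappa>)) * (L2_norm (cell_int m \<tau>) b)\<^sup>2"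
      using \<delta>[OF m] by (intro mult_right_mono) auto
    moreover have "2 * \<delta> (cell m \<tau>) * (L2_norm (cell_int m \<tau>) (maxwell_op (slab m) \<eta>))\<^sup>2 \<le> 2 * (\<beta> * Q m \<tau>)"
      using D[OF m] by simp
    ultimately show ?thesis using e[OF m] by linarith
  qed
  have "energy \<delta> \<xi> M \<le> 4 * (\<Sum>m<M. (L2_norm \<Omega>x (trace_minus \<eta> (tn (Suc m))))\<^sup>2
     + (\<Sum>\<tau>\<in>\<T>. 2 / \<delta> (cell m \<tau>) * (L2_norm (cell_int m \<tau>) \<eta>)\<^sup>2
         + 2 * \<delta> (cell m \<tau>) * (L2_norm (cell_int m \<tau>) (maxwell_op (slab m) \<eta>))\<^sup>2
         + (2 * \<delta> (cell m \<tau>) + 4 * (T + \<kappa>)) * (L2_norm (cell_int m \<tau>) b)\<^sup>2))"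
    by (rule energy_stability[OF \<xi> \<eta> b tr id _ \<kappa>]) (use \<delta> in auto)
  also have "\<dots> \<le> 4 * (\<Sum>m<M. (\<Sum>\<tau>\<in>\<T>. \<gamma> * Q m \<tau>)
     + (\<Sum>\<tau>\<in>\<T>. \<alpha> * Q m \<tau> + 2 * (\<beta> * Q m \<tau>) + (2 * d + 4 * (T + \<kappa>)) * (L2_norm (cell_int m \<tau>) b)\<^sup>2))"
    by (intro mult_left_mono sum_mono add_mono[OF tms sum_mono[OF cellb]]) auto
  also have "\<dots> = 4 * ((\<gamma> + \<alpha> + 2 * \<beta>) * ?SQ + (2 * d + 4 * (T + \<kappa>)) * ?SB)"
    by (simp add: sum.distrib sum_distrib_left[symmetric] distrib_right)
  finally have E\<xi>: "energy \<delta> \<xi> M \<le> 4 * ((\<gamma> + \<alpha> + 2 * \<beta>) * ?SQ + (2 * d + 4 * (T + \<kappa>)) * ?SB)" .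
  \<comment> \<open>The sum is multiplied by 2 (2\<gamma> + \<beta>) from \<eta> and by 8 (\<gamma>
    + \<alpha> + 2\<beta>) from \<xi>.\<close>
  have "energy \<delta> (\<lambda>z. \<eta> z - \<xi> z) M \<le> 2 * ((2 * \<gamma> + \<beta>) * ?SQ) + 2 * (4 * ((\<gamma> + \<alpha> + 2 * \<beta>) * ?SQ + (2 * d + 4 * (T + \<kappa>)) * ?SB))"
    using energy_diff_le[of \<eta> \<xi> \<delta>, OF \<eta> \<xi> \<delta>'] E\<eta> E\<xi> by linarith
  also have "\<dots> = (8 * \<alpha> + 18 * \<beta> + 12 * \<gamma>) * ?SQ + 8 * (2 * d + 4 * (T + \<kappa>)) * ?SB"
    by (simp add: algebra_simps)
  finally show ?thesis .
qed

text \<open>The first conclusion is not a matter of signs, as \<open>Phi_M\<close> may be negative a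
  priori; it is what permits the coefficient of the sum to be enlarged in the final
  estimate.\<close>

lemma galerkin_error:
  fixes C\<^sub>1 C\<^sub>2 C\<^sub>I \<sigma> :: real
  assumes pos: "0 < C\<^sub>1" "0 < C\<^sub>2" "0 < C\<^sub>I" "0 < \<sigma>" and V: "open \<Omega>v" "bounded \<Omega>v"
    and sol: "vlasov_maxwell_solution T \<Omega>x \<Omega>v f E B f0 E0 B0"
    and reg: "sobolev_vec (k + 1) ({0<..<T} \<times> \<Omega>x) (em_field E B)"
    and sh: "shape_regular \<sigma> M tn \<T>"
    and p: "\<forall>K\<in>elements M tn \<T>. 1 \<le> p K"
    and hp: "hp_interpolation C\<^sub>I \<Phi>\<^sub>1 \<Phi>\<^sub>2 T \<Omega>x M tn \<T> p k s"
    and \<delta>: "\<forall>K\<in>elements M tn \<T>. \<delta> K = C\<^sub>1 * (diameter K / real (p K)) \<and> real (p K) * diameter K \<le> C\<^sub>2"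
    and g: "L2_on ({0..T} \<times> \<Omega>x \<times> \<Omega>v) g"
    and Wh: "discrete_maxwell_solution \<Omega>x M tn \<T> p \<delta> (em_field E0 B0) (maxwell_source \<Omega>v g) Wh"
  shows "0 \<le> (\<Sum>K\<in>elements M tn \<T>.
              diameter K ^ (2 * s K + 1) * inverse (real (p K)) * Phi_M \<Phi>\<^sub>1 \<Phi>\<^sub>2 (p K) (s K)
                * (sobolev_norm_vec (s K + 1) (interior K) (em_field E B))\<^sup>2)"
    and "(maxwell_norm \<Omega>x M tn \<T> \<delta> (\<lambda>z. em_field E B z - Wh z))\<^sup>2
      \<le> (8 * (2 * C\<^sub>I / C\<^sub>1) + 18 * (4 * (C\<^sub>1 * C\<^sub>I)) + 12 * (C\<^sub>I * (1 / \<sigma> + 2))) * (\<Sum>K\<in>elements M tn \<T>.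
              diameter K ^ (2 * s K + 1) * inverse (real (p K)) * Phi_M \<Phi>\<^sub>1 \<Phi>\<^sub>2 (p K) (s K)
                * (sobolev_norm_vec (s K + 1) (interior K) (em_field E B))\<^sup>2)
        + 8 * (2 * (C\<^sub>1 * C\<^sub>2) + 4 * (T + C\<^sub>2 / C\<^sub>1)) * (measure lborel \<Omega>v * (L2_norm ({0..T} \<times> \<Omega>x \<times> \<Omega>v) (\<lambda>z. f z - g z))\<^sup>2)"
proof -
  define W where "W = em_field E B"
  define Q where "Q K = diameter K ^ (2 * s K + 1) * inverse (real (p K)) * Phi_M \<Phi>\<^sub>1 \<Phi>\<^sub>2 (p K) (s K)
                * (sobolev_norm_vec (s K + 1) (interior K) W)\<^sup>2" for K
  have f: "L2_on ({0..T} \<times> \<Omega>x \<times> \<Omega>v) f" using sol by (simp add: vlasov_maxwell_solution_def)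
  have supp: "\<exists>S. compact S \<and> S \<subseteq> \<Omega>x \<and> (\<forall>t\<in>{0..T}. \<forall>x\<in>\<Omega>x - S. W (t, x) = 0)"
  proof -
    have "\<exists>S. compact S \<and> S \<subseteq> \<Omega>x \<and>
        (\<forall>t\<in>{0..T}. \<forall>x\<in>\<Omega>x - S. E (t, x) = 0 \<and> B (t, x) = 0 \<and> (\<forall>v\<in>\<Omega>v. f (t, x, v) = 0))"
      using sol by (simp only: vlasov_maxwell_solution_def)
    then obtain S where S: "compact S" "S \<subseteq> \<Omega>x" "\<forall>t\<in>{0..T}. \<forall>x\<in>\<Omega>x - S. E (t, x) = 0 \<and> B (t, x) = 0"
      by blast
    have "W (t, x) = 0" if "t \<in> {0..T}" "x \<in> \<Omega>x - S" for t x
      using S(3) that by (intro em_eqI) (simp_all add: W_def em_field_parts part_linear[THEN linear_0])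
    then show ?thesis using S by blast
  qed
  obtain W' where W': "W' \<in> em_fe_space \<Omega>x M tn \<T> p"
    and i1: "\<And>K c. K \<in> elements M tn \<T> \<Longrightarrow>
           (L2_norm (interior K) (\<lambda>z. (W z - W' z) $ c))\<^sup>2
             \<le> C\<^sub>I * (diameter K / 2) ^ (2 * s K + 2) * inverse ((real (p K))\<^sup>2)
                 * \<Phi>\<^sub>1 (DIM(real^3) + 1) (p K) (s K) * (sobolev_norm (s K + 1) (interior K) (\<lambda>z. W z $ c))\<^sup>2"
    and i2: "\<And>K c. K \<in> elements M tn \<T> \<Longrightarrow>
           (\<Sum>b\<in>Basis. (L2_norm (interior K) (wderiv (interior K) {#b#} (\<lambda>z. (W z - W' z) $ c)))\<^sup>2)
             \<le> C\<^sub>I * (diameter K / 2) ^ (2 * s K)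
                 * \<Phi>\<^sub>2 (DIM(real^3) + 1) (p K) (s K) * (sobolev_norm (s K + 1) (interior K) (\<lambda>z. W z $ c))\<^sup>2"
    using hp_interpolant[OF hp reg[folded W_def] supp] by blast
  define \<eta> where "\<eta> = (\<lambda>z. W z - W' z)"
  define \<xi> where "\<xi> = (\<lambda>z. Wh z - W' z)"
  define b where "b = (\<lambda>z. maxwell_source \<Omega>v g z - maxwell_source \<Omega>v f z)"
  note W = exact_solution[OF sol, folded W_def]
  have Whfe: "Wh \<in> em_fe_space \<Omega>x M tn \<T> p" using Wh by (simp add: discrete_maxwell_solution_def)
  have \<eta>: "mesh_H1 \<eta>" unfolding \<eta>_def by (rule mesh_H1_diff(1)[OF W(1) em_fe_mesh_H1[OF W']])
  have \<xi>fe: "\<xi> \<in> em_fe_space \<Omega>x M tn \<T> p" unfolding \<xi>_def by (rule em_fe_space_diff[OF Whfe W'])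
  have \<xi>: "mesh_H1 \<xi>" by (rule em_fe_mesh_H1[OF \<xi>fe])
  note Lf = source_error(1)[OF V f g] and Lg = source_error(1)[OF V g f]
  have id: "(\<Sum>m<N. form_slab \<delta> \<xi> \<xi> m) = (\<Sum>m<N. form_slab \<delta> \<eta> \<xi> m) + (\<Sum>m<N. src_slab \<delta> b \<xi> m)" if "N \<le> M" for N
    unfolding \<xi>_def \<eta>_def b_def by (rule galerkin_identity[OF W(1) Lf Lg W(2,3,4) Wh W' that])
  define e where "e m \<tau> = (L2_norm (cell_int m \<tau>) \<eta>)\<^sup>2" for m \<tau>
  define F where "F m \<tau> = (\<Sum>c\<in>UNIV. \<Sum>b\<in>Basis. (L2_norm (cell_int m \<tau>) (wderiv (cell_int m \<tau>) {#b#} (\<lambda>z. \<eta> z $ c)))\<^sup>2)" for m \<tau>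
  let ?h = "\<lambda>m \<tau>. diameter (cell m \<tau>)" and ?p = "\<lambda>m \<tau>. real (p (cell m \<tau>))"
  have cell: "e m \<tau> \<le> C\<^sub>I * (?h m \<tau> / ?p m \<tau>) * Q (cell m \<tau>)" "F m \<tau> \<le> C\<^sub>I * (?p m \<tau> / ?h m \<tau>) * Q (cell m \<tau>)"
    if m: "m < M" "\<tau> \<in> \<T>" for m \<tau>
    unfolding e_def F_def Q_def \<eta>_def
    using cell_interpolation_error[where W = W and W' = W' and r = "s (cell m \<tau>)" and \<Phi>\<^sub>1 = \<Phi>\<^sub>1 and \<Phi>\<^sub>2 = \<Phi>\<^sub>2, OF \<eta>[unfolded \<eta>_def] m pos(3) cell_geometry(1)[OF sh m] p[rule_format, OF cell_in_elements[OF m]]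
      i1[OF cell_in_elements[OF m]] i2[OF cell_in_elements[OF m]]] by blast+
  have bounds: "0 \<le> Q (cell m \<tau>)" "0 < \<delta> (cell m \<tau>)" "\<delta> (cell m \<tau>) \<le> C\<^sub>1 * C\<^sub>2" "(tn (Suc m) - tn m)\<^sup>2 \<le> C\<^sub>2 / C\<^sub>1 * \<delta> (cell m \<tau>)"
      "2 / \<delta> (cell m \<tau>) * e m \<tau> \<le> 2 * C\<^sub>I / C\<^sub>1 * Q (cell m \<tau>)" "\<delta> (cell m \<tau>) * F m \<tau> \<le> C\<^sub>1 * C\<^sub>I * Q (cell m \<tau>)"
      "(1 / (tn (Suc m) - tn m) + ?p m \<tau> / ?h m \<tau>) * e m \<tau> + F m \<tau> / (?p m \<tau> / ?h m \<tau>) \<le> C\<^sub>I * (1 / \<sigma> + 2) * Q (cell m \<tau>)"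
      and ph: "0 < ?p m \<tau> / ?h m \<tau>"
    if m: "m < M" "\<tau> \<in> \<T>" for m \<tau>
  proof -
    note K = cell_in_elements[OF m] and geo = cell_geometry[OF sh m]
    have p1: "1 \<le> ?p m \<tau>" using p K by auto
    have d: "\<delta> (cell m \<tau>) = C\<^sub>1 * (?h m \<tau> / ?p m \<tau>)" "?p m \<tau> * ?h m \<tau> \<le> C\<^sub>2" using \<delta> K by auto
    have nn: "0 \<le> e m \<tau>" "0 \<le> F m \<tau>" by (auto simp: e_def F_def intro!: sum_nonneg)
    note c = cell_constants[OF pos geo(1) p1 geo(2,3) d(2,1) nn(1) cell(1)[OF m] nn(2) cell(2)[OF m]]
    show "0 \<le> Q (cell m \<tau>)" "0 < \<delta> (cell m \<tau>)" "\<delta> (cell m \<tau>) \<le> C\<^sub>1 * C\<^sub>2" "(tn (Suc m) - tn m)\<^sup>2 \<le> C\<^sub>2 / C\<^sub>1 * \<delta> (cell m \<tau>)"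
      "2 / \<delta> (cell m \<tau>) * e m \<tau> \<le> 2 * C\<^sub>I / C\<^sub>1 * Q (cell m \<tau>)" "\<delta> (cell m \<tau>) * F m \<tau> \<le> C\<^sub>1 * C\<^sub>I * Q (cell m \<tau>)"
      "(1 / (tn (Suc m) - tn m) + ?p m \<tau> / ?h m \<tau>) * e m \<tau> + F m \<tau> / (?p m \<tau> / ?h m \<tau>) \<le> C\<^sub>I * (1 / \<sigma> + 2) * Q (cell m \<tau>)"
      by (rule c)+
    show "0 < ?p m \<tau> / ?h m \<tau>" using p1 geo(1) by simp
  qed
  show "0 \<le> (\<Sum>K\<in>elements M tn \<T>.
              diameter K ^ (2 * s K + 1) * inverse (real (p K)) * Phi_M \<Phi>\<^sub>1 \<Phi>\<^sub>2 (p K) (s K)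
                * (sobolev_norm_vec (s K + 1) (interior K) (em_field E B))\<^sup>2)"
    unfolding W_def[symmetric] Q_def[symmetric] sum_elements by (intro sum_nonneg bounds(1)) auto
  \<comment> \<open>The constants of \<open>energy_error\<close> come from \<open>bounds\<close>:
    \<alpha> is \<open>2 * C\<^sub>I / C\<^sub>1\<close>, \<gamma> is
    \<open>C\<^sub>I * (1 / \<sigma> + 2)\<close>, \<open>d\<close> is
    \<open>C\<^sub>1 * C\<^sub>2\<close> and \<kappa> is \<open>C\<^sub>2 / C\<^sub>1\<close>. In
    \<beta> the additional 4 stems from the bound of the Maxwell operator by the gradient.\<close>
  have "energy \<delta> (\<lambda>z. \<eta> z - \<xi> z) M
      \<le> (8 * (2 * C\<^sub>I / C\<^sub>1) + 18 * (4 * (C\<^sub>1 * C\<^sub>I)) + 12 * (C\<^sub>I * (1 / \<sigma> + 2))) * (\<Sum>m<M. \<Sum>\<tau>\<in>\<T>. Q (cell m \<tau>))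
      + 8 * (2 * (C\<^sub>1 * C\<^sub>2) + 4 * (T + C\<^sub>2 / C\<^sub>1)) * (\<Sum>m<M. \<Sum>\<tau>\<in>\<T>. (L2_norm (cell_int m \<tau>) b)\<^sup>2)"
  proof (rule energy_error[OF \<xi> \<eta>])
    show "0 < C\<^sub>2 / C\<^sub>1" using pos by simp
    show "\<And>m. m < M \<Longrightarrow> L2_on (slab m) b" unfolding b_def by (intro L2_on_diff Lf Lg)
    show "\<And>m c. m < M \<Longrightarrow> zero_lateral_trace (tn m) (tn (Suc m)) \<Omega>x (\<lambda>z. \<xi> z $ c)"
      by (rule em_fe_lateral_trace[OF \<xi>fe])
    fix m \<tau> assume m: "m < M" "\<tau> \<in> \<T>"
    note bo = bounds[OF m] and r = ph[OF m]
    show "0 < \<delta> (cell m \<tau>) \<and> \<delta> (cell m \<tau>) \<le> C\<^sub>1 * C\<^sub>2" using bo by blast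
    show "2 / \<delta> (cell m \<tau>) * (L2_norm (cell_int m \<tau>) \<eta>)\<^sup>2 \<le> 2 * C\<^sub>I / C\<^sub>1 * Q (cell m \<tau>)" using bo(5) by (simp only: e_def)
    have "\<delta> (cell m \<tau>) * (L2_norm (cell_int m \<tau>) (maxwell_op (slab m) \<eta>))\<^sup>2 \<le> \<delta> (cell m \<tau>) * (4 * F m \<tau>)"
      using cell_maxwell_bound[OF \<eta> m] bo(2) unfolding F_def by (intro mult_left_mono) auto
    then show "\<delta> (cell m \<tau>) * (L2_norm (cell_int m \<tau>) (maxwell_op (slab m) \<eta>))\<^sup>2 \<le> 4 * (C\<^sub>1 * C\<^sub>I) * Q (cell m \<tau>)"
      using bo(6) by (simp only: mult.left_commute[of _ 4] mult.assoc)
    show "(L2_norm (interior \<tau>) (trace_minus \<eta> (tn (Suc m))))\<^sup>2 \<le> C\<^sub>I * (1 / \<sigma> + 2) * Q (cell m \<tau>)"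
      using cell_trace_bound(1)[OF \<eta> m r] bo(7) unfolding e_def F_def by (rule order_trans)
    show "(L2_norm (interior \<tau>) (trace_plus \<eta> (tn m)))\<^sup>2 \<le> C\<^sub>I * (1 / \<sigma> + 2) * Q (cell m \<tau>)"
      using cell_trace_bound(2)[OF \<eta> m r] bo(7) unfolding e_def F_def by (rule order_trans)
  qed (use bounds(4) id in blast)+
  also have "\<dots> \<le> (8 * (2 * C\<^sub>I / C\<^sub>1) + 18 * (4 * (C\<^sub>1 * C\<^sub>I)) + 12 * (C\<^sub>I * (1 / \<sigma> + 2))) * (\<Sum>m<M. \<Sum>\<tau>\<in>\<T>. Q (cell m \<tau>))
      + 8 * (2 * (C\<^sub>1 * C\<^sub>2) + 4 * (T + C\<^sub>2 / C\<^sub>1)) * (measure lborel \<Omega>v * (L2_norm ({0..T} \<times> \<Omega>x \<times> \<Omega>v) (\<lambda>z. f z - g z))\<^sup>2)"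
  proof (intro add_left_mono mult_left_mono)
    show "(\<Sum>m<M. \<Sum>\<tau>\<in>\<T>. (L2_norm (cell_int m \<tau>) b)\<^sup>2) \<le> measure lborel \<Omega>v * (L2_norm ({0..T} \<times> \<Omega>x \<times> \<Omega>v) (\<lambda>z. f z - g z))\<^sup>2"
      unfolding b_def by (rule source_error(2)[OF V f g])
    show "0 \<le> 8 * (2 * (C\<^sub>1 * C\<^sub>2) + 4 * (T + C\<^sub>2 / C\<^sub>1))" using pos T_pos by simp
  qed
  also have "(\<lambda>z. \<eta> z - \<xi> z) = (\<lambda>z. W z - Wh z)" by (simp add: \<eta>_def \<xi>_def)
  finally have fin: "energy \<delta> (\<lambda>z. W z - Wh z) M
      \<le> (8 * (2 * C\<^sub>I / C\<^sub>1) + 18 * (4 * (C\<^sub>1 * C\<^sub>I)) + 12 * (C\<^sub>I * (1 / \<sigma> + 2))) * (\<Sum>m<M. \<Sum>\<tau>\<in>\<T>. Q (cell m \<tau>))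
      + 8 * (2 * (C\<^sub>1 * C\<^sub>2) + 4 * (T + C\<^sub>2 / C\<^sub>1)) * (measure lborel \<Omega>v * (L2_norm ({0..T} \<times> \<Omega>x \<times> \<Omega>v) (\<lambda>z. f z - g z))\<^sup>2)" .
  have "0 \<le> \<delta> K" if "K \<in> elements M tn \<T>" for K
    using that bounds(2) by (fastforce simp: elements_eq less_imp_le)
  from maxwell_norm_energy[of _ \<delta>, OF mesh_H1_diff(1)[OF W(1) em_fe_mesh_H1[OF Whfe]] this] fin
  show "(maxwell_norm \<Omega>x M tn \<T> \<delta> (\<lambda>z. em_field E B z - Wh z))\<^sup>2
      \<le> (8 * (2 * C\<^sub>I / C\<^sub>1) + 18 * (4 * (C\<^sub>1 * C\<^sub>I)) + 12 * (C\<^sub>I * (1 / \<sigma> + 2))) * (\<Sum>K\<in>elements M tn \<T>.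
              diameter K ^ (2 * s K + 1) * inverse (real (p K)) * Phi_M \<Phi>\<^sub>1 \<Phi>\<^sub>2 (p K) (s K)
                * (sobolev_norm_vec (s K + 1) (interior K) (em_field E B))\<^sup>2)
        + 8 * (2 * (C\<^sub>1 * C\<^sub>2) + 4 * (T + C\<^sub>2 / C\<^sub>1)) * (measure lborel \<Omega>v * (L2_norm ({0..T} \<times> \<Omega>x \<times> \<Omega>v) (\<lambda>z. f z - g z))\<^sup>2)"
    unfolding sum_elements Q_def W_def[symmetric] by simp
qed

end

theorem theorem4p3:
  fixes T C\<^sub>1 C\<^sub>2 C\<^sub>I \<sigma> :: real
    and \<Omega>x \<Omega>v :: "(real^3) set"
    and k :: nat
    and \<Phi>\<^sub>1 \<Phi>\<^sub>2 :: "nat \<Rightarrow> nat \<Rightarrow> nat \<Rightarrow> real"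
  assumes "0 < T"
    and "open \<Omega>x" "connected \<Omega>x" "bounded \<Omega>x"
    and "open \<Omega>v" "connected \<Omega>v" "bounded \<Omega>v"
    and "0 < C\<^sub>1" "0 < C\<^sub>2" "C\<^sub>2 < 1" "0 < C\<^sub>I" "0 < \<sigma>"
  shows "\<exists>C>0. \<forall>f E B f0 E0 B0 M tn \<T> p s \<delta> fh Wh i.
    vlasov_maxwell_solution T \<Omega>x \<Omega>v f E B f0 E0 B0 \<longrightarrow>
    sobolev_vec (k + 1) ({0<..<T} \<times> \<Omega>x) (em_field E B) \<longrightarrow>
    mesh T \<Omega>x M tn \<T> \<longrightarrow>
    shape_regular \<sigma> M tn \<T> \<longrightarrow>
    (\<forall>K\<in>elements M tn \<T>. 1 \<le> p K \<and> s K \<le> min (p K) k) \<longrightarrow>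
    hp_interpolation C\<^sub>I \<Phi>\<^sub>1 \<Phi>\<^sub>2 T \<Omega>x M tn \<T> p k s \<longrightarrow>
    (\<forall>K\<in>elements M tn \<T>. \<delta> K = C\<^sub>1 * (diameter K / real (p K)) \<and> real (p K) * diameter K \<le> C\<^sub>2) \<longrightarrow>
    1 \<le> (i::nat) \<longrightarrow>
    L2_on ({0..T} \<times> \<Omega>x \<times> \<Omega>v) (fh (i - 1)) \<longrightarrow>
    discrete_maxwell_solution \<Omega>x M tn \<T> p \<delta> (em_field E0 B0)
      (maxwell_source \<Omega>v (fh (i - 1))) (Wh i) \<longrightarrow>
    (maxwell_norm \<Omega>x M tn \<T> \<delta> (\<lambda>z. em_field E B z - Wh i z))\<^sup>2
      \<le> C * (\<Sum>K\<in>elements M tn \<T>.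
              diameter K ^ (2 * s K + 1) * inverse (real (p K)) * Phi_M \<Phi>\<^sub>1 \<Phi>\<^sub>2 (p K) (s K)
                * (sobolev_norm_vec (s K + 1) (interior K) (em_field E B))\<^sup>2)
        + C * (L2_norm ({0..T} \<times> \<Omega>x \<times> \<Omega>v) (\<lambda>z. f z - fh (i - 1) z))\<^sup>2"
proof -
  \<comment> \<open>\<open>A\<close> and \<open>D\<close> are built from \<open>C\<^sub>1\<close>,
    \<open>C\<^sub>2\<close>, \<open>C\<^sub>I\<close>, \<sigma>, \<open>T\<close> and the measure
    of the velocity domain, all of which are fixed before the mesh, the degrees and the
    orders.\<close>
  define A where "A = 8 * (2 * C\<^sub>I / C\<^sub>1) + 18 * (4 * (C\<^sub>1 * C\<^sub>I)) + 12 * (C\<^sub>I * (1 / \<sigma> + 2))"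
  define D where "D = 8 * (2 * (C\<^sub>1 * C\<^sub>2) + 4 * (T + C\<^sub>2 / C\<^sub>1)) * measure lborel \<Omega>v"
  have "0 < A" using assms by (simp add: A_def add_pos_pos)
  moreover have "0 \<le> D" using assms by (simp add: D_def)
  \<comment> \<open>One constant has to multiply both terms, hence \<open>A + D\<close>. Raising the
    coefficient of the sum \<open>q\<close> from \<open>A\<close> to \<open>A + D\<close> uses that
    the sum is nonnegative.\<close>
  moreover have "r \<le> A * q + 8 * (2 * (C\<^sub>1 * C\<^sub>2) + 4 * (T + C\<^sub>2 / C\<^sub>1)) * (measure lborel \<Omega>v * y\<^sup>2) \<Longrightarrow> 0 \<le> q
      \<Longrightarrow> r \<le> (A + D) * q + (A + D) * y\<^sup>2" for r q y
  proof -
    assume r: "r \<le> A * q + 8 * (2 * (C\<^sub>1 * C\<^sub>2) + 4 * (T + C\<^sub>2 / C\<^sub>1)) * (measure lborel \<Omega>v * y\<^sup>2)" and q: "0 \<le> q"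
    have "0 \<le> D * q" "0 \<le> A * y\<^sup>2" using q \<open>0 < A\<close> \<open>0 \<le> D\<close> by auto
    then show ?thesis using r by (simp add: D_def distrib_right mult.assoc)
  qed
  note est = this
  ultimately show ?thesis
  proof (intro exI[of _ "A + D"] conjI allI impI)
    fix f E B f0 E0 B0 M tn \<T> p s \<delta> fh Wh and i :: nat
    assume sol: "vlasov_maxwell_solution T \<Omega>x \<Omega>v f E B f0 E0 B0"
      and reg: "sobolev_vec (k + 1) ({0<..<T} \<times> \<Omega>x) (em_field E B)"
      and mesh: "mesh T \<Omega>x M tn \<T>" and sh: "shape_regular \<sigma> M tn \<T>"
      and ps: "\<forall>K\<in>elements M tn \<T>. 1 \<le> p K \<and> s K \<le> min (p K) k"
      and hp: "hp_interpolation C\<^sub>I \<Phi>\<^sub>1 \<Phi>\<^sub>2 T \<Omega>x M tn \<T> p k s"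
      and \<delta>: "\<forall>K\<in>elements M tn \<T>. \<delta> K = C\<^sub>1 * (diameter K / real (p K)) \<and> real (p K) * diameter K \<le> C\<^sub>2"
      and fh: "L2_on ({0..T} \<times> \<Omega>x \<times> \<Omega>v) (fh (i - 1))"
      and Wh: "discrete_maxwell_solution \<Omega>x M tn \<T> p \<delta> (em_field E0 B0) (maxwell_source \<Omega>v (fh (i - 1))) (Wh i)"
    interpret maxwell_mesh T \<Omega>x M tn \<T>
      using assms mesh by unfold_locales
    have p: "\<forall>K\<in>elements M tn \<T>. 1 \<le> p K" using ps by blast
    note err = galerkin_error[OF assms(8,9,11,12,5,7) sol reg sh p hp \<delta> fh Wh]
    show "(maxwell_norm \<Omega>x M tn \<T> \<delta> (\<lambda>z. em_field E B z - Wh i z))\<^sup>2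
      \<le> (A + D) * (\<Sum>K\<in>elements M tn \<T>.
              diameter K ^ (2 * s K + 1) * inverse (real (p K)) * Phi_M \<Phi>\<^sub>1 \<Phi>\<^sub>2 (p K) (s K)
                * (sobolev_norm_vec (s K + 1) (interior K) (em_field E B))\<^sup>2)
        + (A + D) * (L2_norm ({0..T} \<times> \<Omega>x \<times> \<Omega>v) (\<lambda>z. f z - fh (i - 1) z))\<^sup>2"
      by (rule est[OF err(2)[folded A_def] err(1)])
  qed simp
qed

end
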